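(* Let $\mathcal{A}$ and $\mathcal{B}$ be separable unital C*-algebras. Suppose $\mathcal{D}$ is a C*-algebra that is embedded as a unital C*-subalgebra of $\mathcal{A}$ and of $\mathcal{B}$ respectively, and that $\mathcal{D}$ is *-isomorphic to a full matrix algebra $\mathcal{M}_n(\mathbb{C})$ for some integer $n$. Then the full amalgamated free product $\mathcal{A}\ast_{\mathcal{D}}\mathcal{B}$ (with respect to these embeddings) is an MF algebra if and only if $\mathcal{A}$ and $\mathcal{B}$ are both MF algebras.
   Context: For positive integers $k_n$, $\prod_n\mathcal{M}_{k_n}(\mathbb{C})$ is the C*-algebra of norm-bounded sequences $(Y_n)_n$, $Y_n\in\mathcal{M}_{k_n}(\mathbb{C})$, and $\sum_n\mathcal{M}_{k_n}(\mathbb{C})$ is the closed two-sided ideal of sequences with $\lim_n\|Y_n\|=0$. A separable C*-algebra is an MF algebra if it embeds as a C*-subalgebra of $\prod_n\mathcal{M}_{k_n}(\mathbb{C})/\sum_n\mathcal{M}_{k_n}(\mathbb{C})$ for some sequence $\{k_n\}$ of positive integers. Given unital embeddings (injective *-homomorphisms) $\psi_{\mathcal{A}}:\mathcal{D}\to\mathcal{A}$, $\psi_{\mathcal{B}}:\mathcal{D}\to\mathcal{B}$, the unital full amalgamated free product $\mathcal{A}\ast_{\mathcal{D}}\mathcal{B}$ is the C*-algebra $\mathcal{C}$ with unital embeddings $\sigma_{\mathcal{A}}:\mathcal{A}\to\mathcal{C}$, $\sigma_{\mathcal{B}}:\mathcal{B}\to\mathcal{C}$ such that $\sigma_{\mathcal{A}}\circ\psi_{\mathcal{A}}=\sigma_{\mathcal{B}}\circ\psi_{\mathcal{B}}$,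 $\mathcal{C}$ is generated by $\sigma_{\mathcal{A}}(\mathcal{A})\cup\sigma_{\mathcal{B}}(\mathcal{B})$, and whenever $\pi_{\mathcal{A}}:\mathcal{A}\to\mathcal{E}$, $\pi_{\mathcal{B}}:\mathcal{B}\to\mathcal{E}$ are *-homomorphisms into a C*-algebra $\mathcal{E}$ with $\pi_{\mathcal{A}}\circ\psi_{\mathcal{A}}=\pi_{\mathcal{B}}\circ\psi_{\mathcal{B}}$, there is a *-homomorphism $\pi:\mathcal{C}\to\mathcal{E}$ with $\pi\circ\sigma_{\mathcal{A}}=\pi_{\mathcal{A}}$ and $\pi\circ\sigma_{\mathcal{B}}=\pi_{\mathcal{B}}$. *)

theory Defs
  imports
    "HOL-Analysis.Abstract_Metric_Spaces"
    "HOL-Analysis.L2_Norm"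
    "HOL-Algebra.QuotRing"
    "HOL-Algebra.Module"
    "Jordan_Normal_Form.Matrix"
    "Jordan_Normal_Form.Schur_Decomposition"
begin

section \<open>C*-algebras\<close>

definition complex_ring :: "complex ring" where
  "complex_ring = \<lparr>carrier = UNIV, monoid.mult = (*), one = 1, zero = 0, add = (+)\<rparr>"

text \<open>C*-algebras need not be unital; the field \<open>one\<close> inherited from the record of
  rings carries no meaning unless \<open>unital_cstar_algebra\<close> is assumed.\<close>

record 'a cstar = "(complex, 'a) module" +
  star :: "'a \<Rightarrow> 'a"
  cnorm :: "'a \<Rightarrow> real"

text \<open>The value outside the carrier is irrelevant, but the locale \<open>Metric_space\<close> asks
  for nonnegativity and symmetry on the whole type.\<close>

definition cdist :: "('a, 'm) cstar_scheme \<Rightarrow> 'a \<Rightarrow> 'a \<Rightarrow> real" where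
  "cdist A x y =
     (if x \<in> carrier A \<and> y \<in> carrier A then cnorm A (x \<ominus>\<^bsub>A\<^esub> y) else 0)"

locale cstar_algebra = Module.module complex_ring A for A :: "('a, 'm) cstar_scheme" (structure) +
  assumes mult_closed: "\<lbrakk>x \<in> carrier A; y \<in> carrier A\<rbrakk> \<Longrightarrow> x \<otimes> y \<in> carrier A"
    and mult_assoc:
      "\<lbrakk>x \<in> carrier A; y \<in> carrier A; z \<in> carrier A\<rbrakk> \<Longrightarrow> (x \<otimes> y) \<otimes> z = x \<otimes> (y \<otimes> z)"
    and distrib_left:
      "\<lbrakk>x \<in> carrier A; y \<in> carrier A; z \<in> carrier A\<rbrakk> \<Longrightarrow> x \<otimes> (y \<oplus> z) = x \<otimes> y \<oplus> x \<otimes> z"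
    and distrib_right:
      "\<lbrakk>x \<in> carrier A; y \<in> carrier A; z \<in> carrier A\<rbrakk> \<Longrightarrow> (x \<oplus> y) \<otimes> z = x \<otimes> z \<oplus> y \<otimes> z"
    and smult_mult_left:
      "\<lbrakk>x \<in> carrier A; y \<in> carrier A\<rbrakk> \<Longrightarrow> (c \<odot> x) \<otimes> y = c \<odot> (x \<otimes> y)"
    and smult_mult_right:
      "\<lbrakk>x \<in> carrier A; y \<in> carrier A\<rbrakk> \<Longrightarrow> x \<otimes> (c \<odot> y) = c \<odot> (x \<otimes> y)"
    and star_closed: "x \<in> carrier A \<Longrightarrow> star A x \<in> carrier A"
    and star_star: "x \<in> carrier A \<Longrightarrow> star A (star A x) = x"
    and star_add:
      "\<lbrakk>x \<in> carrier A; y \<in> carrier A\<rbrakk> \<Longrightarrow> star A (x \<oplus> y) = star A x \<oplus> star A y"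
    and star_smult: "x \<in> carrier A \<Longrightarrow> star A (c \<odot> x) = cnj c \<odot> star A x"
    and star_mult:
      "\<lbrakk>x \<in> carrier A; y \<in> carrier A\<rbrakk> \<Longrightarrow> star A (x \<otimes> y) = star A y \<otimes> star A x"
    and cnorm_nonneg: "x \<in> carrier A \<Longrightarrow> 0 \<le> cnorm A x"
    and cnorm_eq_0_iff: "x \<in> carrier A \<Longrightarrow> cnorm A x = 0 \<longleftrightarrow> x = \<zero>"
    and cnorm_triangle:
      "\<lbrakk>x \<in> carrier A; y \<in> carrier A\<rbrakk> \<Longrightarrow> cnorm A (x \<oplus> y) \<le> cnorm A x + cnorm A y"
    and cnorm_smult: "x \<in> carrier A \<Longrightarrow> cnorm A (c \<odot> x) = cmod c * cnorm A x"
    and cnorm_mult: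
      "\<lbrakk>x \<in> carrier A; y \<in> carrier A\<rbrakk> \<Longrightarrow> cnorm A (x \<otimes> y) \<le> cnorm A x * cnorm A y"
    and cstar_identity: "x \<in> carrier A \<Longrightarrow> cnorm A (star A x \<otimes> x) = (cnorm A x)\<^sup>2"
    and complete: "Metric_space.mcomplete (carrier A) (cdist A)"

lemma (in cstar_algebra) Metric_space_cdist: "Metric_space (carrier A) (cdist A)"
proof -
  have minus: "\<ominus> x = (- 1) \<odot> x" if "x \<in> carrier A" for x
  proof -
    have "x \<oplus> (- 1) \<odot> x = (1 + (- 1)) \<odot> x"
      using smult_l_distr[of 1 "- 1" x] smult_one[of x] that by (simp add: complex_ring_def)
    also have "\<dots> = \<zero>"
      using cnorm_smult[OF that, of 0] cnorm_eq_0_iff smult_closed[of 0 x] that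
      by (simp add: complex_ring_def)
    finally show ?thesis
      using M.minus_equality[of "(- 1) \<odot> x" x] smult_closed[of "- 1" x] that
      by (simp add: complex_ring_def M.a_comm)
  qed
  have sym: "cnorm A (x \<ominus> y) = cnorm A (y \<ominus> x)" if "x \<in> carrier A" "y \<in> carrier A" for x y
  proof -
    have "y \<ominus> x = \<ominus> (x \<ominus> y)"
      using that by (simp add: M.minus_add M.a_comm a_minus_def)
    also have "\<dots> = (- 1) \<odot> (x \<ominus> y)"
      using minus that by simp
    finally show ?thesis
      using cnorm_smult[of "x \<ominus> y" "- 1"] that by simp
  qed
  have triangle: "cnorm A (x \<ominus> z) \<le> cnorm A (x \<ominus> y) + cnorm A (y \<ominus> z)"
    if "x \<in> carrier A" "y \<in> carrier A" "z \<in> carrier A" for x y z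
  proof -
    have "x \<ominus> z = (x \<ominus> y) \<oplus> (y \<ominus> z)"
      using that by (simp add: a_minus_def M.a_assoc M.r_neg1)
    then show ?thesis
      using cnorm_triangle[of "x \<ominus> y" "y \<ominus> z"] that by simp
  qed
  have zero: "cnorm A (x \<ominus> y) = 0 \<longleftrightarrow> x = y" if "x \<in> carrier A" "y \<in> carrier A" for x y
    using that cnorm_eq_0_iff[of "x \<ominus> y"] by simp
  show ?thesis
    by unfold_locales (auto simp: cdist_def cnorm_nonneg sym zero triangle)
qed

locale unital_cstar_algebra = cstar_algebra +
  assumes one_closed: "\<one> \<in> carrier A"
    and one_mult: "x \<in> carrier A \<Longrightarrow> \<one> \<otimes> x = x"
    and mult_one: "x \<in> carrier A \<Longrightarrow> x \<otimes> \<one> = x"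

definition ctopology :: "('a, 'm) cstar_scheme \<Rightarrow> 'a topology" where
  "ctopology A = Metric_space.mtopology (carrier A) (cdist A)"

definition separable_cstar :: "('a, 'm) cstar_scheme \<Rightarrow> bool" where
  "separable_cstar A \<longleftrightarrow> separable_space (ctopology A)"

definition cstar_subalgebra :: "'a set \<Rightarrow> ('a, 'm) cstar_scheme \<Rightarrow> bool" where
  "cstar_subalgebra S A \<longleftrightarrow>
     Module.submodule S complex_ring A \<and>
     (\<forall>x\<in>S. \<forall>y\<in>S. x \<otimes>\<^bsub>A\<^esub> y \<in> S) \<and> (\<forall>x\<in>S. star A x \<in> S) \<and> closedin (ctopology A) S"

definition cstar_generated :: "('a, 'm) cstar_scheme \<Rightarrow> 'a set \<Rightarrow> 'a set" where
  "cstar_generated A X = \<Inter>{S. cstar_subalgebra S A \<and> X \<subseteq> S}"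

section \<open>*-homomorphisms\<close>

definition star_hom :: "('a, 'm) cstar_scheme \<Rightarrow> ('b, 'n) cstar_scheme \<Rightarrow> ('a \<Rightarrow> 'b) \<Rightarrow> bool" where
  "star_hom A B f \<longleftrightarrow>
     f \<in> carrier A \<rightarrow> carrier B \<and>
     (\<forall>x\<in>carrier A. \<forall>y\<in>carrier A. f (x \<oplus>\<^bsub>A\<^esub> y) = f x \<oplus>\<^bsub>B\<^esub> f y) \<and>
     (\<forall>c. \<forall>x\<in>carrier A. f (c \<odot>\<^bsub>A\<^esub> x) = c \<odot>\<^bsub>B\<^esub> f x) \<and>
     (\<forall>x\<in>carrier A. \<forall>y\<in>carrier A. f (x \<otimes>\<^bsub>A\<^esub> y) = f x \<otimes>\<^bsub>B\<^esub> f y) \<and>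
     (\<forall>x\<in>carrier A. f (star A x) = star B (f x))"

definition star_embedding :: "('a, 'm) cstar_scheme \<Rightarrow> ('b, 'n) cstar_scheme \<Rightarrow> ('a \<Rightarrow> 'b) \<Rightarrow> bool" where
  "star_embedding A B f \<longleftrightarrow> star_hom A B f \<and> inj_on f (carrier A)"

definition unital_star_embedding ::
    "('a, 'm) cstar_scheme \<Rightarrow> ('b, 'n) cstar_scheme \<Rightarrow> ('a \<Rightarrow> 'b) \<Rightarrow> bool" where
  "unital_star_embedding A B f \<longleftrightarrow> star_embedding A B f \<and> f \<one>\<^bsub>A\<^esub> = \<one>\<^bsub>B\<^esub>"

definition star_isomorphic :: "('a, 'm) cstar_scheme \<Rightarrow> ('b, 'n) cstar_scheme \<Rightarrow> bool" where
  "star_isomorphic A B \<longleftrightarrow> (\<exists>f. star_hom A B f \<and> bij_betw f (carrier A) (carrier B))"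

section \<open>Matrix algebras, products and quotients\<close>

definition vec_l2norm :: "complex vec \<Rightarrow> real" where
  "vec_l2norm v = L2_set (\<lambda>i. cmod (v $ i)) {..<dim_vec v}"

definition mat_opnorm :: "complex mat \<Rightarrow> real" where
  "mat_opnorm X =
     (SUP v\<in>{v \<in> carrier_vec (dim_col X). vec_l2norm v \<le> 1}. vec_l2norm (X *\<^sub>v v))"

definition matrix_cstar :: "nat \<Rightarrow> complex mat cstar" where
  "matrix_cstar k =
     \<lparr>carrier = carrier_mat k k, monoid.mult = (*), one = 1\<^sub>m k, zero = 0\<^sub>m k k, add = (+),
      module.smult = (\<cdot>\<^sub>m), star = mat_adjoint, cnorm = mat_opnorm\<rparr>"

definition cstar_product :: "(nat \<Rightarrow> 'a cstar) \<Rightarrow> (nat \<Rightarrow> 'a) cstar" where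
  "cstar_product M =
     \<lparr>carrier = {Y. (\<forall>n. Y n \<in> carrier (M n)) \<and> bdd_above (range (\<lambda>n. cnorm (M n) (Y n)))},
      monoid.mult = (\<lambda>X Y n. X n \<otimes>\<^bsub>M n\<^esub> Y n),
      one = (\<lambda>n. \<one>\<^bsub>M n\<^esub>),
      zero = (\<lambda>n. \<zero>\<^bsub>M n\<^esub>),
      add = (\<lambda>X Y n. X n \<oplus>\<^bsub>M n\<^esub> Y n),
      module.smult = (\<lambda>c Y n. c \<odot>\<^bsub>M n\<^esub> Y n),
      star = (\<lambda>Y n. star (M n) (Y n)),
      cnorm = (\<lambda>Y. SUP n. cnorm (M n) (Y n))\<rparr>"

definition cstar_null_ideal :: "(nat \<Rightarrow> 'a cstar) \<Rightarrow> (nat \<Rightarrow> 'a) set" where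
  "cstar_null_ideal M =
     {Y \<in> carrier (cstar_product M). (\<lambda>n. cnorm (M n) (Y n)) \<longlonglongrightarrow> 0}"

text \<open>The ring operations on cosets are those of \<^const>\<open>FactRing\<close>; the norm is the
  quotient norm.\<close>

definition cstar_quotient :: "('a, 'm) cstar_scheme \<Rightarrow> 'a set \<Rightarrow> 'a set cstar" where
  "cstar_quotient A I =
     \<lparr>carrier = a_rcosets\<^bsub>A\<^esub> I, monoid.mult = rcoset_mult A I,
      one = I +>\<^bsub>A\<^esub> \<one>\<^bsub>A\<^esub>, zero = I, add = set_add A,
      module.smult = (\<lambda>c X. \<Union>x\<in>X. I +>\<^bsub>A\<^esub> (c \<odot>\<^bsub>A\<^esub> x)),
      star = (\<lambda>X. star A ` X),
      cnorm = (\<lambda>X. INF x\<in>X. cnorm A x)\<rparr>"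

section \<open>MF algebras\<close>

definition MF_algebra :: "('a, 'm) cstar_scheme \<Rightarrow> bool" where
  "MF_algebra A \<longleftrightarrow>
     cstar_algebra A \<and> separable_cstar A \<and>
     (\<exists>k :: nat \<Rightarrow> nat. (\<forall>n. 0 < k n) \<and>
        (\<exists>f. star_embedding A
               (cstar_quotient (cstar_product (\<lambda>n. matrix_cstar (k n)))
                  (cstar_null_ideal (\<lambda>n. matrix_cstar (k n)))) f))"

section \<open>Full amalgamated free products\<close>

text \<open>The test algebras \<open>E\<close> in the universal property, which may be nonunital, have their
  carrier in the type \<open>'c\<close> of \<open>C\<close>. This loses nothing. One may replace \<open>E\<close> by its
  C*-subalgebra \<open>E'\<close> generated by the images of \<open>A\<close> and \<open>B\<close>. If \<open>A\<close> and \<open>B\<close> are separable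
  (the general case is similar), then \<open>E'\<close> is separable and so has at most continuum many
  elements; and if \<open>E'\<close> is nonzero, then \<open>A\<close> or \<open>B\<close> is nonzero, hence so is \<open>C\<close>, which then
  has at least continuum many elements. So an isomorphic copy of \<open>E'\<close> has its carrier in \<open>'c\<close>.\<close>

locale full_amalgamated_free_product =
  fixes D :: "'d cstar" and A :: "'a cstar" and B :: "'b cstar"
    and \<psi>\<^sub>A :: "'d \<Rightarrow> 'a" and \<psi>\<^sub>B :: "'d \<Rightarrow> 'b"
    and C :: "'c cstar" and \<sigma>\<^sub>A :: "'a \<Rightarrow> 'c" and \<sigma>\<^sub>B :: "'b \<Rightarrow> 'c"
  assumes unital_cstar_algebra_C: "unital_cstar_algebra C"
    and embedding_A: "unital_star_embedding A C \<sigma>\<^sub>A"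
    and embedding_B: "unital_star_embedding B C \<sigma>\<^sub>B"
    and amalgamated: "\<forall>d\<in>carrier D. \<sigma>\<^sub>A (\<psi>\<^sub>A d) = \<sigma>\<^sub>B (\<psi>\<^sub>B d)"
    and generated: "cstar_generated C (\<sigma>\<^sub>A ` carrier A \<union> \<sigma>\<^sub>B ` carrier B) = carrier C"
    and universal:
      "\<And>(E :: 'c cstar) \<pi>\<^sub>A \<pi>\<^sub>B.
         \<lbrakk>cstar_algebra E; star_hom A E \<pi>\<^sub>A; star_hom B E \<pi>\<^sub>B;
          \<forall>d\<in>carrier D. \<pi>\<^sub>A (\<psi>\<^sub>A d) = \<pi>\<^sub>B (\<psi>\<^sub>B d)\<rbrakk>
         \<Longrightarrow> \<exists>\<pi>. star_hom C E \<pi> \<and>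
               (\<forall>a\<in>carrier A. \<pi> (\<sigma>\<^sub>A a) = \<pi>\<^sub>A a) \<and>
               (\<forall>b\<in>carrier B. \<pi> (\<sigma>\<^sub>B b) = \<pi>\<^sub>B b)"

end

theory Submission
 imports Defs
begin

text \<open>An MF embedding of C restricts along \<open>\<sigma>\<^sub>A\<close> and
  \<open>\<sigma>\<^sub>B\<close> to embeddings of A and B, which is one direction. For the converse
  the given embeddings of A and B into matrix quotients cannot simply be glued: they need not agree
  on D, and even if they did, the homomorphism produced by the universal property need not be
  injective. Both defects are repaired by modelling a faithful positive functional of C.

  Since C is generated by two separable algebras it is separable and has a faithful positive
  functional \<open>phi\<close> (\<open>faithful_state\<close>). Let e be the image of a minimal
  projection of D. The embedding of A lifts e to projections in matrix algebras, and compression to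
  their ranges gives asymptotically multiplicative models of the corner eAe. For finitely many u_i
  in C the functionals a \<mapsto> phi(u_j^* a u_i) on the corner are limits of finite sums of
  vector functionals (microstates) of these models, with coordinates as late as desired
  (\<open>microstates_approximate\<close>). Otherwise a separating functional
  (\<open>cone_separation\<close>) yields a matrix over A that is positive in the quotient, hence
  positive over A because injective homomorphisms reflect positivity; but the family of functionals
  is completely positive and therefore nonnegative on it (\<open>cp_family_pos_matrix\<close>), a
  contradiction. Orthonormalizing the vectors turns a sum of microstates into an orthogonal
  decomposition of one space \<complex>^N into model spaces, in which fixed coordinate vectors
  reproduce the functionals (\<open>corner_resolution\<close>). Since N may be replaced by its
  multiples, A and B get the same N and the same vectors (\<open>common_resolutions\<close>).

  A is an algebra of n by n matrices over eAe, so blocks of corner models give a homomorphism of A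
  into the quotient for the sizes n N (\<open>star_hom_Th\<close>), and likewise for B. Elements of
  D have entries that are scalar multiples of e, and e goes exactly to the identity of \<complex>^N.
  Both homomorphisms thus send D to the same scalar block matrices
  (\<open>cls_Th_scalar_entries\<close>), and the universal property joins them to a homomorphism
  \<open>hp\<close> on C (\<open>universal_star_hom\<close>).

  The block vectors \<open>eta\<close> have, in the limit, the inner products of the GNS vectors of
  a dense sequence d_l of C (\<open>tower_gram\<close>). Lifts of \<open>hp c\<close> act on them
  asymptotically as c acts on the GNS space: for generators by \<open>tower_limit\<close>, and then
  on the closed algebra that they generate. If hp c = 0, faithfulness gives c d_l = 0 for all l,
  hence c = 0 (\<open>injective\<close>).\<close>

abbreviation (input) mult_in ("(_ *[_] _)" [70,0,71] 70) where "x *[G] y \<equiv> x \<otimes>\<^bsub>G\<^esub> y"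
abbreviation (input) add_in ("(_ +[_] _)" [65,0,66] 65) where "x +[G] y \<equiv> x \<oplus>\<^bsub>G\<^esub> y"
abbreviation (input) minus_in ("(_ -[_] _)" [65,0,66] 65) where "x -[G] y \<equiv> x \<ominus>\<^bsub>G\<^esub> y"
abbreviation (input) smult_in ("(_ *:[_] _)" [70,0,71] 70) where "c *:[G] y \<equiv> c \<odot>\<^bsub>G\<^esub> y"
abbreviation (input) mat_vec (infixl "*!" 70) where "X *! v \<equiv> X *\<^sub>v v"
abbreviation (input) seq_lim (infix "---->" 60) where "x ----> l \<equiv> x \<longlonglongrightarrow> l"
abbreviation (input) "car \<equiv> carrier"
abbreviation (input) "cr \<equiv> complex_of_real"
abbreviation (input) "CV \<equiv> carrier_vec"
abbreviation (input) "CM \<equiv> carrier_mat"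
abbreviation (input) "adj \<equiv> mat_adjoint :: complex mat \<Rightarrow> complex mat"
abbreviation (input) "opn \<equiv> mat_opnorm"
abbreviation (input) "nm2 \<equiv> vec_l2norm"

section \<open>C*-algebra theory from the axioms: functionals, square roots, positivity,
  states\<close>

subsection \<open>Linear functionals\<close>

context cstar_algebra
begin

lemma sm_closed [simp, intro]: "x : car A ==> c \<odot> x : car A"
 using smult_closed by (simp add: complex_ring_def)

declare mult_closed [simp, intro] star_closed [simp, intro] star_star [simp]

lemma sm_add_left: "x : car A ==> (c + d) \<odot> x = c \<odot> x \<oplus> d \<odot> x"
 using smult_l_distr[of c d x] by (simp add: complex_ring_def)

lemma sm_add_right: "x : car A ==> y : car A ==> c \<odot> (x \<oplus> y) = c \<odot> x \<oplus> c \<odot> y"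
 using smult_r_distr[of c x y] by (simp add: complex_ring_def)

lemma sm_sm: "x : car A ==> c \<odot> (d \<odot> x) = (c * d) \<odot> x"
 using smult_assoc1[of c d x] by (simp add: complex_ring_def)

lemma sm_1 [simp]: "x : car A ==> 1 \<odot> x = x"
 using smult_one[of x] by (simp add: complex_ring_def)

lemma sm_0 [simp]: "x : car A ==> 0 \<odot> x = \<zero>"
 using cnorm_smult[of x 0] cnorm_eq_0_iff[of "0 \<odot> x"] by simp

lemma cnorm_zero [simp]: "cnorm A \<zero> = 0"
 using cnorm_eq_0_iff[of \<zero>] by simp

lemma sm_zero [simp]: "c \<odot> \<zero> = \<zero>"
 using cnorm_smult[of \<zero> c] cnorm_eq_0_iff[of "c \<odot> \<zero>"] by simp

lemma uminus_eq: "x : car A ==> \<ominus> x = (- 1) \<odot> x"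
 using M.minus_equality[of "(- 1) \<odot> x" x] sm_add_left[of x "- 1" 1] by simp

lemma minus_eq: "x : car A ==> y : car A ==> x \<ominus> y = x \<oplus> (- 1) \<odot> y"
 by (simp add: a_minus_def uminus_eq)

text \<open>Values off the carrier are fixed to 0, so that the pointwise order on the whole type is
  the order on the carrier and minimality yields an equation between functions.\<close>

definition sublinear :: "('a => real) => bool" where
 "sublinear q \<longleftrightarrow> (ALL x. x \<notin> car A --> q x = 0) &
 (ALL x:car A. ALL y:car A. q (x \<oplus> y) <= q x + q y) &
 (ALL x:car A. ALL t>0. q (cr t \<odot> x) = t * q x)"

lemma sublinear_zero: assumes "sublinear q" shows "q \<zero> = 0"
proof -
 have "q (cr 2 \<odot> \<zero>) = 2 * q \<zero>"
 using assms M.zero_closed unfolding sublinear_def by (metis zero_less_numeral)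
 then show ?thesis by simp
qed

lemma sublinear_neg: assumes "sublinear q" "x : car A" shows "- q ((- 1) \<odot> x) <= q x"
proof -
 have "x \<oplus> (- 1) \<odot> x = \<zero>" using sm_add_left[of x 1 "- 1"] assms by simp
 then show ?thesis
 using assms sublinear_zero[OF assms(1)] unfolding sublinear_def
 by (smt (verit) sm_closed)
qed

text \<open>The infimum of q(x + s y) - s q(y) over s \<ge> 0 is a sublinear function below q whose
  value at -y is at most -q(y). A minimal q equals all its tightenings, and this makes it
  additive.\<close>

definition tighten :: "('a => real) => 'a => 'a => real" where
 "tighten q y x = (if x : car A
 then INF s\<in>{0..}. q (x \<oplus> cr s \<odot> y) - s * q y else 0)"

context
 fixes q y assumes q: "sublinear q" and y: "y : car A"
begin

lemma q_add: "x : car A ==> z : car A ==> q (x \<oplus> z) <= q x + q z"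
 using q unfolding sublinear_def by blast

lemma q_scale: assumes "x : car A" "t >= 0" shows "q (cr t \<odot> x) = t * q x"
proof (cases "t = 0")
 case True
 then show ?thesis using assms sublinear_zero[OF q] by simp
next
 case False
 then show ?thesis using q assms unfolding sublinear_def by force
qed

text \<open>Keeps the infimum in \<open>tighten\<close> finite: s y = -x + (x + s y) and q(s y) = s
  q(y).\<close>

lemma tighten_lb:
 assumes x: "x : car A" and s: "s >= 0"
 shows "- q ((- 1) \<odot> x) <= q (x \<oplus> cr s \<odot> y) - s * q y"
proof -
 have "cr s \<odot> y = ((- 1) \<odot> x \<oplus> x) \<oplus> cr s \<odot> y"
 using sm_add_left[of x "- 1" 1] x y by simp
 also have "... = (- 1) \<odot> x \<oplus> (x \<oplus> cr s \<odot> y)"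
 using x y by (simp add: M.a_assoc)
 finally have "s * q y <= q ((- 1) \<odot> x) + q (x \<oplus> cr s \<odot> y)"
 using q_add[of "(- 1) \<odot> x" "x \<oplus> cr s \<odot> y"] q_scale[OF y s] x y by simp
 then show ?thesis by simp
qed

lemma tighten_le:
 assumes x: "x : car A" and s: "s >= 0"
 shows "tighten q y x <= q (x \<oplus> cr s \<odot> y) - s * q y"
proof -
 have "(INF s\<in>{0..}. q (x \<oplus> cr s \<odot> y) - s * q y)
 <= q (x \<oplus> cr s \<odot> y) - s * q y"
 by (rule cINF_lower) (auto intro!: bdd_belowI[of _ "- q ((- 1) \<odot> x)"] tighten_lb x s)
 then show ?thesis using x by (simp add: tighten_def)
qed

lemma tighten_approx:
 assumes x: "x : car A" and e: "e > 0"
 obtains s where "s >= 0" "q (x \<oplus> cr s \<odot> y) - s * q y < tighten q y x + e"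
proof -
 have "Inf ((%s. q (x \<oplus> cr s \<odot> y) - s * q y) ` {0..}) < tighten q y x + e"
 using x e by (simp add: tighten_def)
 then have "EX r:(%s. q (x \<oplus> cr s \<odot> y) - s * q y) ` {0..}. r < tighten q y x + e"
 by (intro cInf_lessD) auto
 then show ?thesis using that by auto
qed

lemma tighten_le_self: "x : car A ==> tighten q y x <= q x"
 using tighten_le[of x 0] y by simp

lemma tighten_neg: "tighten q y ((- 1) \<odot> y) <= - q y"
 using tighten_le[of "(- 1) \<odot> y" 1] sm_add_left[of y "- 1" 1] y sublinear_zero[OF q] by simp

lemma sublinear_tighten: "sublinear (tighten q y)"
 unfolding sublinear_def
proof (intro conjI ballI allI impI)
 fix x assume "x \<notin> car A" then show "tighten q y x = 0" by (simp add: tighten_def)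
next
 fix x z assume xz: "x : car A" "z : car A"
 show "tighten q y (x \<oplus> z) <= tighten q y x + tighten q y z"
 proof (rule field_le_epsilon)
 fix e :: real assume e: "e > 0"
 obtain s where s: "s >= 0" "q (x \<oplus> cr s \<odot> y) - s * q y < tighten q y x + e/2"
 using tighten_approx[OF xz(1), of "e/2"] e by auto
 obtain t where t: "t >= 0" "q (z \<oplus> cr t \<odot> y) - t * q y < tighten q y z + e/2"
 using tighten_approx[OF xz(2), of "e/2"] e by auto
 have "(x \<oplus> z) \<oplus> cr (s + t) \<odot> y
 = (x \<oplus> cr s \<odot> y) \<oplus> (z \<oplus> cr t \<odot> y)"
 using xz y by (simp add: sm_add_left M.a_ac)
 then have "q ((x \<oplus> z) \<oplus> cr (s + t) \<odot> y)
 <= q (x \<oplus> cr s \<odot> y) + q (z \<oplus> cr t \<odot> y)"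
 using q_add xz y by simp
 moreover have "tighten q y (x \<oplus> z) <= q ((x \<oplus> z) \<oplus> cr (s + t) \<odot> y) - (s + t) * q y"
 using tighten_le[of "x \<oplus> z" "s + t"] xz s t by simp
 ultimately show "tighten q y (x \<oplus> z) <= tighten q y x + tighten q y z + e"
 using s t by (simp add: algebra_simps)
 qed
next
 fix x and t :: real assume x: "x : car A" and t: "t > 0"
 have le: "tighten q y (cr t \<odot> x) <= t * tighten q y x"
 if x: "x : car A" and t: "t > 0" for x t
 proof (rule field_le_epsilon)
 fix e :: real assume e: "e > 0"
 obtain s where s: "s >= 0" "q (x \<oplus> cr s \<odot> y) - s * q y < tighten q y x + e/t"
 using tighten_approx[OF x, of "e/t"] e t by auto
 have "cr t \<odot> x \<oplus> cr (t * s) \<odot> y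
 = cr t \<odot> (x \<oplus> cr s \<odot> y)"
 using x y by (simp add: sm_add_right sm_sm)
 then have "q (cr t \<odot> x \<oplus> cr (t * s) \<odot> y)
 = t * q (x \<oplus> cr s \<odot> y)"
 using q_scale x y t by simp
 moreover have "tighten q y (cr t \<odot> x)
 <= q (cr t \<odot> x \<oplus> cr (t * s) \<odot> y) - t * s * q y"
 using tighten_le[of "cr t \<odot> x" "t * s"] x s t by simp
 ultimately have "tighten q y (cr t \<odot> x) <= t * (q (x \<oplus> cr s \<odot> y) - s * q y)"
 by (simp add: algebra_simps)
 also have "... <= t * (tighten q y x + e/t)"
 using s t by (intro mult_left_mono) auto
 finally show "tighten q y (cr t \<odot> x) <= t * tighten q y x + e"
 using t by (simp add: algebra_simps)
 qed
 \<comment> \<open>The reverse inequality is \<open>le\<close> for the factor 1/t at the point t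
   x.\<close>
 have "tighten q y (cr (1/t) \<odot> (cr t \<odot> x))
 <= (1/t) * tighten q y (cr t \<odot> x)"
 by (rule le) (use x t in auto)
 then have "t * tighten q y x <= tighten q y (cr t \<odot> x)"
 using x t by (simp add: sm_sm field_simps)
 then show "tighten q y (cr t \<odot> x) = t * tighten q y x"
 using le[OF x t] by simp
qed

end

text \<open>Zorn's lemma for the reversed order. A chain is bounded below at x by -p(-x), and its
  pointwise infimum is again sublinear.\<close>

lemma minimal_sublinear:
 assumes p: "sublinear p"
 obtains q where "sublinear q" "q <= p" "!!q'. sublinear q' ==> q' <= q ==> q' = q"
proof -
 let ?S = "{q. sublinear q & q <= p}"
 have "EX m:?S. ALL a:?S. a <= m --> a = m"
 proof (rule predicate_Zorn[of ?S "%a b. b <= a"])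
 show "partial_order_on ?S (relation_of (%a b. b <= a) ?S)"
 by (rule partial_order_on_relation_ofI) auto
 next
 fix Ch assume "Ch : Chains (relation_of (%a b. b <= a) ?S)"
 then have sub: "Ch <= ?S" and tot: "!!a b. a : Ch ==> b : Ch ==> a <= b \<or> b <= a"
 unfolding Chains_def relation_of_def by auto
 show "EX u:?S. ALL a:Ch. u <= a"
 proof (cases "Ch = {}")
 case True then show ?thesis using p by auto
 next
 case False
 define u where "u x = (INF q\<in>Ch. q x)" for x
 have bdd: "bdd_below ((%q. q x) ` Ch)" for x
 proof (rule bdd_belowI[of _ "if x : car A then - p ((- 1) \<odot> x) else 0"])
 fix r assume "r : (%q. q x) ` Ch"
 then obtain q where q: "q : Ch" "r = q x" by auto
 then have "sublinear q" "q <= p" using sub by auto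
 then show "(if x : car A then - p ((- 1) \<odot> x) else 0) <= r"
 using sublinear_neg[of q x] q le_funD[of q p "(- 1) \<odot> x"]
 by (auto simp: sublinear_def)
 qed
 have ule: "u <= q" if "q : Ch" for q
 unfolding le_fun_def u_def using cINF_lower[OF bdd that] by blast
 have uap: "EX q:Ch. q x < u x + e" if "e > 0" for x e
 using cInf_lessD[of "(%q. q x) ` Ch" "u x + e"] False that unfolding u_def by auto
 have "sublinear u"
 unfolding sublinear_def
 proof (intro conjI ballI allI impI)
 fix x assume "x \<notin> car A"
 then have "!!q. q : Ch ==> q x = 0" using sub by (auto simp: sublinear_def)
 then have "(%q. q x) ` Ch = {0}" using False by force
 then show "u x = 0" unfolding u_def by simp
 next
 fix x z assume xz: "x : car A" "z : car A"
 show "u (x \<oplus> z) <= u x + u z"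
 proof (rule field_le_epsilon)
 fix e :: real assume e: "e > 0"
 obtain q1 where q1: "q1 : Ch" "q1 x < u x + e/2" using uap[of "e/2" x] e by auto
 obtain q2 where q2: "q2 : Ch" "q2 z < u z + e/2" using uap[of "e/2" z] e by auto
 \<comment> \<open>Comparability in the chain gives one member below both approximants, so that
   subadditivity is used for a single function.\<close>
 obtain q where q: "q : Ch" "q <= q1" "q <= q2" using tot[OF q1(1) q2(1)] q1 q2 by auto
 have "u (x \<oplus> z) <= q (x \<oplus> z)" using ule[OF q(1)] by (simp add: le_funD)
 also have "... <= q x + q z" using sub q(1) xz unfolding sublinear_def by blast
 also have "... <= q1 x + q2 z" using q by (simp add: add_mono le_funD)
 finally show "u (x \<oplus> z) <= u x + u z + e" using q1 q2 by simp
 qed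
 next
 fix x and t :: real assume x: "x : car A" and t: "t > 0"
 have qs: "q (cr t \<odot> x) = t * q x" if "q : Ch" for q
 using sub that x t unfolding sublinear_def by blast
 show "u (cr t \<odot> x) = t * u x"
 proof (rule antisym; rule field_le_epsilon)
 fix e :: real assume e: "e > 0"
 obtain q where q: "q : Ch" "q x < u x + e/t" using uap[of "e/t" x] e t by auto
 have "u (cr t \<odot> x) <= t * q x" using ule[OF q(1)] qs[OF q(1)] by (metis le_funD)
 also have "... <= t * (u x + e/t)" using q t by (intro mult_left_mono) auto
 finally show "u (cr t \<odot> x) <= t * u x + e" using t by (simp add: algebra_simps)
 next
 fix e :: real assume e: "e > 0"
 obtain q where q: "q : Ch" "q (cr t \<odot> x) < u (cr t \<odot> x) + e"
 using uap[of e] e t by auto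
 have "t * u x <= t * q x" using ule[OF q(1)] t by (simp add: le_funD)
 then show "t * u x <= u (cr t \<odot> x) + e" using q qs[OF q(1)] by simp
 qed
 qed
 moreover have "u <= p" using False ule sub by (blast intro: order_trans)
 ultimately show ?thesis using ule by auto
 qed
 qed
 then obtain m where m: "sublinear m" "m <= p" "!!a. sublinear a ==> a <= p ==> a <= m ==> a = m"
 by auto
 show ?thesis
 by (rule that[OF m(1,2)]) (use m order_trans in blast)
qed

text \<open>Hahn-Banach by minimality instead of extension. A minimal sublinear function below the
  norm tightened in the direction y equals each of its own tightenings, hence is additive; the
  initial tightening forces its value at -y down to -||y||.\<close>

lemma norming_real_functional:
 assumes y: "y : car A"
 obtains F where "!!x z. x : car A ==> z : car A ==> F (x \<oplus> z) = F x + F z"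
 "!!x t. x : car A ==> F (cr t \<odot> x) = t * F x"
 "!!x. x : car A ==> F x <= cnorm A x" "F y = cnorm A y"
proof -
 define p where "p x = (if x : car A then cnorm A x else 0)" for x
 have p: "sublinear p"
 unfolding sublinear_def p_def using cnorm_triangle by (auto simp: cnorm_smult)
 obtain q where q: "sublinear q" "q <= tighten p y"
 "!!q'. sublinear q' ==> q' <= q ==> q' = q"
 using minimal_sublinear[OF sublinear_tighten[OF p y]] by blast
 have add: "q (x \<oplus> z) = q x + q z" if x: "x : car A" and z: "z : car A" for x z
 proof -
 have "tighten q z <= q"
 proof (rule le_funI)
 fix x show "tighten q z x <= q x"
 using tighten_le_self[OF q(1) z, of x] q(1) by (cases "x : car A") (auto simp: sublinear_def tighten_def)
 qed
 then have "tighten q z = q"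
 using q(3) sublinear_tighten[OF q(1) z] by blast
 then have "q x <= q (x \<oplus> z) - q z"
 using tighten_le[OF q(1) z x, of 1] z by simp
 then show ?thesis using q(1) x z unfolding sublinear_def by fastforce
 qed
 have neg: "q ((- 1) \<odot> x) = - q x" if x: "x : car A" for x
 using add[of x "(- 1) \<odot> x"] x sm_add_left[of x 1 "- 1"] sublinear_zero[OF q(1)] by simp
 have scale: "q (cr t \<odot> x) = t * q x" if x: "x : car A" for x t
 proof (cases "t >= 0")
 case True
 then show ?thesis using q_scale[OF q(1) y] x by simp
 next
 case False
 have "cr t \<odot> x = (- 1) \<odot> (cr (- t) \<odot> x)"
 using x by (simp add: sm_sm)
 then show ?thesis using neg q_scale[OF q(1) y x, of "- t"] x False by simp
 qed
 have le: "q x <= cnorm A x" if x: "x : car A" for x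
 proof -
 have "q x <= tighten p y x" using q(2) by (simp add: le_funD)
 also have "... <= p x" by (rule tighten_le_self[OF p y x])
 finally show ?thesis using x by (simp add: p_def)
 qed
 have "q ((- 1) \<odot> y) <= - cnorm A y"
 using le_funD[OF q(2), of "(- 1) \<odot> y"] tighten_neg[OF p y] y by (simp add: p_def)
 then have "q y = cnorm A y" using neg[OF y] le[OF y] by simp
 then show ?thesis using that[of q] add scale le by blast
qed

section \<open>Complex linear functionals, and identities tested by them\<close>

definition lfun :: "('a => complex) => bool" where
 "lfun F \<longleftrightarrow>
 (ALL x:car A. ALL y:car A. F (x \<oplus> y) = F x + F y) &
 (ALL c. ALL x:car A. F (c \<odot> x) = c * F x)"

lemma lfun_add:
 "lfun F ==> x : car A ==> y : car A ==> F (x \<oplus> y) = F x + F y"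
 by (simp add: lfun_def)

lemma lfun_sm:
 "lfun F ==> x : car A ==> F (c \<odot> x) = c * F x"
 by (simp add: lfun_def)

lemma lfun_minus:
 "lfun F ==> x : car A ==> y : car A ==> F (x \<ominus> y) = F x - F y"
 by (simp add: lfun_def minus_eq)

lemma lfun_uminus:
 "lfun F ==> x : car A ==> F (\<ominus> x) = - F x"
 by (simp add: lfun_def uminus_eq)

lemma lfun_zero: "lfun F ==> F \<zero> = 0"
 using lfun_sm[of F \<zero> 0] by simp

lemma lfun_finsum:
 assumes "lfun F" "finite I" "!!i. i : I ==> g i : car A"
 shows "F (finsum A g I) = (\<Sum>i\<in>I. F (g i))"
 using assms(2,3)
proof (induction I rule: finite_induct)
 case empty
 then show ?case using lfun_zero[OF assms(1)] by simp
next
 case (insert i I)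
 then have "F (finsum A g (insert i I)) = F (g i \<oplus> finsum A g I)"
 by (subst M.finsum_insert) auto
 then show ?case
 using insert lfun_add[OF assms(1)] by (simp add: Pi_I)
qed

lemmas lfun_simps = lfun_add lfun_sm
 lfun_minus lfun_uminus lfun_zero lfun_finsum

text \<open>F(x) - i F(i x) is the complex linear functional whose real part is F.\<close>

lemma complexify_functional:
 assumes add: "!!x z. x : car A ==> z : car A ==> F (x \<oplus> z) = F x + F z"
 and scale: "!!x t. x : car A ==> F (cr t \<odot> x) = t * F x"
 shows "lfun (%x. Complex (F x) (- F (\<i> \<odot> x)))"
 unfolding lfun_def
proof (intro conjI ballI allI)
 fix x y assume "x : car A" "y : car A"
 then show "Complex (F (x \<oplus> y)) (- F (\<i> \<odot> (x \<oplus> y)))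
 = Complex (F x) (- F (\<i> \<odot> x)) + Complex (F y) (- F (\<i> \<odot> y))"
 by (simp add: add sm_add_right complex_eq_iff)
next
 fix c x assume x: "x : car A"
 have "c \<odot> x = cr (Re c) \<odot> x \<oplus> cr (Im c) \<odot> (\<i> \<odot> x)"
 using sm_add_left[OF x, of "cr (Re c)" "cr (Im c) * \<i>"]
 complex_eq[of c] x by (simp add: sm_sm mult.commute)
 then have 1: "F (c \<odot> x) = Re c * F x + Im c * F (\<i> \<odot> x)"
 using x by (simp add: add scale)
 have ic: "\<i> * c = cr (- Im c) + cr (Re c) * \<i>"
 by (simp add: complex_eq_iff)
 have "\<i> \<odot> (c \<odot> x) = cr (- Im c) \<odot> x \<oplus> cr (Re c) \<odot> (\<i> \<odot> x)"
 unfolding sm_sm[OF x] ic by (rule sm_add_left[OF x])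
 then have 2: "F (\<i> \<odot> (c \<odot> x)) = - Im c * F x + Re c * F (\<i> \<odot> x)"
 using x by (simp only: add scale sm_closed)
 show "Complex (F (c \<odot> x)) (- F (\<i> \<odot> (c \<odot> x))) = c * Complex (F x) (- F (\<i> \<odot> x))"
 by (simp add: 1 2 complex_eq_iff)
qed

text \<open>Turns a linear identity into an identity of complex numbers, where \<open>simp\<close> can collect
  coefficients.\<close>

lemma feqI:
 assumes "!!F. lfun F ==> F x = F y" "x : car A" "y : car A"
 shows "x = y"
proof -
 have "x \<ominus> y : car A" using assms by simp
 then obtain F where F: "!!x z. x : car A ==> z : car A ==> F (x \<oplus> z) = F x + F z"
 "!!x t. x : car A ==> F (cr t \<odot> x) = t * F x"
 "F (x \<ominus> y) = cnorm A (x \<ominus> y)"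
 using norming_real_functional[of "x \<ominus> y"] by metis
 let ?G = "%x. Complex (F x) (- F (\<i> \<odot> x))"
 have "lfun ?G" by (rule complexify_functional[OF F(1,2)])
 then have "?G (x \<ominus> y) = 0" using assms lfun_minus[of ?G x y] by (metis right_minus_eq)
 then have "F (x \<ominus> y) = 0" by (metis complex.sel(1) zero_complex.simps(1))
 then show ?thesis using F(3) cnorm_eq_0_iff[of "x \<ominus> y"] assms by simp
qed

end

subsection \<open>Convergence\<close>

context cstar_algebra
begin

lemmas alg_simps = distrib_left distrib_right mult_assoc smult_mult_left smult_mult_right
 sm_sm sm_add_right star_add star_mult star_smult minus_eq

lemma star_zero [simp]: "star A \<zero> = \<zero>"
 using star_smult[of \<zero> 0] by simp

lemma mult_zero [simp]: "x : car A ==> x \<otimes> \<zero> = \<zero>"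
 using smult_mult_right[of x x 0] by simp

lemma zero_mult [simp]: "x : car A ==> \<zero> \<otimes> x = \<zero>"
 using smult_mult_left[of x x 0] by simp

lemma minus_self [simp]: "x : car A ==> x \<ominus> x = \<zero>"
 by simp

lemma star_minus: "x : car A ==> y : car A ==> star A (x \<ominus> y) = star A x \<ominus> star A y"
 by (simp add: alg_simps)

lemma mult_minus: "x : car A ==> y : car A ==> z : car A ==>
 x \<otimes> (y \<ominus> z) = x \<otimes> y \<ominus> x \<otimes> z"
 by (simp add: alg_simps)

lemma minus_mult: "x : car A ==> y : car A ==> z : car A ==>
 (y \<ominus> z) \<otimes> x = y \<otimes> x \<ominus> z \<otimes> x"
 by (simp add: alg_simps)

lemma minus_eq_zero_iff: "x : car A ==> y : car A ==> x \<ominus> y = \<zero> \<longleftrightarrow> x = y"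
 by simp

lemma cnorm_minus_commute: 
 assumes "x : car A" "y : car A" shows "cnorm A (x \<ominus> y) = cnorm A (y \<ominus> x)"
proof -
 have "y \<ominus> x = (- 1) \<odot> (x \<ominus> y)"
 using assms by (intro feqI) (auto simp: lfun_simps)
 then show ?thesis using cnorm_smult[of "x \<ominus> y" "- 1"] assms by simp
qed

lemma cnorm_minus_trans:
 assumes "x : car A" "y : car A" "z : car A"
 shows "cnorm A (x \<ominus> z) <= cnorm A (x \<ominus> y) + cnorm A (y \<ominus> z)"
proof -
 have "x \<ominus> z = (x \<ominus> y) \<oplus> (y \<ominus> z)"
 using assms by (intro feqI) (auto simp: lfun_simps)
 then show ?thesis using cnorm_triangle assms by simp
qed

lemma cnorm_diff_le:
 assumes "x : car A" "y : car A"
 shows "cnorm A x <= cnorm A y + cnorm A (x \<ominus> y)"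
proof -
 have "x = y \<oplus> (x \<ominus> y)"
 using assms by (intro feqI) (auto simp: lfun_simps)
 then show ?thesis using cnorm_triangle[of y "x \<ominus> y"] assms by simp
qed

text \<open>The C*-identity gives ||x||^2 = ||x^* x|| \<le> ||x^*|| ||x||; this is applied to x and
  to its adjoint.\<close>

lemma cnorm_star [simp]: assumes x: "x : car A" shows "cnorm A (star A x) = cnorm A x"
proof -
 have *: "cnorm A x <= cnorm A (star A x)" if x: "x : car A" for x
 proof -
 have "(cnorm A x)\<^sup>2 <= cnorm A (star A x) * cnorm A x"
 using cnorm_mult[of "star A x" x] cstar_identity[OF x] x by simp
 then show ?thesis
 using cnorm_nonneg[OF x] cnorm_nonneg[of "star A x"] x
 by (cases "cnorm A x = 0") (auto simp: power2_eq_square)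
 qed
 show ?thesis using *[OF x] *[of "star A x"] x by simp
qed

lemma cnorm_self_adjoint_square: "x : car A ==> star A x = x ==> cnorm A (x \<otimes> x) = (cnorm A x)\<^sup>2"
 using cstar_identity[of x] by simp

definition conv :: "(nat => 'a) => 'a => bool" where
 "conv x l \<longleftrightarrow> (ALL n. x n : car A) & l : car A & (%n. cnorm A (x n \<ominus> l)) ----> 0"

lemma conv_carrier: "conv x l ==> x n : car A" "conv x l ==> l : car A"
 by (auto simp: conv_def)

lemma conv_bound:
 assumes "!!n. x n : car A" "l : car A" "!!n. cnorm A (x n \<ominus> l) <= e n" "e ----> 0"
 shows "conv x l"
proof -
 have "(%n. cnorm A (x n \<ominus> l)) ----> 0"
 by (rule tendsto_sandwich[OF _ _ tendsto_const assms(4)])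
 (use assms in \<open>simp_all add: cnorm_nonneg\<close>)
 then show ?thesis using assms by (simp add: conv_def)
qed

lemma conv_const: "x : car A ==> conv (%_. x) x"
 by (rule conv_bound[of _ _ "%_. 0"]) auto

lemma conv_Suc: "conv x l ==> conv (%n. x (Suc n)) l"
 unfolding conv_def using LIMSEQ_Suc[of "%n. cnorm A (x n \<ominus> l)"] by auto

lemma conv_add:
 assumes "conv x l" "conv y m" shows "conv (%n. x n \<oplus> y n) (l \<oplus> m)"
proof (rule conv_bound)
 have [simp]: "x n : car A" "y n : car A" "l : car A" "m : car A" for n
 using assms by (auto simp: conv_def)
 fix n
 have "(x n \<oplus> y n) \<ominus> (l \<oplus> m) = (x n \<ominus> l) \<oplus> (y n \<ominus> m)"
 by (intro feqI) (auto simp: lfun_simps)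
 then show "cnorm A ((x n \<oplus> y n) \<ominus> (l \<oplus> m)) <= cnorm A (x n \<ominus> l) + cnorm A (y n \<ominus> m)"
 using cnorm_triangle by simp
 show "(%n. cnorm A (x n \<ominus> l) + cnorm A (y n \<ominus> m)) ----> 0"
 using assms unfolding conv_def by (intro tendsto_add_zero) simp_all
qed (use assms in \<open>auto simp: conv_def\<close>)

lemma conv_sm:
 assumes "conv x l" shows "conv (%n. c \<odot> x n) (c \<odot> l)"
proof (rule conv_bound)
 have [simp]: "x n : car A" "l : car A" for n
 using assms by (auto simp: conv_def)
 fix n
 have "c \<odot> x n \<ominus> c \<odot> l = c \<odot> (x n \<ominus> l)"
 by (intro feqI) (auto simp: lfun_simps algebra_simps)
 then show "cnorm A (c \<odot> x n \<ominus> c \<odot> l) <= cmod c * cnorm A (x n \<ominus> l)"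
 using cnorm_smult by simp
 show "(%n. cmod c * cnorm A (x n \<ominus> l)) ----> 0"
 using assms unfolding conv_def by (intro tendsto_mult_right_zero) simp
qed (use assms in \<open>auto simp: conv_def\<close>)

lemma conv_star:
 assumes "conv x l" shows "conv (%n. star A (x n)) (star A l)"
proof -
 have [simp]: "x n : car A" "l : car A" for n
 using assms by (auto simp: conv_def)
 have "cnorm A (star A (x n) \<ominus> star A l) = cnorm A (x n \<ominus> l)" for n
 using cnorm_star[of "x n \<ominus> l"] star_minus[of "x n" l] by simp
 then show ?thesis using assms by (simp add: conv_def)
qed

lemma conv_cnorm:
 assumes "conv x l" shows "(%n. cnorm A (x n)) ----> cnorm A l"
proof -
 have [simp]: "x n : car A" "l : car A" for n
 using assms by (auto simp: conv_def)
 have le: "norm (cnorm A (x n) - cnorm A l) <= cnorm A (x n \<ominus> l)" for n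
 using cnorm_diff_le[of "x n" l] cnorm_diff_le[of l "x n"] cnorm_minus_commute[of l "x n"]
 by (simp add: abs_le_iff)
 have lim: "(%n. cnorm A (x n \<ominus> l)) ----> 0"
 using assms by (simp add: conv_def)
 have "(%n. cnorm A (x n) - cnorm A l) ----> 0"
 by (rule Lim_null_comparison[OF _ lim]) (simp only: le eventually_True)
 then show ?thesis by (simp add: LIM_zero_iff)
qed

lemma conv_mult:
 assumes "conv x l" "conv y m" shows "conv (%n. x n \<otimes> y n) (l \<otimes> m)"
proof (rule conv_bound)
 have [simp]: "x n : car A" "y n : car A" "l : car A" "m : car A" for n
 using assms by (auto simp: conv_def)
 fix n
 have "x n \<otimes> y n \<ominus> l \<otimes> m = (x n \<ominus> l) \<otimes> y n \<oplus> l \<otimes> (y n \<ominus> m)"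
 by (intro feqI) (auto simp: alg_simps lfun_simps)
 then have "cnorm A (x n \<otimes> y n \<ominus> l \<otimes> m) <= cnorm A ((x n \<ominus> l) \<otimes> y n) + cnorm A (l \<otimes> (y n \<ominus> m))"
 using cnorm_triangle by simp
 also have "... <= cnorm A (x n \<ominus> l) * cnorm A (y n) + cnorm A l * cnorm A (y n \<ominus> m)"
 by (intro add_mono cnorm_mult) auto
 finally show "cnorm A (x n \<otimes> y n \<ominus> l \<otimes> m)
 <= cnorm A (x n \<ominus> l) * cnorm A (y n) + cnorm A l * cnorm A (y n \<ominus> m)" .
 have "(%n. cnorm A (x n \<ominus> l) * cnorm A (y n) + cnorm A l * cnorm A (y n \<ominus> m))
 ----> 0 * cnorm A m + cnorm A l * 0"
 using assms unfolding conv_def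
 by (intro tendsto_add tendsto_mult tendsto_const conv_cnorm[OF assms(2)]) simp_all
 then show "(%n. cnorm A (x n \<ominus> l) * cnorm A (y n) + cnorm A l * cnorm A (y n \<ominus> m)) ----> 0"
 by simp
qed (use assms in \<open>auto simp: conv_def\<close>)

lemma conv_unique:
 assumes "conv x l" "conv x m" shows "l = m"
proof -
 have c: "x n : car A" "l : car A" "m : car A" for n using assms by (auto simp: conv_def)
 have "(%n. cnorm A (x n \<ominus> l) + cnorm A (x n \<ominus> m)) ----> 0"
 using assms unfolding conv_def by (intro tendsto_add_zero) simp_all
 then have "cnorm A (l \<ominus> m) <= 0"
 proof (rule LIMSEQ_le_const)
 show "EX N. ALL n>=N. cnorm A (l \<ominus> m) <= cnorm A (x n \<ominus> l) + cnorm A (x n \<ominus> m)"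
 using cnorm_minus_trans[of l "x _" m] cnorm_minus_commute[of l "x _"] c by auto
 qed
 then show ?thesis
 using cnorm_nonneg[of "l \<ominus> m"] cnorm_eq_0_iff[of "l \<ominus> m"] c by simp
qed

lemma Cauchy_conv:
 assumes x: "!!n. x n : car A"
 and C: "!!e. e > 0 ==> EX N. ALL m>=N. ALL n>=N. cnorm A (x m \<ominus> x n) < e"
 obtains l where "conv x l"
proof -
 interpret X: Metric_space "car A" "cdist A" by (rule Metric_space_cdist)
 have "X.MCauchy x"
 unfolding X.MCauchy_def using x C by (auto simp: cdist_def image_subset_iff)
 then obtain l where l: "limitin X.mtopology x l sequentially"
 using complete unfolding X.mcomplete_def by blast
 then have "l : car A" "!!e. e > 0 ==> EX N. ALL n>=N. cdist A (x n) l < e"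
 unfolding X.limitin_metric eventually_sequentially by blast+
 then have "conv x l"
 unfolding conv_def using x
 by (auto simp: LIMSEQ_iff cdist_def cnorm_nonneg)
 then show ?thesis by (rule that)
qed

lemma in_closure_conv:
 assumes S: "S <= car A" and cl: "!!x l. [|!!n. x n : S; conv x l|] ==> l : S"
 shows "closedin (ctopology A) S"
proof -
 interpret X: Metric_space "car A" "cdist A" by (rule Metric_space_cdist)
 have "l : S" if x: "range x <= S" and l: "limitin X.mtopology x l sequentially" for x l
 proof (rule cl)
 show "x n : S" for n using x by auto
 have "l : car A" "!!e. e > 0 ==> EX N. ALL n>=N. cdist A (x n) l < e"
 using l unfolding X.limitin_metric eventually_sequentially by blast+
 moreover have "x n : car A" for n using x S by auto
 ultimately show "conv x l"
 unfolding conv_def by (auto simp: LIMSEQ_iff cdist_def cnorm_nonneg)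
 qed
 then show ?thesis
 unfolding ctopology_def X.metric_closedin_iff_sequentially_closed using S by blast
qed

lemma closed_conv:
 assumes "closedin (ctopology A) S" "!!n. x n : S" "conv x l"
 shows "l : S"
proof -
 interpret X: Metric_space "car A" "cdist A" by (rule Metric_space_cdist)
 have c: "x n : car A" "l : car A" for n using assms by (auto simp: conv_def)
 have "limitin X.mtopology x l sequentially"
 unfolding X.limitin_metric eventually_sequentially
 using c assms(3) unfolding conv_def by (auto simp: LIMSEQ_iff cdist_def cnorm_nonneg)
 then show ?thesis
 using assms(1,2) unfolding ctopology_def X.metric_closedin_iff_sequentially_closed by blast
qed

end

subsection \<open>Square roots\<close>

text \<open>Iteration for the smaller root 1 - sqrt(1 - t) of y = (t + y^2)/2. It majorizes the
  norms and the increments of the corresponding iteration in the algebra.\<close>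

fun scalar_iter :: "real => nat => real" where
 "scalar_iter t 0 = 0"
| "scalar_iter t (Suc n) = (t + (scalar_iter t n)\<^sup>2) / 2"

lemma scalar_iter_nonneg: "0 <= t ==> 0 <= scalar_iter t n"
 by (cases n) auto

lemma scalar_iter_le: "0 <= t ==> t <= 1 ==> scalar_iter t n <= 1 - sqrt (1 - t)"
proof (induction n)
 case (Suc n)
 have "(scalar_iter t n)\<^sup>2 <= (1 - sqrt (1 - t))\<^sup>2"
 using Suc scalar_iter_nonneg by (intro power_mono) auto
 also have "... = 2 - t - 2 * sqrt (1 - t)"
 using Suc.prems by (simp add: power2_diff)
 finally show ?case by simp
qed auto

lemma scalar_iter_mono: "0 <= t ==> scalar_iter t n <= scalar_iter t (Suc n)"
proof (induction n)
 case (Suc n)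
 then have "(scalar_iter t n)\<^sup>2 <= (scalar_iter t (Suc n))\<^sup>2"
 using scalar_iter_nonneg by (intro power_mono) auto
 then show ?case by simp
qed auto

context unital_cstar_algebra
begin

declare one_closed [simp, intro] one_mult [simp] mult_one [simp]

lemma star_one [simp]: "star A \<one> = \<one>"
 using star_mult[of "star A \<one>" \<one>] one_mult[of "star A \<one>"] by simp

primrec root_iter :: "'a => nat => 'a" where
 "root_iter z 0 = \<zero>"
| "root_iter z (Suc n) = (1/2) \<odot> (z \<oplus> root_iter z n \<otimes> root_iter z n)"

text \<open>The fixed point \<open>y\<close> of \<open>y = (z + y\<^sup>2) / 2\<close> satisfies \<open>(1 - y)\<^sup>2 = 1 - z\<close>. The increments of
  the iteration are dominated by those of the scalar iteration at \<open>\<parallel>z\<parallel>\<close>.\<close>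

lemma root_of_one_minus:
 assumes z: "z : car A" and n1: "cnorm A z <= 1"
 obtains y where "y : car A" "cnorm A y <= 1 - sqrt (1 - cnorm A z)"
 "(\<one> \<ominus> y) \<otimes> (\<one> \<ominus> y) = \<one> \<ominus> z"
 "!!w. w : car A ==> w \<otimes> z = z \<otimes> w ==> w \<otimes> y = y \<otimes> w"
 "star A z = z ==> star A y = y"
proof -
 let ?y = "root_iter z" and ?h = "scalar_iter (cnorm A z)"
 have t0: "0 <= cnorm A z" using z by (rule cnorm_nonneg)
 have c[simp]: "?y n : car A" for n by (induction n) (auto simp: z)
 have com: "w \<otimes> ?y n = ?y n \<otimes> w" if w: "w : car A" "w \<otimes> z = z \<otimes> w" for w n
 proof (induction n)
 case (Suc n)
 have "w \<otimes> (?y n \<otimes> ?y n) = (?y n \<otimes> ?y n) \<otimes> w"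
 using Suc w by (metis c mult_assoc)
 then show ?case using w z by (simp add: alg_simps)
 qed (use w in simp)
 have com2: "?y m \<otimes> ?y n = ?y n \<otimes> ?y m" for m n
 using com[of "?y m" n] com[of z m] z by simp
 have nrm: "cnorm A (?y n) <= ?h n" for n
 proof (induction n)
 case (Suc n)
 have "cnorm A (?y (Suc n)) <= (1/2) * (cnorm A z + cnorm A (?y n \<otimes> ?y n))"
 using cnorm_triangle[of z "?y n \<otimes> ?y n"] z by (simp add: cnorm_smult)
 also have "cnorm A (?y n \<otimes> ?y n) <= (?h n)\<^sup>2"
 using cnorm_mult[of "?y n" "?y n"] Suc cnorm_nonneg[of "?y n"]
 by (smt (verit, best) c mult_mono power2_eq_square)
 finally show ?case by simp
 qed auto
 have inc: "cnorm A (?y (Suc n) \<ominus> ?y n) <= ?h (Suc n) - ?h n" for n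
 proof (induction n)
 case 0
 then show ?case using z by (simp add: cnorm_smult minus_eq)
 next
 case (Suc n)
 \<comment> \<open>The iterates commute, so the difference of their squares factors, and each factor
   is bounded through the scalar iteration.\<close>
 have "?y (Suc (Suc n)) \<ominus> ?y (Suc n)
 = (1/2) \<odot> ((?y (Suc n) \<ominus> ?y n) \<otimes> (?y (Suc n) \<oplus> ?y n))"
 proof -
 have "?y (Suc (Suc n)) \<ominus> ?y (Suc n) = (1/2) \<odot> (z \<oplus> ?y (Suc n) \<otimes> ?y (Suc n)) \<ominus> (1/2) \<odot> (z \<oplus> ?y n \<otimes> ?y n)"
 by simp
 also have "... = (1/2) \<odot> ((?y (Suc n) \<ominus> ?y n) \<otimes> (?y (Suc n) \<oplus> ?y n))"
 using z com2[of n "Suc n"] by (intro feqI)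
 (simp_all add: alg_simps lfun_simps del: root_iter.simps)
 finally show ?thesis .
 qed
 then have "cnorm A (?y (Suc (Suc n)) \<ominus> ?y (Suc n))
 <= (1/2) * (cnorm A (?y (Suc n) \<ominus> ?y n) * cnorm A (?y (Suc n) \<oplus> ?y n))"
 using cnorm_mult by (simp add: cnorm_smult del: root_iter.simps)
 also have "... <= (1/2) * ((?h (Suc n) - ?h n) * (?h (Suc n) + ?h n))"
 using Suc cnorm_triangle[of "?y (Suc n)" "?y n"] nrm[of n] nrm[of "Suc n"]
 by (intro mult_left_mono mult_mono) (auto simp: cnorm_nonneg scalar_iter_mono t0 simp del: root_iter.simps scalar_iter.simps
 intro: order_trans[OF cnorm_nonneg])
 also have "... = ?h (Suc (Suc n)) - ?h (Suc n)"
 by (simp add: power2_eq_square field_simps)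
 finally show ?case .
 qed
 have dif: "cnorm A (?y (n + k) \<ominus> ?y n) <= ?h (n + k) - ?h n" for n k
 proof (induction k)
 case (Suc k)
 have "cnorm A (?y (n + Suc k) \<ominus> ?y n) <= cnorm A (?y (Suc (n + k)) \<ominus> ?y (n + k)) + cnorm A (?y (n + k) \<ominus> ?y n)"
 using cnorm_minus_trans[of "?y (Suc (n + k))" "?y (n + k)" "?y n"] by (simp del: root_iter.simps)
 then show ?case using Suc inc[of "n + k"] by (simp del: root_iter.simps scalar_iter.simps)
 qed (simp add: minus_eq_zero_iff)
 have "incseq ?h" by (rule incseq_SucI) (rule scalar_iter_mono[OF t0])
 moreover have "ALL n. ?h n <= 1 - sqrt (1 - cnorm A z)" using scalar_iter_le[OF t0 n1] by blast
 ultimately obtain L where "?h ----> L" by (rule incseq_convergent)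
 then have "Cauchy ?h" by (rule LIMSEQ_imp_Cauchy)
 obtain y where y: "conv ?y y"
 proof (rule Cauchy_conv)
 fix e :: real assume "e > 0"
 from CauchyD[OF \<open>Cauchy ?h\<close> this] obtain N
 where N: "!!m n. m >= N ==> n >= N ==> \<bar>?h m - ?h n\<bar> < e"
 by (auto simp: real_norm_def)
 have *: "cnorm A (?y m \<ominus> ?y n) < e" if "m >= n" "n >= N" for m n
 using dif[of n "m - n"] N[of m n] that by simp
 have "cnorm A (?y m \<ominus> ?y n) < e" if "m >= N" "n >= N" for m n
 using *[of m n] *[of n m] that cnorm_minus_commute[of "?y m" "?y n"] by (cases "m >= n") auto
 then show "EX N. ALL m>=N. ALL n>=N. cnorm A (?y m \<ominus> ?y n) < e" by blast
 qed auto
 have yc[simp]: "y : car A" using y by (rule conv_carrier)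
 show ?thesis
 proof (rule that[of y])
 show "cnorm A y <= 1 - sqrt (1 - cnorm A z)"
 proof (rule LIMSEQ_le_const2[OF conv_cnorm[OF y]])
 have "cnorm A (?y n) <= 1 - sqrt (1 - cnorm A z)" for n
 using nrm[of n] scalar_iter_le[OF t0 n1, of n] by linarith
 then show "EX N. ALL n>=N. cnorm A (?y n) <= 1 - sqrt (1 - cnorm A z)" by blast
 qed
 have "conv (%n. ?y (Suc n)) ((1/2) \<odot> (z \<oplus> y \<otimes> y))"
 using conv_sm[OF conv_add[OF conv_const[OF z] conv_mult[OF y y]]] by simp
 then have fp: "y = (1/2) \<odot> (z \<oplus> y \<otimes> y)"
 using conv_unique[OF conv_Suc[OF y]] by blast
 have "z = 2 \<odot> y \<ominus> y \<otimes> y"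
 proof (rule feqI)
 fix F assume F: "lfun F"
 have "F y = F ((1/2) \<odot> (z \<oplus> y \<otimes> y))" using fp by (rule arg_cong)
 also have "... = (1/2) * (F z + F (y \<otimes> y))"
 using F z by (simp add: lfun_simps)
 finally have "F y = (1/2) * (F z + F (y \<otimes> y))" .
 then show "F z = F (2 \<odot> y \<ominus> y \<otimes> y)" using F z by (simp add: lfun_simps algebra_simps)
 qed (use z in auto)
 then show "(\<one> \<ominus> y) \<otimes> (\<one> \<ominus> y) = \<one> \<ominus> z"
 by (intro feqI) (auto simp: alg_simps lfun_simps)
 show "w \<otimes> y = y \<otimes> w" if w: "w : car A" "w \<otimes> z = z \<otimes> w" for w
 proof (rule conv_unique)
 show "conv (%n. w \<otimes> ?y n) (w \<otimes> y)" by (rule conv_mult[OF conv_const[OF w(1)] y])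
 show "conv (%n. w \<otimes> ?y n) (y \<otimes> w)"
 unfolding com[OF w] by (rule conv_mult[OF y conv_const[OF w(1)]])
 qed
 show "star A y = y" if "star A z = z"
 proof -
 have "star A (?y n) = ?y n" for n
 by (induction n) (use that z in \<open>auto simp: alg_simps\<close>)
 then have "conv ?y (star A y)" using conv_star[OF y] by simp
 then show ?thesis by (rule conv_unique[OF y, symmetric])
 qed
 qed (rule yc)
qed

end

subsection \<open>The positive cone\<close>

context unital_cstar_algebra
begin

lemmas lin_simps = alg_simps lfun_simps

abbreviation real_scalar :: "real => 'a" where
 "real_scalar t \<equiv> cr t \<odot> \<one>"

lemma cnorm_one_le: "cnorm A \<one> <= 1"
proof -
 have "cnorm A \<one> = cnorm A \<one> * cnorm A \<one>"
 using cstar_identity[of \<one>] by (simp add: power2_eq_square)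
 then show ?thesis by (cases "cnorm A \<one> = 0") auto
qed

lemma cnorm_real_scalar: "t >= 0 ==> cnorm A (real_scalar t) <= t"
 using mult_left_mono[OF cnorm_one_le, of t] by (simp add: cnorm_smult)

text \<open>For self-adjoint h the inequality says that the spectrum lies in [0, 2t]. This form
  avoids spectra and behaves well under sums and nonnegative multiples.\<close>

definition pos :: "'a => bool" where
 "pos h \<longleftrightarrow> h : car A & star A h = h & (EX t>=0. cnorm A (real_scalar t \<ominus> h) <= t)"

lemma pos_carrier: "pos h ==> h : car A"
 and pos_star: "pos h ==> star A h = h"
 by (simp_all add: pos_def)

lemma posI: "[|h : car A; star A h = h; 0 <= t; cnorm A (real_scalar t \<ominus> h) <= t|] ==> pos h"
 unfolding pos_def by blast

lemma pos_bound_mono: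
 assumes h: "h : car A" and "cnorm A (real_scalar t \<ominus> h) <= t" "t <= t'"
 shows "cnorm A (real_scalar t' \<ominus> h) <= t'"
proof -
 have "real_scalar t' \<ominus> h = (real_scalar t \<ominus> h) \<oplus> real_scalar (t' - t)"
 using h by (intro feqI) (simp_all add: lin_simps algebra_simps)
 then have "cnorm A (real_scalar t' \<ominus> h) <= cnorm A (real_scalar t \<ominus> h) + cnorm A (real_scalar (t' - t))"
 using cnorm_triangle[of "real_scalar t \<ominus> h" "real_scalar (t' - t)"] h by simp
 then show ?thesis using assms cnorm_real_scalar[of "t' - t"] by linarith
qed

lemma pos_bound:
 assumes "pos h"
 obtains t where "t > 0" "t >= c" "cnorm A (real_scalar t \<ominus> h) <= t"
proof -
 obtain t where t: "t >= 0" "cnorm A (real_scalar t \<ominus> h) <= t"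
 using assms by (auto simp: pos_def)
 show ?thesis
 by (rule that[of "max (t + 1) c"])
 (use t in \<open>auto intro!: pos_bound_mono[OF pos_carrier[OF assms] t(2)]\<close>)
qed

lemma pos_zero [simp]: "pos \<zero>"
 by (rule posI[of _ 0]) simp_all

lemma pos_add:
 assumes "pos h" "pos k" shows "pos (h \<oplus> k)"
proof -
 have c: "h : car A" "k : car A" using assms by (simp_all add: pos_carrier)
 obtain t where t: "t > 0" "cnorm A (real_scalar t \<ominus> h) <= t" by (rule pos_bound[OF assms(1)])
 obtain s where s: "s > 0" "cnorm A (real_scalar s \<ominus> k) <= s" by (rule pos_bound[OF assms(2)])
 have eq: "real_scalar (t + s) \<ominus> (h \<oplus> k) = (real_scalar t \<ominus> h) \<oplus> (real_scalar s \<ominus> k)"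
 using c by (intro feqI) (simp_all add: lin_simps algebra_simps)
 have "cnorm A (real_scalar (t + s) \<ominus> (h \<oplus> k)) <= t + s"
 unfolding eq using cnorm_triangle[of "real_scalar t \<ominus> h" "real_scalar s \<ominus> k"] c t s by simp
 then show ?thesis
 using assms c t s by (intro posI[of _ "t + s"]) (simp_all add: star_add pos_star)
qed

lemma pos_scale:
 assumes "pos h" "r >= 0" shows "pos (cr r \<odot> h)"
proof -
 have c: "h : car A" using assms by (simp add: pos_carrier)
 obtain t where t: "t > 0" "cnorm A (real_scalar t \<ominus> h) <= t" by (rule pos_bound[OF assms(1)])
 have eq: "real_scalar (r * t) \<ominus> cr r \<odot> h = cr r \<odot> (real_scalar t \<ominus> h)"
 using c by (intro feqI) (simp_all add: lin_simps algebra_simps)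
 have "cnorm A (real_scalar (r * t) \<ominus> cr r \<odot> h) <= r * t"
 unfolding eq using c t assms(2) by (simp add: cnorm_smult mult_left_mono)
 then show ?thesis
 using assms c t by (intro posI[of _ "r * t"]) (simp_all add: star_smult pos_star)
qed

lemma pos_real_scalar: "t >= 0 ==> pos (real_scalar t)"
 by (rule posI[of _ t]) (simp_all add: star_smult)

lemma pos_norm_minus:
 assumes h: "h : car A" "star A h = h" and le: "cnorm A h <= c"
 shows "pos (real_scalar c \<ominus> h)"
proof (rule posI[of _ c])
 have "real_scalar c \<ominus> (real_scalar c \<ominus> h) = h"
 using h by (intro feqI) (simp_all add: lin_simps)
 then show "cnorm A (real_scalar c \<ominus> (real_scalar c \<ominus> h)) <= c" using le by simp
 show "0 <= c" using cnorm_nonneg[OF h(1)] le by simp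
qed (use h in \<open>simp_all add: star_minus star_smult\<close>)

text \<open>If ||t - h|| \<le> t, then z = 1 - h/t has norm at most 1, and sqrt t times the square
  root 1 - y of 1 - z squares to h. The root commutes with whatever commutes with h because y has
  this property relative to z.\<close>

lemma pos_sqrt:
 assumes "pos h"
 obtains g where "pos g" "g \<otimes> g = h"
 "!!w. w : car A ==> w \<otimes> h = h \<otimes> w ==> w \<otimes> g = g \<otimes> w"
proof -
 have h: "h : car A" "star A h = h" using assms by (simp_all add: pos_carrier pos_star)
 obtain t where t: "t > 0" "cnorm A (real_scalar t \<ominus> h) <= t" by (rule pos_bound[OF assms(1)])
 define z where "z = \<one> \<ominus> cr (1/t) \<odot> h"
 have z: "z : car A" using h by (simp add: z_def)
 have "z = cr (1/t) \<odot> (real_scalar t \<ominus> h)"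
 unfolding z_def using h t by (intro feqI) (simp_all add: lin_simps field_simps)
 then have "cnorm A z <= 1"
 using h t by (simp add: cnorm_smult norm_divide)
 then obtain y where y: "y : car A" "cnorm A y <= 1 - sqrt (1 - cnorm A z)"
 "(\<one> \<ominus> y) \<otimes> (\<one> \<ominus> y) = \<one> \<ominus> z"
 "!!w. w : car A ==> w \<otimes> z = z \<otimes> w ==> w \<otimes> y = y \<otimes> w"
 "star A z = z ==> star A y = y"
 using root_of_one_minus[OF z] by metis
 have "star A z = z" unfolding z_def using h by (simp add: star_minus star_smult)
 then have ys: "star A y = y" by (rule y(5))
 have "sqrt (1 - cnorm A z) >= 0" using \<open>cnorm A z <= 1\<close> by simp
 then have y1: "cnorm A y <= 1" using y(2) by linarith
 define g where "g = cr (sqrt t) \<odot> (\<one> \<ominus> y)"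
 have g: "g : car A" using y by (simp add: g_def)
 have "g \<otimes> g = cr t \<odot> ((\<one> \<ominus> y) \<otimes> (\<one> \<ominus> y))"
 unfolding g_def using y(1) t
 by (simp add: smult_mult_left smult_mult_right sm_sm flip: of_real_mult)
 also have "... = h"
 unfolding y(3) z_def using h t by (intro feqI) (simp_all add: lin_simps field_simps)
 finally have gg: "g \<otimes> g = h" .
 have "real_scalar (sqrt t) \<ominus> g = cr (sqrt t) \<odot> y"
 unfolding g_def using y(1) by (intro feqI) (simp_all add: lin_simps algebra_simps)
 then have "cnorm A (real_scalar (sqrt t) \<ominus> g) <= sqrt t"
 using y1 t y(1) by (simp add: cnorm_smult mult_left_le)
 moreover have "star A g = g" unfolding g_def using y(1) ys by (simp add: star_minus star_smult)
 ultimately have pg: "pos g" using g t by (intro posI[of _ "sqrt t"]) simp_all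
 have com: "w \<otimes> g = g \<otimes> w" if w: "w : car A" "w \<otimes> h = h \<otimes> w" for w
 proof -
 have "w \<otimes> z = z \<otimes> w" unfolding z_def using w h by (simp add: alg_simps)
 then have "w \<otimes> y = y \<otimes> w" by (rule y(4)[OF w(1)])
 then show ?thesis unfolding g_def using w y(1) by (simp add: alg_simps)
 qed
 show ?thesis by (rule that[OF pg gg com])
qed

text \<open>For self-adjoint \<open>\<parallel>g\<parallel> \<le> 1\<close> the element \<open>u = g + i \<surd>(1 - g\<^sup>2)\<close> is unitary, and
  \<open>2 g\<^sup>2 - 1\<close> is the real part of \<open>u\<^sup>2\<close>.\<close>

lemma cnorm_one_minus_square:
 assumes g: "g : car A" "star A g = g" "cnorm A g <= 1"
 shows "cnorm A (\<one> \<ominus> 2 \<odot> (g \<otimes> g)) <= 1"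
proof -
 have z: "g \<otimes> g : car A" "cnorm A (g \<otimes> g) <= 1"
 using g by (simp_all add: cnorm_self_adjoint_square power_le_one cnorm_nonneg)
 obtain y where y: "y : car A" "cnorm A y <= 1 - sqrt (1 - cnorm A (g \<otimes> g))"
 "(\<one> \<ominus> y) \<otimes> (\<one> \<ominus> y) = \<one> \<ominus> g \<otimes> g"
 "!!w. w : car A ==> w \<otimes> (g \<otimes> g) = (g \<otimes> g) \<otimes> w ==> w \<otimes> y = y \<otimes> w"
 "star A (g \<otimes> g) = g \<otimes> g ==> star A y = y"
 using root_of_one_minus[OF z] by metis
 define s where "s = \<one> \<ominus> y"
 have s: "s : car A" "s \<otimes> s = \<one> \<ominus> g \<otimes> g"
 using y(1,3) by (simp_all add: s_def)
 have "star A y = y" by (rule y(5)) (use g in \<open>simp add: star_mult\<close>)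
 then have ss: "star A s = s" using y(1) by (simp add: s_def star_minus)
 have "g \<otimes> y = y \<otimes> g" using y(4)[of g] g by (simp add: mult_assoc)
 then have com: "g \<otimes> s = s \<otimes> g" using g(1) y(1) by (simp add: s_def alg_simps)
 define u where "u = g \<oplus> \<i> \<odot> s"
 have u: "u : car A" using g s by (simp add: u_def)
 have su: "star A u = g \<ominus> \<i> \<odot> s"
 unfolding u_def using g s ss by (simp add: alg_simps)
 have "star A u \<otimes> u = g \<otimes> g \<oplus> s \<otimes> s"
 unfolding su unfolding u_def using g s(1) com
 by (intro feqI) (simp_all add: lin_simps)
 also have "... = \<one>" unfolding s(2) using g by (intro feqI) (simp_all add: lin_simps)
 finally have "(cnorm A u)\<^sup>2 <= 1" using cstar_identity[OF u] cnorm_one_le by simp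
 then have u2: "cnorm A (u \<otimes> u) <= 1"
 using cnorm_mult[OF u u] by (simp add: power2_eq_square)
 have "\<one> \<ominus> 2 \<odot> (g \<otimes> g) = s \<otimes> s \<ominus> g \<otimes> g"
 unfolding s(2) using g by (intro feqI) (simp_all add: lin_simps)
 also have "... = (- 1/2) \<odot> (u \<otimes> u \<oplus> star A u \<otimes> star A u)"
 unfolding su unfolding u_def using g s(1) com
 by (intro feqI) (simp_all add: lin_simps algebra_simps)
 also have "... = (- 1/2) \<odot> (u \<otimes> u \<oplus> star A (u \<otimes> u))"
 using u by (simp add: star_mult)
 finally show ?thesis
 using cnorm_triangle[of "u \<otimes> u" "star A (u \<otimes> u)"] u u2
 by (simp add: cnorm_smult)
qed

lemma cnorm_norm_minus_square:
 assumes g: "g : car A" "star A g = g"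
 shows "cnorm A (real_scalar ((cnorm A g)\<^sup>2) \<ominus> 2 \<odot> (g \<otimes> g)) <= (cnorm A g)\<^sup>2"
proof (cases "cnorm A g = 0")
 case True
 then show ?thesis using g cnorm_eq_0_iff by simp
next
 case False
 let ?r = "cnorm A g"
 have r: "?r > 0" using False cnorm_nonneg[OF g(1)] by simp
 let ?k = "cr (1/?r) \<odot> g"
 have "cnorm A (\<one> \<ominus> 2 \<odot> (?k \<otimes> ?k)) <= 1"
 using g r by (intro cnorm_one_minus_square) (simp_all add: star_smult cnorm_smult norm_divide)
 moreover have "real_scalar (?r\<^sup>2) \<ominus> 2 \<odot> (g \<otimes> g)
 = cr (?r\<^sup>2) \<odot> (\<one> \<ominus> 2 \<odot> (?k \<otimes> ?k))"
 using g r by (intro feqI) (simp_all add: lin_simps field_simps power2_eq_square)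
 moreover have "\<one> \<ominus> 2 \<odot> (?k \<otimes> ?k) : car A" using g by simp
 ultimately show ?thesis
 using r by (simp only: cnorm_smult) (simp add: mult_left_le norm_power)
qed

text \<open>With t = ||g||^2, the element t - g^2 is the average of t and t - 2 g^2, both of norm at
  most t.\<close>

lemma pos_square:
 assumes g: "g : car A" "star A g = g" shows "pos (g \<otimes> g)"
proof -
 let ?t = "(cnorm A g)\<^sup>2"
 have eq: "real_scalar ?t \<ominus> g \<otimes> g
 = (1/2) \<odot> (real_scalar ?t \<oplus> (real_scalar ?t \<ominus> 2 \<odot> (g \<otimes> g)))"
 using g by (intro feqI) (simp_all add: lin_simps field_simps)
 have "cnorm A (real_scalar ?t \<ominus> g \<otimes> g) <= ?t"
 unfolding eq using cnorm_triangle[of "real_scalar ?t" "real_scalar ?t \<ominus> 2 \<odot> (g \<otimes> g)"]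
 cnorm_norm_minus_square[OF g] cnorm_real_scalar[of ?t] g
 by (simp add: cnorm_smult)
 then show ?thesis using g by (intro posI[of _ ?t]) (simp_all add: star_mult)
qed

text \<open>Records that the spectrum of h lies in [0, ||h||]. It is
  \<open>cnorm_norm_minus_square\<close> for a square root of h.\<close>

lemma pos_cnorm_reflect:
 assumes "pos h"
 shows "cnorm A (real_scalar (cnorm A h) \<ominus> 2 \<odot> h) <= cnorm A h"
proof -
 obtain g where g: "pos g" "g \<otimes> g = h" using pos_sqrt[OF assms] by metis
 have "cnorm A h = (cnorm A g)\<^sup>2"
 using g cnorm_self_adjoint_square[of g] by (simp add: pos_carrier pos_star)
 then show ?thesis
 using cnorm_norm_minus_square[of g] g by (simp add: pos_carrier pos_star)
qed

lemma pos_cnorm_bound: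
 assumes "pos h"
 shows "cnorm A (real_scalar (cnorm A h) \<ominus> h) <= cnorm A h"
proof -
 let ?t = "cnorm A h"
 have h: "h : car A" using assms by (rule pos_carrier)
 have eq: "real_scalar ?t \<ominus> h = (1/2) \<odot> (real_scalar ?t \<oplus> (real_scalar ?t \<ominus> 2 \<odot> h))"
 using h by (intro feqI) (simp_all add: lin_simps field_simps)
 have "cnorm A (real_scalar ?t \<oplus> (real_scalar ?t \<ominus> 2 \<odot> h)) <= ?t + ?t"
 using cnorm_triangle[of "real_scalar ?t" "real_scalar ?t \<ominus> 2 \<odot> h"]
 pos_cnorm_reflect[OF assms] cnorm_real_scalar[of ?t] h cnorm_nonneg[OF h] by simp
 then show ?thesis
 unfolding eq using h by (simp only: cnorm_smult sm_closed M.a_closed minus_closed one_closed) simp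
qed

text \<open>The largest spectral value of a positive h is ||h||, and a shift moves it by s. Without
  spectra: for r = ||h|| the element (s + r/2) h equals (r/2) (h + s) - (s/2) (r - 2h), and r - 2h
  has norm at most r.\<close>

lemma pos_cnorm_shift:
 assumes "pos h" "h ~= \<zero>" "s >= 0"
 shows "cnorm A h + s <= cnorm A (h \<oplus> real_scalar s)"
proof -
 let ?r = "cnorm A h" and ?d = "cnorm A (h \<oplus> real_scalar s)"
 have h: "h : car A" using assms by (simp add: pos_carrier)
 have r: "?r > 0" using cnorm_nonneg[OF h] cnorm_eq_0_iff[OF h] assms by simp
 let ?x = "cr (?r/2) \<odot> (h \<oplus> real_scalar s)"
 and ?y = "cr (- s/2) \<odot> (real_scalar ?r \<ominus> 2 \<odot> h)"
 have "cr (s + ?r/2) \<odot> h = ?x \<oplus> ?y"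
 using h by (intro feqI) (simp_all add: lin_simps field_simps)
 then have "cnorm A (cr (s + ?r/2) \<odot> h) <= cnorm A ?x + cnorm A ?y"
 using cnorm_triangle[of ?x ?y] h by simp
 moreover have "cnorm A (cr (s + ?r/2) \<odot> h) = (s + ?r/2) * ?r"
 by (simp only: cnorm_smult[OF h] norm_of_real) (use r assms in simp)
 moreover have "cnorm A ?x = (?r/2) * ?d"
 using h r by (simp add: cnorm_smult)
 moreover have "cnorm A ?y = (s/2) * cnorm A (real_scalar ?r \<ominus> 2 \<odot> h)"
 using h assms by (simp add: cnorm_smult)
 moreover have "(s/2) * cnorm A (real_scalar ?r \<ominus> 2 \<odot> h) <= (s/2) * ?r"
 using pos_cnorm_reflect[OF assms(1)] assms(3) by (intro mult_left_mono) auto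
 ultimately have "(s + ?r/2) * ?r <= (?r/2) * ?d + (s/2) * ?r" by linarith
 then have "?r * (s + ?r) <= ?r * ?d" by (simp add: algebra_simps)
 then show ?thesis using r by simp
qed

text \<open>With c = ||a + b||, the element c - a = b + (c - a - b) is positive, so t - (c - a) = a
  + (t - c) has norm at most t for some t \<ge> c. By \<open>pos_cnorm_shift\<close> that norm is at
  least ||a|| + t - c.\<close>

lemma pos_cnorm_mono:
 assumes "pos a" "pos b" shows "cnorm A a <= cnorm A (a \<oplus> b)"
proof (cases "a = \<zero>")
 case True
 then show ?thesis using assms by (simp add: cnorm_nonneg pos_carrier)
next
 case False
 let ?c = "cnorm A (a \<oplus> b)"
 have c: "a : car A" "b : car A" using assms by (simp_all add: pos_carrier)
 have "pos (real_scalar ?c \<ominus> (a \<oplus> b))"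
 using assms c by (intro pos_norm_minus) (simp_all add: star_add pos_star)
 then have "pos (b \<oplus> (real_scalar ?c \<ominus> (a \<oplus> b)))" using assms by (intro pos_add)
 moreover have "b \<oplus> (real_scalar ?c \<ominus> (a \<oplus> b)) = real_scalar ?c \<ominus> a"
 using c by (intro feqI) (simp_all add: lin_simps)
 ultimately have "pos (real_scalar ?c \<ominus> a)" by simp
 then obtain t where t: "t > 0" "t >= ?c" "cnorm A (real_scalar t \<ominus> (real_scalar ?c \<ominus> a)) <= t"
 by (rule pos_bound)
 have "real_scalar t \<ominus> (real_scalar ?c \<ominus> a) = a \<oplus> real_scalar (t - ?c)"
 using c by (intro feqI) (simp_all add: lin_simps algebra_simps)
 then have "cnorm A a + (t - ?c) <= t"
 using pos_cnorm_shift[OF assms(1) False, of "t - ?c"] t by simp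
 then show ?thesis by simp
qed

lemma pos_add_eq_zero: "pos a ==> pos b ==> a \<oplus> b = \<zero> ==> a = \<zero>"
 using pos_cnorm_mono[of a b] cnorm_eq_0_iff[of a] cnorm_nonneg[of a] by (simp add: pos_carrier)

text \<open>The fourth power vanishes too, and the C*-identity, used twice, turns its norm into
  ||d||^4.\<close>

lemma self_adjoint_nilpotent:
 assumes d: "d : car A" "star A d = d" "d \<otimes> (d \<otimes> d) = \<zero>" shows "d = \<zero>"
proof -
 have "(d \<otimes> d) \<otimes> (d \<otimes> d) = (d \<otimes> (d \<otimes> d)) \<otimes> d" using d(1) by (simp add: mult_assoc)
 then have "(cnorm A (d \<otimes> d))\<^sup>2 = 0"
 using cnorm_self_adjoint_square[of "d \<otimes> d"] d by (simp add: star_mult)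
 then show ?thesis using cnorm_self_adjoint_square[of d] d cnorm_eq_0_iff[of d] by simp
qed

text \<open>For d = w - y the positive elements d w d and d y d add up to d (w^2 - y^2) = 0. Hence
  both vanish, and so does their difference d^3.\<close>

lemma pos_sqrt_unique_commuting:
 assumes w: "pos w" and y: "pos y" and eq: "w \<otimes> w = y \<otimes> y" and com: "w \<otimes> y = y \<otimes> w"
 shows "w = y"
proof -
 have c: "w : car A" "y : car A" using w y by (simp_all add: pos_carrier)
 define d where "d = w \<ominus> y"
 have d: "d : car A" "star A d = d" using w y c by (simp_all add: d_def star_minus pos_star)
 have dw: "d \<otimes> w = w \<otimes> d" "d \<otimes> y = y \<otimes> d"
 using c com by (simp_all add: d_def alg_simps)
 have sq: "pos (d \<otimes> (v \<otimes> d))" if v: "pos v" "d \<otimes> v = v \<otimes> d" for v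
 proof -
 obtain g where g: "pos g" "g \<otimes> g = v"
 "!!w. w : car A ==> w \<otimes> v = v \<otimes> w ==> w \<otimes> g = g \<otimes> w"
 using pos_sqrt[OF v(1)] by metis
 have gc: "g : car A" "star A g = g" using g by (simp_all add: pos_carrier pos_star)
 have gd: "d \<otimes> g = g \<otimes> d" using g(3) d v by simp
 have "pos ((g \<otimes> d) \<otimes> (g \<otimes> d))"
 using gc d gd by (intro pos_square) (simp_all add: star_mult)
 moreover have "(g \<otimes> d) \<otimes> (g \<otimes> d) = d \<otimes> (v \<otimes> d)"
 proof -
 have "(g \<otimes> d) \<otimes> (g \<otimes> d) = (d \<otimes> g) \<otimes> (g \<otimes> d)" using gd by simp
 also have "... = d \<otimes> ((g \<otimes> g) \<otimes> d)" using gc d by (simp add: mult_assoc)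
 finally show ?thesis using g(2) by simp
 qed
 ultimately show ?thesis by simp
 qed
 have "d \<otimes> (w \<otimes> d) \<oplus> d \<otimes> (y \<otimes> d) = d \<otimes> (w \<otimes> w \<ominus> y \<otimes> y)"
 proof -
 have "w \<otimes> (y \<otimes> x) = y \<otimes> (w \<otimes> x)" if "x : car A" for x
 using c com that by (metis mult_assoc)
 then show ?thesis
 unfolding d_def using c com by (intro feqI) (simp_all add: lin_simps)
 qed
 also have "... = \<zero>" using eq c d by simp
 finally have sum0: "d \<otimes> (w \<otimes> d) \<oplus> d \<otimes> (y \<otimes> d) = \<zero>" .
 have "d \<otimes> (w \<otimes> d) = \<zero>" using sq[OF w dw(1)] sq[OF y dw(2)] sum0 by (rule pos_add_eq_zero)
 moreover have "d \<otimes> (y \<otimes> d) = \<zero>"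
 by (rule pos_add_eq_zero[OF sq[OF y dw(2)] sq[OF w dw(1)]]) (use sum0 c d in \<open>simp add: M.a_comm\<close>)
 moreover have "d \<otimes> (d \<otimes> d) = d \<otimes> (w \<otimes> d) \<ominus> d \<otimes> (y \<otimes> d)"
 proof -
 have "d \<otimes> d = w \<otimes> d \<ominus> y \<otimes> d"
 using minus_mult[of d w y] c d(1) by (simp flip: d_def)
 then show ?thesis using mult_minus[of d "w \<otimes> d" "y \<otimes> d"] c d(1) by simp
 qed
 ultimately have "d \<otimes> (d \<otimes> d) = \<zero>" by simp
 then have "d = \<zero>" by (rule self_adjoint_nilpotent[OF d])
 then show ?thesis using c by (simp add: d_def)
qed

text \<open>Reduction to the commuting case: both roots commute with w^2, hence with the root g of
  \<open>pos_sqrt\<close>, and each is compared with g.\<close>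

lemma pos_sqrt_unique:
 assumes w: "pos w" and y: "pos y" and eq: "w \<otimes> w = y \<otimes> y"
 shows "w = y"
proof -
 have c: "w : car A" "y : car A" using w y by (simp_all add: pos_carrier)
 have "pos (w \<otimes> w)" using w c by (simp add: pos_square pos_star)
 then obtain g where g: "pos g" "g \<otimes> g = w \<otimes> w"
 "!!v. v : car A ==> v \<otimes> (w \<otimes> w) = (w \<otimes> w) \<otimes> v ==> v \<otimes> g = g \<otimes> v"
 using pos_sqrt by metis
 have "w \<otimes> (w \<otimes> w) = (w \<otimes> w) \<otimes> w" using c by (simp add: mult_assoc)
 then have "w = g"
 using pos_sqrt_unique_commuting[OF w g(1)] g(2) g(3)[OF c(1)] by simp
 moreover have "y \<otimes> (w \<otimes> w) = (w \<otimes> w) \<otimes> y" unfolding eq using c by (simp add: mult_assoc)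
 then have "y = g"
 using pos_sqrt_unique_commuting[OF y g(1)] g(2) g(3)[OF c(2)] eq by simp
 ultimately show ?thesis by simp
qed

lemma abs_value:
 assumes h: "h : car A" "star A h = h"
 obtains a where "pos a" "a \<otimes> a = h \<otimes> h" "a \<otimes> h = h \<otimes> a"
proof -
 have "pos (h \<otimes> h)" using h by (rule pos_square)
 then obtain a where a: "pos a" "a \<otimes> a = h \<otimes> h"
 "!!w. w : car A ==> w \<otimes> (h \<otimes> h) = (h \<otimes> h) \<otimes> w ==> w \<otimes> a = a \<otimes> w"
 using pos_sqrt by metis
 have "h \<otimes> a = a \<otimes> h" by (rule a(3)) (use h in \<open>simp_all add: mult_assoc\<close>)
 then show ?thesis using that[of a] a by simp
qed

text \<open>Suppose y is nonzero. With a and b the real and imaginary parts of y, the element s = y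
  y^* equals 2 a^2 + 2 b^2 + p, so it is positive, and its norm is r = ||p||. Put T = s + r. Then
  ||T|| = 2r, whereas T^2 = r T + y (r - p) y^* has norm at most 3 r^2.\<close>

lemma star_mult_self_not_negative:
 assumes y: "y : car A" and p: "pos p" and eq: "star A y \<otimes> y = (- 1) \<odot> p"
 shows "y = \<zero>"
proof (rule ccontr)
 assume ne: "y ~= \<zero>"
 define s where "s = y \<otimes> star A y"
 let ?r = "cnorm A p"
 have pc: "p : car A" using p by (rule pos_carrier)
 have sc: "s : car A" using y by (simp add: s_def)
 have r: "(cnorm A y)\<^sup>2 = ?r" using cstar_identity[OF y] eq pc by (simp add: cnorm_smult)
 have rs: "cnorm A s = ?r"
 using cstar_identity[of "star A y"] r y by (simp add: s_def)
 have r0: "?r > 0" using r ne cnorm_eq_0_iff[OF y] by (metis zero_less_power2)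
 define a where "a = (1/2) \<odot> (y \<oplus> star A y)"
 define b where "b = (1/(2*\<i>)) \<odot> (y \<ominus> star A y)"
 have ab: "a : car A" "b : car A" "star A a = a" "star A b = b"
 using y by (auto simp: a_def b_def alg_simps M.a_comm intro!: feqI)
 have "s = (2 \<odot> (a \<otimes> a) \<oplus> 2 \<odot> (b \<otimes> b)) \<oplus> p"
 proof -
 have "p = (- 1) \<odot> (star A y \<otimes> y)" using eq pc by (simp add: sm_sm)
 then show ?thesis
 unfolding s_def a_def b_def using y
 by (intro feqI) (simp_all add: lin_simps field_simps)
 qed
 then have "pos s"
 using pos_add[OF pos_add[OF pos_scale[OF pos_square[of a], of 2] pos_scale[OF pos_square[of b], of 2]] p] ab
 by simp
 have "s ~= \<zero>" using rs r0 by auto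
 let ?T = "s \<oplus> real_scalar ?r"
 have Tc: "?T : car A" "star A ?T = ?T"
 using sc \<open>pos s\<close> by (simp_all add: star_add star_smult pos_star)
 have T: "2 * ?r <= cnorm A ?T"
 using pos_cnorm_shift[OF \<open>pos s\<close> \<open>s ~= \<zero>\<close>, of ?r] rs r0 by simp
 have T': "cnorm A ?T <= 2 * ?r"
 using cnorm_triangle[of s "real_scalar ?r"] sc rs cnorm_real_scalar[of ?r] r0 by simp
 have "?T \<otimes> s = y \<otimes> ((real_scalar ?r \<ominus> p) \<otimes> star A y)"
 proof -
 have "s \<otimes> s = y \<otimes> ((star A y \<otimes> y) \<otimes> star A y)" using y by (simp add: s_def mult_assoc)
 also have "... = (- 1) \<odot> (y \<otimes> (p \<otimes> star A y))" unfolding eq using y pc by (simp add: alg_simps)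
 finally have "s \<otimes> s = (- 1) \<odot> (y \<otimes> (p \<otimes> star A y))" .
 moreover have "real_scalar ?r \<otimes> s = cr ?r \<odot> (y \<otimes> star A y)"
 using y by (simp add: s_def alg_simps)
 moreover have "?T \<otimes> s = s \<otimes> s \<oplus> real_scalar ?r \<otimes> s" using sc by (simp add: distrib_right)
 ultimately show ?thesis
 using y pc by (intro feqI) (simp_all add: lin_simps del: of_real_mult)
 qed
 then have "cnorm A (?T \<otimes> s) <= cnorm A y * (cnorm A (real_scalar ?r \<ominus> p) * cnorm A y)"
 using y pc cnorm_mult[of y "(real_scalar ?r \<ominus> p) \<otimes> star A y"]
 cnorm_mult[of "real_scalar ?r \<ominus> p" "star A y"] cnorm_nonneg[of y]
 by simp (meson mult_left_mono order_trans)
 also have "... <= cnorm A y * (?r * cnorm A y)"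
 using pos_cnorm_bound[OF p] cnorm_nonneg[OF y] by (intro mult_left_mono mult_right_mono) auto
 also have "... = ?r * ?r" using r by (simp add: power2_eq_square mult.assoc mult.left_commute)
 finally have Ts: "cnorm A (?T \<otimes> s) <= ?r * ?r" .
 have "?T \<otimes> ?T = cr ?r \<odot> ?T \<oplus> ?T \<otimes> s"
 using sc by (intro feqI) (simp_all add: lin_simps algebra_simps)
 then have "(cnorm A ?T)\<^sup>2 <= ?r * cnorm A ?T + cnorm A (?T \<otimes> s)"
 using cnorm_triangle[of "cr ?r \<odot> ?T" "?T \<otimes> s"] Tc sc r0
 cnorm_self_adjoint_square[OF Tc] cnorm_smult[OF Tc(1), of "cr ?r"] by simp
 also have "... <= ?r * (2 * ?r) + ?r * ?r"
 using T' Ts r0 by (intro add_mono mult_left_mono) auto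
 finally have "(cnorm A ?T)\<^sup>2 <= 3 * (?r * ?r)" by simp
 moreover have "(2 * ?r)\<^sup>2 <= (cnorm A ?T)\<^sup>2" using T r0 by (intro power_mono) auto
 ultimately show False using mult_pos_pos[OF r0 r0] unfolding power2_eq_square by linarith
qed

text \<open>Let h = x^* x, let a be its absolute value and m = (a - h)/2 its negative part. Then h m
  = -m^2, so y = x m satisfies y^* y = -m^3 with m^3 positive. By
  \<open>star_mult_self_not_negative\<close> x m = 0, hence m = 0 and h = a.\<close>

theorem pos_star_mult:
 assumes x: "x : car A" shows "pos (star A x \<otimes> x)"
proof -
 define h where "h = star A x \<otimes> x"
 have h: "h : car A" "star A h = h" using x by (simp_all add: h_def star_mult)
 obtain a where a: "pos a" "a \<otimes> a = h \<otimes> h" "a \<otimes> h = h \<otimes> a" by (rule abs_value[OF h])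
 have ac: "a : car A" "star A a = a" using a by (simp_all add: pos_carrier pos_star)
 define m where "m = (1/2) \<odot> (a \<ominus> h)"
 have m: "m : car A" "star A m = m" using h ac by (simp_all add: m_def star_minus star_smult)
 have am: "a \<otimes> m = m \<otimes> a" using a h ac by (simp add: m_def alg_simps)
 have mm: "m \<otimes> m = a \<otimes> m"
 unfolding m_def using a h ac by (intro feqI) (simp_all add: lin_simps field_simps)
 have hm: "h \<otimes> m = (- 1) \<odot> (m \<otimes> m)"
 unfolding mm unfolding m_def using a h ac
 by (intro feqI) (simp_all add: lin_simps field_simps)
 obtain g where g: "pos g" "g \<otimes> g = a"
 "!!w. w : car A ==> w \<otimes> a = a \<otimes> w ==> w \<otimes> g = g \<otimes> w"
 using pos_sqrt[OF a(1)] by metis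
 have gc: "g : car A" "star A g = g" using g by (simp_all add: pos_carrier pos_star)
 have mg: "m \<otimes> g = g \<otimes> m" using g(3) m am by simp
 have "pos ((g \<otimes> m) \<otimes> (g \<otimes> m))"
 using gc m mg by (intro pos_square) (simp_all add: star_mult)
 moreover have "(g \<otimes> m) \<otimes> (g \<otimes> m) = m \<otimes> (m \<otimes> m)"
 proof -
 have "(g \<otimes> m) \<otimes> (g \<otimes> m) = (m \<otimes> g) \<otimes> (g \<otimes> m)" using mg by simp
 also have "... = m \<otimes> ((g \<otimes> g) \<otimes> m)" using gc m by (simp add: mult_assoc)
 finally show ?thesis using g(2) mm by simp
 qed
 ultimately have pm: "pos (m \<otimes> (m \<otimes> m))" by simp
 have "star A (x \<otimes> m) \<otimes> (x \<otimes> m) = m \<otimes> (h \<otimes> m)"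
 using x m by (simp add: h_def star_mult mult_assoc)
 also have "... = (- 1) \<odot> (m \<otimes> (m \<otimes> m))" unfolding hm using m by (simp add: smult_mult_right)
 finally have e: "star A (x \<otimes> m) \<otimes> (x \<otimes> m) = (- 1) \<odot> (m \<otimes> (m \<otimes> m))" .
 have "x \<otimes> m = \<zero>" by (rule star_mult_self_not_negative[OF _ pm e]) (use x m in simp)
 then have "(- 1) \<odot> (m \<otimes> (m \<otimes> m)) = star A \<zero> \<otimes> \<zero>" by (simp only: flip: e)
 then have "(- 1) \<odot> (m \<otimes> (m \<otimes> m)) = \<zero>" by simp
 then have "m \<otimes> (m \<otimes> m) = \<zero>"
 using cnorm_smult[of "m \<otimes> (m \<otimes> m)" "- 1"] cnorm_eq_0_iff[of "m \<otimes> (m \<otimes> m)"] m by simp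
 then have "m = \<zero>" by (rule self_adjoint_nilpotent[OF m])
 then have "a = h"
 using cnorm_smult[of "a \<ominus> h" "1/2"] cnorm_eq_0_iff[of "a \<ominus> h"] ac h by (simp add: m_def)
 then show ?thesis using a by (simp add: h_def)
qed

end

subsection \<open>States\<close>

context unital_cstar_algebra
begin

definition pfun :: "('a => complex) => bool" where
 "pfun f \<longleftrightarrow> lfun f &
 (ALL x:car A. f (star A x) = cnj (f x)) & (ALL p. pos p --> 0 <= Re (f p))"

text \<open>Norming h + ||h|| 1, of norm 2 ||h||, instead of h forces F(h) = ||h|| and F(1) = 1 at
  once. A contractive functional with value 1 at the unit is nonnegative on positive p, since t -
  F(p) = F(t - p) \<le> t. Averaging over x and its adjoint makes it hermitian.\<close>

lemma norming_state:
 assumes h: "pos h" "h ~= \<zero>"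
 obtains f where "pfun f" "Re (f h) = cnorm A h"
 "!!x. x : car A ==> \<bar>Re (f x)\<bar> <= cnorm A x"
 "!!x. x : car A ==> cmod (f x) <= 2 * cnorm A x"
proof -
 let ?r = "cnorm A h"
 have hc: "h : car A" "star A h = h" using h by (simp_all add: pos_carrier pos_star)
 have r0: "?r > 0" using cnorm_nonneg[OF hc(1)] cnorm_eq_0_iff[OF hc(1)] h by simp
 have yc: "h \<oplus> real_scalar ?r : car A" using hc by simp
 obtain F where F: "!!x z. x : car A ==> z : car A ==> F (x \<oplus> z) = F x + F z"
 "!!x t. x : car A ==> F (cr t \<odot> x) = t * F x"
 "!!x. x : car A ==> F x <= cnorm A x"
 "F (h \<oplus> real_scalar ?r) = cnorm A (h \<oplus> real_scalar ?r)"
 by (rule norming_real_functional[OF yc]) (rule that)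
 have "F h + ?r * F \<one> >= 2 * ?r"
 using F(4) pos_cnorm_shift[OF h, of ?r] r0 F(1)[of h "real_scalar ?r"] F(2)[of \<one> ?r] hc by simp
 moreover have "F h <= ?r" using F(3) hc by simp
 moreover have "F \<one> <= 1" using F(3)[of \<one>] cnorm_one_le by simp
 then have "?r * F \<one> <= ?r" using r0 by (simp add: mult_left_le)
 ultimately have Fh: "F h = ?r" and "?r * F \<one> = ?r" by linarith+
 then have F1: "F \<one> = 1" using r0 by simp
 define G where "G x = (F x + F (star A x)) / 2" for x
 have G: "!!x z. x : car A ==> z : car A ==> G (x \<oplus> z) = G x + G z"
 "!!x t. x : car A ==> G (cr t \<odot> x) = t * G x"
 by (simp_all add: G_def F star_add star_smult algebra_simps add_divide_distrib)
 have Gle: "G x <= cnorm A x" if "x : car A" for x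
 using F(3)[of x] F(3)[of "star A x"] that by (simp add: G_def)
 have Gneg: "G ((- 1) \<odot> x) = - G x" if "x : car A" for x
 using G(2)[OF that, of "- 1"] by simp
 have Gabs: "\<bar>G x\<bar> <= cnorm A x" if x: "x : car A" for x
 using Gle[OF x] Gle[of "(- 1) \<odot> x"] Gneg[OF x] x cnorm_smult[OF x, of "- 1"] by simp
 have Gstar: "G (star A x) = G x" if "x : car A" for x using that by (simp add: G_def)
 have G1: "G \<one> = 1" using F1 by (simp add: G_def)
 define f where "f x = Complex (G x) (- G (\<i> \<odot> x))" for x
 have lin: "lfun f"
 unfolding f_def by (rule complexify_functional[OF G])
 have st: "f (star A x) = cnj (f x)" if x: "x : car A" for x
 proof -
 have "\<i> \<odot> star A x = star A ((- 1) \<odot> (\<i> \<odot> x))" using x by (simp add: star_smult sm_sm)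
 then have "G (\<i> \<odot> star A x) = - G (\<i> \<odot> x)"
 using Gstar[of "(- 1) \<odot> (\<i> \<odot> x)"] Gneg[of "\<i> \<odot> x"] x by simp
 then show ?thesis using x by (simp add: f_def Gstar complex_eq_iff)
 qed
 have ps: "0 <= Re (f p)" if p: "pos p" for p
 proof -
 have pc: "p : car A" using p by (rule pos_carrier)
 obtain t where t: "t > 0" "cnorm A (real_scalar t \<ominus> p) <= t" by (rule pos_bound[OF p])
 have "G (real_scalar t \<ominus> p) = t - G p"
 using G(1)[of "real_scalar t" "(- 1) \<odot> p"] G(2)[of \<one> t] Gneg[OF pc] G1 pc by (simp add: minus_eq)
 then show ?thesis using Gle[of "real_scalar t \<ominus> p"] t pc by (simp add: f_def)
 qed
 have "G h = ?r" using Fh hc by (simp add: G_def)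
 moreover have "cmod (f x) <= 2 * cnorm A x" if x: "x : car A" for x
 using cmod_le[of "f x"] Gabs[OF x] Gabs[of "\<i> \<odot> x"] x by (simp add: f_def cnorm_smult)
 ultimately show ?thesis
 using that[of f] lin st ps Gabs unfolding pfun_def by (simp add: f_def)
qed

lemma pfun_linear: "pfun f ==> lfun f"
 by (simp add: pfun_def)

lemma pfun_pos: "pfun f ==> pos p ==> 0 <= Re (f p)"
 by (simp add: pfun_def)

lemma pfun_star:
 "pfun f ==> x : car A ==> f (star A x) = cnj (f x)"
 by (simp add: pfun_def)

lemma pfun_pos_real:
 assumes "pfun f" "pos p" shows "f p = cr (Re (f p))"
 using pfun_star[OF assms(1), of p] assms pos_carrier[OF assms(2)] pos_star[OF assms(2)]
 by (simp add: complex_eq_iff)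

text \<open>A weighted sum of states norming a dense sequence.\<close>

lemma faithful_state:
 fixes d :: "nat => 'a"
 assumes dc: "!!l. d l : car A"
 and dense: "!!x e. x : car A ==> e > 0 ==> EX l. cnorm A (x \<ominus> d l) < e"
 obtains f M where "pfun f" "!!x. x : car A ==> cmod (f x) <= M * cnorm A x"
 "!!x. x : car A ==> Re (f (star A x \<otimes> x)) = 0 ==> x = \<zero>"
proof -
 have "EX f. pfun f & Re (f (star A (d l) \<otimes> d l)) = (cnorm A (d l))\<^sup>2 &
 (ALL x:car A. \<bar>Re (f x)\<bar> <= cnorm A x & cmod (f x) <= 2 * cnorm A x)" for l
 proof (cases "d l = \<zero>")
 case True
 then show ?thesis
 by (intro exI[of _ "%_. 0"])
 (simp add: pfun_def lfun_def cnorm_nonneg)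
 next
 case False
 then have "star A (d l) \<otimes> d l ~= \<zero>"
 using cstar_identity[OF dc[of l]] cnorm_eq_0_iff[OF dc[of l]] by auto
 with pos_star_mult[OF dc[of l]] obtain f where "pfun f"
 "Re (f (star A (d l) \<otimes> d l)) = cnorm A (star A (d l) \<otimes> d l)"
 "!!x. x : car A ==> \<bar>Re (f x)\<bar> <= cnorm A x"
 "!!x. x : car A ==> cmod (f x) <= 2 * cnorm A x"
 using norming_state by metis
 then show ?thesis using cstar_identity[OF dc[of l]] by (intro exI[of _ f]) simp
 qed
 then obtain g where g: "!!l. pfun (g l)"
 "!!l. Re (g l (star A (d l) \<otimes> d l)) = (cnorm A (d l))\<^sup>2"
 "!!l x. x : car A ==> \<bar>Re (g l x)\<bar> <= cnorm A x"
 "!!l x. x : car A ==> cmod (g l x) <= 2 * cnorm A x"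
 by metis
 define f where "f x = (\<Sum>l. cr ((1/2)^l) * g l x)" for x
 have geo: "summable (%l. (1/2)^l * (2 * cnorm A x))" for x
 by (intro summable_mult2 summable_geometric) simp
 have nb: "norm (cr ((1/2)^l) * g l x) <= (1/2)^l * (2 * cnorm A x)"
 if "x : car A" for l x
 using g(4)[OF that, of l] by (simp add: norm_mult norm_power mult_left_mono)
 have sm: "summable (%l. cr ((1/2)^l) * g l x)" if "x : car A" for x
 by (rule summable_comparison_test'[OF geo]) (rule nb[OF that])
 have gl: "lfun (g l)" for l using g(1) by (rule pfun_linear)
 have lin: "lfun f"
 unfolding lfun_def
 proof (intro conjI ballI allI)
 fix x y assume xy: "x : car A" "y : car A"
 show "f (x \<oplus> y) = f x + f y"
 unfolding f_def suminf_add[OF sm[OF xy(1)] sm[OF xy(2)]]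
 using xy gl by (simp add: lfun_add ring_distribs)
 next
 fix c x assume x: "x : car A"
 show "f (c \<odot> x) = c * f x"
 unfolding f_def suminf_mult[OF sm[OF x], symmetric]
 using x gl by (simp add: lfun_sm mult.left_commute)
 qed
 have fpos: "Re (f p) = (\<Sum>l. (1/2)^l * Re (g l p))" "summable (%l. (1/2)^l * Re (g l p))"
 if "p : car A" for p
 proof -
 have "(%l. Re (cr ((1/2)^l) * g l p)) sums Re (f p)"
 unfolding f_def by (intro sums_Re summable_sums sm that)
 then have "(%l. (1/2)^l * Re (g l p)) sums Re (f p)"
 by (simp only: times_complex.sel Re_complex_of_real Im_complex_of_real mult_zero_left diff_0_right)
 then show "Re (f p) = (\<Sum>l. (1/2)^l * Re (g l p))" "summable (%l. (1/2)^l * Re (g l p))"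
 by (simp_all add: sums_iff)
 qed
 have pf: "pfun f"
 unfolding pfun_def
 proof (intro conjI ballI allI impI lin)
 fix x assume x: "x : car A"
 have "(%l. cnj (cr ((1/2)^l) * g l x)) sums cnj (f x)"
 unfolding f_def by (subst sums_cnj) (intro summable_sums sm x)
 then have "(%l. cr ((1/2)^l) * g l (star A x)) sums cnj (f x)"
 using x g(1) by (simp add: pfun_star)
 then show "f (star A x) = cnj (f x)" by (simp add: f_def sums_iff)
 next
 fix p assume p: "pos p"
 then have "p : car A" by (rule pos_carrier)
 then show "0 <= Re (f p)"
 unfolding fpos(1)[OF \<open>p : car A\<close>]
 by (intro suminf_nonneg fpos(2)) (simp_all add: pfun_pos[OF g(1) p])
 qed
 have bd: "cmod (f x) <= 4 * cnorm A x" if x: "x : car A" for x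
 proof -
 have "cmod (f x) <= (\<Sum>l. (1/2)^l * (2 * cnorm A x))"
 unfolding f_def by (rule norm_suminf_le[OF nb[OF x] geo])
 also have "... = 4 * cnorm A x"
 using suminf_mult2[OF summable_geometric[of "1/2::real"], of "2 * cnorm A x"]
 suminf_geometric[of "1/2::real"] by simp
 finally show ?thesis .
 qed
 have faithful: "x = \<zero>" if x: "x : car A" and z: "Re (f (star A x \<otimes> x)) = 0" for x
 proof (rule ccontr)
 assume "x ~= \<zero>"
 then have n0: "cnorm A x > 0" using cnorm_nonneg[OF x] cnorm_eq_0_iff[OF x] by simp
 obtain l where l: "cnorm A (x \<ominus> d l) < cnorm A x / 4" using dense[OF x, of "cnorm A x / 4"] n0 by auto
 have xp: "pos (star A x \<otimes> x)" using x by (rule pos_star_mult)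
 have t0: "(1/2)^l * Re (g l (star A x \<otimes> x)) >= 0" for l
 using pfun_pos[OF g(1) xp] by simp
 have "(1/2)^l * Re (g l (star A x \<otimes> x)) = 0"
 using suminf_eq_zero_iff[OF fpos(2)[of "star A x \<otimes> x"] t0] fpos(1)[of "star A x \<otimes> x"] z x by auto
 then have z': "Re (g l (star A x \<otimes> x)) = 0" by simp
 define b where "b = d l \<ominus> x"
 have b: "b : car A" using x dc by (simp add: b_def)
 \<comment> \<open>Parallelogram law for x + b = d l and x - b. As g l vanishes at x^* x, it yields
   ||d l||^2 \<le> 2 ||b||^2, which is impossible when d l is within ||x||/4 of x.\<close>
 have "star A (d l) \<otimes> d l \<oplus> star A (x \<ominus> b) \<otimes> (x \<ominus> b) = 2 \<odot> (star A x \<otimes> x) \<oplus> 2 \<odot> (star A b \<otimes> b)"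
 unfolding b_def using x dc by (intro feqI) (simp_all add: lin_simps algebra_simps)
 then have "g l (star A (d l) \<otimes> d l) + g l (star A (x \<ominus> b) \<otimes> (x \<ominus> b))
 = 2 * g l (star A x \<otimes> x) + 2 * g l (star A b \<otimes> b)"
 using x b dc lfun_add[OF gl, of "star A (d l) \<otimes> d l" "star A (x \<ominus> b) \<otimes> (x \<ominus> b)" l]
 lfun_add[OF gl, of "2 \<odot> (star A x \<otimes> x)" "2 \<odot> (star A b \<otimes> b)" l]
 by (simp add: lfun_sm[OF gl])
 then have "Re (g l (star A (d l) \<otimes> d l)) + Re (g l (star A (x \<ominus> b) \<otimes> (x \<ominus> b)))
 = 2 * Re (g l (star A x \<otimes> x)) + 2 * Re (g l (star A b \<otimes> b))"
 by (simp add: complex_eq_iff)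
 then have "(cnorm A (d l))\<^sup>2 <= 2 * Re (g l (star A b \<otimes> b))"
 using z' g(2)[of l] pfun_pos[OF g(1) pos_star_mult[of "x \<ominus> b"], of l] x b by simp
 also have "... <= 2 * (cnorm A b)\<^sup>2"
 using g(3)[of "star A b \<otimes> b" l] cstar_identity[OF b] b by simp
 also have "cnorm A b = cnorm A (x \<ominus> d l)" unfolding b_def by (rule cnorm_minus_commute[OF dc x])
 also have "(cnorm A (x \<ominus> d l))\<^sup>2 <= (cnorm A x / 4)\<^sup>2"
 using l by (intro power_mono) (simp_all add: cnorm_nonneg x dc)
 finally have "(cnorm A (d l))\<^sup>2 <= (cnorm A x)\<^sup>2 / 8" by (simp add: power2_eq_square)
 moreover have "cnorm A (d l) >= 3 / 4 * cnorm A x"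
 using cnorm_diff_le[OF x dc[of l]] l by simp
 then have "(3 / 4 * cnorm A x)\<^sup>2 <= (cnorm A (d l))\<^sup>2" using n0 by (intro power_mono) auto
 moreover have "(cnorm A x)\<^sup>2 > 0" using n0 by simp
 ultimately show False by (simp add: power2_eq_square)
 qed
 show ?thesis by (rule that[OF pf bd faithful])
qed

subsection \<open>Inverses\<close>

primrec neumann :: "'a => nat => 'a" where
 "neumann z 0 = \<one>"
| "neumann z (Suc n) = \<one> \<oplus> z \<otimes> neumann z n"

text \<open>The Neumann series, with partial sums \<open>neumann z n\<close>; the geometric tails
  \<open>e n\<close> bound the distances between them.\<close>

lemma inverse_of_one_minus:
 assumes z: "z : car A" and n1: "cnorm A z < 1"
 obtains s where "s : car A" "(\<one> \<ominus> z) \<otimes> s = \<one>" "s \<otimes> (\<one> \<ominus> z) = \<one>"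
 "star A z = z ==> star A s = s" "cnorm A s <= 1 / (1 - cnorm A z)"
proof -
 let ?s = "neumann z" and ?q = "cnorm A z"
 have q0: "0 <= ?q" using z by (rule cnorm_nonneg)
 have c[simp]: "?s n : car A" for n by (induction n) (simp_all add: z)
 have com: "z \<otimes> ?s n = ?s n \<otimes> z" for n
 proof (induction n)
 case (Suc n)
 show ?case using z by (simp add: distrib_left distrib_right mult_assoc Suc[symmetric])
 qed (use z in simp)
 have inc: "cnorm A (?s (Suc n) \<ominus> ?s n) <= ?q ^ Suc n" for n
 proof (induction n)
 case 0
 have "?s (Suc 0) \<ominus> ?s 0 = z" using z by (intro feqI) (simp_all add: lin_simps)
 then show ?case by simp
 next
 case (Suc n)
 have "?s (Suc (Suc n)) \<ominus> ?s (Suc n) = z \<otimes> (?s (Suc n) \<ominus> ?s n)"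
 proof -
 have "?s (Suc (Suc n)) \<ominus> ?s (Suc n) = (\<one> \<oplus> z \<otimes> ?s (Suc n)) \<ominus> (\<one> \<oplus> z \<otimes> ?s n)" by simp
 also have "... = z \<otimes> (?s (Suc n) \<ominus> ?s n)"
 using z by (intro feqI) (simp_all add: lin_simps del: neumann.simps)
 finally show ?thesis .
 qed
 then have "cnorm A (?s (Suc (Suc n)) \<ominus> ?s (Suc n)) <= ?q * cnorm A (?s (Suc n) \<ominus> ?s n)"
 using cnorm_mult[OF z, of "?s (Suc n) \<ominus> ?s n"] by (simp del: neumann.simps)
 also have "... <= ?q * ?q ^ Suc n" using Suc q0 by (intro mult_left_mono) auto
 finally show ?case by simp
 qed
 define e where "e n = ?q ^ Suc n / (1 - ?q)" for n
 have eS: "?q ^ Suc n + e (Suc n) = e n" for n using n1 by (simp add: e_def field_simps)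
 have e0: "0 <= e n" for n using q0 n1 by (simp add: e_def)
 have dif: "cnorm A (?s (n + k) \<ominus> ?s n) <= e n - e (n + k)" for n k
 proof (induction k)
 case (Suc k)
 have "cnorm A (?s (n + Suc k) \<ominus> ?s n) <= cnorm A (?s (Suc (n + k)) \<ominus> ?s (n + k)) + cnorm A (?s (n + k) \<ominus> ?s n)"
 using cnorm_minus_trans[of "?s (Suc (n + k))" "?s (n + k)" "?s n"] by (simp del: neumann.simps)
 then show ?case using Suc inc[of "n + k"] eS[of "n + k"] by (simp del: neumann.simps)
 qed simp
 have elim: "e ----> 0"
 proof -
 have "(%n. ?q * ?q ^ n / (1 - ?q)) ----> ?q * 0 / (1 - ?q)"
 by (intro tendsto_divide tendsto_mult tendsto_const LIMSEQ_realpow_zero) (use n1 q0 in auto)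
 then show ?thesis by (simp add: e_def[abs_def])
 qed
 obtain s where s: "conv ?s s"
 proof (rule Cauchy_conv)
 fix r :: real assume "r > 0"
 with LIMSEQ_D[OF elim this] obtain N where N: "!!n. n >= N ==> e n < r" using e0 by auto
 have *: "cnorm A (?s m \<ominus> ?s n) < r" if "m >= n" "n >= N" for m n
 using dif[of n "m - n"] N[of n] e0[of m] that by simp
 have "cnorm A (?s m \<ominus> ?s n) < r" if "m >= N" "n >= N" for m n
 using *[of m n] *[of n m] that cnorm_minus_commute[of "?s m" "?s n"] by (cases "m >= n") auto
 then show "EX N. ALL m>=N. ALL n>=N. cnorm A (?s m \<ominus> ?s n) < r" by blast
 qed (rule c)
 have sc: "s : car A" using s by (rule conv_carrier)
 have "conv (%n. ?s (Suc n)) (\<one> \<oplus> z \<otimes> s)"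
 using conv_add[OF conv_const[OF one_closed] conv_mult[OF conv_const[OF z] s]] by simp
 then have fp: "s = \<one> \<oplus> z \<otimes> s" by (rule conv_unique[OF conv_Suc[OF s]])
 have zs: "z \<otimes> s = s \<otimes> z"
 proof (rule conv_unique)
 show "conv (%n. z \<otimes> ?s n) (z \<otimes> s)" by (rule conv_mult[OF conv_const[OF z] s])
 show "conv (%n. z \<otimes> ?s n) (s \<otimes> z)" unfolding com by (rule conv_mult[OF s conv_const[OF z]])
 qed
 have zsm: "z \<otimes> s = s \<ominus> \<one>"
 proof (rule feqI)
 fix F assume F: "lfun F"
 have "F s = F (\<one> \<oplus> z \<otimes> s)" using fp by (rule arg_cong)
 then show "F (z \<otimes> s) = F (s \<ominus> \<one>)" using F z sc by (simp add: lfun_simps)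
 qed (use z sc in simp_all)
 have i1: "(\<one> \<ominus> z) \<otimes> s = \<one>"
 unfolding minus_mult[OF sc one_closed z] zsm
 using sc by (intro feqI) (simp_all add: lin_simps)
 have i2: "s \<otimes> (\<one> \<ominus> z) = \<one>"
 unfolding mult_minus[OF sc one_closed z] zs[symmetric] zsm
 using sc by (intro feqI) (simp_all add: lin_simps)
 have st: "star A s = s" if "star A z = z"
 proof -
 have "star A (?s n) = ?s n" for n
 by (induction n) (use that z com in \<open>simp_all add: star_add star_mult\<close>)
 then have "conv ?s (star A s)" using conv_star[OF s] by simp
 then show ?thesis by (rule conv_unique[OF s, symmetric])
 qed
 have "cnorm A s <= cnorm A \<one> + cnorm A (z \<otimes> s)"
 using cnorm_triangle[of \<one> "z \<otimes> s"] z sc fp by simp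
 also have "... <= 1 + ?q * cnorm A s" using cnorm_one_le cnorm_mult[OF z sc] by simp
 finally have "cnorm A s * (1 - ?q) <= 1" by (simp add: algebra_simps)
 then have "cnorm A s <= 1 / (1 - ?q)" using n1 by (simp add: pos_le_divide_eq)
 with sc i1 i2 st show ?thesis by (rule that)
qed

text \<open>If ||t - h|| \<le> t, then h + dlt = T (1 - z) with T = t + dlt and z = (t - h)/T of
  norm at most t/T < 1.\<close>

lemma pos_shift_inverse:
 assumes h: "pos h" and dlt: "dlt > 0"
 obtains e where "e : car A" "star A e = e"
 "(h \<oplus> real_scalar dlt) \<otimes> e = \<one>" "e \<otimes> (h \<oplus> real_scalar dlt) = \<one>"
proof -
 have hc: "h : car A" "star A h = h" using h by (simp_all add: pos_carrier pos_star)
 obtain t where t: "t > 0" "cnorm A (real_scalar t \<ominus> h) <= t" by (rule pos_bound[OF h])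
 define T where "T = t + dlt"
 have T: "T > 0" "t < T" using t dlt by (simp_all add: T_def)
 define z where "z = cr (1/T) \<odot> (real_scalar t \<ominus> h)"
 have z: "z : car A" "star A z = z" using hc by (simp_all add: z_def star_minus star_smult)
 have "cnorm A z < 1" using t T hc by (simp add: z_def cnorm_smult norm_divide)
 then obtain s where s: "s : car A" "(\<one> \<ominus> z) \<otimes> s = \<one>" "s \<otimes> (\<one> \<ominus> z) = \<one>" "star A s = s"
 using inverse_of_one_minus[OF z(1)] z(2) by metis
 have "cr T \<odot> (real_scalar 1 \<ominus> z) = real_scalar T \<ominus> (real_scalar t \<ominus> h)"
 unfolding z_def using T hc by (intro feqI) (simp_all add: lin_simps algebra_simps)
 moreover have "real_scalar T \<ominus> (real_scalar t \<ominus> h) = h \<oplus> real_scalar dlt"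
 unfolding T_def using hc by (intro feqI) (simp_all add: lin_simps algebra_simps)
 ultimately have d: "h \<oplus> real_scalar dlt = cr T \<odot> (\<one> \<ominus> z)" by simp
 show ?thesis
 by (rule that[of "cr (1/T) \<odot> s"])
 (use s T z in \<open>simp_all add: d star_smult smult_mult_left smult_mult_right sm_sm\<close>)
qed

subsection \<open>Complete positivity\<close>

text \<open>Together the phi i j are a positive functional on r by r matrices over A, tested only on
  the matrices with entries c_j^* c_i.\<close>

definition cp_family :: "nat => (nat => nat => 'a => complex) => bool" where
 "cp_family r phi \<longleftrightarrow> (ALL i<r. ALL j<r. lfun (phi i j)) &
 (ALL c. (ALL i<r. c i : car A) --> 0 <= Re (\<Sum>i<r. \<Sum>j<r. phi i j (star A (c j) \<otimes> c i)))"

definition matrix_form :: "nat => (nat => nat => 'a) => (nat => 'a) => 'a" where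
 "matrix_form r H z = finsum A (%j. star A (z j) \<otimes> finsum A (%i. H i j \<otimes> z i) {..<r}) {..<r}"

text \<open>Positivity of a matrix over A is expressed through the A-valued form z^* H z, so that no
  C*-structure on such matrices has to be built.\<close>

definition pos_matrix :: "nat => (nat => nat => 'a) => bool" where
 "pos_matrix r H \<longleftrightarrow> (ALL i<r. ALL j<r. H i j : car A & star A (H i j) = H j i) &
 (ALL z. (ALL i<r. z i : car A) --> pos (matrix_form r H z))"

lemma finsum_closed': "(!!i. i : I ==> g i : car A) ==> finsum A g I : car A"
 by (intro M.finsum_closed) auto

lemma finsum_lessThan_Suc:
 "(!!i. i <= n ==> g i : car A) ==> finsum A g {..<Suc n} = finsum A g {..<n} \<oplus> g n"
 unfolding lessThan_Suc by (subst M.finsum_insert) (auto simp: M.a_comm finsum_closed')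

lemma finsum_zero': "(!!i. i : I ==> g i = \<zero>) ==> finsum A g I = \<zero>"
 using M.finsum_cong'[of I I "%_. \<zero>" g] by (simp add: M.finsum_zero)

lemma lfun_mult_left:
 "lfun F ==> b : car A ==> lfun (%x. F (b \<otimes> x))"
 by (simp add: lfun_def distrib_left smult_mult_right)

text \<open>Eliminate the last index by a Schur complement: with \<open>d = H\<^sub>r\<^sub>r + \<delta>\<close> and \<open>e = 1/d\<close>,
  the matrix \<open>S\<^sub>i\<^sub>j = H\<^sub>i\<^sub>j - H\<^sub>r\<^sub>j e H\<^sub>i\<^sub>r\<close> is again positive.\<close>

lemma cp_family_pos_matrix:
 "[|pos_matrix r H; cp_family r phi|] ==> 0 <= Re (\<Sum>i<r. \<Sum>j<r. phi i j (H i j))"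
proof (induction r arbitrary: H)
 case 0
 then show ?case by simp
next
 case (Suc r)
 have Hc[simp]: "H i j : car A" if "i <= r" "j <= r" for i j
 using Suc.prems(1) that by (simp add: pos_matrix_def)
 have Hs: "star A (H i j) = H j i" if "i <= r" "j <= r" for i j
 using Suc.prems(1) that by (simp add: pos_matrix_def)
 have Hp: "pos (matrix_form (Suc r) H z)" if "!!i. i <= r ==> z i : car A" for z
 using Suc.prems(1) that by (simp add: pos_matrix_def)
 have lin: "lfun (phi i j)" if "i <= r" "j <= r" for i j
 using Suc.prems(2) that by (simp add: cp_family_def)
 have cp: "0 <= Re (\<Sum>i<Suc r. \<Sum>j<Suc r. phi i j (star A (c j) \<otimes> c i))"
 if "!!i. i <= r ==> c i : car A" for c
 using Suc.prems(2) that by (simp add: cp_family_def)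
 have cp_r: "cp_family r phi"
 unfolding cp_family_def
 proof (intro conjI allI impI)
 fix c assume c: "ALL i<r. c i : car A"
 define c' where "c' i = (if i < r then c i else \<zero>)" for i
 have "0 <= Re (\<Sum>i<Suc r. \<Sum>j<Suc r. phi i j (star A (c' j) \<otimes> c' i))"
 by (rule cp) (use c in \<open>simp add: c'_def\<close>)
 moreover have "phi i j (star A (c' j) \<otimes> c' i) = (if i < r & j < r then phi i j (star A (c j) \<otimes> c i) else 0)"
 if "i <= r" "j <= r" for i j
 using c that lfun_zero[OF lin[OF that]] by (auto simp: c'_def)
 ultimately show "0 <= Re (\<Sum>i<r. \<Sum>j<r. phi i j (star A (c j) \<otimes> c i))" by simp
 qed (use lin in simp)
 let ?h = "H r r"
 have h: "pos ?h"
 proof -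
 define z where "z i = (if i = r then \<one> else \<zero>)" for i
 have row: "finsum A (%i. H i j \<otimes> z i) {..<Suc r} = H r j" if "j <= r" for j
 proof -
 have "finsum A (%i. H i j \<otimes> z i) {..<r} = \<zero>"
 by (rule finsum_zero') (use that in \<open>simp add: z_def\<close>)
 then show ?thesis using that by (subst finsum_lessThan_Suc) (simp_all add: z_def)
 qed
 have rc: "finsum A (%i. H i j \<otimes> z i) {..<Suc r} : car A" if "j <= r" for j
 using row[OF that] that by simp
 have "finsum A (%j. star A (z j) \<otimes> finsum A (%i. H i j \<otimes> z i) {..<Suc r}) {..<r} = \<zero>"
 by (rule finsum_zero') (use rc in \<open>simp add: z_def\<close>)
 then have "matrix_form (Suc r) H z = ?h"
 unfolding matrix_form_def
 by (subst finsum_lessThan_Suc) (use rc row in \<open>simp_all add: z_def\<close>)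
 then show ?thesis using Hp[of z] by (simp add: z_def)
 qed
 \<comment> \<open>The corner entry need not be invertible, so it is shifted by dlt, which tends to
   0 at the end.\<close>
 have "0 <= Re (\<Sum>i<Suc r. \<Sum>j<Suc r. phi i j (H i j)) + dlt * Re (phi r r \<one>)" if dlt: "dlt > 0" for dlt
 proof -
 obtain e where e: "e : car A" "star A e = e"
 "(?h \<oplus> real_scalar dlt) \<otimes> e = \<one>" "e \<otimes> (?h \<oplus> real_scalar dlt) = \<one>"
 by (rule pos_shift_inverse[OF h dlt])
 define d where "d = ?h \<oplus> real_scalar dlt"
 have d: "d : car A" "pos d" "d \<otimes> e = \<one>" "e \<otimes> d = \<one>"
 using h dlt e by (simp_all add: d_def pos_add pos_real_scalar)
 have de: "d \<otimes> (e \<otimes> x) = x" "e \<otimes> (d \<otimes> x) = x" if "x : car A" for x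
 using d e that by (simp_all flip: mult_assoc)
 define S where "S i j = H i j \<ominus> H r j \<otimes> (e \<otimes> H i r)" for i j
 have Sc: "S i j : car A" if "i < r" "j < r" for i j using that e by (simp add: S_def)
 have "pos_matrix r S"
 unfolding pos_matrix_def
 proof (intro conjI allI impI)
 fix i j assume ij: "i < r" "j < r"
 show "S i j : car A" using Sc ij .
 show "star A (S i j) = S j i"
 using ij e by (simp add: S_def star_minus star_mult Hs mult_assoc)
 next
 fix z assume z: "ALL i<r. z i : car A"
 define y where "y = finsum A (%i. H i r \<otimes> z i) {..<r}"
 \<comment> \<open>The last component -e y cancels the last row of the shifted matrix. Hence the
   form of H at z', plus the contribution of the shift, is the form of S at z.\<close>
 define z' where "z' i = (if i < r then z i else (- 1) \<odot> (e \<otimes> y))" for i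
 define R where "R j = finsum A (%i. H i j \<otimes> z i) {..<r}" for j
 have y: "y : car A" unfolding y_def by (rule finsum_closed') (use z in simp)
 have zr: "z' r = (- 1) \<odot> (e \<otimes> y)" "z' r : car A" using e y by (simp_all add: z'_def)
 have z': "z' i : car A" if "i <= r" for i using z zr that by (simp add: z'_def)
 have Rc: "R j : car A" if "j <= r" for j
 unfolding R_def by (rule finsum_closed') (use z that in simp)
 have Rr: "R r = y" by (simp add: R_def y_def)
 have row: "finsum A (%i. H i j \<otimes> z' i) {..<Suc r} = R j \<oplus> H r j \<otimes> z' r" if j: "j <= r" for j
 proof -
 have "finsum A (%i. H i j \<otimes> z' i) {..<r} = R j"
 unfolding R_def by (rule M.finsum_cong') (use z j in \<open>auto simp: z'_def\<close>)
 then show ?thesis using z' j by (subst finsum_lessThan_Suc) simp_all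
 qed
 have rowS: "finsum A (%i. S i j \<otimes> z i) {..<r} = R j \<ominus> H r j \<otimes> (e \<otimes> y)" if j: "j < r" for j
 proof (rule feqI)
 fix F assume F: "lfun F"
 have F': "lfun (%x. F (H r j \<otimes> (e \<otimes> x)))"
 using lfun_mult_left[OF lfun_mult_left[OF F, of "H r j"], of e] j e by simp
 have "F (finsum A (%i. S i j \<otimes> z i) {..<r}) = (\<Sum>i<r. F (S i j \<otimes> z i))"
 by (rule lfun_finsum[OF F]) (use z j Sc in auto)
 also have "... = (\<Sum>i<r. F (H i j \<otimes> z i) - F (H r j \<otimes> (e \<otimes> (H i r \<otimes> z i))))"
 by (rule sum.cong) (use z j e F in \<open>simp_all add: S_def minus_mult mult_assoc lfun_minus\<close>)
 also have "... = F (R j) - F (H r j \<otimes> (e \<otimes> y))"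
 unfolding R_def y_def
 by (subst lfun_finsum[OF F], simp, use z j in simp,
 subst lfun_finsum[OF F'], simp, use z in simp, simp add: sum_subtractf)
 finally show "F (finsum A (%i. S i j \<otimes> z i) {..<r}) = F (R j \<ominus> H r j \<otimes> (e \<otimes> y))"
 using F Rc[of j] j e y by (simp add: lfun_minus)
 qed (use z j Sc Rc e y in \<open>auto intro!: finsum_closed'\<close>)
 have mS: "matrix_form r S z = finsum A (%j. star A (z j) \<otimes> (R j \<ominus> H r j \<otimes> (e \<otimes> y))) {..<r}"
 unfolding matrix_form_def
 by (rule M.finsum_cong') (use rowS z Rc e y in \<open>auto simp: Pi_iff\<close>)
 have mH: "matrix_form (Suc r) H z'
 = finsum A (%j. star A (z j) \<otimes> (R j \<ominus> H r j \<otimes> (e \<otimes> y))) {..<r} \<oplus> star A (z' r) \<otimes> (y \<oplus> ?h \<otimes> z' r)"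
 proof -
 have "matrix_form (Suc r) H z' = finsum A (%j. star A (z' j) \<otimes> (R j \<oplus> H r j \<otimes> z' r)) {..<Suc r}"
 unfolding matrix_form_def
 by (rule M.finsum_cong') (use row z' Rc in \<open>auto simp: Pi_iff\<close>)
 also have "... = finsum A (%j. star A (z' j) \<otimes> (R j \<oplus> H r j \<otimes> z' r)) {..<r}
 \<oplus> star A (z' r) \<otimes> (R r \<oplus> ?h \<otimes> z' r)"
 by (rule finsum_lessThan_Suc) (use z' Rc in simp)
 also have "finsum A (%j. star A (z' j) \<otimes> (R j \<oplus> H r j \<otimes> z' r)) {..<r}
 = finsum A (%j. star A (z j) \<otimes> (R j \<ominus> H r j \<otimes> (e \<otimes> y))) {..<r}"
 proof (rule M.finsum_cong'[OF refl])
 fix j assume j: "j : {..<r}"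
 have "H r j \<otimes> z' r = (- 1) \<odot> (H r j \<otimes> (e \<otimes> y))"
 using j zr e y by (simp add: smult_mult_right)
 then show "star A (z' j) \<otimes> (R j \<oplus> H r j \<otimes> z' r) = star A (z j) \<otimes> (R j \<ominus> H r j \<otimes> (e \<otimes> y))"
 using j Rc[of j] e y by (simp add: z'_def minus_eq)
 qed (use z Rc e y in auto)
 finally show ?thesis by (simp add: Rr)
 qed
 have "y \<oplus> d \<otimes> z' r = \<zero>"
 unfolding zr(1) smult_mult_right[OF d(1) mult_closed[OF e(1) y]] de(1)[OF y]
 using y by (intro feqI) (simp_all add: lfun_simps)
 moreover have "d \<otimes> z' r = ?h \<otimes> z' r \<oplus> cr dlt \<odot> z' r"
 unfolding d_def using zr(2) by (simp add: distrib_right smult_mult_left)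
 ultimately have "(y \<oplus> ?h \<otimes> z' r) \<oplus> cr dlt \<odot> z' r = \<zero>"
 using y zr(2) by (simp add: M.a_assoc)
 then have "star A (z' r) \<otimes> ((y \<oplus> ?h \<otimes> z' r) \<oplus> cr dlt \<odot> z' r) = \<zero>" using zr(2) by simp
 then have 0: "star A (z' r) \<otimes> (y \<oplus> ?h \<otimes> z' r) \<oplus> cr dlt \<odot> (star A (z' r) \<otimes> z' r) = \<zero>"
 using y zr(2) by (simp add: distrib_left smult_mult_right)
 have "matrix_form (Suc r) H z' \<oplus> cr dlt \<odot> (star A (z' r) \<otimes> z' r) = matrix_form r S z"
 unfolding mH mS using 0 y zr(2) z Rc e by (simp add: M.a_assoc finsum_closed' M.r_zero)
 moreover have "pos (matrix_form (Suc r) H z' \<oplus> cr dlt \<odot> (star A (z' r) \<otimes> z' r))"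
 by (intro pos_add pos_scale pos_star_mult Hp z' zr(2)) (use dlt in auto)
 ultimately show "pos (matrix_form r S z)" by simp
 qed
 then have S0: "0 <= Re (\<Sum>i<r. \<Sum>j<r. phi i j (S i j))" by (rule Suc.IH[OF _ cp_r])
 obtain g where g: "pos g" "g \<otimes> g = d" using pos_sqrt[OF d(2)] by metis
 have gc: "g : car A" "star A g = g" using g by (simp_all add: pos_carrier pos_star)
 \<comment> \<open>For this c the matrix c_j^* d c_i is the shifted H minus S: it is H r j e H i r
   in the old block, agrees with H in the rest of the last row and column, and has d in the corner.
   As d = g^2, complete positivity applies to the g c_i.\<close>
 define c where "c i = (if i < r then e \<otimes> H i r else \<one>)" for i
 have cc: "c i : car A" if "i <= r" for i using that e by (simp add: c_def)
 have gg: "star A (g \<otimes> c j) \<otimes> (g \<otimes> c i) = star A (c j) \<otimes> (d \<otimes> c i)" if "i <= r" "j <= r" for i j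
 using cc[OF that(1)] cc[OF that(2)] gc unfolding g(2)[symmetric] by (simp add: star_mult mult_assoc)
 have "0 <= Re (\<Sum>i<Suc r. \<Sum>j<Suc r. phi i j (star A (g \<otimes> c j) \<otimes> (g \<otimes> c i)))"
 by (rule cp) (use gc cc in simp)
 then have X0: "0 <= Re (\<Sum>i<Suc r. \<Sum>j<Suc r. phi i j (star A (c j) \<otimes> (d \<otimes> c i)))"
 by (simp add: gg)
 have cdc: "star A (c j) \<otimes> (d \<otimes> c i) =
 (if i < r then if j < r then H r j \<otimes> (e \<otimes> H i r) else H i r
 else if j < r then H r j else d)" if "i <= r" "j <= r" for i j
 using that e d de by (auto simp: c_def star_mult Hs mult_assoc)
 have "phi i j (H i j) = phi i j (S i j) + phi i j (H r j \<otimes> (e \<otimes> H i r))" if "i < r" "j < r" for i j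
 using that e by (simp add: S_def lfun_minus[OF lin])
 then have "(\<Sum>i<r. \<Sum>j<r. phi i j (H i j)) = (\<Sum>i<r. \<Sum>j<r. phi i j (S i j))
 + (\<Sum>i<r. \<Sum>j<r. phi i j (H r j \<otimes> (e \<otimes> H i r)))"
 by (simp add: sum.distrib)
 moreover have "phi r r d = phi r r ?h + cr dlt * phi r r \<one>"
 by (simp add: d_def lfun_simps lin)
 moreover have "(\<Sum>i<Suc r. \<Sum>j<Suc r. phi i j (star A (c j) \<otimes> (d \<otimes> c i)))
 = (\<Sum>i<r. \<Sum>j<r. phi i j (H r j \<otimes> (e \<otimes> H i r))) + (\<Sum>i<r. phi i r (H i r))
 + (\<Sum>j<r. phi r j (H r j)) + phi r r d"
 by (simp add: cdc sum.distrib)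
 ultimately show ?thesis using S0 X0 by (simp add: sum.distrib)
 qed
 then have *: "0 <= Re (\<Sum>i<Suc r. \<Sum>j<Suc r. phi i j (H i j)) + dlt * Re (phi r r \<one>)" if "dlt > 0" for dlt
 using that by blast
 have "((%dlt. Re (\<Sum>i<Suc r. \<Sum>j<Suc r. phi i j (H i j)) + dlt * Re (phi r r \<one>))
 \<longlongrightarrow> Re (\<Sum>i<Suc r. \<Sum>j<Suc r. phi i j (H i j)) + 0 * Re (phi r r \<one>)) (at_right 0)"
 by (intro tendsto_add tendsto_mult tendsto_const tendsto_ident_at)
 then have "0 <= Re (\<Sum>i<Suc r. \<Sum>j<Suc r. phi i j (H i j)) + 0 * Re (phi r r \<one>)"
 by (rule tendsto_lowerbound) (use * in \<open>auto simp: eventually_at_right_less eventually_at_filter\<close>)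
 then show ?case by simp
qed

end

unbundle no vec_syntax

subsection \<open>*-homomorphisms and positivity\<close>

lemma star_homD:
 assumes "star_hom A B f"
 shows star_hom_closed: "x : car A ==> f x : car B"
 and star_hom_add: "x : car A ==> y : car A ==> f (x +[A] y) = f x +[B] f y"
 and star_hom_smult: "x : car A ==> f (c *:[A] x) = c *:[B] f x"
 and star_hom_mult: "x : car A ==> y : car A ==> f (x *[A] y) = f x *[B] f y"
 and star_hom_star: "x : car A ==> f (star A x) = star B (f x)"
 using assms unfolding star_hom_def by auto

lemma star_hom_comp:
 assumes "star_hom A B f" "star_hom B C g" shows "star_hom A C (%x. g (f x))"
 unfolding star_hom_def using star_homD[OF assms(1)] star_homD[OF assms(2)] by simp

locale star_hom_pair = A: unital_cstar_algebra A + B: unital_cstar_algebra B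
 for A :: "('a, 'm) cstar_scheme" and B :: "('b, 'n) cstar_scheme" +
 fixes f :: "'a => 'b"
 assumes hom: "star_hom A B f"
begin

lemmas hom_closed [simp, intro] = star_hom_closed[OF hom]
lemmas hom_add = star_hom_add[OF hom]
lemmas hom_smult = star_hom_smult[OF hom]
lemmas hom_mult = star_hom_mult[OF hom]
lemmas hom_star = star_hom_star[OF hom]

lemma hom_zero [simp]: "f \<zero>\<^bsub>A\<^esub> = \<zero>\<^bsub>B\<^esub>"
 using hom_smult[of "\<zero>\<^bsub>A\<^esub>" 0] by simp

lemma hom_minus: "x : car A ==> y : car A ==> f (x -[A] y) = f x -[B] f y"
 by (simp add: A.minus_eq B.minus_eq hom_add hom_smult)

lemma hom_finsum:
 assumes "finite I" "!!i. i : I ==> g i : car A"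
 shows "f (finsum A g I) = finsum B (%i. f (g i)) I"
 using assms
proof (induction I rule: finite_induct)
 case (insert i I)
 then have "f (finsum A g (insert i I)) = f (g i +[A] finsum A g I)"
 by (subst A.M.finsum_insert) auto
 also have "... = f (g i) +[B] finsum B (%i. f (g i)) I"
 using insert by (simp add: hom_add A.finsum_closed')
 also have "... = finsum B (%i. f (g i)) (insert i I)"
 using insert by (subst B.M.finsum_insert) auto
 finally show ?case .
qed simp

lemma hom_pos: assumes "A.pos h" shows "B.pos (f h)"
proof -
 obtain g where g: "A.pos g" "g *[A] g = h" using A.pos_sqrt[OF assms] by metis
 have gc: "g : car A" "star A g = g" using g by (simp_all add: A.pos_carrier A.pos_star)
 have "f h = f g *[B] f g" using g(2) hom_mult[OF gc(1) gc(1)] by simp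
 moreover have "star B (f g) = f g" using hom_star[OF gc(1)] gc(2) by simp
 ultimately show ?thesis using B.pos_square[of "f g"] gc by simp
qed

lemma cnorm_hom_one: "cnorm B (f \<one>\<^bsub>A\<^esub>) <= 1"
proof -
 have "f \<one>\<^bsub>A\<^esub> *[B] f \<one>\<^bsub>A\<^esub> = f \<one>\<^bsub>A\<^esub>" using hom_mult[of "\<one>\<^bsub>A\<^esub>" "\<one>\<^bsub>A\<^esub>"] by simp
 moreover have "star B (f \<one>\<^bsub>A\<^esub>) = f \<one>\<^bsub>A\<^esub>" using hom_star[of "\<one>\<^bsub>A\<^esub>"] by simp
 ultimately have "cnorm B (f \<one>\<^bsub>A\<^esub>) = cnorm B (f \<one>\<^bsub>A\<^esub>) * cnorm B (f \<one>\<^bsub>A\<^esub>)"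
 using B.cnorm_self_adjoint_square[of "f \<one>\<^bsub>A\<^esub>"] by (simp add: power2_eq_square)
 then show ?thesis by (cases "cnorm B (f \<one>\<^bsub>A\<^esub>) = 0") auto
qed

text \<open>The positive element ||c||^2 - c^* c has a positive image, so by monotonicity of the
  norm ||f(c^* c)|| \<le> ||c||^2 ||f(1)||. Here f(1) is a projection, not necessarily the
  unit.\<close>

lemma hom_contractive: assumes c: "c : car A" shows "cnorm B (f c) <= cnorm A c"
proof -
 let ?t = "(cnorm A c)\<^sup>2" and ?h = "star A c *[A] c"
 have h: "A.pos ?h" "?h : car A" using c by (simp_all add: A.pos_star_mult)
 have "A.pos (A.real_scalar ?t -[A] ?h)"
 by (rule A.pos_norm_minus) (use c h A.pos_star[OF h(1)] in \<open>simp_all add: A.cstar_identity\<close>)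
 then have q: "B.pos (f (A.real_scalar ?t -[A] ?h))" by (rule hom_pos)
 have "f (A.real_scalar ?t) = f (?h +[A] (A.real_scalar ?t -[A] ?h))"
 using c by (intro arg_cong[of _ _ f] A.feqI) (simp_all add: A.lfun_simps)
 also have "... = f ?h +[B] f (A.real_scalar ?t -[A] ?h)"
 using h by (intro hom_add) simp_all
 finally have "cnorm B (f ?h) <= cnorm B (f (A.real_scalar ?t))"
 using B.pos_cnorm_mono[OF hom_pos[OF h(1)] q] by simp
 also have "... = ?t * cnorm B (f \<one>\<^bsub>A\<^esub>)" by (simp add: hom_smult B.cnorm_smult norm_power)
 also have "... <= ?t" using cnorm_hom_one by (simp add: mult_left_le)
 finally have "(cnorm B (f c))\<^sup>2 <= ?t"
 using c B.cstar_identity[of "f c"] by (simp add: hom_mult hom_star)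
 then show ?thesis using A.cnorm_nonneg[OF c] by (rule power2_le_imp_le)
qed

text \<open>Both \<open>f |h|\<close> and \<open>f h\<close> are positive square roots of \<open>(f h)\<^sup>2\<close>.\<close>

lemma injective_hom_reflects_pos:
 assumes inj: "inj_on f (car A)" and h: "h : car A" "star A h = h" and p: "B.pos (f h)"
 shows "A.pos h"
proof -
 obtain a where a: "A.pos a" "a *[A] a = h *[A] h" using A.abs_value[OF h] by metis
 have ac: "a : car A" using a by (simp add: A.pos_carrier)
 have "f a *[B] f a = f h *[B] f h"
 using a(2) hom_mult[OF ac ac] hom_mult[OF h(1) h(1)] by simp
 then have "f a = f h" by (rule B.pos_sqrt_unique[OF hom_pos[OF a(1)] p])
 then have "a = h" using inj ac h by (simp add: inj_on_eq_iff)
 then show ?thesis using a by simp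
qed

end

lemma star_hom_pairI: "unital_cstar_algebra A ==> unital_cstar_algebra B ==> star_hom A B f ==> star_hom_pair A B f"
 by (intro star_hom_pair.intro star_hom_pair_axioms.intro)

section \<open>The concrete algebras: matrices, bounded sequences, the quotient by null
  sequences\<close>

subsection \<open>Matrices and their operator norm\<close>

lemma mat_adjoint_eq: "adj A = mat (dim_col A) (dim_row A) (%(i,j). cnj (A $$ (j,i)))"
 unfolding mat_adjoint_def by (rule eq_matI) (auto simp: mat_of_rows_def)

lemma mat_adjoint_index [simp]:
 "i < dim_col A ==> j < dim_row A ==> adj A $$ (i,j) = cnj (A $$ (j,i))"
 by (simp add: mat_adjoint_eq)

lemma mat_adjoint_carrier [simp]: "A : CM m n ==> adj (A :: complex mat) : CM n m"
 unfolding mat_adjoint_eq by auto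

lemma mat_adjoint_dim [simp]: "dim_row (adj (A :: complex mat)) = dim_col A"
 "dim_col (adj A) = dim_row A"
 by (simp_all add: mat_adjoint_eq)

lemma mat_adjoint_adjoint [simp]: "adj (adj A) = (A :: complex mat)"
 by (rule eq_matI) simp_all

lemma mat_adjoint_add: "A : CM m n ==> B : CM m n ==>
 adj (A + B) = adj A + adj (B :: complex mat)"
 by (rule eq_matI) auto

lemma mat_adjoint_minus: "A : CM m n ==> B : CM m n ==>
 adj (A - B) = adj A - adj (B :: complex mat)"
 by (rule eq_matI) auto

lemma mat_adjoint_smult: "adj (c \<cdot>\<^sub>m A) = cnj c \<cdot>\<^sub>m adj (A :: complex mat)"
 by (rule eq_matI) auto

lemma mat_adjoint_one [simp]: "adj (1\<^sub>m n) = (1\<^sub>m n :: complex mat)"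
 by (rule eq_matI) auto

lemma mat_adjoint_zero [simp]: "adj (0\<^sub>m m n) = (0\<^sub>m n m :: complex mat)"
 by (rule eq_matI) auto

lemma mat_adjoint_mult: "A : CM m n ==> B : CM n k ==>
 adj (A * B) = adj B * adj (A :: complex mat)"
 by (rule eq_matI) (auto simp: scalar_prod_def mult.commute intro!: sum.cong)

abbreviation cinner :: "complex vec => complex vec => complex" where
 "cinner v w \<equiv> v \<bullet>c w"

lemma cinner_eq: "w : CV n ==> cinner v w = (\<Sum>i<n. v $ i * cnj (w $ i))"
 by (simp add: scalar_prod_def atLeast0LessThan)

lemma cinner_add_left: "u : CV n ==> v : CV n ==> w : CV n ==>
 cinner (u + v) w = cinner u w + cinner v w"
 by (simp add: cinner_eq[of _ n] sum.distrib algebra_simps)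

lemma cinner_add_right: "u : CV n ==> v : CV n ==> w : CV n ==>
 cinner u (v + w) = cinner u v + cinner u w"
 by (simp add: cinner_eq[of _ n] sum.distrib algebra_simps)

lemma cinner_diff_left: "u : CV n ==> v : CV n ==> w : CV n ==>
 cinner (u - v) w = cinner u w - cinner v w"
 by (simp add: cinner_eq[of _ n] sum_subtractf algebra_simps)

lemma cinner_diff_right: "u : CV n ==> v : CV n ==> w : CV n ==>
 cinner u (v - w) = cinner u v - cinner u w"
 by (simp add: cinner_eq[of _ n] sum_subtractf algebra_simps)

lemma cinner_smult_left: "u : CV n ==> v : CV n ==>
 cinner (c \<cdot>\<^sub>v u) v = c * cinner u v"
 by (simp add: cinner_eq[of _ n] sum_distrib_left algebra_simps)

lemma cinner_smult_right: "u : CV n ==> v : CV n ==>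
 cinner u (c \<cdot>\<^sub>v v) = cnj c * cinner u v"
 by (simp add: cinner_eq[of _ n] sum_distrib_left algebra_simps)

lemma cinner_cnj: "u : CV n ==> v : CV n ==> cinner v u = cnj (cinner u v)"
 by (simp add: cinner_eq[of _ n] mult.commute)

lemma cinner_adjoint:
 assumes "A : CM m n" "v : CV n" "w : CV m"
 shows "cinner (A *! v) w = cinner v (adj A *! w)"
proof -
 have "cinner (A *! v) w = (\<Sum>i<m. (\<Sum>j<n. A $$ (i,j) * v $ j) * cnj (w $ i))"
 using assms by (simp add: cinner_eq[of _ m] scalar_prod_def atLeast0LessThan)
 also have "... = (\<Sum>j<n. \<Sum>i<m. A $$ (i,j) * v $ j * cnj (w $ i))"
 by (simp add: sum_distrib_right) (rule sum.swap)
 also have "... = (\<Sum>j<n. v $ j * cnj (\<Sum>i<m. cnj (A $$ (i,j)) * w $ i))"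
 by (simp add: sum_distrib_left mult_ac)
 also have "... = cinner v (adj A *! w)"
 using assms mult_mat_vec_carrier[OF mat_adjoint_carrier[OF assms(1)] assms(3)] by (subst cinner_eq[of _ n]) (auto simp: scalar_prod_def atLeast0LessThan intro!: sum.cong)
 finally show ?thesis .
qed

lemma nrm_nonneg [simp]: "0 <= nm2 v"
 by (simp add: vec_l2norm_def L2_set_nonneg)

lemma nrm_square: "cr ((nm2 v)\<^sup>2) = cinner v v"
 by (simp add: vec_l2norm_def L2_set_def sum_nonneg scalar_prod_def atLeast0LessThan complex_norm_square[symmetric])

lemma nrm_Re: "(nm2 v)\<^sup>2 = Re (cinner v v)"
 by (metis Re_complex_of_real nrm_square)

lemma nrm_zero_iff: "v : CV n ==> nm2 v = 0 \<longleftrightarrow> v = 0\<^sub>v n"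
 unfolding vec_l2norm_def by (subst L2_set_eq_0_iff) auto

lemma nrm_zero [simp]: "nm2 (0\<^sub>v n) = 0"
 by (simp add: nrm_zero_iff[of _ n])

lemma nrm_add: assumes "v : CV n" "w : CV n"
 shows "nm2 (v + w) <= nm2 v + nm2 w"
proof -
 have "nm2 (v + w) <= L2_set (%i. cmod (v $ i) + cmod (w $ i)) {..<n}"
 unfolding vec_l2norm_def using assms by (auto intro!: L2_set_mono norm_triangle_ineq)
 also have "... <= nm2 v + nm2 w"
 using L2_set_triangle_ineq[of "%i. cmod (v $ i)" "%i. cmod (w $ i)" "{..<n}"] assms
 by (simp add: vec_l2norm_def)
 finally show ?thesis .
qed

lemma nrm_smult [simp]: "nm2 (c \<cdot>\<^sub>v v) = cmod c * nm2 v"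
 unfolding vec_l2norm_def L2_set_right_distrib[OF norm_ge_zero] index_smult_vec(2)
 by (rule L2_set_cong) (auto simp: norm_mult)

lemma cinner_Cauchy_Schwarz: assumes "v : CV n" "w : CV n"
 shows "cmod (cinner v w) <= nm2 v * nm2 w"
proof -
 have "cmod (cinner v w) <= (\<Sum>i<n. cmod (v $ i) * cmod (w $ i))"
 unfolding cinner_eq[OF assms(2)] by (rule order_trans[OF norm_sum]) (simp add: norm_mult)
 also have "... <= nm2 v * nm2 w"
 using L2_set_mult_ineq[of "%i. cmod (v $ i)" "%i. cmod (w $ i)" "{..<n}"] assms
 by (simp add: vec_l2norm_def)
 finally show ?thesis .
qed

lemma cmod_le_vec_l2norm: "i < dim_vec v ==> cmod (v $ i) <= nm2 v"
 unfolding vec_l2norm_def by (rule member_le_L2_set) auto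

lemma nrm_mult_le_sum:
 assumes A: "A : CM m n" and v: "v : CV n"
 shows "nm2 (A *! v) <= (\<Sum>i<m. \<Sum>j<n. cmod (A $$ (i,j))) * nm2 v"
proof -
 have "nm2 (A *! v) <= (\<Sum>i<m. cmod ((A *! v) $ i))"
 using A L2_set_le_sum[of "{..<m}" "%i. cmod ((A *! v) $ i)"] by (simp add: vec_l2norm_def)
 also have "... <= (\<Sum>i<m. (\<Sum>j<n. cmod (A $$ (i,j))) * nm2 v)"
 proof (rule sum_mono)
 fix i assume i: "i : {..<m}"
 have "cmod ((A *! v) $ i) <= (\<Sum>j<n. cmod (A $$ (i,j) * v $ j))"
 using A v i norm_sum[of "%j. A $$ (i,j) * v $ j" "{..<n}"]
 by (simp add: scalar_prod_def atLeast0LessThan)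
 also have "... <= (\<Sum>j<n. cmod (A $$ (i,j)) * nm2 v)"
 using v by (intro sum_mono) (auto simp: norm_mult intro!: mult_left_mono cmod_le_vec_l2norm)
 finally show "cmod ((A *! v) $ i) <= (\<Sum>j<n. cmod (A $$ (i,j))) * nm2 v"
 by (simp add: sum_distrib_right)
 qed
 finally show ?thesis by (simp add: sum_distrib_right)
qed

lemma opn_bdd:
 assumes A: "A : CM m n"
 shows "bdd_above ((%v. nm2 (A *! v)) ` {v : CV n. nm2 v <= 1})"
proof (rule bdd_aboveI2)
 fix v assume v: "v : {v : CV n. nm2 v <= 1}"
 have "(\<Sum>i<m. \<Sum>j<n. cmod (A $$ (i,j))) * nm2 v <= (\<Sum>i<m. \<Sum>j<n. cmod (A $$ (i,j))) * 1"
 using v by (intro mult_left_mono) (auto intro!: sum_nonneg)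
 then show "nm2 (A *! v) <= (\<Sum>i<m. \<Sum>j<n. cmod (A $$ (i,j)))"
 using nrm_mult_le_sum[OF A, of v] v by simp
qed

lemma nrm_mult_le:
 assumes A: "A : CM m n" and v: "v : CV n"
 shows "nm2 (A *! v) <= opn A * nm2 v"
proof (cases "nm2 v = 0")
 case True
 then have "v = 0\<^sub>v n" using v nrm_zero_iff by blast
 moreover have "A *! 0\<^sub>v n = 0\<^sub>v m" using A by (intro eq_vecI) auto
 ultimately show ?thesis by simp
next
 case False
 then have pos: "nm2 v > 0" using nrm_nonneg[of v] by linarith
 let ?w = "cr (1 / nm2 v) \<cdot>\<^sub>v v"
 have w: "?w : {v : CV n. nm2 v <= 1}" using v pos by (simp add: norm_divide)
 have "nm2 (A *! ?w) <= opn A"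
 unfolding mat_opnorm_def carrier_matD(2)[OF A] by (rule cSUP_upper[OF w opn_bdd[OF A]])
 moreover have "A *! ?w = cr (1 / nm2 v) \<cdot>\<^sub>v (A *! v)"
 by (rule mult_mat_vec[OF A v])
 ultimately show ?thesis using pos by (simp add: norm_divide field_simps)
qed

lemma opn_le:
 assumes A: "A : CM m n" and c: "c >= 0"
 and le: "!!v. v : CV n ==> nm2 (A *! v) <= c * nm2 v"
 shows "opn A <= c"
proof -
 have "0\<^sub>v n : {v : CV n. nm2 v <= 1}" by simp
 then have ne: "{v : CV n. nm2 v <= 1} ~= {}" by blast
 have "nm2 (A *! v) <= c" if "v : CV n" "nm2 v <= 1" for v
 using le[OF that(1)] mult_left_le[OF that(2) c] by linarith
 then show ?thesis
 unfolding mat_opnorm_def carrier_matD(2)[OF A] by (intro cSUP_least[OF ne]) auto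
qed

lemma opn_nonneg: assumes A: "A : CM m n" shows "0 <= opn A"
proof -
 have "nm2 (A *! 0\<^sub>v n) <= opn A"
 unfolding mat_opnorm_def carrier_matD(2)[OF A]
 by (rule cSUP_upper[OF _ opn_bdd[OF A]]) simp
 then show ?thesis using nrm_nonneg order_trans by blast
qed

lemma opn_le_sum: "A : CM m n ==> opn A <= (\<Sum>i<m. \<Sum>j<n. cmod (A $$ (i,j)))"
 by (rule opn_le) (auto intro!: sum_nonneg nrm_mult_le_sum)

lemma cmod_cinner_le: assumes "A : CM m n" "v : CV n" "w : CV m"
 shows "cmod (cinner (A *! v) w) <= opn A * nm2 v * nm2 w"
proof -
 have "cmod (cinner (A *! v) w) <= nm2 (A *! v) * nm2 w"
 using assms by (intro cinner_Cauchy_Schwarz[of _ m]) auto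
 also have "... <= opn A * nm2 v * nm2 w"
 using nrm_mult_le[OF assms(1,2)] by (intro mult_right_mono) auto
 finally show ?thesis .
qed

lemma cinner_unit_vec: assumes A: "A : CM m n" and ij: "i < m" "j < n"
 shows "cinner (A *! unit_vec n j) (unit_vec m i) = A $$ (i,j)"
proof -
 have "A *! unit_vec n j = col A j" using A ij by (intro eq_vecI) auto
 then show ?thesis using A ij
 by (simp add: cinner_eq[of _ m] unit_vec_def if_distrib[of cnj] if_distrib[of "%x. _ * x"] cong: if_cong)
qed

lemma nrm_unit_vec: "i < n ==> nm2 (unit_vec n i) = 1"
proof -
 assume i: "i < n"
 have "cinner (unit_vec n i) (unit_vec n i) = (1 :: complex)"
 using i by (simp add: cinner_eq[of _ n] unit_vec_def if_distrib[of cnj] if_distrib[of "%x. _ * x"] cong: if_cong)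
 then show ?thesis using nrm_Re[of "unit_vec n i"] nrm_nonneg[of "unit_vec n i"]
 by (simp add: power2_eq_1_iff)
qed

lemma cmod_index_le_mat_opnorm: assumes A: "A : CM m n" and ij: "i < m" "j < n"
 shows "cmod (A $$ (i,j)) <= opn A"
 using cmod_cinner_le[OF A, of "unit_vec n j" "unit_vec m i"] cinner_unit_vec[OF A ij] ij
 by (simp add: nrm_unit_vec)

lemma opn_add: assumes "A : CM m n" "B : CM m n"
 shows "opn (A + B) <= opn A + opn B"
proof (rule opn_le)
 fix v :: "complex vec" assume v: "v : CV n"
 have "nm2 ((A + B) *! v) <= nm2 (A *! v) + nm2 (B *! v)"
 using assms v nrm_add[of "A *! v" m "B *! v"] by (simp add: add_mult_distrib_mat_vec)
 then show "nm2 ((A + B) *! v) <= (opn A + opn B) * nm2 v"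
 using nrm_mult_le[OF assms(1) v] nrm_mult_le[OF assms(2) v] by (simp add: algebra_simps)
qed (use assms opn_nonneg in \<open>auto intro!: add_nonneg_nonneg\<close>)

lemma opn_mult: assumes A: "A : CM m n" and B: "B : CM n k"
 shows "opn (A * B) <= opn A * opn B"
proof (rule opn_le)
 fix v :: "complex vec" assume v: "v : CV k"
 have "nm2 (A *! (B *! v)) <= opn A * nm2 (B *! v)"
 using nrm_mult_le[OF A, of "B *! v"] B v by simp
 also have "... <= opn A * (opn B * nm2 v)"
 using nrm_mult_le[OF B v] opn_nonneg[OF A] by (intro mult_left_mono)
 finally show "nm2 (A * B *! v) <= opn A * opn B * nm2 v"
 using A B v by (simp add: mult.assoc)
qed (use A B opn_nonneg in \<open>auto intro!: mult_nonneg_nonneg\<close>)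

lemma opn_smult_le: assumes A: "A : CM m n"
 shows "opn (c \<cdot>\<^sub>m A) <= cmod c * opn A"
proof (rule opn_le)
 fix v :: "complex vec" assume v: "v : CV n"
 have "(c \<cdot>\<^sub>m A) *! v = c \<cdot>\<^sub>v (A *! v)" using A v by (intro eq_vecI) auto
 then show "nm2 ((c \<cdot>\<^sub>m A) *! v) <= cmod c * opn A * nm2 v"
 using nrm_mult_le[OF A v] by (simp add: mult.assoc mult_left_mono)
qed (use A opn_nonneg in auto)

lemma opn_smult: assumes A: "A : CM m n"
 shows "opn (c \<cdot>\<^sub>m A) = cmod c * opn A"
proof (cases "c = 0")
 case True
 then show ?thesis using opn_smult_le[OF A, of c] opn_nonneg[of "c \<cdot>\<^sub>m A" m n] A by simp
next
 case False
 have "(1/c) \<cdot>\<^sub>m (c \<cdot>\<^sub>m A) = A" using False by (intro eq_matI) auto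
 then have "opn A <= cmod (1/c) * opn (c \<cdot>\<^sub>m A)"
 using opn_smult_le[of "c \<cdot>\<^sub>m A" m n "1/c"] A by simp
 then have "cmod c * opn A <= opn (c \<cdot>\<^sub>m A)"
 using False by (simp add: norm_divide field_simps)
 then show ?thesis using opn_smult_le[OF A, of c] by simp
qed

lemma opn_adjoint_le: assumes A: "A : CM m n"
 shows "(opn A)\<^sup>2 <= opn (adj A * A)"
proof -
 have AA: "adj A * A : CM n n" using A by auto
 have "opn A <= sqrt (opn (adj A * A))"
 proof (rule opn_le[OF A])
 fix v :: "complex vec" assume v: "v : CV n"
 have "(nm2 (A *! v))\<^sup>2 = Re (cinner v (adj A *! (A *! v)))"
 unfolding nrm_Re using A v by (simp add: cinner_adjoint[OF A])
 also have "... <= cmod (cinner v ((adj A * A) *! v))"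
 using A v complex_Re_le_cmod by (simp add: assoc_mult_mat_vec[of _ n m])
 also have "... <= nm2 v * (opn (adj A * A) * nm2 v)"
 using AA v by (intro order_trans[OF cinner_Cauchy_Schwarz[of _ n]] mult_left_mono nrm_mult_le) auto
 finally have "(nm2 (A *! v))\<^sup>2 <= opn (adj A * A) * (nm2 v)\<^sup>2"
 by (simp add: power2_eq_square algebra_simps)
 then show "nm2 (A *! v) <= sqrt (opn (adj A * A)) * nm2 v"
 using real_sqrt_le_mono by (fastforce simp: real_sqrt_mult)
 qed (use opn_nonneg[OF AA] in simp)
 then show ?thesis
 using opn_nonneg[OF A] opn_nonneg[OF AA] by (metis power_mono real_sqrt_pow2)
qed

lemma opn_adjoint: assumes A: "A : CM m n"
 shows "opn (adj A) = opn A"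
proof -
 have *: "opn A <= opn (adj A)" if A: "A : CM m n" for A m n
 proof -
 have "(opn A)\<^sup>2 <= opn (adj A) * opn A"
 using opn_adjoint_le[OF A] opn_mult[of "adj A" n m A n] A by fastforce
 then show ?thesis
 using opn_nonneg[OF A] opn_nonneg[OF mat_adjoint_carrier[OF A]]
 by (cases "opn A = 0") (auto simp: power2_eq_square)
 qed
 show ?thesis using *[OF A] *[OF mat_adjoint_carrier[OF A]] by simp
qed

lemma opn_cstar: assumes A: "A : CM m n"
 shows "opn (adj A * A) = (opn A)\<^sup>2"
 using opn_adjoint_le[OF A] opn_mult[OF mat_adjoint_carrier[OF A] A]
 by (simp add: opn_adjoint[OF A] power2_eq_square)

lemma opn_eq_0_iff: assumes A: "A : CM m n" shows "opn A = 0 \<longleftrightarrow> A = 0\<^sub>m m n"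
proof
 assume "opn A = 0"
 then have "A $$ (i,j) = 0" if "i < m" "j < n" for i j
 using cmod_index_le_mat_opnorm[OF A that] by simp
 then show "A = 0\<^sub>m m n" using A by (intro eq_matI) auto
next
 assume "A = 0\<^sub>m m n"
 then show "opn A = 0"
 using opn_le_sum[OF A] opn_nonneg[OF A] by simp
qed

text \<open>In fixed dimension the operator norm dominates the modulus of each entry and is
  dominated by the sum of the moduli, so convergence can be checked entrywise.\<close>

lemma opn_limit:
 fixes X :: "nat => complex mat"
 assumes X: "!!l. X l : CM m n"
 and C: "!!e. e > 0 ==> EX N. ALL p>=N. ALL q>=N. opn (X p - X q) < e"
 obtains L where "L : CM m n" "(%l. opn (X l - L)) ----> 0"
proof -
 have "Cauchy (%l. X l $$ (i,j))" if ij: "i < m" "j < n" for i j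
 proof (rule metric_CauchyI)
 fix e :: real assume "e > 0"
 then obtain N where N: "!!p q. p >= N ==> q >= N ==> opn (X p - X q) < e" using C by meson
 have "dist (X p $$ (i,j)) (X q $$ (i,j)) < e" if "p >= N" "q >= N" for p q
 using cmod_index_le_mat_opnorm[OF minus_carrier_mat[OF X[of q]], of i j "X p"] X[of p] X[of q] ij N[OF that]
 by (simp add: dist_norm)
 then show "EX N. ALL p>=N. ALL q>=N. dist (X p $$ (i,j)) (X q $$ (i,j)) < e" by blast
 qed
 then have "EX l. (%p. X p $$ (i,j)) ----> l" if "i < m" "j < n" for i j
 using that Cauchy_convergent convergent_def by metis
 then obtain l where l: "!!i j. i < m ==> j < n ==> (%p. X p $$ (i,j)) ----> l i j" by metis
 define L where "L = mat m n (%(i,j). l i j)"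
 have L: "L : CM m n" by (simp add: L_def)
 have XL: "X p - L : CM m n" for p using L by (rule minus_carrier_mat)
 have "(%p. \<Sum>i<m. \<Sum>j<n. cmod (X p $$ (i,j) - l i j)) ----> (\<Sum>i<m. \<Sum>j<n. 0)"
 by (intro tendsto_sum tendsto_norm_zero LIM_zero l) auto
 then have lim: "(%p. \<Sum>i<m. \<Sum>j<n. cmod (X p $$ (i,j) - l i j)) ----> 0" by simp
 have le: "opn (X p - L) <= (\<Sum>i<m. \<Sum>j<n. cmod (X p $$ (i,j) - l i j))" for p
 using opn_le_sum[OF XL[of p]] X[of p] L by (simp add: L_def)
 have "(%p. opn (X p - L)) ----> 0"
 by (rule tendsto_sandwich[OF _ _ tendsto_const lim]) (simp_all add: le opn_nonneg[OF XL])
 with L show ?thesis by (rule that)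
qed

lemma matrix_cstar_simps [simp]:
 "car (matrix_cstar k) = CM k k" "x *[matrix_cstar k] y = x * y"
 "\<one>\<^bsub>matrix_cstar k\<^esub> = 1\<^sub>m k" "\<zero>\<^bsub>matrix_cstar k\<^esub> = 0\<^sub>m k k" "x +[matrix_cstar k] y = x + y"
 "c *:[matrix_cstar k] x = c \<cdot>\<^sub>m x" "star (matrix_cstar k) x = adj x"
 "cnorm (matrix_cstar k) x = opn x"
 by (simp_all add: matrix_cstar_def)

lemma cring_complex_ring: "cring complex_ring"
 by (rule cringI)
 (auto simp: complex_ring_def algebra_simps intro!: abelian_groupI comm_monoidI exI[of _ "- _"])

text \<open>Introduction rule with the algebraic side conditions spelled out over the complex numbers
  and completeness as convergence of Cauchy sequences.\<close>

lemma unital_cstar_algebraI: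
 fixes A :: "('a, 'm) cstar_scheme" (structure)
 assumes closed: "\<zero> : car A" "\<one> : car A"
 "!!x y. [|x : car A; y : car A|] ==> x \<oplus> y : car A"
 "!!x y. [|x : car A; y : car A|] ==> x \<otimes> y : car A"
 "!!c x. x : car A ==> c \<odot> x : car A"
 "!!x. x : car A ==> star A x : car A"
 and a: "!!x y z. [|x : car A; y : car A; z : car A|] ==> (x \<oplus> y) \<oplus> z = x \<oplus> (y \<oplus> z)"
 "!!x y. [|x : car A; y : car A|] ==> x \<oplus> y = y \<oplus> x"
 "!!x. x : car A ==> \<zero> \<oplus> x = x"
 "!!x. x : car A ==> (- 1) \<odot> x \<oplus> x = \<zero>"
 and s: "!!c d x. x : car A ==> (c + d) \<odot> x = c \<odot> x \<oplus> d \<odot> x"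
 "!!c x y. [|x : car A; y : car A|] ==> c \<odot> (x \<oplus> y) = c \<odot> x \<oplus> c \<odot> y"
 "!!c d x. x : car A ==> (c * d) \<odot> x = c \<odot> (d \<odot> x)"
 "!!x. x : car A ==> 1 \<odot> x = x"
 and m: "!!x y z. [|x : car A; y : car A; z : car A|] ==> (x \<otimes> y) \<otimes> z = x \<otimes> (y \<otimes> z)"
 "!!x y z. [|x : car A; y : car A; z : car A|] ==> x \<otimes> (y \<oplus> z) = x \<otimes> y \<oplus> x \<otimes> z"
 "!!x y z. [|x : car A; y : car A; z : car A|] ==> (x \<oplus> y) \<otimes> z = x \<otimes> z \<oplus> y \<otimes> z"
 "!!c x y. [|x : car A; y : car A|] ==> (c \<odot> x) \<otimes> y = c \<odot> (x \<otimes> y)"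
 "!!c x y. [|x : car A; y : car A|] ==> x \<otimes> (c \<odot> y) = c \<odot> (x \<otimes> y)"
 "!!x. x : car A ==> \<one> \<otimes> x = x"
 "!!x. x : car A ==> x \<otimes> \<one> = x"
 and st: "!!x. x : car A ==> star A (star A x) = x"
 "!!x y. [|x : car A; y : car A|] ==> star A (x \<oplus> y) = star A x \<oplus> star A y"
 "!!c x. x : car A ==> star A (c \<odot> x) = cnj c \<odot> star A x"
 "!!x y. [|x : car A; y : car A|] ==> star A (x \<otimes> y) = star A y \<otimes> star A x"
 and n: "!!x. x : car A ==> 0 <= cnorm A x"
 "!!x. x : car A ==> cnorm A x = 0 \<longleftrightarrow> x = \<zero>"
 "!!x y. [|x : car A; y : car A|] ==> cnorm A (x \<oplus> y) <= cnorm A x + cnorm A y"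
 "!!c x. x : car A ==> cnorm A (c \<odot> x) = cmod c * cnorm A x"
 "!!x y. [|x : car A; y : car A|] ==> cnorm A (x \<otimes> y) <= cnorm A x * cnorm A y"
 "!!x. x : car A ==> cnorm A (star A x \<otimes> x) = (cnorm A x)\<^sup>2"
 and complete: "!!X :: nat => 'a. [|!!l. X l : car A;
 !!e. e > 0 ==> EX N. ALL p>=N. ALL q>=N. cnorm A (X p \<oplus> (- 1) \<odot> X q) < e|]
 ==> EX L:car A. (%l. cnorm A (X l \<oplus> (- 1) \<odot> L)) ----> 0"
 shows "unital_cstar_algebra A"
proof -
 have ag: "abelian_group A"
 by (rule abelian_groupI) (use closed a in \<open>auto intro!: bexI[of _ "(- 1) \<odot> _"]\<close>)
 interpret M: abelian_group A by (rule ag)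
 have mod: "Module.module complex_ring A"
 by (rule moduleI[OF cring_complex_ring ag]) (use closed s in \<open>auto simp: complex_ring_def\<close>)
 have um: "\<ominus> x = (- 1) \<odot> x" if "x : car A" for x
 using M.minus_equality[of "(- 1) \<odot> x" x] a(4)[OF that] that closed by simp
 have mi: "x \<ominus> y = x \<oplus> (- 1) \<odot> y" if "x : car A" "y : car A" for x y
 using um that by (simp add: a_minus_def)
 have sym: "cnorm A (x \<ominus> y) = cnorm A (y \<ominus> x)" if "x : car A" "y : car A" for x y
 proof -
 have "y \<ominus> x = \<ominus> (x \<ominus> y)"
 using that by (simp add: M.minus_add M.a_comm a_minus_def)
 then show ?thesis using um[of "x \<ominus> y"] n(4)[of "x \<ominus> y" "- 1"] that by simp
 qed
 have triangle: "cnorm A (x \<ominus> z) <= cnorm A (x \<ominus> y) + cnorm A (y \<ominus> z)"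
 if "x : car A" "y : car A" "z : car A" for x y z
 proof -
 have "x \<ominus> z = (x \<ominus> y) \<oplus> (y \<ominus> z)"
 using that by (simp add: a_minus_def M.a_assoc M.r_neg1)
 then show ?thesis using n(3)[of "x \<ominus> y" "y \<ominus> z"] that by simp
 qed
 interpret X: Metric_space "car A" "cdist A"
 by unfold_locales (auto simp: cdist_def n sym triangle)
 have comp: "X.mcomplete"
 unfolding X.mcomplete_def
 proof (intro allI impI)
 fix sg assume "X.MCauchy sg"
 then have sg: "!!l. sg l : car A"
 and C: "!!e. e > 0 ==> EX N. ALL p q. N <= p --> N <= q --> cdist A (sg p) (sg q) < e"
 unfolding X.MCauchy_def by auto
 have "EX N. ALL p>=N. ALL q>=N. cnorm A (sg p \<oplus> (- 1) \<odot> sg q) < e" if "e > 0" for e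
 using C[OF that] sg by (simp add: cdist_def mi)
 from complete[OF sg this] obtain L where
 L: "L : car A" "(%l. cnorm A (sg l \<oplus> (- 1) \<odot> L)) ----> 0" by blast
 have "limitin X.mtopology sg L sequentially"
 unfolding X.limitin_metric
 proof (intro conjI allI impI L)
 fix e :: real assume "e > 0"
 from LIMSEQ_D[OF L(2) this] show "\<forall>\<^sub>F l in sequentially. sg l : car A & cdist A (sg l) L < e"
 using sg L(1) by (auto simp: eventually_sequentially cdist_def mi n closed)
 qed
 then show "EX x. limitin X.mtopology sg x sequentially" by blast
 qed
 show ?thesis
 unfolding unital_cstar_algebra_def cstar_algebra_def
 cstar_algebra_axioms_def unital_cstar_algebra_axioms_def
 using mod comp by (intro conjI allI impI) (simp_all add: closed m st n)
qed

theorem unital_cstar_algebra_matrix: "unital_cstar_algebra (matrix_cstar k)"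
proof (rule unital_cstar_algebraI)
 fix X :: "nat => complex mat"
 assume X: "!!l. X l : car (matrix_cstar k)"
 and C: "!!e. e > 0 ==> EX N. ALL p>=N. ALL q>=N.
 cnorm (matrix_cstar k) (X p +[matrix_cstar k] (- 1) *:[matrix_cstar k] X q) < e"
 have mi: "P + (- 1) \<cdot>\<^sub>m Q = P - Q" if "P : CM k k" "Q : CM k k" for P Q :: "complex mat"
 using that by (intro eq_matI) auto
 obtain L where L: "L : CM k k" "(%l. opn (X l - L)) ----> 0"
 by (rule opn_limit[of X k k]) (use X C in \<open>simp_all add: mi\<close>)
 then show "EX L:car (matrix_cstar k).
 (%l. cnorm (matrix_cstar k) (X l +[matrix_cstar k] (- 1) *:[matrix_cstar k] L)) ----> 0"
 using X by (intro bexI[of _ L]) (simp_all add: mi)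
qed (auto simp: opn_nonneg opn_eq_0_iff opn_cstar mat_adjoint_add[of _ k k]
 mat_adjoint_mult[of _ k k] mat_adjoint_smult opn_smult[of _ k k] add_mult_distrib_mat[of _ k k]
 mult_add_distrib_mat[of _ k k] mult_smult_distrib[of _ k k] mult_smult_assoc_mat[of _ k k]
 intro: opn_mult opn_add assoc_mult_mat assoc_add_mat comm_add_mat intro!: eq_matI[of _ "0\<^sub>m k k"]
 simp: add_smult_distrib_right_mat add_smult_distrib_left_mat ring_distribs)

subsection \<open>Products and quotients by null sequences\<close>

locale cstar_sequence =
 fixes M :: "nat => 'a cstar"
 assumes M: "!!n. unital_cstar_algebra (M n)"
begin

sublocale M: unital_cstar_algebra "M n" for n by (rule M)

abbreviation Prod :: "(nat => 'a) cstar" where "Prod \<equiv> cstar_product M"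
abbreviation Null :: "(nat => 'a) set" where "Null \<equiv> cstar_null_ideal M"
abbreviation Quo :: "(nat => 'a) set cstar" where "Quo \<equiv> cstar_quotient Prod Null"

lemma Prod_simps:
 "x *[Prod] y = (%n. x n *[M n] y n)" "\<one>\<^bsub>Prod\<^esub> = (%n. \<one>\<^bsub>M n\<^esub>)" "\<zero>\<^bsub>Prod\<^esub> = (%n. \<zero>\<^bsub>M n\<^esub>)"
 "x +[Prod] y = (%n. x n +[M n] y n)" "c *:[Prod] x = (%n. c *:[M n] x n)"
 "star Prod x = (%n. star (M n) (x n))" "cnorm Prod x = (SUP n. cnorm (M n) (x n))"
 by (simp_all add: cstar_product_def)

lemma Prod_carrier: "x : car Prod \<longleftrightarrow> (ALL n. x n : car (M n)) & (EX c. ALL n. cnorm (M n) (x n) <= c)"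
 by (auto simp: cstar_product_def bdd_above_def)

lemma Prod_carrierI: "(!!n. x n : car (M n)) ==> (!!n. cnorm (M n) (x n) <= c) ==> x : car Prod"
 by (auto simp: Prod_carrier)

lemma Prod_nth: "x : car Prod ==> x n : car (M n)"
 by (simp add: Prod_carrier)

lemma Prod_norm_ub: assumes "x : car Prod" shows "cnorm (M n) (x n) <= cnorm Prod x"
 unfolding Prod_simps by (rule cSUP_upper) (use assms in \<open>auto simp: Prod_carrier bdd_above_def\<close>)

lemma Prod_norm_least: "(!!n. cnorm (M n) (x n) <= c) ==> cnorm Prod x <= c"
 unfolding Prod_simps by (rule cSUP_least) auto

lemma Prod_norm_nonneg: assumes "x : car Prod" shows "0 <= cnorm Prod x"
 using Prod_norm_ub[OF assms, of 0] M.cnorm_nonneg[OF Prod_nth[OF assms], of 0] by linarith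

lemma Prod_closed:
 shows "x : car Prod ==> y : car Prod ==> x +[Prod] y : car Prod"
 and "x : car Prod ==> y : car Prod ==> x *[Prod] y : car Prod"
 and "x : car Prod ==> c *:[Prod] x : car Prod"
 and "x : car Prod ==> star Prod x : car Prod"
 and "\<one>\<^bsub>Prod\<^esub> : car Prod" and "\<zero>\<^bsub>Prod\<^esub> : car Prod"
proof -
 assume x: "x : car Prod"
 note xn = Prod_nth[OF x] and xb = Prod_norm_ub[OF x]
 show "c *:[Prod] x : car Prod"
 by (rule Prod_carrierI[of _ "cmod c * cnorm Prod x"])
 (use xn xb in \<open>simp_all add: Prod_simps(5) M.cnorm_smult mult_left_mono\<close>)
 show "star Prod x : car Prod"
 by (rule Prod_carrierI[of _ "cnorm Prod x"]) (use xn xb in \<open>simp_all add: Prod_simps(6)\<close>)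
 assume y: "y : car Prod"
 note yn = Prod_nth[OF y] and yb = Prod_norm_ub[OF y]
 show "x +[Prod] y : car Prod"
 proof (rule Prod_carrierI[of _ "cnorm Prod x + cnorm Prod y"])
 fix n show "cnorm (M n) ((x +[Prod] y) n) <= cnorm Prod x + cnorm Prod y"
 using M.cnorm_triangle[OF xn yn, of n] xb[of n] yb[of n] by (simp add: Prod_simps(4))
 qed (use xn yn in \<open>simp add: Prod_simps(4)\<close>)
 show "x *[Prod] y : car Prod"
 proof (rule Prod_carrierI[of _ "cnorm Prod x * cnorm Prod y"])
 fix n
 have "cnorm (M n) (x n) * cnorm (M n) (y n) <= cnorm Prod x * cnorm Prod y"
 by (intro mult_mono xb yb Prod_norm_nonneg x M.cnorm_nonneg yn)
 then show "cnorm (M n) ((x *[Prod] y) n) <= cnorm Prod x * cnorm Prod y"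
 using M.cnorm_mult[OF xn yn, of n] by (simp add: Prod_simps(1))
 qed (use xn yn in \<open>simp add: Prod_simps(1)\<close>)
next
 show "\<one>\<^bsub>Prod\<^esub> : car Prod"
 by (rule Prod_carrierI[of _ 1]) (simp_all add: Prod_simps(2) M.cnorm_one_le)
 show "\<zero>\<^bsub>Prod\<^esub> : car Prod"
 by (rule Prod_carrierI[of _ 0]) (simp_all add: Prod_simps(3))
qed

text \<open>For completeness, a Cauchy sequence converges in each coordinate, and the Cauchy bounds,
  uniform in the coordinate, survive the limit.\<close>

theorem unital_cstar_algebra_Prod: "unital_cstar_algebra Prod"
proof (rule unital_cstar_algebraI)
 fix x assume x: "x : car Prod"
 note xn = Prod_nth[OF x] and xb = Prod_norm_ub[OF x]
 show "0 <= cnorm Prod x" by (rule Prod_norm_nonneg[OF x])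
 show "cnorm Prod x = 0 \<longleftrightarrow> x = \<zero>\<^bsub>Prod\<^esub>"
 proof
 assume z: "cnorm Prod x = 0"
 have "x n = \<zero>\<^bsub>M n\<^esub>" for n
 using xb[of n] z M.cnorm_nonneg[OF xn, of n] M.cnorm_eq_0_iff[OF xn, of n] by simp
 then show "x = \<zero>\<^bsub>Prod\<^esub>" by (simp add: Prod_simps(3) fun_eq_iff)
 qed (simp add: Prod_simps)
 show "cnorm Prod (star Prod x *[Prod] x) = (cnorm Prod x)\<^sup>2"
 proof (rule antisym)
 show "cnorm Prod (star Prod x *[Prod] x) <= (cnorm Prod x)\<^sup>2"
 by (rule Prod_norm_least)
 (use xn xb in \<open>simp add: Prod_simps(1,6) M.cstar_identity power_mono M.cnorm_nonneg\<close>)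
 have c: "star Prod x *[Prod] x : car Prod" using x by (intro Prod_closed)
 have "cnorm Prod x <= sqrt (cnorm Prod (star Prod x *[Prod] x))"
 proof (rule Prod_norm_least)
 fix n show "cnorm (M n) (x n) <= sqrt (cnorm Prod (star Prod x *[Prod] x))"
 using Prod_norm_ub[OF c, of n] xn[of n]
 by (intro real_le_rsqrt) (simp add: Prod_simps(1,6) M.cstar_identity)
 qed
 then show "(cnorm Prod x)\<^sup>2 <= cnorm Prod (star Prod x *[Prod] x)"
 using Prod_norm_nonneg[OF x] Prod_norm_nonneg[OF c] by (metis power_mono real_sqrt_pow2)
 qed
 fix c
 show "cnorm Prod (c *:[Prod] x) = cmod c * cnorm Prod x"
 proof (cases "c = 0")
 case True
 then show ?thesis using xn by (simp add: Prod_simps)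
 next
 case False
 have le: "cnorm Prod (d *:[Prod] y) <= cmod d * cnorm Prod y" if "y : car Prod" for d y
 using Prod_norm_ub[OF that] Prod_nth[OF that]
 by (intro Prod_norm_least) (simp add: Prod_simps(5) M.cnorm_smult mult_left_mono)
 have "(1/c) *:[Prod] (c *:[Prod] x) = x" using False xn by (simp add: Prod_simps(5) M.sm_sm)
 then have "cnorm Prod x <= cmod (1/c) * cnorm Prod (c *:[Prod] x)"
 using le[of "c *:[Prod] x" "1/c"] Prod_closed(3)[OF x, of c] by simp
 then have "cmod c * cnorm Prod x <= cnorm Prod (c *:[Prod] x)"
 using False by (simp add: norm_divide field_simps)
 then show ?thesis using le[OF x, of c] by simp
 qed
next
 fix x y assume x: "x : car Prod" and y: "y : car Prod"
 note xn = Prod_nth[OF x] and xb = Prod_norm_ub[OF x]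
 note yn = Prod_nth[OF y] and yb = Prod_norm_ub[OF y]
 show "cnorm Prod (x +[Prod] y) <= cnorm Prod x + cnorm Prod y"
 proof (rule Prod_norm_least)
 fix n show "cnorm (M n) ((x +[Prod] y) n) <= cnorm Prod x + cnorm Prod y"
 using M.cnorm_triangle[OF xn yn, of n] xb[of n] yb[of n] by (simp add: Prod_simps(4))
 qed
 show "cnorm Prod (x *[Prod] y) <= cnorm Prod x * cnorm Prod y"
 proof (rule Prod_norm_least)
 fix n
 have "cnorm (M n) (x n) * cnorm (M n) (y n) <= cnorm Prod x * cnorm Prod y"
 by (intro mult_mono xb yb Prod_norm_nonneg x M.cnorm_nonneg yn)
 then show "cnorm (M n) ((x *[Prod] y) n) <= cnorm Prod x * cnorm Prod y"
 using M.cnorm_mult[OF xn yn, of n] by (simp add: Prod_simps(1))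
 qed
next
 fix X :: "nat => nat => 'a"
 assume X: "!!l. X l : car Prod"
 and C: "!!e. e > 0 ==> EX N. ALL p>=N. ALL q>=N. cnorm Prod (X p +[Prod] (- 1) *:[Prod] X q) < e"
 have Xn: "X l n : car (M n)" for l n by (rule Prod_nth[OF X])
 have le: "cnorm (M n) (X p n -[M n] X q n) <= cnorm Prod (X p +[Prod] (- 1) *:[Prod] X q)" for p q n
 using Prod_norm_ub[OF Prod_closed(1)[OF X Prod_closed(3)[OF X]], of n p "- 1" q] Xn
 by (simp add: Prod_simps(4,5) M.minus_eq)
 have "EX l. M.conv n (%p. X p n) l" for n
 proof -
 have "EX N. ALL p>=N. ALL q>=N. cnorm (M n) (X p n -[M n] X q n) < e" if "e > 0" for e
 using C[OF that] le[of n] by (meson order_le_less_trans)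
 from M.Cauchy_conv[of "%p. X p n" n, OF Xn this] show ?thesis by blast
 qed
 then obtain L where L: "!!n. M.conv n (%p. X p n) (L n)" by metis
 have Ln: "L n : car (M n)" for n using L by (rule M.conv_carrier)
 have lim: "cnorm (M n) (X p n -[M n] L n) <= e"
 if N: "!!q. q >= N ==> cnorm (M n) (X p n -[M n] X q n) <= e" for p n N e
 proof -
 have "M.conv n (%q. X p n +[M n] (- 1) *:[M n] X q n) (X p n +[M n] (- 1) *:[M n] L n)"
 by (rule M.conv_add[OF M.conv_const[OF Xn] M.conv_sm[OF L]])
 from M.conv_cnorm[OF this]
 have "(%q. cnorm (M n) (X p n -[M n] X q n)) ----> cnorm (M n) (X p n -[M n] L n)"
 by (simp add: M.minus_eq Xn Ln)
 then show ?thesis by (rule LIMSEQ_le_const2) (use N in blast)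
 qed
 obtain N1 where N1: "!!p q. p >= N1 ==> q >= N1 ==> cnorm Prod (X p +[Prod] (- 1) *:[Prod] X q) < 1"
 using C[of 1] by auto
 have "L : car Prod"
 proof (rule Prod_carrierI[OF Ln])
 fix n
 have "cnorm (M n) (X N1 n -[M n] L n) <= 1"
 by (rule lim[of N1]) (meson N1 le less_imp_le order_refl order_trans)
 then show "cnorm (M n) (L n) <= cnorm Prod (X N1) + 1"
 using M.cnorm_diff_le[OF Ln Xn, of n N1] M.cnorm_minus_commute[OF Ln Xn, of n N1]
 Prod_norm_ub[OF X, of n N1] by simp
 qed
 moreover have "(%l. cnorm Prod (X l +[Prod] (- 1) *:[Prod] L)) ----> 0"
 proof (rule LIMSEQ_I)
 fix e :: real assume e: "e > 0"
 obtain N where N: "!!p q. p >= N ==> q >= N ==> cnorm Prod (X p +[Prod] (- 1) *:[Prod] X q) < e/2"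
 using C[of "e/2"] e by auto
 have "norm (cnorm Prod (X p +[Prod] (- 1) *:[Prod] L) - 0) < e" if p: "p >= N" for p
 proof -
 have "cnorm Prod (X p +[Prod] (- 1) *:[Prod] L) <= e/2"
 proof (rule Prod_norm_least)
 fix n
 have "cnorm (M n) (X p n -[M n] L n) <= e/2"
 by (rule lim[of N]) (meson N p le less_imp_le order_trans)
 then show "cnorm (M n) ((X p +[Prod] (- 1) *:[Prod] L) n) <= e/2"
 by (simp add: Prod_simps(4,5) M.minus_eq Xn Ln)
 qed
 moreover have "0 <= cnorm Prod (X p +[Prod] (- 1) *:[Prod] L)"
 by (intro Prod_norm_nonneg Prod_closed X \<open>L : car Prod\<close>)
 ultimately show ?thesis using e by simp
 qed
 then show "EX no. ALL n>=no. norm (cnorm Prod (X n +[Prod] (- 1) *:[Prod] L) - 0) < e" by blast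
 qed
 ultimately show "EX L:car Prod. (%l. cnorm Prod (X l +[Prod] (- 1) *:[Prod] L)) ----> 0" by blast
next
 fix x assume x: "x : car Prod"
 show "(- 1) *:[Prod] x +[Prod] x = \<zero>\<^bsub>Prod\<^esub>"
 unfolding Prod_simps
 proof
 fix n show "(- 1) *:[M n] x n +[M n] x n = \<zero>\<^bsub>M n\<^esub>"
 using M.sm_add_left[OF Prod_nth[OF x], of n "- 1" 1] by (simp add: Prod_nth[OF x])
 qed
qed ((rule Prod_closed; assumption)
 | (simp only: Prod_simps(1-6), rule ext,
 simp add: Prod_nth M.M.a_ac M.sm_add_left M.sm_add_right M.sm_sm
 M.mult_assoc M.distrib_left M.distrib_right M.smult_mult_left M.smult_mult_right
 M.star_add M.star_smult M.star_mult))+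

sublocale P: unital_cstar_algebra Prod by (rule unital_cstar_algebra_Prod)

definition cls :: "(nat => 'a) => (nat => 'a) set" where
 "cls x = Null +>\<^bsub>Prod\<^esub> x"

lemma Null_iff: "x : Null \<longleftrightarrow> x : car Prod & (%n. cnorm (M n) (x n)) ----> 0"
 by (simp add: cstar_null_ideal_def)

lemma Prod_minus_nth: "x : car Prod ==> y : car Prod ==> (x -[Prod] y) n = x n -[M n] y n"
 by (simp add: P.minus_eq M.minus_eq Prod_simps(4,5) Prod_nth)

lemma Null_bound:
 assumes "x : car Prod" "!!n. cnorm (M n) (x n) <= g n" "g ----> 0" shows "x : Null"
proof -
 have "(%n. cnorm (M n) (x n)) ----> 0"
 by (rule tendsto_sandwich[OF _ _ tendsto_const assms(3)])
 (use assms(2) M.cnorm_nonneg[OF Prod_nth[OF assms(1)]] in simp_all)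
 then show ?thesis using assms(1) by (simp add: Null_iff)
qed

lemma Null_carrier: "x : Null ==> x : car Prod"
 by (simp add: Null_iff)

lemma Null_zero: "\<zero>\<^bsub>Prod\<^esub> : Null"
 by (rule Null_bound[OF Prod_closed(6), of "%_. 0"]) (simp_all add: Prod_simps(3))

lemma Null_add: assumes "x : Null" "y : Null" shows "x +[Prod] y : Null"
proof (rule Null_bound)
 show "x +[Prod] y : car Prod" using assms by (simp add: Null_carrier)
 show "cnorm (M n) ((x +[Prod] y) n) <= cnorm (M n) (x n) + cnorm (M n) (y n)" for n
 using assms by (simp add: Prod_simps(4) M.cnorm_triangle Prod_nth Null_carrier)
 show "(%n. cnorm (M n) (x n) + cnorm (M n) (y n)) ----> 0"
 using assms by (intro tendsto_add_zero) (simp_all add: Null_iff)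
qed

lemma Null_smult: assumes "x : Null" shows "c *:[Prod] x : Null"
proof (rule Null_bound)
 show "c *:[Prod] x : car Prod" using assms by (simp add: Null_carrier)
 show "cnorm (M n) ((c *:[Prod] x) n) <= cmod c * cnorm (M n) (x n)" for n
 using assms by (simp add: Prod_simps(5) M.cnorm_smult Prod_nth Null_carrier)
 show "(%n. cmod c * cnorm (M n) (x n)) ----> 0"
 using assms by (intro tendsto_mult_right_zero) (simp add: Null_iff)
qed

lemma Null_mult:
 assumes x: "x : Null" and y: "y : car Prod"
 shows Null_mult_right: "x *[Prod] y : Null" and Null_mult_left: "y *[Prod] x : Null"
proof -
 have xc: "x : car Prod" using x by (rule Null_carrier)
 have lim: "(%n. cnorm (M n) (x n) * cnorm Prod y) ----> 0"
 using x by (intro tendsto_mult_left_zero) (simp add: Null_iff)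
 have b: "cnorm (M n) (x n) * cnorm (M n) (y n) <= cnorm (M n) (x n) * cnorm Prod y" for n
 by (intro mult_left_mono Prod_norm_ub y M.cnorm_nonneg Prod_nth xc)
 show "x *[Prod] y : Null"
 proof (rule Null_bound[OF _ _ lim])
 fix n show "cnorm (M n) ((x *[Prod] y) n) <= cnorm (M n) (x n) * cnorm Prod y"
 using b[of n] M.cnorm_mult[of "x n" n "y n"] xc y by (simp add: Prod_simps(1) Prod_nth)
 qed (use xc y in simp)
 show "y *[Prod] x : Null"
 proof (rule Null_bound[OF _ _ lim])
 fix n show "cnorm (M n) ((y *[Prod] x) n) <= cnorm (M n) (x n) * cnorm Prod y"
 using b[of n] M.cnorm_mult[of "y n" n "x n"] xc y by (simp add: Prod_simps(1) Prod_nth mult.commute)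
 qed (use xc y in simp)
qed

lemma Null_star: assumes "x : Null" shows "star Prod x : Null"
 using assms by (simp add: Null_iff) (simp add: Prod_simps(6) Prod_nth)

lemma cls_iff:
 assumes "y : car Prod"
 shows "x : cls y \<longleftrightarrow> x : car Prod & x -[Prod] y : Null"
proof
 assume "x : cls y"
 then obtain h where h: "h : Null" "x = h +[Prod] y"
 by (auto simp: cls_def a_r_coset_def r_coset_def)
 have "x -[Prod] y = h"
 unfolding h(2) using h(1) assms Null_carrier[OF h(1)]
 by (intro P.feqI) (simp_all add: P.lfun_simps)
 then show "x : car Prod & x -[Prod] y : Null" using h assms by (simp add: Null_carrier)
next
 assume x: "x : car Prod & x -[Prod] y : Null"
 then have "x = (x -[Prod] y) +[Prod] y"
 using assms by (intro P.feqI) (simp_all add: P.lfun_simps)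
 then show "x : cls y" using x by (auto simp: cls_def a_r_coset_def r_coset_def)
qed

lemma Null_minus_sym:
 assumes "x : car Prod" "y : car Prod" "x -[Prod] y : Null" shows "y -[Prod] x : Null"
proof -
 have "y -[Prod] x = (- 1) *:[Prod] (x -[Prod] y)"
 using assms by (intro P.feqI) (simp_all add: P.lfun_simps)
 then show ?thesis using Null_smult[OF assms(3)] by simp
qed

lemma Null_minus_trans:
 assumes "x : car Prod" "y : car Prod" "z : car Prod"
 "x -[Prod] y : Null" "y -[Prod] z : Null"
 shows "x -[Prod] z : Null"
proof -
 have "x -[Prod] z = (x -[Prod] y) +[Prod] (y -[Prod] z)"
 using assms by (intro P.feqI) (simp_all add: P.lfun_simps)
 then show ?thesis using Null_add[OF assms(4,5)] by simp
qed

lemma cls_self: "x : car Prod ==> x : cls x"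
 using P.minus_self[of x] by (simp add: cls_iff Null_zero)

lemma cls_eq_iff:
 assumes "x : car Prod" "y : car Prod"
 shows "cls x = cls y \<longleftrightarrow> x -[Prod] y : Null"
proof
 assume "cls x = cls y"
 then show "x -[Prod] y : Null" using cls_self[OF assms(1)] cls_iff[OF assms(2)] by simp
next
 assume xy: "x -[Prod] y : Null"
 have yx: "y -[Prod] x : Null" by (rule Null_minus_sym[OF assms xy])
 show "cls x = cls y"
 using Null_minus_trans[OF _ assms _ xy] Null_minus_trans[OF _ assms(2,1) _ yx]
 by (auto simp: cls_iff assms)
qed

lemma cls_eqI: "x : car Prod ==> y : cls x ==> cls y = cls x"
 by (subst cls_eq_iff) (auto simp: cls_iff)

lemma Quot_carrier: "car Quo = cls ` car Prod"
 by (auto simp: cstar_quotient_def A_RCOSETS_def RCOSETS_def cls_def a_r_coset_def)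

lemma Quot_zero: "\<zero>\<^bsub>Quo\<^esub> = cls \<zero>\<^bsub>Prod\<^esub>"
proof -
 have "x : Null \<longleftrightarrow> x : cls \<zero>\<^bsub>Prod\<^esub>" for x
 proof -
 have "x -[Prod] \<zero>\<^bsub>Prod\<^esub> = x" if "x : car Prod"
 using that by (intro P.feqI) (simp_all add: P.lfun_simps)
 then show ?thesis by (auto simp: cls_iff Null_carrier)
 qed
 then show ?thesis by (auto simp: cstar_quotient_def)
qed

lemma Quot_one: "\<one>\<^bsub>Quo\<^esub> = cls \<one>\<^bsub>Prod\<^esub>"
 by (simp add: cstar_quotient_def cls_def)

lemma Quot_add:
 assumes "x : car Prod" "y : car Prod"
 shows "cls x +[Quo] cls y = cls (x +[Prod] y)"
proof -
 have e: "cls x +[Quo] cls y = {a +[Prod] b |a b. a : cls x & b : cls y}"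
 by (auto simp: cstar_quotient_def set_add_def set_mult_def)
 have "a +[Prod] b : cls (x +[Prod] y)" if "a : cls x" "b : cls y" for a b
 proof -
 have ab: "a : car Prod" "b : car Prod" "a -[Prod] x : Null" "b -[Prod] y : Null"
 using that assms by (auto simp: cls_iff)
 have "(a +[Prod] b) -[Prod] (x +[Prod] y) = (a -[Prod] x) +[Prod] (b -[Prod] y)"
 using ab(1,2) assms by (intro P.feqI) (simp_all add: P.lfun_simps)
 then show ?thesis using ab assms Null_add by (simp add: cls_iff)
 qed
 moreover have "EX a b. c = a +[Prod] b & a : cls x & b : cls y" if "c : cls (x +[Prod] y)" for c
 proof (intro exI conjI)
 have c: "c : car Prod" "c -[Prod] (x +[Prod] y) : Null" using that assms by (auto simp: cls_iff)
 show "c = (c -[Prod] y) +[Prod] y"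
 using c(1) assms by (intro P.feqI) (simp_all add: P.lfun_simps)
 have "(c -[Prod] y) -[Prod] x = c -[Prod] (x +[Prod] y)"
 using c(1) assms by (intro P.feqI) (simp_all add: P.lfun_simps)
 then show "c -[Prod] y : cls x" using c assms by (simp add: cls_iff)
 show "y : cls y" by (rule cls_self[OF assms(2)])
 qed
 ultimately show ?thesis unfolding e by blast
qed

lemma Quot_mult:
 assumes "x : car Prod" "y : car Prod"
 shows "cls x *[Quo] cls y = cls (x *[Prod] y)"
proof -
 have e: "cls x *[Quo] cls y = (\<Union>a\<in>cls x. \<Union>b\<in>cls y. cls (a *[Prod] b))"
 by (simp add: cstar_quotient_def rcoset_mult_def cls_def)
 have "cls (a *[Prod] b) = cls (x *[Prod] y)" if "a : cls x" "b : cls y" for a b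
 proof -
 have ab: "a : car Prod" "b : car Prod" "a -[Prod] x : Null" "b -[Prod] y : Null"
 using that assms by (auto simp: cls_iff)
 have "a *[Prod] b -[Prod] x *[Prod] y
 = (a -[Prod] x) *[Prod] b +[Prod] x *[Prod] (b -[Prod] y)"
 using ab(1,2) assms by (intro P.feqI) (simp_all add: P.lin_simps)
 then show ?thesis using ab assms Null_add Null_mult by (simp add: cls_eq_iff)
 qed
 then show ?thesis unfolding e using cls_self[OF assms(1)] cls_self[OF assms(2)] by blast
qed

lemma Quot_smult:
 assumes "x : car Prod" shows "c *:[Quo] cls x = cls (c *:[Prod] x)"
proof -
 have e: "c *:[Quo] cls x = (\<Union>a\<in>cls x. cls (c *:[Prod] a))"
 by (simp add: cstar_quotient_def cls_def)
 have "cls (c *:[Prod] a) = cls (c *:[Prod] x)" if "a : cls x" for a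
 proof -
 have a: "a : car Prod" "a -[Prod] x : Null" using that assms by (auto simp: cls_iff)
 have "c *:[Prod] a -[Prod] c *:[Prod] x = c *:[Prod] (a -[Prod] x)"
 using a(1) assms by (intro P.feqI) (simp_all add: P.lin_simps algebra_simps)
 then show ?thesis using a assms Null_smult by (simp add: cls_eq_iff)
 qed
 then show ?thesis unfolding e using cls_self[OF assms] by blast
qed

lemma Quot_star:
 assumes "x : car Prod" shows "star Quo (cls x) = cls (star Prod x)"
proof -
 have *: "star Prod a : cls (star Prod x)" if a: "a : cls x" and x: "x : car Prod" for a x
 proof -
 have a: "a : car Prod" "a -[Prod] x : Null" using that by (auto simp: cls_iff)
 then show ?thesis using x Null_star[OF a(2)] by (simp add: cls_iff P.star_minus)
 qed
 have "star Quo (cls x) = star Prod ` cls x" by (simp add: cstar_quotient_def)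
 also have "... = cls (star Prod x)"
 proof
 show "star Prod ` cls x <= cls (star Prod x)" using * assms by blast
 show "cls (star Prod x) <= star Prod ` cls x"
 proof
 fix b assume b: "b : cls (star Prod x)"
 then have "star Prod b : cls x" using *[OF b] assms by simp
 moreover have "b = star Prod (star Prod b)" using b assms by (simp add: cls_iff)
 ultimately show "b : star Prod ` cls x" by blast
 qed
 qed
 finally show ?thesis .
qed

text \<open>A representative whose norm is nearly the quotient norm differs from x by a null
  sequence. Together with \<open>Quot_norm_upper\<close> this identifies the quotient norm as the
  limit superior of the coordinate norms.\<close>

lemma Quot_norm_lower:
 assumes "x : car Prod" "e > 0"
 shows "\<forall>\<^sub>F n in sequentially. cnorm (M n) (x n) <= cnorm Quo (cls x) + e"
proof -
 have lt: "Inf (cnorm Prod ` cls x) < cnorm Quo (cls x) + e / 2"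
 using assms by (simp add: cstar_quotient_def)
 have ne: "cnorm Prod ` cls x ~= {}" using cls_self[OF assms(1)] by blast
 obtain y where y: "y : cls x" "cnorm Prod y < cnorm Quo (cls x) + e / 2"
 using cInf_lessD[OF ne lt] by (elim bexE imageE) simp
 have yc: "y : car Prod" "y -[Prod] x : Null" using y(1) cls_iff[OF assms(1)] by simp_all
 have "\<forall>\<^sub>F n in sequentially. cnorm (M n) ((y -[Prod] x) n) < e / 2"
 using yc(2) assms(2) by (intro order_tendstoD(2)[of _ 0]) (simp_all add: Null_iff)
 then show ?thesis
 proof eventually_elim
 case (elim n)
 have "cnorm (M n) (x n) <= cnorm (M n) (y n) + cnorm (M n) (x n -[M n] y n)"
 using M.cnorm_diff_le[OF Prod_nth[OF assms(1)] Prod_nth[OF yc(1)]] .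
 then show ?case
 using elim y(2) Prod_norm_ub[OF yc(1), of n] assms yc
 M.cnorm_minus_commute[OF Prod_nth[OF assms(1)] Prod_nth[OF yc(1)], of n]
 by (simp add: Prod_minus_nth)
 qed
qed

text \<open>The coordinates before N are replaced by 0, which does not change the class.\<close>

lemma Quot_norm_lift:
 assumes x: "x : car Prod" and c: "c >= 0"
 and le: "\<forall>\<^sub>F n in sequentially. cnorm (M n) (x n) <= c"
 obtains y where "y : cls x" "cnorm Prod y <= c"
proof -
 obtain N where N: "!!n. n >= N ==> cnorm (M n) (x n) <= c" using le by (auto simp: eventually_sequentially)
 define y where "y n = (if n >= N then x n else \<zero>\<^bsub>M n\<^esub>)" for n
 have y: "cnorm (M n) (y n) <= c" "y n : car (M n)" for n
 using N c x by (simp_all add: y_def Prod_nth)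
 have yc: "y : car Prod" by (rule Prod_carrierI[OF y(2) y(1)])
 have "(%n. cnorm (M n) ((y -[Prod] x) n)) ----> 0"
 proof (rule tendsto_eventually, unfold eventually_sequentially, intro exI allI impI)
 fix n assume "n >= N"
 then show "cnorm (M n) ((y -[Prod] x) n) = 0"
 using x yc M.minus_self[OF Prod_nth[OF x], of n] by (simp add: Prod_minus_nth y_def)
 qed
 then have "y : cls x" using x yc by (simp add: cls_iff Null_iff)
 then show ?thesis using that Prod_norm_least[OF y(1)] by blast
qed

lemma Quot_norm_le_Prod:
 assumes x: "x : car Prod" and y: "y : cls x" shows "cnorm Quo (cls x) <= cnorm Prod y"
proof -
 have "bdd_below (cnorm Prod ` cls x)"
 using x by (intro bdd_belowI2[of _ 0]) (auto simp: cls_iff Prod_norm_nonneg)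
 then have "Inf (cnorm Prod ` cls x) <= cnorm Prod y" using y by (intro cInf_lower) auto
 then show ?thesis by (simp add: cstar_quotient_def)
qed

lemma Quot_norm_upper:
 assumes x: "x : car Prod" and c: "c >= 0"
 and le: "!!e. e > 0 ==> \<forall>\<^sub>F n in sequentially. cnorm (M n) (x n) <= c + e"
 shows "cnorm Quo (cls x) <= c"
proof (rule field_le_epsilon)
 fix e :: real assume e: "e > 0"
 then have ce: "c + e >= 0" using c by simp
 obtain y where "y : cls x" "cnorm Prod y <= c + e" by (rule Quot_norm_lift[OF x ce le[OF e]])
 then show "cnorm Quo (cls x) <= c + e" using Quot_norm_le_Prod[OF x] by fastforce
qed

lemma Quot_norm_nonneg: assumes x: "x : car Prod" shows "0 <= cnorm Quo (cls x)"
proof (rule field_le_epsilon)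
 fix e :: real assume e: "e > 0"
 obtain n where "cnorm (M n) (x n) <= cnorm Quo (cls x) + e"
 using Quot_norm_lower[OF x e] by (auto simp: eventually_sequentially)
 then show "0 <= cnorm Quo (cls x) + e" using M.cnorm_nonneg[OF Prod_nth[OF x], of n] by linarith
qed

lemma Quot_norm_zero_iff:
 assumes x: "x : car Prod" shows "cnorm Quo (cls x) = 0 \<longleftrightarrow> x : Null"
proof
 assume z: "cnorm Quo (cls x) = 0"
 have "(%n. cnorm (M n) (x n)) ----> 0"
 proof (rule tendstoI)
 fix e :: real assume e: "e > 0"
 have "e / 2 > 0" using e by simp
 from Quot_norm_lower[OF x this] show "\<forall>\<^sub>F n in sequentially. dist (cnorm (M n) (x n)) 0 < e"
 proof eventually_elim
 case (elim n)
 then show ?case using e z M.cnorm_nonneg[OF Prod_nth[OF x], of n] by (simp add: dist_real_def)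
 qed
 qed
 then show "x : Null" using x by (simp add: Null_iff)
next
 assume n: "x : Null"
 have "cnorm Quo (cls x) <= 0"
 proof (rule Quot_norm_upper[OF x order_refl])
 fix e :: real assume "e > 0"
 then have "\<forall>\<^sub>F n in sequentially. cnorm (M n) (x n) < e"
 using n by (intro order_tendstoD(2)[of _ 0]) (simp_all add: Null_iff)
 then show "\<forall>\<^sub>F n in sequentially. cnorm (M n) (x n) <= 0 + e" by eventually_elim simp
 qed
 then show "cnorm Quo (cls x) = 0" using Quot_norm_nonneg[OF x] by simp
qed

end

section \<open>The quotient as a C*-algebra\<close>

context cstar_sequence
begin

lemma Quo_clsI: "x : car Prod ==> cls x : car Quo"
 by (simp add: Quot_carrier)

lemma Quo_cases: assumes "X : car Quo" obtains x where "x : car Prod" "X = cls x"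
 using assms by (auto simp: Quot_carrier)

lemmas Quo_ops = Quot_zero Quot_one Quot_add Quot_mult Quot_smult Quot_star

lemma Quo_norm_add:
 assumes x: "x : car Prod" and y: "y : car Prod"
 shows "cnorm Quo (cls (x +[Prod] y)) <= cnorm Quo (cls x) + cnorm Quo (cls y)"
proof (rule Quot_norm_upper)
 fix e :: real assume e: "e > 0"
 then have "e / 2 > 0" by simp
 from Quot_norm_lower[OF x this] Quot_norm_lower[OF y this]
 show "\<forall>\<^sub>F n in sequentially. cnorm (M n) ((x +[Prod] y) n) <= cnorm Quo (cls x) + cnorm Quo (cls y) + e"
 proof eventually_elim
 case (elim n)
 then show ?case
 using M.cnorm_triangle[OF Prod_nth[OF x] Prod_nth[OF y], of n] by (simp add: Prod_simps(4))
 qed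
qed (use x y Quot_norm_nonneg in \<open>simp_all add: add_nonneg_nonneg\<close>)

lemma Quo_norm_mult:
 assumes x: "x : car Prod" and y: "y : car Prod"
 shows "cnorm Quo (cls (x *[Prod] y)) <= cnorm Quo (cls x) * cnorm Quo (cls y)"
proof -
 let ?a = "cnorm Quo (cls x)" and ?b = "cnorm Quo (cls y)"
 have ab: "0 <= ?a" "0 <= ?b" using x y by (simp_all add: Quot_norm_nonneg)
 have *: "cnorm Quo (cls (x *[Prod] y)) <= (?a + d) * (?b + d)" if d: "d > 0" for d
 proof (rule Quot_norm_upper)
 fix e :: real assume e: "e > 0"
 from Quot_norm_lower[OF x d] Quot_norm_lower[OF y d]
 show "\<forall>\<^sub>F n in sequentially. cnorm (M n) ((x *[Prod] y) n) <= (?a + d) * (?b + d) + e"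
 proof eventually_elim
 case (elim n)
 have "cnorm (M n) (x n *[M n] y n) <= cnorm (M n) (x n) * cnorm (M n) (y n)"
 by (rule M.cnorm_mult[OF Prod_nth[OF x] Prod_nth[OF y]])
 also have "... <= (?a + d) * (?b + d)"
 using elim ab d by (intro mult_mono M.cnorm_nonneg Prod_nth x y) auto
 finally show ?case using e by (simp add: Prod_simps(1))
 qed
 qed (use x y ab d in simp_all)
 have "((%d. (?a + d) * (?b + d)) \<longlongrightarrow> (?a + 0) * (?b + 0)) (at_right 0)"
 by (intro tendsto_mult tendsto_add tendsto_const tendsto_ident_at)
 then have "cnorm Quo (cls (x *[Prod] y)) <= (?a + 0) * (?b + 0)"
 by (rule tendsto_lowerbound) (use * in \<open>auto simp: eventually_at_filter\<close>)
 then show ?thesis by simp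
qed

lemma Quo_norm_smult_le:
 assumes x: "x : car Prod"
 shows "cnorm Quo (cls (c *:[Prod] x)) <= cmod c * cnorm Quo (cls x)"
proof -
 have *: "cnorm Quo (cls (c *:[Prod] x)) <= cmod c * (cnorm Quo (cls x) + d)" if d: "d > 0" for d
 proof (rule Quot_norm_upper)
 fix e :: real assume e: "e > 0"
 from Quot_norm_lower[OF x d]
 show "\<forall>\<^sub>F n in sequentially. cnorm (M n) ((c *:[Prod] x) n) <= cmod c * (cnorm Quo (cls x) + d) + e"
 proof eventually_elim
 case (elim n)
 have "cmod c * cnorm (M n) (x n) <= cmod c * (cnorm Quo (cls x) + d)"
 using elim by (intro mult_left_mono) auto
 then show ?case using e by (simp add: Prod_simps(5) M.cnorm_smult[OF Prod_nth[OF x]])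
 qed
 qed (use x Quot_norm_nonneg[OF x] d in simp_all)
 have "((%d. cmod c * (cnorm Quo (cls x) + d)) \<longlongrightarrow> cmod c * (cnorm Quo (cls x) + 0)) (at_right 0)"
 by (intro tendsto_mult tendsto_add tendsto_const tendsto_ident_at)
 then have "cnorm Quo (cls (c *:[Prod] x)) <= cmod c * (cnorm Quo (cls x) + 0)"
 by (rule tendsto_lowerbound) (use * in \<open>auto simp: eventually_at_filter\<close>)
 then show ?thesis by simp
qed

lemma Quo_norm_smult:
 assumes x: "x : car Prod"
 shows "cnorm Quo (cls (c *:[Prod] x)) = cmod c * cnorm Quo (cls x)"
proof (cases "c = 0")
 case True
 then show ?thesis using Quo_norm_smult_le[OF x, of 0] Quot_norm_nonneg[of "0 *:[Prod] x"] x by simp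
next
 case False
 have "(1/c) *:[Prod] (c *:[Prod] x) = x" using False x by (simp add: P.sm_sm)
 then have "cnorm Quo (cls x) <= cmod (1/c) * cnorm Quo (cls (c *:[Prod] x))"
 using Quo_norm_smult_le[of "c *:[Prod] x" "1/c"] x by simp
 then have "cmod c * cnorm Quo (cls x) <= cnorm Quo (cls (c *:[Prod] x))"
 using False by (simp add: norm_divide field_simps)
 then show ?thesis using Quo_norm_smult_le[OF x, of c] by simp
qed

lemma Quo_norm_cstar:
 assumes x: "x : car Prod"
 shows "cnorm Quo (cls (star Prod x *[Prod] x)) = (cnorm Quo (cls x))\<^sup>2"
proof (rule antisym)
 let ?a = "cnorm Quo (cls x)" and ?q = "cnorm Quo (cls (star Prod x *[Prod] x))"
 have sx: "star Prod x : car Prod" and c: "star Prod x *[Prod] x : car Prod" using x by simp_all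
 have q0: "0 <= ?q" by (rule Quot_norm_nonneg[OF c])
 have "cnorm Quo (cls (star Prod x)) <= ?a"
 proof (rule Quot_norm_upper[OF sx Quot_norm_nonneg[OF x]])
 fix e :: real assume "e > 0"
 from Quot_norm_lower[OF x this]
 show "\<forall>\<^sub>F n in sequentially. cnorm (M n) (star Prod x n) <= ?a + e"
 by eventually_elim (simp add: Prod_simps(6) M.cnorm_star[OF Prod_nth[OF x]])
 qed
 then have "cnorm Quo (cls (star Prod x)) * ?a <= ?a * ?a"
 using Quot_norm_nonneg[OF x] by (intro mult_right_mono)
 then show "?q <= ?a\<^sup>2" using Quo_norm_mult[OF sx x] by (simp add: power2_eq_square)
 show "?a\<^sup>2 <= ?q"
 proof (rule field_le_epsilon)
 fix d :: real assume d: "d > 0"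
 have "?a <= sqrt (?q + d)"
 proof (rule Quot_norm_upper[OF x])
 fix e :: real assume e: "e > 0"
 from Quot_norm_lower[OF c d] show "\<forall>\<^sub>F n in sequentially. cnorm (M n) (x n) <= sqrt (?q + d) + e"
 proof eventually_elim
 case (elim n)
 then have "(cnorm (M n) (x n))\<^sup>2 <= ?q + d"
 by (simp add: Prod_simps(1,6) M.cstar_identity[OF Prod_nth[OF x]])
 then have "cnorm (M n) (x n) <= sqrt (?q + d)" by (rule real_le_rsqrt)
 then show ?case using e by simp
 qed
 qed (use q0 d in simp)
 then have "?a\<^sup>2 <= (sqrt (?q + d))\<^sup>2" by (intro power_mono Quot_norm_nonneg[OF x])
 then show "?a\<^sup>2 <= ?q + d" using q0 d by simp
 qed
qed

text \<open>Along a subsequence whose consecutive distances are below (1/2)^j, each difference lifts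
  to a sequence of norm at most (1/2)^j. The partial sums of these lifts are Cauchy in the product,
  and the class of their limit is the limit of the classes.\<close>

lemma Quo_complete:
 fixes X :: "nat => (nat => 'a)"
 assumes X: "!!l. X l : car Prod"
 and C: "!!e. e > 0 ==> EX N. ALL p>=N. ALL q>=N. cnorm Quo (cls (X p -[Prod] X q)) < e"
 obtains L where "L : car Prod" "(%l. cnorm Quo (cls (X l -[Prod] L))) ----> 0"
proof -
 have "EX N. ALL p>=N. ALL q>=N. cnorm Quo (cls (X p -[Prod] X q)) < (1/2)^j" for j
 by (rule C) simp
 then obtain K where K: "!!j p q. p >= K j ==> q >= K j ==> cnorm Quo (cls (X p -[Prod] X q)) < (1/2)^j"
 by metis
 \<comment> \<open>The maximum over \<open>{..j}\<close> puts both s j and s (Suc j) beyond K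
   j.\<close>
 define s where "s j = Max (K ` {..j})" for j
 have sK: "K i <= s j" if "i <= j" for i j using that by (auto simp: s_def intro!: Max_ge)
 have "EX Y. ALL j. Y j : cls (X (s j)) & cnorm Prod (Y (Suc j) -[Prod] Y j) <= (1/2)^j"
 proof (rule dependent_nat_choice[of "%j y. y : cls (X (s j))"
 "%j y y'. cnorm Prod (y' -[Prod] y) <= (1/2)^j"])
 show "EX x. x : cls (X (s 0))" using cls_self[OF X] by blast
 fix y j assume y: "y : cls (X (s j))"
 then have yc: "y : car Prod" "cls y = cls (X (s j))" using X by (auto simp: cls_iff cls_eqI)
 let ?w = "X (s (Suc j)) -[Prod] y"
 have wc: "?w : car Prod" using X yc by simp
 have "y -[Prod] X (s j) : Null" using y X by (simp add: cls_iff)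
 then have "cls ?w = cls (X (s (Suc j)) -[Prod] X (s j))"
 proof (subst cls_eq_iff)
 assume n: "y -[Prod] X (s j) : Null"
 have "?w -[Prod] (X (s (Suc j)) -[Prod] X (s j)) = (- 1) *:[Prod] (y -[Prod] X (s j))"
 using X yc by (intro P.feqI) (simp_all add: P.lfun_simps)
 then show "?w -[Prod] (X (s (Suc j)) -[Prod] X (s j)) : Null"
 using Null_smult[OF n] by simp
 qed (use X yc in simp_all)
 moreover have "cnorm Quo (cls (X (s (Suc j)) -[Prod] X (s j))) < (1/2)^j"
 by (rule K) (simp_all add: sK)
 ultimately have lt: "cnorm Quo (cls ?w) < (1/2)^j" by simp
 have "(1/2)^j - cnorm Quo (cls ?w) > 0" using lt by simp
 from Quot_norm_lower[OF wc this]
 have ev: "\<forall>\<^sub>F n in sequentially. cnorm (M n) (?w n) <= (1/2)^j" by eventually_elim simp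
 obtain z where z: "z : cls ?w" "cnorm Prod z <= (1/2)^j"
 by (rule Quot_norm_lift[OF wc _ ev]) simp
 have zc: "z : car Prod" "z -[Prod] ?w : Null" using z wc by (simp_all add: cls_iff)
 have e1: "(y +[Prod] z) -[Prod] X (s (Suc j)) = z -[Prod] ?w"
 using X yc zc by (intro P.feqI) (simp_all add: P.lfun_simps)
 have e2: "(y +[Prod] z) -[Prod] y = z"
 using yc zc by (intro P.feqI) (simp_all add: P.lfun_simps)
 show "EX y'. y' : cls (X (s (Suc j))) & cnorm Prod (y' -[Prod] y) <= (1/2)^j"
 by (rule exI[of _ "y +[Prod] z"])
 (simp only: cls_iff[OF X] e1 e2, use z zc yc in simp)
 qed
 then obtain Y where Y: "!!j. Y j : cls (X (s j))"
 "!!j. cnorm Prod (Y (Suc j) -[Prod] Y j) <= (1/2)^j" by metis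
 have Yc: "Y j : car Prod" for j using Y(1)[of j] X by (simp add: cls_iff)
 have dif: "cnorm Prod (Y (j + k) -[Prod] Y j) <= 2 * (1/2)^j - 2 * (1/2)^(j + k)" for j k
 proof (induction k)
 case (Suc k)
 have "cnorm Prod (Y (j + Suc k) -[Prod] Y j)
 <= cnorm Prod (Y (Suc (j + k)) -[Prod] Y (j + k)) + cnorm Prod (Y (j + k) -[Prod] Y j)"
 using P.cnorm_minus_trans[OF Yc[of "Suc (j + k)"] Yc[of "j + k"] Yc[of j]] by simp
 then show ?case using Suc Y(2)[of "j + k"] by simp
 qed (use P.minus_self[OF Yc[of j]] in simp)
 have half: "(%j. 2 * (1/2::real)^j) ----> 0"
 by (intro tendsto_mult_right_zero LIMSEQ_realpow_zero) auto
 obtain L where L: "P.conv Y L"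
 proof (rule P.Cauchy_conv[OF Yc])
 fix e :: real assume "e > 0"
 from LIMSEQ_D[OF half this] obtain N where N: "!!j. j >= N ==> 2 * (1/2)^j < e" by auto
 have *: "cnorm Prod (Y p -[Prod] Y q) < e" if "p >= q" "q >= N" for p q
 proof -
 have "cnorm Prod (Y p -[Prod] Y q) <= 2 * (1/2)^q - 2 * (1/2)^p" using dif[of q "p - q"] that by simp
 also have "... < e" using N[OF that(2)] zero_less_power[of "1/2::real" p] by linarith
 finally show ?thesis .
 qed
 have "cnorm Prod (Y p -[Prod] Y q) < e" if "p >= N" "q >= N" for p q
 using *[of p q] *[of q p] that P.cnorm_minus_commute[OF Yc[of p] Yc[of q]] by (cases "p >= q") auto
 then show "EX N. ALL p>=N. ALL q>=N. cnorm Prod (Y p -[Prod] Y q) < e" by blast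
 qed
 have Lc: "L : car Prod" using L by (rule P.conv_carrier)
 have YL: "cnorm Quo (cls (X (s j) -[Prod] L)) <= cnorm Prod (Y j -[Prod] L)" for j
 proof (rule Quot_norm_le_Prod)
 have "(Y j -[Prod] L) -[Prod] (X (s j) -[Prod] L) = Y j -[Prod] X (s j)"
 using Yc X Lc by (intro P.feqI) (simp_all add: P.lfun_simps)
 then show "Y j -[Prod] L : cls (X (s j) -[Prod] L)"
 using Y(1)[of j] Yc X Lc by (simp add: cls_iff)
 qed (use X Lc in simp)
 have "(%l. cnorm Quo (cls (X l -[Prod] L))) ----> 0"
 proof (rule LIMSEQ_I)
 fix e :: real assume e: "e > 0"
 have lim: "(%j. (1/2)^j + cnorm Prod (Y j -[Prod] L)) ----> 0"
 using L unfolding P.conv_def by (intro tendsto_add_zero LIMSEQ_realpow_zero) simp_all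
 obtain j where j: "(1/2)^j + cnorm Prod (Y j -[Prod] L) < e"
 using order_tendstoD(2)[OF lim e] by (auto simp: eventually_sequentially)
 have "norm (cnorm Quo (cls (X l -[Prod] L)) - 0) < e" if l: "l >= s j" for l
 proof -
 have "X l -[Prod] L = (X l -[Prod] X (s j)) +[Prod] (X (s j) -[Prod] L)"
 using X Lc by (intro P.feqI) (simp_all add: P.lfun_simps)
 then have "cnorm Quo (cls (X l -[Prod] L))
 <= cnorm Quo (cls (X l -[Prod] X (s j))) + cnorm Quo (cls (X (s j) -[Prod] L))"
 using Quo_norm_add[of "X l -[Prod] X (s j)" "X (s j) -[Prod] L"] X Lc by simp
 also have "cnorm Quo (cls (X l -[Prod] X (s j))) < (1/2)^j"
 by (rule K) (use l sK[of j j] in simp_all)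
 finally show ?thesis
 using YL[of j] j Quot_norm_nonneg[of "X l -[Prod] L"] X Lc by simp
 qed
 then show "EX no. ALL n>=no. norm (cnorm Quo (cls (X n -[Prod] L)) - 0) < e" by blast
 qed
 with Lc show ?thesis by (rule that)
qed

theorem unital_cstar_algebra_Quo: "unital_cstar_algebra Quo"
proof (rule unital_cstar_algebraI)
 fix X :: "nat => (nat => 'a) set"
 assume X: "!!l. X l : car Quo"
 and C: "!!e. e > 0 ==> EX N. ALL p>=N. ALL q>=N. cnorm Quo (X p +[Quo] (- 1) *:[Quo] X q) < e"
 have "EX x. x : car Prod & X l = cls x" for l using X[of l] by (auto simp: Quot_carrier)
 then obtain x where x: "!!l. x l : car Prod" "!!l. X l = cls (x l)" by metis
 have e: "cls a +[Quo] (- 1) *:[Quo] cls b = cls (a -[Prod] b)"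
 if "a : car Prod" "b : car Prod" for a b
 using that by (simp add: Quo_ops P.minus_eq)
 obtain L where "L : car Prod" "(%l. cnorm Quo (cls (x l -[Prod] L))) ----> 0"
 by (rule Quo_complete[of x]) (use x C in \<open>simp_all add: e\<close>)
 then show "EX L:car Quo. (%l. cnorm Quo (X l +[Quo] (- 1) *:[Quo] L)) ----> 0"
 using x by (intro bexI[of _ "cls L"]) (simp_all add: e Quo_clsI)
next
 fix X assume X: "X : car Quo"
 then obtain x where x: "x : car Prod" "X = cls x" by (rule Quo_cases)
 show "0 <= cnorm Quo X" "cnorm Quo X = 0 \<longleftrightarrow> X = \<zero>\<^bsub>Quo\<^esub>"
 "cnorm Quo (star Quo X *[Quo] X) = (cnorm Quo X)\<^sup>2"
 proof -
 have "x -[Prod] \<zero>\<^bsub>Prod\<^esub> = x"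
 using x by (intro P.feqI) (simp_all add: P.lfun_simps)
 then show "cnorm Quo X = 0 \<longleftrightarrow> X = \<zero>\<^bsub>Quo\<^esub>"
 using x Quot_norm_zero_iff[OF x(1)] cls_eq_iff[OF x(1) P.M.zero_closed] by (simp add: Quot_zero)
 qed (use x in \<open>simp_all add: Quo_ops Quot_norm_nonneg Quo_norm_cstar\<close>)
 show "cnorm Quo (c *:[Quo] X) = cmod c * cnorm Quo X" for c
 using x by (simp add: Quo_ops Quo_norm_smult)
 show "(- 1) *:[Quo] X +[Quo] X = \<zero>\<^bsub>Quo\<^esub>"
 using x P.sm_add_left[of x "- 1" 1] by (simp add: Quo_ops)
next
 fix X Y assume "X : car Quo" "Y : car Quo"
 then obtain x y where xy: "x : car Prod" "X = cls x" "y : car Prod" "Y = cls y"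
 by (metis Quo_cases)
 show "cnorm Quo (X +[Quo] Y) <= cnorm Quo X + cnorm Quo Y"
 "cnorm Quo (X *[Quo] Y) <= cnorm Quo X * cnorm Quo Y"
 using xy by (simp_all add: Quo_ops Quo_norm_add Quo_norm_mult)
qed (elim Quo_cases | simp add: Quo_ops Quo_clsI P.M.a_ac P.sm_add_left P.sm_add_right P.sm_sm
 P.mult_assoc P.distrib_left P.distrib_right P.smult_mult_left P.smult_mult_right
 P.star_add P.star_smult P.star_mult)+

sublocale Q: unital_cstar_algebra Quo by (rule unital_cstar_algebra_Quo)

lemma star_hom_Quo:
 assumes c: "!!a. a : car A ==> Th a : car Prod"
 and "!!a b. a : car A ==> b : car A ==> Th (a +[A] b) -[Prod] (Th a +[Prod] Th b) : Null"
 and "!!a b. a : car A ==> b : car A ==> Th (a *[A] b) -[Prod] (Th a *[Prod] Th b) : Null"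
 and "!!a z. a : car A ==> Th (z *:[A] a) -[Prod] (z *:[Prod] Th a) : Null"
 and "!!a. a : car A ==> Th (star A a) -[Prod] (star Prod (Th a)) : Null"
 and A: "cstar_algebra A"
 shows "star_hom A Quo (%a. cls (Th a))"
proof -
 interpret A: cstar_algebra A by (rule A)
 show ?thesis
 unfolding star_hom_def using assms(1-5)
 by (auto simp: Quo_ops Quo_clsI cls_eq_iff)
qed

text \<open>Replacing the coordinates before J by 0 keeps the class and gives a sequence that is
  positive with the single constant t = ||Y||. The class map preserves positivity.\<close>

lemma Quo_pos:
 assumes Y: "Y : car Prod" and p: "!!n. n >= J ==> M.pos n (Y n)"
 shows "Q.pos (cls Y)"
proof -
 define Z where "Z n = (if n >= J then Y n else \<zero>\<^bsub>M n\<^esub>)" for n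
 let ?t = "cnorm Prod Y"
 have Zp: "M.pos n (Z n)" for n using p by (simp add: Z_def)
 have Zb: "cnorm (M n) (Z n) <= ?t" for n
 using Prod_norm_ub[OF Y, of n] Prod_norm_nonneg[OF Y] by (simp add: Z_def)
 have Zn: "Z n : car (M n)" for n using Zp by (rule M.pos_carrier)
 have Zc: "Z : car Prod" by (rule Prod_carrierI[OF Zn Zb])
 have "P.pos Z"
 proof (rule P.posI[OF Zc])
 show "star Prod Z = Z" using Zp by (simp add: Prod_simps(6) M.pos_star)
 show "cnorm Prod (P.real_scalar ?t -[Prod] Z) <= ?t"
 proof (rule Prod_norm_least)
 fix n
 have "cnorm (M n) (M.real_scalar n ?t -[M n] Z n) <= ?t"
 by (rule M.pos_bound_mono[OF Zn M.pos_cnorm_bound[OF Zp] Zb])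
 then show "cnorm (M n) ((P.real_scalar ?t -[Prod] Z) n) <= ?t"
 using Prod_minus_nth[OF P.sm_closed[OF P.one_closed] Zc, of "cr ?t" n]
 by (simp add: Prod_simps(2,5))
 qed
 qed (rule Prod_norm_nonneg[OF Y])
 then have pZ: "P.pos Z" .
 interpret cl: star_hom_pair Prod Quo cls
 by (intro star_hom_pair.intro star_hom_pair_axioms.intro unital_cstar_algebra_Prod unital_cstar_algebra_Quo)
 (simp add: star_hom_def Quo_ops Quo_clsI)
 have "Q.pos (cls Z)" by (rule cl.hom_pos[OF pZ])
 moreover have "cls Z = cls Y"
 proof (subst cls_eq_iff[OF Zc Y], subst Null_iff, intro conjI)
 show "(%n. cnorm (M n) ((Z -[Prod] Y) n)) ----> 0"
 proof (rule tendsto_eventually, unfold eventually_sequentially, intro exI allI impI)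
 fix n assume "n >= J"
 then show "cnorm (M n) ((Z -[Prod] Y) n) = 0"
 using M.minus_self[OF Prod_nth[OF Y], of n] by (simp add: Prod_minus_nth Zc Y Z_def)
 qed
 qed (use Zc Y in simp)
 ultimately show ?thesis by simp
qed

end

section \<open>Finite-dimensional tools: separation, projections, isometries, direct sums\<close>

subsection \<open>Separation from a convex cone\<close>

text \<open>Let q be the point of the closure of K nearest to \<open>Phi\<close> in the Euclidean
  norm over I, and h = q - Phi. The first-order conditions in the directions of K and of -q show
  that h is nonnegative on K and negative at \<open>Phi\<close>; the functional returned is the
  conjugate of h. K is not assumed closed, so q is reached through a minimizing sequence.\<close>

lemma cone_separation:
 fixes K :: "('i => complex) set" and Phi :: "'i => complex"
 assumes I: "finite I" and zero: "(%_. 0) : K"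
 and add: "!!f g. f : K ==> g : K ==> (%i. f i + g i) : K"
 and scale: "!!f r. f : K ==> r >= 0 ==> (%i. cr r * f i) : K"
 and far: "e > 0" "!!g. g : K ==> EX i:I. e <= cmod (g i - Phi i)"
 obtains h where "!!g. g : K ==> 0 <= Re (\<Sum>i\<in>I. h i * g i)" "Re (\<Sum>i\<in>I. h i * Phi i) < 0"
proof -
 define nsq where "nsq f = (\<Sum>i\<in>I. (cmod (f i))\<^sup>2)" for f :: "'i => complex"
 define ip where "ip f g = Re (\<Sum>i\<in>I. cnj (f i) * g i)" for f g :: "'i => complex"
 define D where "D g = nsq (%i. g i - Phi i)" for g
 have nsq0: "0 <= nsq f" for f by (simp add: nsq_def sum_nonneg)
 have expand: "nsq (%i. f i + cr t * g i) = nsq f + 2 * t * ip f g + t\<^sup>2 * nsq g" for f g t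
 proof -
 have "(cmod (a + cr t * b))\<^sup>2 = (cmod a)\<^sup>2 + 2 * t * Re (cnj a * b) + t\<^sup>2 * (cmod b)\<^sup>2" for a b
 unfolding cmod_power2 by (simp add: power2_eq_square algebra_simps)
 then show ?thesis
 unfolding nsq_def ip_def by (simp only: sum.distrib Re_sum sum_distrib_left)
 qed
 have Dbd: "e\<^sup>2 <= D g" if g: "g : K" for g
 proof -
 obtain i where i: "i : I" "e <= cmod (g i - Phi i)" using far(2)[OF g] by blast
 have "e\<^sup>2 <= (cmod (g i - Phi i))\<^sup>2" using i far(1) by (intro power_mono) auto
 also have "... <= D g" unfolding D_def nsq_def using i I
 by (intro member_le_sum[of i I "%i. (cmod (g i - Phi i))\<^sup>2"]) auto
 finally show ?thesis .
 qed
 define d where "d = Inf (D ` K)"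
 have bdd: "bdd_below (D ` K)" by (rule bdd_belowI2[of _ "e\<^sup>2"]) (rule Dbd)
 have dle: "d <= D g" if "g : K" for g unfolding d_def by (rule cInf_lower[OF imageI[OF that] bdd])
 have "e\<^sup>2 <= d" unfolding d_def by (rule cInf_greatest) (use zero Dbd in auto)
 then have d0: "d > 0" using far(1) by (smt (verit) zero_less_power)
 have "EX g:K. D g < d + 1 / (real m + 1)" for m
 proof -
 have "EX r:D ` K. r < d + 1 / (real m + 1)"
 by (rule cInf_lessD) (use zero in \<open>auto simp: d_def\<close>)
 then show ?thesis by auto
 qed
 then obtain g where gK: "!!m. g m : K" and gD: "!!m. D (g m) < d + 1 / (real m + 1)" by metis
 have par: "nsq (%i. g m i - g l i) <= 2 / (real m + 1) + 2 / (real l + 1)" for m l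
 proof -
 \<comment> \<open>The midpoint stays in the cone, so the parallelogram law makes the minimizing
   sequence Cauchy.\<close>
 define c where "c i = cr (1/2) * g m i + cr (1/2) * g l i" for i
 have "c : K" unfolding c_def by (intro add scale gK) auto
 have par0: "(cmod (a - b))\<^sup>2 = 2 * (cmod (a - p))\<^sup>2 + 2 * (cmod (b - p))\<^sup>2
 - 4 * (cmod (cr (1/2) * a + cr (1/2) * b - p))\<^sup>2" for a b p
 unfolding cmod_power2 by (simp add: power2_eq_square field_simps)
 have "nsq (%i. g m i - g l i) = (\<Sum>i\<in>I. 2 * (cmod (g m i - Phi i))\<^sup>2
 + 2 * (cmod (g l i - Phi i))\<^sup>2 - 4 * (cmod (c i - Phi i))\<^sup>2)"
 unfolding nsq_def c_def by (rule sum.cong[OF refl par0])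
 also have "... = 2 * D (g m) + 2 * D (g l) - 4 * D c"
 unfolding D_def nsq_def by (simp only: sum.distrib sum_subtractf sum_distrib_left)
 finally have "nsq (%i. g m i - g l i) = 2 * D (g m) + 2 * D (g l) - 4 * D c" .
 moreover have "2 / x = 2 * (1 / x)" for x :: real by simp
 ultimately show ?thesis using gD[of m] gD[of l] dle[OF \<open>c : K\<close>] by linarith
 qed
 have inv0: "(%m. 4 / (real m + 1)) ----> 0"
 using tendsto_mult_right_zero[OF LIMSEQ_inverse_real_of_nat, of 4] by (simp add: field_simps)
 have "Cauchy (%m. g m i)" if i: "i : I" for i
 proof (rule metric_CauchyI)
 fix r :: real assume r: "r > 0"
 then have "r\<^sup>2 > 0" by simp
 from order_tendstoD(2)[OF inv0 this] obtain N where N: "4 / (real N + 1) < r\<^sup>2"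
 by (auto simp: eventually_sequentially)
 have "dist (g m i) (g l i) < r" if "m >= N" "l >= N" for m l
 proof -
 have "2 / (real m + 1) <= 2 / (real N + 1)" "2 / (real l + 1) <= 2 / (real N + 1)"
 using that by (simp_all add: frac_le)
 moreover have "(cmod (g m i - g l i))\<^sup>2 <= nsq (%i. g m i - g l i)"
 unfolding nsq_def using i I
 by (intro member_le_sum[of i I "%i. (cmod (g m i - g l i))\<^sup>2"]) auto
 ultimately have "(cmod (g m i - g l i))\<^sup>2 < r\<^sup>2" using par[of m l] N by simp
 then show ?thesis using r by (simp add: dist_norm power2_less_imp_less)
 qed
 then show "EX N. ALL m>=N. ALL l>=N. dist (g m i) (g l i) < r" by blast
 qed
 then have "EX l. (%m. g m i) ----> l" if "i : I" for i
 using that Cauchy_convergent convergent_def by metis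
 then obtain q where q: "!!i. i : I ==> (%m. g m i) ----> q i" by metis
 define h where "h i = q i - Phi i" for i
 \<comment> \<open>The competitors g m + t u m lie in K while q and s are only limits; the distance
   bound passes to the limit.\<close>
 have far_q: "d <= nsq (%i. h i + cr t * s i)"
 if lim: "!!i. i : I ==> (%m. u m i) ----> s i" and K: "!!m. (%i. g m i + cr t * u m i) : K"
 for t u s
 proof -
 have "(%m. D (%i. g m i + cr t * u m i))
 ----> nsq (%i. (q i + cr t * s i) - Phi i)"
 unfolding D_def nsq_def by (intro tendsto_intros q lim) 
 then have "d <= nsq (%i. (q i + cr t * s i) - Phi i)"
 by (rule LIMSEQ_le_const) (use dle K in blast)
 then show ?thesis by (simp add: h_def algebra_simps)
 qed
 have hd: "nsq h = d"
 proof -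
 have "(%m. D (g m)) ----> nsq h"
 unfolding D_def nsq_def h_def by (intro tendsto_intros q)
 moreover have "(%m. D (g m)) ----> d"
 proof (rule tendsto_sandwich[OF _ _ tendsto_const])
 show "(%m. d + 1 / (real m + 1)) ----> d"
 using tendsto_add[OF tendsto_const LIMSEQ_inverse_real_of_nat, of d] by (simp add: field_simps)
 qed (use dle gK gD in \<open>simp_all add: less_imp_le\<close>)
 ultimately show ?thesis by (rule LIMSEQ_unique)
 qed
 have small: "0 <= a" if "!!t::real. 0 < t ==> t < 1 ==> 0 <= 2 * t * a + t\<^sup>2 * b" for a b :: real
 proof -
 have "0 <= 2 * a + t * b" if t: "0 < t" "t < 1" for t
 proof -
 have "0 <= t * (2 * a + t * b)" using \<open>!!t::real. 0 < t ==> t < 1 ==> _\<close>[OF t]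
 by (simp add: power2_eq_square algebra_simps)
 then show ?thesis using t by (simp add: zero_le_mult_iff)
 qed
 moreover have "((%t. 2 * a + t * b) \<longlongrightarrow> 2 * a + 0 * b) (at_right 0)"
 by (intro tendsto_add tendsto_mult tendsto_const tendsto_ident_at)
 moreover have "\<forall>\<^sub>F t in at_right 0. (0::real) < t & t < 1"
 using eventually_at_right_less[of "0::real"] eventually_at_right_real[of 0 "1::real"]
 by (auto elim: eventually_elim2)
 ultimately have "0 <= 2 * a + 0 * b"
 by (intro tendsto_lowerbound[where F = "at_right (0::real)" and f = "%t. 2 * a + t * b"])
 (auto elim: eventually_mono)
 then show ?thesis by simp
 qed
 have pos: "0 <= ip h s" if s: "s : K" for s
 proof (rule small)
 fix t :: real assume "0 < t"
 then have "d <= nsq (%i. h i + cr t * s i)"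
 proof (intro far_q[of "%_. s"])
 fix m show "(%i. g m i + cr t * s i) : K"
 by (rule add[OF gK scale[OF s]]) (use \<open>0 < t\<close> in simp)
 qed simp
 then show "0 <= 2 * t * ip h s + t\<^sup>2 * nsq s" by (simp add: expand hd)
 qed
 \<comment> \<open>The direction -q is admissible for t < 1, because (1 - t) g m is still in the
   cone.\<close>
 have "0 <= - ip h q"
 proof (rule small)
 fix t :: real assume t: "0 < t" "t < 1"
 have "d <= nsq (%i. h i + cr (- t) * q i)"
 proof (rule far_q[of g])
 fix m
 have "(%i. cr (1 - t) * g m i) : K" using t by (intro scale gK) auto
 then show "(%i. g m i + cr (- t) * g m i) : K" by (simp add: algebra_simps)
 qed (rule q)
 then show "0 <= 2 * t * - ip h q + t\<^sup>2 * nsq q" by (simp only: expand hd) simp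
 qed
 moreover have "ip h Phi = ip h q - nsq h"
 proof -
 have "Re (cnj (h i) * Phi i) = Re (cnj (h i) * q i) - (cmod (h i))\<^sup>2" for i
 unfolding cmod_power2 by (simp add: h_def power2_eq_square algebra_simps)
 then show ?thesis unfolding ip_def nsq_def by (simp only: Re_sum sum_subtractf)
 qed
 ultimately have "ip h Phi < 0" using hd d0 by simp
 then show ?thesis using that[of "%i. cnj (h i)"] pos unfolding ip_def by blast
qed

subsection \<open>Positive matrices, projections and isometries\<close>

text \<open>Let t = ||Y||. The form at v - Y v / t gives ||Y v||^2 \<le> t <Y v, v>, and this is
  what ||(t - Y) v|| \<le> t ||v|| requires once the square is expanded.\<close>

lemma mat_pos_if_form_nonneg:
 assumes Y: "Y : CM k k" "adj Y = Y"
 and form: "!!v. v : CV k ==> 0 <= Re (cinner (Y *! v) v)"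
 shows "unital_cstar_algebra.pos (matrix_cstar k) Y"
proof -
 interpret M: unital_cstar_algebra "matrix_cstar k" by (rule unital_cstar_algebra_matrix)
 let ?t = "opn Y"
 have t0: "?t >= 0" by (rule opn_nonneg[OF Y(1)])
 have bound: "(nm2 (Y *! v))\<^sup>2 <= ?t * Re (cinner (Y *! v) v)" if v: "v : CV k" for v
 proof (cases "?t = 0")
 case True
 then show ?thesis using nrm_mult_le[OF Y(1) v] nrm_nonneg[of "Y *! v"] by simp
 next
 case False
 then have t: "?t > 0" using t0 by simp
 let ?s = "cr (1 / ?t)"
 let ?w = "Y *! v"
 have w: "?w : CV k" "Y *! ?w : CV k" using Y v by auto
 have sw: "?s \<cdot>\<^sub>v ?w : CV k" using w by simp
 have Yd: "Y *! (v - ?s \<cdot>\<^sub>v ?w) = ?w - ?s \<cdot>\<^sub>v (Y *! ?w)"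
 using Y v w sw by (simp add: mult_minus_distrib_mat_vec mult_mat_vec)
 have nw: "Re (cinner ?w ?w) = (nm2 ?w)\<^sup>2" by (simp add: nrm_Re)
 have Ywv: "cinner (Y *! ?w) v = cinner ?w ?w"
 using cinner_adjoint[OF Y(1) w(1) v] Y(2) by simp
 have "Re (cinner (Y *! ?w) ?w) <= ?t * (nm2 ?w)\<^sup>2"
 using cmod_cinner_le[OF Y(1) w(1) w(1)] complex_Re_le_cmod[of "cinner (Y *! ?w) ?w"]
 by (simp add: power2_eq_square mult.assoc)
 moreover have "0 <= Re (cinner ?w v) - 2 * (1 / ?t) * (nm2 ?w)\<^sup>2
 + (1 / ?t)\<^sup>2 * Re (cinner (Y *! ?w) ?w)"
 proof -
 have "cinner (?w - ?s \<cdot>\<^sub>v (Y *! ?w)) (v - ?s \<cdot>\<^sub>v ?w)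
 = cinner ?w v - ?s * cinner ?w ?w - ?s * cinner ?w ?w + ?s * ?s * cinner (Y *! ?w) ?w"
 using v w sw Ywv
 by (simp add: cinner_diff_left[of _ k] cinner_diff_right[of _ k] cinner_smult_left[of _ k]
 cinner_smult_right[of _ k] algebra_simps)
 moreover have "0 <= Re (cinner (?w - ?s \<cdot>\<^sub>v (Y *! ?w)) (v - ?s \<cdot>\<^sub>v ?w))"
 using form[OF minus_carrier_vec[OF v sw]] unfolding Yd .
 moreover have "Re (?s * ?s * z) = (1 / ?t)\<^sup>2 * Re z" "Re (?s * z) = (1 / ?t) * Re z" for z
 by (simp_all add: power2_eq_square flip: of_real_mult of_real_divide)
 ultimately show ?thesis by (simp add: nw)
 qed
 ultimately have "0 <= Re (cinner ?w v) - 2 * (1 / ?t) * (nm2 ?w)\<^sup>2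
 + (1 / ?t)\<^sup>2 * (?t * (nm2 ?w)\<^sup>2)"
 using mult_left_mono[of "Re (cinner (Y *! ?w) ?w)" "?t * (nm2 ?w)\<^sup>2" "(1 / ?t)\<^sup>2"] by simp
 then have "(nm2 ?w)\<^sup>2 / ?t <= Re (cinner ?w v)" using t by (simp add: power2_eq_square field_simps)
 then show ?thesis using t by (simp add: field_simps)
 qed
 have "opn (cr ?t \<cdot>\<^sub>m 1\<^sub>m k - Y) <= ?t"
 proof (rule opn_le[of _ k k])
 fix v :: "complex vec" assume v: "v : CV k"
 let ?c = "cr ?t" and ?w = "Y *! v"
 have w: "?w : CV k" using Y v by auto
 have e: "(?c \<cdot>\<^sub>m 1\<^sub>m k - Y) *! v = ?c \<cdot>\<^sub>v v - ?w"
 proof -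
 have "(?c \<cdot>\<^sub>m 1\<^sub>m k) *! v = ?c \<cdot>\<^sub>v v"
 using v by (intro eq_vecI) (auto simp: smult_scalar_prod_distrib[of _ k])
 then show ?thesis using Y v by (simp add: minus_mult_distrib_mat_vec[of _ k k])
 qed
 have "cinner v ?w = cinner ?w v" using cinner_adjoint[OF Y(1) v v] Y(2) by simp
 then have "cinner (?c \<cdot>\<^sub>v v - ?w) (?c \<cdot>\<^sub>v v - ?w)
 = ?c * ?c * cinner v v - 2 * ?c * cinner ?w v + cinner ?w ?w"
 using v w by (simp add: cinner_diff_left[of _ k] cinner_diff_right[of _ k] cinner_smult_left[of _ k]
 cinner_smult_right[of _ k] algebra_simps)
 then have "(nm2 (?c \<cdot>\<^sub>v v - ?w))\<^sup>2 = ?t\<^sup>2 * (nm2 v)\<^sup>2 - 2 * ?t * Re (cinner ?w v) + (nm2 ?w)\<^sup>2"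
 unfolding nrm_Re by (simp add: power2_eq_square)
 also have "... <= ?t\<^sup>2 * (nm2 v)\<^sup>2"
 using bound[OF v] mult_nonneg_nonneg[OF t0 form[OF v]] by simp
 finally have "(nm2 (?c \<cdot>\<^sub>v v - ?w))\<^sup>2 <= (?t * nm2 v)\<^sup>2" by (simp add: power_mult_distrib)
 then show "nm2 ((?c \<cdot>\<^sub>m 1\<^sub>m k - Y) *! v) <= ?t * nm2 v"
 unfolding e by (rule power2_le_imp_le) (simp add: t0)
 qed (use Y t0 in auto)
 moreover have "M.real_scalar ?t -[matrix_cstar k] Y = cr ?t \<cdot>\<^sub>m 1\<^sub>m k - Y"
 using Y by (subst M.minus_eq) (auto intro!: eq_matI)
 ultimately show ?thesis
 by (intro M.posI[of _ ?t]) (use Y t0 in auto)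
qed

definition hcat :: "complex mat => complex mat => complex mat" where
 "hcat A B = mat (dim_row A) (dim_col A + dim_col B)
 (%(i,j). if j < dim_col A then A $$ (i,j) else B $$ (i, j - dim_col A))"

lemma hcat_carrier: "A : CM k q ==> B : CM k r ==> hcat A B : CM k (q + r)"
 by (auto simp: hcat_def)

lemma sum_lessThan_add:
 fixes n :: nat
 shows "(\<Sum>l<m + n. f l) = (\<Sum>l<m. f l) + (\<Sum>l<n. f (m + l) :: 'a :: comm_monoid_add)"
 by (induction n) (simp_all add: add.assoc)

lemma index_mult_adjoint:
 "A : CM m n ==> B : CM k n ==> i < m ==> j < k ==>
 (A * adj B) $$ (i,j) = (\<Sum>l<n. A $$ (i,l) * cnj (B $$ (j,l)))"
 by (simp add: scalar_prod_def atLeast0LessThan)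

lemma index_adjoint_mult:
 "A : CM n m ==> B : CM n k ==> i < m ==> j < k ==>
 (adj A * B) $$ (i,j) = (\<Sum>l<n. cnj (A $$ (l,i)) * B $$ (l,j))"
 by (simp add: scalar_prod_def atLeast0LessThan)

lemma hcat_mult_adjoint:
 assumes A: "A : CM k q" and B: "B : CM k r"
 shows "hcat A B * adj (hcat A B) = A * adj A + B * adj B"
proof (rule eq_matI)
 fix i j assume "i < dim_row (A * adj A + B * adj B)"
 "j < dim_col (A * adj A + B * adj B)"
 then have ij: "i < k" "j < k" using assms by auto
 have "(hcat A B * adj (hcat A B)) $$ (i,j)
 = (\<Sum>l<q. A $$ (i,l) * cnj (A $$ (j,l))) + (\<Sum>l<r. B $$ (i,l) * cnj (B $$ (j,l)))"
 unfolding index_mult_adjoint[OF hcat_carrier[OF A B] hcat_carrier[OF A B] ij] sum_lessThan_add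
 using A B ij by (simp add: hcat_def)
 then show "(hcat A B * adj (hcat A B)) $$ (i,j) = (A * adj A + B * adj B) $$ (i,j)"
 using A B ij index_mult_adjoint[OF A A ij] index_mult_adjoint[OF B B ij] by simp
qed (use assms in \<open>simp_all add: hcat_def\<close>)

lemma hcat_isometry:
 assumes A: "A : CM k q" and B: "B : CM k r"
 and AA: "adj A * A = 1\<^sub>m q" and BB: "adj B * B = 1\<^sub>m r"
 and AB: "adj A * B = 0\<^sub>m q r"
 shows "adj (hcat A B) * hcat A B = 1\<^sub>m (q + r)"
proof (rule eq_matI)
 have BA: "adj B * A = 0\<^sub>m r q"
 using mat_adjoint_mult[OF mat_adjoint_carrier[OF A] B] by (simp add: AB)
 fix i j assume "i < dim_row (1\<^sub>m (q + r) :: complex mat)" "j < dim_col (1\<^sub>m (q + r) :: complex mat)"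
 then have ij: "i < q + r" "j < q + r" by auto
 have *: "(adj (hcat A B) * hcat A B) $$ (i,j)
 = (\<Sum>l<k. cnj (if i < q then A $$ (l,i) else B $$ (l,i-q)) * (if j < q then A $$ (l,j) else B $$ (l,j-q)))"
 unfolding index_adjoint_mult[OF hcat_carrier[OF A B] hcat_carrier[OF A B] ij]
 using A B ij carrier_matD[OF A] by (intro sum.cong) (auto simp: hcat_def)
 show "(adj (hcat A B) * hcat A B) $$ (i,j) = 1\<^sub>m (q + r) $$ (i,j)"
 unfolding * using ij
 index_adjoint_mult[OF A A, of i j, symmetric] index_adjoint_mult[OF A B, of i "j - q", symmetric]
 index_adjoint_mult[OF B A, of "i - q" j, symmetric] index_adjoint_mult[OF B B, of "i - q" "j - q", symmetric]
 by (cases "i < q"; cases "j < q") (auto simp: AA BB AB BA)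
qed (use assms in \<open>simp_all add: hcat_def\<close>)

text \<open>The two products of W with its adjoint both have as trace the sum of the squared moduli
  of the entries of W.\<close>

lemma isometry_square:
 fixes W :: "complex mat"
 assumes W: "W : CM m n" "W * adj W = 1\<^sub>m m" "adj W * W = 1\<^sub>m n"
 shows "m = n"
proof -
 have "complex_of_nat m = (\<Sum>i<m. (W * adj W) $$ (i,i))" by (simp add: W)
 also have "... = (\<Sum>i<m. \<Sum>l<n. W $$ (i,l) * cnj (W $$ (i,l)))"
 by (intro sum.cong refl index_mult_adjoint[OF W(1) W(1)]) auto
 also have "... = (\<Sum>l<n. \<Sum>i<m. cnj (W $$ (i,l)) * W $$ (i,l))"
 by (subst sum.swap) (simp add: mult.commute)
 also have "... = (\<Sum>l<n. (adj W * W) $$ (l,l))"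
 by (intro sum.cong refl index_adjoint_mult[OF W(1) W(1), symmetric]) auto
 also have "... = complex_of_nat n" by (simp add: W)
 finally show ?thesis by simp
qed

text \<open>Split off unit vectors of the range; the trace bounds the number of steps.\<close>

lemma projection_decomposition:
 fixes p :: "complex mat"
 assumes "p : CM k k" "adj p = p" "p * p = p" "Re (\<Sum>i<k. p $$ (i,i)) <= real n"
 shows "EX q v. v : CM k q & adj v * v = 1\<^sub>m q & v * adj v = p"
 using assms
proof (induction n arbitrary: p)
 case (0 p)
 note p = 0(1-3)
 \<comment> \<open>The trace of a projection is the sum of the squared moduli of its entries, so
   trace at most 0 means p = 0.\<close>
 have diag: "p $$ (i,i) = (\<Sum>l<k. p $$ (i,l) * cnj (p $$ (i,l)))" if "i < k" for i
 using index_mult_adjoint[OF p(1) p(1) that that] p by simp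
 then have diag': "Re (p $$ (i,i)) = (\<Sum>l<k. (cmod (p $$ (i,l)))\<^sup>2)" if "i < k" for i
 proof -
 have "Re (z * cnj z) = (cmod z)\<^sup>2" for z
 unfolding cmod_power2 by (simp add: power2_eq_square)
 then show ?thesis unfolding diag[OF that] by (simp only: Re_sum)
 qed
 have "Re (\<Sum>i<k. p $$ (i,i)) = (\<Sum>i<k. \<Sum>l<k. (cmod (p $$ (i,l)))\<^sup>2)" using diag' by simp
 then have "(\<Sum>i<k. \<Sum>l<k. (cmod (p $$ (i,l)))\<^sup>2) = 0" using 0(4) by (simp add: sum_nonneg antisym)
 then have "p $$ (i,l) = 0" if "i < k" "l < k" for i l
 using that by (simp add: sum_nonneg_eq_0_iff sum_nonneg)
 then have "p = 0\<^sub>m k k" using p by (intro eq_matI) auto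
 moreover have "(0\<^sub>m k 0 :: complex mat) * adj (0\<^sub>m k 0) = 0\<^sub>m k k"
 by (rule eq_matI) (auto simp: scalar_prod_def)
 moreover have "adj (0\<^sub>m k 0 :: complex mat) * 0\<^sub>m k 0 = 1\<^sub>m 0" by (rule eq_matI) auto
 ultimately show ?case by (intro exI[of _ 0] exI[of _ "0\<^sub>m k 0"]) auto
next
 case (Suc n p)
 note p = Suc.prems(1-3)
 show ?case
 proof (cases "p = 0\<^sub>m k k")
 case True
 then have "Re (\<Sum>i<k. p $$ (i,i)) <= real n" by simp
 then show ?thesis by (rule Suc.IH[OF p])
 next
 case False
 have "EX i<k. EX j<k. p $$ (i,j) ~= 0"
 proof (rule ccontr)
 assume "\<not> ?thesis"
 then have "p = 0\<^sub>m k k" using p by (intro eq_matI) auto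
 then show False using False by simp
 qed
 then obtain i j where ij: "i < k" "j < k" "p $$ (i,j) ~= 0" by blast
 \<comment> \<open>A nonzero column of p lies in the range of p. H is its normalization, and
   subtracting the projection h onto H lowers the trace by one.\<close>
 define c where "c = sqrt (\<Sum>l<k. (cmod (p $$ (l,j)))\<^sup>2)"
 have "(cmod (p $$ (i,j)))\<^sup>2 <= (\<Sum>l<k. (cmod (p $$ (l,j)))\<^sup>2)"
 using ij by (intro member_le_sum[of i _ "%l. (cmod (p $$ (l,j)))\<^sup>2"]) auto
 moreover have "(cmod (p $$ (i,j)))\<^sup>2 > 0" using ij by simp
 ultimately have c2: "(\<Sum>l<k. (cmod (p $$ (l,j)))\<^sup>2) > 0" by linarith
 then have c0: "c > 0" "c\<^sup>2 = (\<Sum>l<k. (cmod (p $$ (l,j)))\<^sup>2)" by (simp_all add: c_def)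
 define H where "H = mat k 1 (%(l,_). p $$ (l,j) / cr c)"
 have H: "H : CM k 1" by (simp add: H_def)
 have HH: "adj H * H = 1\<^sub>m 1"
 proof (rule eq_matI)
 fix a b assume "a < dim_row (1\<^sub>m 1 :: complex mat)" "b < dim_col (1\<^sub>m 1 :: complex mat)"
 then have ab: "a = 0" "b = 0" by auto
 have "cnj (z / cr c) * (z / cr c) = cr ((cmod z)\<^sup>2 / c\<^sup>2)" for z
 unfolding of_real_divide complex_norm_square by (simp add: power2_eq_square mult.commute)
 then have "(adj H * H) $$ (0,0) = (\<Sum>l<k. cr ((cmod (p $$ (l,j)))\<^sup>2 / c\<^sup>2))"
 by (subst index_adjoint_mult[OF H H]) (simp_all only: H_def, simp_all)
 also have "... = cr ((\<Sum>l<k. (cmod (p $$ (l,j)))\<^sup>2) / c\<^sup>2)"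
 by (simp add: sum_divide_distrib)
 also have "... = 1" using c0 c2 by (simp del: of_real_sum of_real_power)
 finally show "(adj H * H) $$ (a,b) = 1\<^sub>m 1 $$ (a,b)" using ab by simp
 qed (use H in simp_all)
 have pH: "p * H = H"
 proof (rule eq_matI)
 fix a b assume "a < dim_row H" "b < dim_col H"
 then have ab: "a < k" "b = 0" using H by auto
 have "(p * H) $$ (a,0) = (\<Sum>l<k. p $$ (a,l) * p $$ (l,j)) / cr c"
 using p H ab by (simp add: scalar_prod_def atLeast0LessThan H_def sum_divide_distrib)
 also have "(\<Sum>l<k. p $$ (a,l) * p $$ (l,j)) = (p * p) $$ (a,j)"
 using p(1) ab ij by (simp add: scalar_prod_def atLeast0LessThan)
 finally show "(p * H) $$ (a,b) = H $$ (a,b)" using p ab by (simp add: H_def)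
 qed (use p H in auto)
 have Hp: "adj H * p = adj H"
 using mat_adjoint_mult[OF p(1) H] p pH by simp
 define h where "h = H * adj H"
 have h: "h : CM k k" "adj h = h"
 using H mat_adjoint_mult[OF H mat_adjoint_carrier[OF H]] by (auto simp: h_def)
 have hh: "h * h = h" "p * h = h" "h * p = h"
 proof -
 have aH: "adj H : CM 1 k" using H by simp
 have "h * h = H * ((adj H * H) * adj H)"
 unfolding h_def using H aH by (simp add: assoc_mult_mat[of _ k 1 _ k _ k] assoc_mult_mat[of _ 1 k _ 1 _ k])
 then show "h * h = h" unfolding HH using left_mult_one_mat[OF aH] by (simp add: h_def)
 show "p * h = h" unfolding h_def using p(1) H aH pH by (simp add: assoc_mult_mat[of _ k k _ 1 _ k, symmetric])
 show "h * p = h" unfolding h_def using p(1) H aH Hp by (simp add: assoc_mult_mat[of _ k 1 _ k _ k])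
 qed
 let ?p = "p - h"
 have p': "?p : CM k k" "adj ?p = ?p" "?p * ?p = ?p"
 proof -
 show "?p : CM k k" using h by (simp add: minus_carrier_mat)
 show "adj ?p = ?p" using mat_adjoint_minus[OF p(1) h(1)] p h by simp
 have "?p * ?p = (p * p - h * p) - (p * h - h * h)"
 using p(1) h(1) minus_carrier_mat[OF h(1), of p]
 by (simp add: minus_mult_distrib_mat[of _ k k] mult_minus_distrib_mat[of _ k k])
 then show "?p * ?p = ?p" unfolding hh p(3) using p(1) h(1) by (auto intro!: eq_matI)
 qed
 have "(\<Sum>i<k. h $$ (i,i)) = 1"
 proof -
 have "(\<Sum>i<k. h $$ (i,i)) = (\<Sum>i<k. \<Sum>l<1. H $$ (i,l) * cnj (H $$ (i,l)))"
 unfolding h_def by (intro sum.cong refl index_mult_adjoint[OF H H]) auto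
 also have "... = (adj H * H) $$ (0,0)"
 by (subst index_adjoint_mult[OF H H]) (auto simp: mult.commute)
 finally show ?thesis using HH by simp
 qed
 moreover have "(\<Sum>i<k. ?p $$ (i,i)) = (\<Sum>i<k. p $$ (i,i)) - (\<Sum>i<k. h $$ (i,i))"
 using p(1) h(1) by (simp add: sum_subtractf)
 ultimately have "Re (\<Sum>i<k. ?p $$ (i,i)) <= real n" using Suc.prems(4) by simp
 from Suc.IH[OF p' this] obtain q v where v: "v : CM k q" "adj v * v = 1\<^sub>m q"
 "v * adj v = ?p" by blast
 have av: "adj v : CM q k" using v by simp
 have "adj v * H = adj v * v * adj v * H"
 using v av H by (simp add: left_mult_one_mat[of _ q])
 also have "... = adj v * (v * adj v * H)"
 using v(1) av H by (simp add: assoc_mult_mat[of _ q k _ q _ k] assoc_mult_mat[of _ q k _ k _ 1]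
 assoc_mult_mat[of _ k q _ k _ 1])
 also have "v * adj v * H = 0\<^sub>m k 1"
 proof -
 have "h * H = H"
 proof -
 have "h * H = H * (adj H * H)" unfolding h_def using H by (intro assoc_mult_mat[of _ k 1 _ k _ 1]) auto
 then show ?thesis unfolding HH using H by simp
 qed
 then show ?thesis unfolding v(3) using p(1) h(1) H pH by (auto simp: minus_mult_distrib_mat[of _ k k _ _ 1])
 qed
 also have "adj v * 0\<^sub>m k 1 = 0\<^sub>m q 1" by (rule right_mult_zero_mat[OF av])
 finally have vH: "adj v * H = 0\<^sub>m q 1" .
 have "hcat v H * adj (hcat v H) = p"
 unfolding hcat_mult_adjoint[OF v(1) H] v(3) using p(1) h(1) unfolding h_def[symmetric]
 by (auto intro!: eq_matI)
 then show ?thesis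
 using hcat_carrier[OF v(1) H] hcat_isometry[OF v(1) H v(2) HH vH] by blast
 qed
qed

lemma projection_eq_isometry_mult_adjoint:
 fixes p :: "complex mat"
 assumes "p : CM k k" "adj p = p" "p * p = p"
 obtains q v where "v : CM k q" "adj v * v = 1\<^sub>m q" "v * adj v = p"
 using projection_decomposition[OF assms, of "nat \<lceil>Re (\<Sum>i<k. p $$ (i,i))\<rceil>"]
 by (meson order_trans real_nat_ceiling_ge)

text \<open>The projection 1 - E, with E the range projection of Om, is v v^* for an isometry v
  whose columns complete those of Om. Comparing traces gives N = r + q.\<close>

lemma isometry_extends_to_unitary:
 fixes Om :: "complex mat"
 assumes Om: "Om : CM N r" "adj Om * Om = 1\<^sub>m r"
 obtains W where "W : CM N N" "W * adj W = 1\<^sub>m N" "adj W * W = 1\<^sub>m N"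
 "r <= N" "!!i j. i < N ==> j < r ==> W $$ (i,j) = Om $$ (i,j)"
proof -
 have aOm: "adj Om : CM r N" using Om by simp
 define E where "E = Om * adj Om"
 have E: "E : CM N N" "adj E = E"
 using Om mat_adjoint_mult[OF Om(1) aOm] by (auto simp: E_def)
 have EOm: "E * Om = Om"
 proof -
 have "E * Om = Om * (adj Om * Om)"
 unfolding E_def by (rule assoc_mult_mat[OF Om(1) aOm Om(1)])
 then show ?thesis unfolding Om(2) using Om(1) by simp
 qed
 have oo: "E * E = E"
 proof -
 have "E * E = (E * Om) * adj Om"
 by (subst (2) E_def) (rule assoc_mult_mat[OF E(1) Om(1) aOm, symmetric])
 then show ?thesis unfolding EOm by (simp add: E_def)
 qed
 let ?p = "1\<^sub>m N - E"
 have p: "?p : CM N N" using E by (simp add: minus_carrier_mat)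
 have ps: "adj ?p = ?p" using mat_adjoint_minus[OF one_carrier_mat E(1)] E by simp
 have pp: "?p * ?p = ?p"
 proof -
 have "?p * ?p = (1\<^sub>m N - E) - (E - E * E)"
 using E(1) p by (simp add: minus_mult_distrib_mat[of _ N N] mult_minus_distrib_mat[OF E(1) one_carrier_mat E(1)])
 then show ?thesis unfolding oo using E(1) by (auto intro!: eq_matI)
 qed
 obtain q v where v: "v : CM N q" "adj v * v = 1\<^sub>m q" "v * adj v = ?p"
 by (rule projection_eq_isometry_mult_adjoint[OF p ps pp])
 have av: "adj v : CM q N" using v by simp
 have pv: "?p * v = v"
 proof -
 have "?p * v = v * (adj v * v)" unfolding v(3)[symmetric] by (rule assoc_mult_mat[OF v(1) av v(1)])
 then show ?thesis unfolding v(2) using v(1) by simp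
 qed
 have Omv: "adj Om * v = 0\<^sub>m r q"
 proof -
 have "adj Om * E = adj Om" using mat_adjoint_mult[OF E(1) Om(1)] E EOm by simp
 then have "adj Om * ?p = 0\<^sub>m r N"
 using mult_minus_distrib_mat[OF aOm one_carrier_mat E(1)] right_mult_one_mat[OF aOm] aOm
 by (auto intro!: eq_matI)
 then have "adj Om * (?p * v) = 0\<^sub>m r N * v" using assoc_mult_mat[OF aOm p v(1)] by simp
 then show ?thesis unfolding pv using v(1) by simp
 qed
 let ?W = "hcat Om v"
 have W: "?W : CM N (r + q)" by (rule hcat_carrier[OF Om(1) v(1)])
 have WW: "?W * adj ?W = 1\<^sub>m N"
 unfolding hcat_mult_adjoint[OF Om(1) v(1)] v(3) E_def[symmetric] using E(1) by (auto intro!: eq_matI)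
 have W'W: "adj ?W * ?W = 1\<^sub>m (r + q)" by (rule hcat_isometry[OF Om(1) v(1) Om(2) v(2) Omv])
 have N: "N = r + q" by (rule isometry_square[OF W WW W'W])
 have "?W $$ (i,j) = Om $$ (i,j)" if "i < N" "j < r" for i j
 using that Om(1) v(1) by (simp add: hcat_def)
 then show ?thesis using that[of ?W] W WW W'W N by simp
qed

subsection \<open>Compressions by families of partial isometries\<close>

lemma cinner_mat_eq:
 assumes A: "A : CM m n" "v : CV n" "w : CV m"
 shows "cinner (A *! v) w = (\<Sum>i<m. \<Sum>j<n. A $$ (i,j) * v $ j * cnj (w $ i))"
 using assms by (simp add: cinner_eq[of _ m] scalar_prod_def atLeast0LessThan sum_distrib_right)

lemma mat_eq_if_cinner_eq:
 assumes "A : CM m n" "B : CM m n"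
 and "!!v w. v : CV n ==> w : CV m ==> cinner (A *! v) w = cinner (B *! v) w"
 shows "A = B"
proof (rule eq_matI)
 fix i j assume "i < dim_row B" "j < dim_col B"
 then have ij: "i < m" "j < n" using assms(2) by auto
 show "A $$ (i,j) = B $$ (i,j)"
 using assms(3)[of "unit_vec n j" "unit_vec m i"] cinner_unit_vec[OF assms(1) ij]
 cinner_unit_vec[OF assms(2) ij] by simp
qed (use assms in auto)

lemma opn_le_if_cinner_le:
 assumes A: "A : CM m n" and c: "c >= 0"
 and le: "!!v w. v : CV n ==> w : CV m ==>
 cmod (cinner (A *! v) w) <= c * nm2 v * nm2 w"
 shows "opn A <= c"
proof (rule opn_le[OF A c])
 fix v :: "complex vec" assume v: "v : CV n"
 have Av: "A *! v : CV m" using A v by auto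
 have "(nm2 (A *! v))\<^sup>2 <= cmod (cinner (A *! v) (A *! v))"
 unfolding nrm_Re by (rule complex_Re_le_cmod)
 also have "... <= c * nm2 v * nm2 (A *! v)" by (rule le[OF v Av])
 finally show "nm2 (A *! v) <= c * nm2 v"
 using nrm_nonneg[of "A *! v"] c nrm_nonneg[of v]
 by (cases "nm2 (A *! v) = 0") (auto simp: power2_eq_square)
qed

text \<open>The dimensions are arguments, so that the empty sum is a zero matrix of the intended
  size.\<close>

definition sum_mat :: "nat => nat => nat => (nat => complex mat) => complex mat" where
 "sum_mat m n T A = mat m n (%ij. \<Sum>t<T. A t $$ ij)"

lemma sum_mat_carrier [simp]: "sum_mat m n T A : CM m n"
 by (simp add: sum_mat_def)

lemma cinner_sum_mat:
 assumes A: "!!t. t < T ==> A t : CM m n" and v: "v : CV n" "w : CV m"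
 shows "cinner (sum_mat m n T A *! v) w = (\<Sum>t<T. cinner (A t *! v) w)"
proof -
 have "cinner (sum_mat m n T A *! v) w = (\<Sum>i<m. \<Sum>j<n. \<Sum>t<T. A t $$ (i,j) * v $ j * cnj (w $ i))"
 unfolding cinner_mat_eq[OF sum_mat_carrier v] by (simp add: sum_mat_def sum_distrib_right)
 also have "... = (\<Sum>i<m. \<Sum>t<T. \<Sum>j<n. A t $$ (i,j) * v $ j * cnj (w $ i))"
 by (intro sum.cong refl sum.swap)
 also have "... = (\<Sum>t<T. \<Sum>i<m. \<Sum>j<n. A t $$ (i,j) * v $ j * cnj (w $ i))" by (rule sum.swap)
 also have "... = (\<Sum>t<T. cinner (A t *! v) w)"
 by (intro sum.cong refl cinner_mat_eq[symmetric] A v) simp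
 finally show ?thesis .
qed

definition compress :: "nat => nat => (nat => complex mat) => (nat => complex mat) => complex mat" where
 "compress N T Z X = sum_mat N N T (%t. adj (Z t) * (X t * Z t))"

text \<open>Up to a unitary, a resolution is the decomposition of \<open>\<complex>\<^sup>N\<close> as the orthogonal sum
  of the spaces \<open>\<complex>\<^bsup>k t\<^esup>\<close>.\<close>

definition resolution :: "(nat => nat) => nat => nat => (nat => complex mat) => bool" where
 "resolution k N T Z \<longleftrightarrow> (ALL t<T. Z t : CM (k t) N) &
 (ALL t<T. ALL s<T. Z t * adj (Z s) = (if t = s then 1\<^sub>m (k t) else 0\<^sub>m (k t) (k s))) &
 (ALL v:CV N. ALL w:CV N. (\<Sum>t<T. cinner (Z t *! v) (Z t *! w)) = cinner v w)"

lemma compress_carrier [simp]: "compress N T Z X : CM N N"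
 by (simp add: compress_def)

lemma cinner_compress:
 assumes Z: "!!t. t < T ==> Z t : CM (k t) N" and X: "!!t. t < T ==> X t : CM (k t) (k t)"
 and v: "v : CV N" "w : CV N"
 shows "cinner (compress N T Z X *! v) w = (\<Sum>t<T. cinner (X t *! (Z t *! v)) (Z t *! w))"
proof -
 have "adj (Z t) * (X t * Z t) : CM N N" if "t < T" for t
 using Z[OF that] X[OF that] by (intro mult_carrier_mat[of _ N "k t"]) auto
 then have "cinner (compress N T Z X *! v) w = (\<Sum>t<T. cinner ((adj (Z t) * (X t * Z t)) *! v) w)"
 unfolding compress_def by (rule cinner_sum_mat[OF _ v])
 also have "... = (\<Sum>t<T. cinner (X t *! (Z t *! v)) (Z t *! w))"
 proof (rule sum.cong[OF refl])
 fix t assume "t : {..<T}"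
 then have t: "t < T" by simp
 have az: "adj (Z t) : CM N (k t)" using Z[OF t] by simp
 have xz: "X t * Z t : CM (k t) N" using Z[OF t] X[OF t] by simp
 have xzv: "(X t * Z t) *! v : CV (k t)" using xz v by auto
 have "(adj (Z t) * (X t * Z t)) *! v = adj (Z t) *! ((X t * Z t) *! v)"
 by (rule assoc_mult_mat_vec[OF az xz v(1)])
 moreover have "(X t * Z t) *! v = X t *! (Z t *! v)" by (rule assoc_mult_mat_vec[OF X[OF t] Z[OF t] v(1)])
 ultimately show "cinner ((adj (Z t) * (X t * Z t)) *! v) w = cinner (X t *! (Z t *! v)) (Z t *! w)"
 using cinner_adjoint[OF az xzv v(2)] by simp
 qed
 finally show ?thesis .
qed

context
 fixes k N T Z assumes res: "resolution k N T Z"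
begin

lemma resolution_carrier: "t < T ==> Z t : CM (k t) N"
 using res by (simp add: resolution_def)

lemma resolution_vec: "t < T ==> v : CV N ==> Z t *! v : CV (k t)"
 by (rule mult_mat_vec_carrier[OF resolution_carrier])

lemma cinner_compress_resolution:
 assumes "!!t. t < T ==> X t : CM (k t) (k t)" "v : CV N" "w : CV N"
 shows "cinner (compress N T Z X *! v) w = (\<Sum>t<T. cinner (X t *! (Z t *! v)) (Z t *! w))"
 by (rule cinner_compress[OF resolution_carrier assms])

lemma resolution_sum:
 "v : CV N ==> w : CV N ==> (\<Sum>t<T. cinner (Z t *! v) (Z t *! w)) = cinner v w"
 using res by (simp add: resolution_def)

lemma resolution_norm: assumes v: "v : CV N"
 shows "(\<Sum>t<T. (nm2 (Z t *! v))\<^sup>2) = (nm2 v)\<^sup>2"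
 unfolding nrm_Re using resolution_sum[OF v v] by (simp flip: Re_sum)

text \<open>Cauchy-Schwarz over the summands, since the squared norms of the components Z_t v add up
  to that of v.\<close>

lemma compress_norm_le:
 assumes X: "!!t. t < T ==> X t : CM (k t) (k t)" and c: "c >= 0" "!!t. t < T ==> opn (X t) <= c"
 shows "opn (compress N T Z X) <= c"
proof (rule opn_le_if_cinner_le[OF compress_carrier c(1)])
 fix v w :: "complex vec" assume v: "v : CV N" and w: "w : CV N"
 have e: "cinner (compress N T Z X *! v) w = (\<Sum>t<T. cinner (X t *! (Z t *! v)) (Z t *! w))"
 by (rule cinner_compress_resolution[OF X v w])
 have "cmod (cinner (compress N T Z X *! v) w)
 <= (\<Sum>t<T. cmod (cinner (X t *! (Z t *! v)) (Z t *! w)))"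
 unfolding e by (rule norm_sum)
 also have "... <= (\<Sum>t<T. c * (\<bar>nm2 (Z t *! v)\<bar> * \<bar>nm2 (Z t *! w)\<bar>))"
 proof (rule sum_mono)
 fix t assume "t : {..<T}"
 then have t: "t < T" by simp
 have "cmod (cinner (X t *! (Z t *! v)) (Z t *! w))
 <= opn (X t) * (nm2 (Z t *! v) * nm2 (Z t *! w))"
 using cmod_cinner_le[OF X[OF t] resolution_vec[OF t v] resolution_vec[OF t w]] by (simp add: mult.assoc)
 also have "... <= c * (nm2 (Z t *! v) * nm2 (Z t *! w))"
 by (intro mult_right_mono c(2) t) auto
 finally show "cmod (cinner (X t *! (Z t *! v)) (Z t *! w))
 <= c * (\<bar>nm2 (Z t *! v)\<bar> * \<bar>nm2 (Z t *! w)\<bar>)" by simp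
 qed
 also have "... <= c * (L2_set (%t. nm2 (Z t *! v)) {..<T} * L2_set (%t. nm2 (Z t *! w)) {..<T})"
 unfolding sum_distrib_left[symmetric] by (intro mult_left_mono c(1) L2_set_mult_ineq)
 also have "... = c * nm2 v * nm2 w"
 unfolding L2_set_def resolution_norm[OF v] resolution_norm[OF w] by simp
 finally show "cmod (cinner (compress N T Z X *! v) w) <= c * nm2 v * nm2 w" .
qed

text \<open>Orthogonality of the Z_t singles out one summand: on the t-th component the compression
  acts as X_t. Multiplicativity of \<open>compress\<close> rests on this.\<close>

lemma resolution_compress_vec:
 assumes X: "!!t. t < T ==> X t : CM (k t) (k t)" and t: "t < T" and v: "v : CV N"
 shows "Z t *! (compress N T Z X *! v) = X t *! (Z t *! v)"
proof -
 have ZC: "Z t * compress N T Z X : CM (k t) N"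
 using resolution_carrier[OF t] by (intro mult_carrier_mat[OF _ compress_carrier])
 have XZ: "X t * Z t : CM (k t) N" using resolution_carrier[OF t] X[OF t] by simp
 have "Z t * compress N T Z X = X t * Z t"
 proof (rule mat_eq_if_cinner_eq[OF ZC XZ])
 fix v w :: "complex vec" assume v: "v : CV N" and w: "w : CV (k t)"
 have az: "adj (Z t) : CM N (k t)" using resolution_carrier[OF t] by simp
 have azw: "adj (Z t) *! w : CV N" using az w by auto
 have Cv: "compress N T Z X *! v : CV N" using compress_carrier v by (rule mult_mat_vec_carrier)
 have "cinner ((Z t * compress N T Z X) *! v) w = cinner (compress N T Z X *! v) (adj (Z t) *! w)"
 using cinner_adjoint[OF resolution_carrier[OF t] Cv w]
 assoc_mult_mat_vec[OF resolution_carrier[OF t] compress_carrier v] by simp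
 also have "... = (\<Sum>s<T. cinner (X s *! (Z s *! v)) (Z s *! (adj (Z t) *! w)))"
 by (rule cinner_compress[OF resolution_carrier X v azw])
 also have "... = (\<Sum>s<T. if s = t then cinner (X t *! (Z t *! v)) w else 0)"
 proof (rule sum.cong[OF refl])
 fix s assume "s : {..<T}"
 then have s: "s < T" by simp
 have "Z s *! (adj (Z t) *! w) = (Z s * adj (Z t)) *! w"
 by (rule assoc_mult_mat_vec[OF resolution_carrier[OF s] az w, symmetric])
 also have "Z s * adj (Z t) = (if s = t then 1\<^sub>m (k s) else 0\<^sub>m (k s) (k t))"
 using res s t by (simp add: resolution_def)
 finally have e: "Z s *! (adj (Z t) *! w) = (if s = t then w else 0\<^sub>v (k s))"
 using w by auto
 have "X s *! (Z s *! v) : CV (k s)" using X[OF s] resolution_vec[OF s v] by auto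
 then show "cinner (X s *! (Z s *! v)) (Z s *! (adj (Z t) *! w))
 = (if s = t then cinner (X t *! (Z t *! v)) w else 0)"
 unfolding e by (auto simp: cinner_eq[of _ "k s"])
 qed
 also have "... = cinner (X t *! (Z t *! v)) w" using t by simp
 also have "... = cinner ((X t * Z t) *! v) w"
 using assoc_mult_mat_vec[OF X[OF t] resolution_carrier[OF t] v] by simp
 finally show "cinner ((Z t * compress N T Z X) *! v) w = cinner ((X t * Z t) *! v) w" .
 qed
 then show ?thesis
 using assoc_mult_mat_vec[OF resolution_carrier[OF t] compress_carrier v]
 assoc_mult_mat_vec[OF X[OF t] resolution_carrier[OF t] v] by metis
qed

lemma compress_mult:
 assumes X: "!!t. t < T ==> X t : CM (k t) (k t)" and Y: "!!t. t < T ==> Y t : CM (k t) (k t)"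
 shows "compress N T Z (%t. X t * Y t) = compress N T Z X * compress N T Z Y"
proof (rule mat_eq_if_cinner_eq)
 fix v w :: "complex vec" assume v: "v : CV N" and w: "w : CV N"
 have XY: "X t * Y t : CM (k t) (k t)" if "t < T" for t using X[OF that] Y[OF that] by simp
 have Cv: "compress N T Z Y *! v : CV N" using compress_carrier v by (rule mult_mat_vec_carrier)
 have "cinner ((compress N T Z X * compress N T Z Y) *! v) w
 = (\<Sum>t<T. cinner (X t *! (Z t *! (compress N T Z Y *! v))) (Z t *! w))"
 using cinner_compress[OF resolution_carrier X Cv w] assoc_mult_mat_vec[OF compress_carrier compress_carrier v] by simp
 also have "... = (\<Sum>t<T. cinner ((X t * Y t) *! (Z t *! v)) (Z t *! w))"
 using v assoc_mult_mat_vec[OF X Y resolution_vec[OF _ v]] by (simp add: resolution_compress_vec[OF Y])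
 also have "... = cinner (compress N T Z (%t. X t * Y t) *! v) w"
 by (rule cinner_compress[OF resolution_carrier XY v w, symmetric])
 finally show "cinner (compress N T Z (%t. X t * Y t) *! v) w
 = cinner ((compress N T Z X * compress N T Z Y) *! v) w" by simp
qed (auto intro: mult_carrier_mat[OF compress_carrier compress_carrier])

lemma compress_add:
 assumes X: "!!t. t < T ==> X t : CM (k t) (k t)" and Y: "!!t. t < T ==> Y t : CM (k t) (k t)"
 shows "compress N T Z (%t. X t + Y t) = compress N T Z X + compress N T Z Y"
proof (rule mat_eq_if_cinner_eq)
 fix v w :: "complex vec" assume v: "v : CV N" and w: "w : CV N"
 have XY: "X t + Y t : CM (k t) (k t)" if "t < T" for t using X[OF that] Y[OF that] by simp
 note Cv = mult_mat_vec_carrier[OF compress_carrier v]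
 have "cinner ((X t + Y t) *! (Z t *! v)) (Z t *! w)
 = cinner (X t *! (Z t *! v)) (Z t *! w) + cinner (Y t *! (Z t *! v)) (Z t *! w)" if t: "t < T" for t
 unfolding add_mult_distrib_mat_vec[OF X[OF t] Y[OF t] resolution_vec[OF t v]]
 by (intro cinner_add_left[of _ "k t"] mult_mat_vec_carrier[OF X[OF t]] mult_mat_vec_carrier[OF Y[OF t]] resolution_vec t v w)
 moreover have "cinner (compress N T Z (%t. X t + Y t) *! v) w
 = (\<Sum>t<T. cinner ((X t + Y t) *! (Z t *! v)) (Z t *! w))"
 by (rule cinner_compress_resolution[OF XY v w])
 moreover have "cinner (compress N T Z X *! v) w = (\<Sum>t<T. cinner (X t *! (Z t *! v)) (Z t *! w))"
 by (rule cinner_compress_resolution[OF X v w])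
 moreover have "cinner (compress N T Z Y *! v) w = (\<Sum>t<T. cinner (Y t *! (Z t *! v)) (Z t *! w))"
 by (rule cinner_compress_resolution[OF Y v w])
 ultimately show "cinner (compress N T Z (%t. X t + Y t) *! v) w
 = cinner ((compress N T Z X + compress N T Z Y) *! v) w"
 unfolding add_mult_distrib_mat_vec[OF compress_carrier compress_carrier v] cinner_add_left[OF Cv Cv w]
 by (simp add: sum.distrib)
qed auto

lemma compress_smult:
 assumes X: "!!t. t < T ==> X t : CM (k t) (k t)"
 shows "compress N T Z (%t. c \<cdot>\<^sub>m X t) = c \<cdot>\<^sub>m compress N T Z X"
proof (rule eq_matI)
 have "adj (Z t) * (c \<cdot>\<^sub>m X t * Z t) = c \<cdot>\<^sub>m (adj (Z t) * (X t * Z t))" if t: "t < T" for t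
 using mult_smult_assoc_mat[OF X[OF t] resolution_carrier[OF t], of c]
 mult_smult_distrib[OF mat_adjoint_carrier[OF resolution_carrier[OF t]]
 mult_carrier_mat[OF X[OF t] resolution_carrier[OF t]], of c] by simp
 then have e: "(adj (Z t) * (c \<cdot>\<^sub>m X t * Z t)) $$ (i,j) = c * (adj (Z t) * (X t * Z t)) $$ (i,j)"
 if "t < T" "i < N" "j < N" for t i j
 using that X[OF that(1)] resolution_carrier[OF that(1)] by simp
 fix i j assume "i < dim_row (c \<cdot>\<^sub>m compress N T Z X)" "j < dim_col (c \<cdot>\<^sub>m compress N T Z X)"
 then have "i < N" "j < N" by (simp_all add: compress_def sum_mat_def)
 then show "compress N T Z (%t. c \<cdot>\<^sub>m X t) $$ (i,j) = (c \<cdot>\<^sub>m compress N T Z X) $$ (i,j)"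
 unfolding compress_def sum_mat_def by (simp add: e sum_distrib_left del: index_mult_mat)
qed (simp_all add: compress_def sum_mat_def)

lemma compress_one: "compress N T Z (%t. 1\<^sub>m (k t)) = 1\<^sub>m N"
proof (rule mat_eq_if_cinner_eq)
 fix v w :: "complex vec" assume v: "v : CV N" and w: "w : CV N"
 have "cinner (compress N T Z (%t. 1\<^sub>m (k t)) *! v) w = (\<Sum>t<T. cinner (Z t *! v) (Z t *! w))"
 by (subst cinner_compress_resolution[OF one_carrier_mat v w], intro sum.cong refl)
 (simp add: one_mult_mat_vec[OF resolution_vec[OF _ v]])
 then show "cinner (compress N T Z (%t. 1\<^sub>m (k t)) *! v) w = cinner (1\<^sub>m N *! v) w"
 using resolution_sum[OF v w] v by simp
qed auto

lemma compress_adjoint: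
 assumes X: "!!t. t < T ==> X t : CM (k t) (k t)"
 shows "compress N T Z (%t. adj (X t)) = adj (compress N T Z X)"
proof (rule mat_eq_if_cinner_eq)
 fix v w :: "complex vec" assume v: "v : CV N" and w: "w : CV N"
 have aX: "adj (X t) : CM (k t) (k t)" if "t < T" for t using X[OF that] by simp
 have "cinner (adj (X t) *! (Z t *! v)) (Z t *! w) = cnj (cinner (X t *! (Z t *! w)) (Z t *! v))"
 if t: "t < T" for t
 using cinner_adjoint[OF aX[OF t] resolution_vec[OF t v] resolution_vec[OF t w]]
 cinner_cnj[OF resolution_vec[OF t v] mult_mat_vec_carrier[OF X[OF t] resolution_vec[OF t w]]] by simp
 moreover have "cinner (compress N T Z (%t. adj (X t)) *! v) w
 = (\<Sum>t<T. cinner (adj (X t) *! (Z t *! v)) (Z t *! w))"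
 by (rule cinner_compress_resolution[OF aX v w])
 moreover have "cinner (compress N T Z X *! w) v = (\<Sum>t<T. cinner (X t *! (Z t *! w)) (Z t *! v))"
 by (rule cinner_compress_resolution[OF X w v])
 ultimately have "cinner (compress N T Z (%t. adj (X t)) *! v) w = cnj (cinner (compress N T Z X *! w) v)"
 by simp
 also have "... = cinner (adj (compress N T Z X) *! v) w"
 using cinner_adjoint[OF mat_adjoint_carrier[OF compress_carrier[of N T Z X]] v w]
 cinner_cnj[OF v mult_mat_vec_carrier[OF compress_carrier w, of T Z X]] by simp
 finally show "cinner (compress N T Z (%t. adj (X t)) *! v) w
 = cinner (adj (compress N T Z X) *! v) w" .
qed auto

end

text \<open>Stack the Om_t into one matrix with N rows. By hypothesis it is an isometry; extend it
  to a unitary W and cut W into row blocks again. The first r columns, which are the images of the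
  first unit vectors, are those of the Om_t.\<close>

lemma resolution_extending:
 fixes Om :: "nat => complex mat" and k :: "nat => nat"
 assumes Om: "!!t. t < T ==> Om t : CM (k t) r"
 and iso: "!!v w. v : CV r ==> w : CV r ==>
 (\<Sum>t<T. cinner (Om t *! v) (Om t *! w)) = cinner v w"
 and N: "N = (\<Sum>t<T. k t)"
 obtains Z where "resolution k N T Z" "r <= N"
 "!!t j. t < T ==> j < r ==> Z t *! unit_vec N j = Om t *! unit_vec r j"
proof -
 define off where "off t = (\<Sum>s<t. k s)" for t
 have off_Suc: "off (Suc t) = off t + k t" for t by (simp add: off_def)
 have off_mono: "off t <= off s" if "t <= s" for t s
 unfolding off_def using that by (intro sum_mono2) auto
 have off_lt: "off t + i < N" if "t < T" "i < k t" for t i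
 using off_mono[of "Suc t" T] that off_Suc[of t] by (simp add: N off_def)
 have sum_off: "(\<Sum>p<off t. g p) = (\<Sum>s<t. \<Sum>i<k s. g (off s + i))" for t and g :: "nat => complex"
 by (induction t) (simp_all add: off_Suc sum_lessThan_add off_def[of 0])
 have sum_N: "(\<Sum>p<N. g p) = (\<Sum>s<T. \<Sum>i<k s. g (off s + i))" for g :: "nat => complex"
 using sum_off[of g T] by (simp add: N off_def)
 have off_inj: "t = s & i = j" if "off t + i = off s + j" "i < k t" "j < k s" for t s i j
 proof -
 have "\<not> t < s" using off_mono[of "Suc t" s] off_Suc[of t] that by auto
 moreover have "\<not> s < t" using off_mono[of "Suc s" t] off_Suc[of s] that by auto
 ultimately show ?thesis using that by auto
 qed
 \<comment> \<open>The block containing row p; block t occupies the k t rows that start at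
   \<open>off t\<close>.\<close>
 define blk where "blk p = (LEAST t. p < off (Suc t))" for p
 have blk: "blk (off t + i) = t" if "i < k t" for t i
 unfolding blk_def
 proof (rule Least_equality)
 show "off t + i < off (Suc t)" using that off_Suc[of t] by simp
 fix s assume "off t + i < off (Suc s)"
 then show "t <= s" using off_mono[of "Suc s" t] by (meson le_add1 le_trans not_less not_less_eq_eq)
 qed
 define O' where "O' = mat N r (%(p,j). Om (blk p) $$ (p - off (blk p), j))"
 have O': "O' : CM N r" by (simp add: O'_def)
 have O'i: "O' $$ (off t + i, j) = Om t $$ (i,j)" if "t < T" "i < k t" "j < r" for t i j
 using that off_lt blk by (simp add: O'_def)
 have "adj O' * O' = 1\<^sub>m r"
 proof (rule eq_matI)
 fix i j assume "i < dim_row (1\<^sub>m r :: complex mat)" "j < dim_col (1\<^sub>m r :: complex mat)"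
 then have ij: "i < r" "j < r" by auto
 have "(adj O' * O') $$ (i,j) = (\<Sum>t<T. \<Sum>l<k t. cnj (Om t $$ (l,i)) * Om t $$ (l,j))"
 unfolding index_adjoint_mult[OF O' O' ij] sum_N using ij by (intro sum.cong) (simp_all add: O'i)
 also have "... = (\<Sum>t<T. cinner (Om t *! unit_vec r j) (Om t *! unit_vec r i))"
 proof (rule sum.cong[OF refl])
 fix t assume "t : {..<T}"
 then have t: "t < T" by simp
 have "Om t *! unit_vec r j = col (Om t) j" "Om t *! unit_vec r i = col (Om t) i"
 using Om[OF t] ij by (auto intro!: eq_vecI)
 then show "(\<Sum>l<k t. cnj (Om t $$ (l,i)) * Om t $$ (l,j))
 = cinner (Om t *! unit_vec r j) (Om t *! unit_vec r i)"
 using Om[OF t] ij by (simp add: cinner_eq[of _ "k t"] mult.commute)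
 qed
 also have "... = cinner (1\<^sub>m r *! unit_vec r j) (unit_vec r i)" using iso by simp
 also have "... = 1\<^sub>m r $$ (i,j)" by (rule cinner_unit_vec[OF one_carrier_mat ij])
 finally show "(adj O' * O') $$ (i,j) = 1\<^sub>m r $$ (i,j)" .
 qed (simp_all add: O'_def)
 then obtain W where W: "W : CM N N" "W * adj W = 1\<^sub>m N" "adj W * W = 1\<^sub>m N"
 "r <= N" "!!i j. i < N ==> j < r ==> W $$ (i,j) = O' $$ (i,j)"
 using isometry_extends_to_unitary[OF O'] by metis
 define Z where "Z t = mat (k t) N (%(i,j). W $$ (off t + i, j))" for t
 have Z: "Z t : CM (k t) N" for t by (simp add: Z_def)
 have Zv: "(Z t *! v) $ i = (W *! v) $ (off t + i)" if "t < T" "i < k t" "v : CV N" for t i v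
 using that W(1) off_lt by (simp add: Z_def scalar_prod_def)
 have "resolution k N T Z"
 unfolding resolution_def
 proof (intro conjI allI impI ballI Z)
 fix t s assume ts: "t < T" "s < T"
 show "Z t * adj (Z s) = (if t = s then 1\<^sub>m (k t) else 0\<^sub>m (k t) (k s))"
 proof (rule eq_matI)
 fix i j assume "i < dim_row (if t = s then 1\<^sub>m (k t) else 0\<^sub>m (k t) (k s) :: complex mat)"
 "j < dim_col (if t = s then 1\<^sub>m (k t) else 0\<^sub>m (k t) (k s) :: complex mat)"
 then have ij: "i < k t" "j < k s" by (auto split: if_splits)
 have "(Z t * adj (Z s)) $$ (i,j) = (\<Sum>l<N. W $$ (off t + i,l) * cnj (W $$ (off s + j,l)))"
 unfolding index_mult_adjoint[OF Z Z ij] using ij by (intro sum.cong) (simp_all add: Z_def)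
 also have "... = (W * adj W) $$ (off t + i, off s + j)"
 by (rule index_mult_adjoint[OF W(1) W(1), symmetric]) (use ts ij off_lt in auto)
 finally show "(Z t * adj (Z s)) $$ (i,j) = (if t = s then 1\<^sub>m (k t) else 0\<^sub>m (k t) (k s)) $$ (i,j)"
 unfolding W(2) using ts ij off_lt off_inj[of t i s j] by auto
 qed (simp_all add: Z_def)
 next
 fix v w :: "complex vec" assume v: "v : CV N" and w: "w : CV N"
 have Wv: "W *! v : CV N" "W *! w : CV N" using W(1) v w by auto
 have Zvc: "Z t *! w : CV (k t)" for t using Z w by (rule mult_mat_vec_carrier)
 have "(\<Sum>t<T. cinner (Z t *! v) (Z t *! w)) = cinner (W *! v) (W *! w)"
 unfolding cinner_eq[OF Wv(2)] sum_N
 by (intro sum.cong refl, subst cinner_eq[OF Zvc]) (use v w in \<open>simp add: Zv\<close>)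
 also have "... = cinner v ((adj W * W) *! w)"
 using cinner_adjoint[OF W(1) v Wv(2)] assoc_mult_mat_vec[OF mat_adjoint_carrier[OF W(1)] W(1) w] by simp
 finally show "(\<Sum>t<T. cinner (Z t *! v) (Z t *! w)) = cinner v w" unfolding W(3) using w by simp
 qed
 moreover have "Z t *! unit_vec N j = Om t *! unit_vec r j" if tj: "t < T" "j < r" for t j
 proof -
 have jN: "j < N" using tj W(4) by simp
 have "Z t *! unit_vec N j = col (Z t) j" using Z[of t] jN by (auto intro!: eq_vecI)
 moreover have "Om t *! unit_vec r j = col (Om t) j" using Om[OF tj(1)] tj by (auto intro!: eq_vecI)
 moreover have "col (Z t) j = col (Om t) j"
 using Om[OF tj(1)] tj jN off_lt W(5) by (intro eq_vecI) (simp_all add: Z_def O'i)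
 ultimately show ?thesis by simp
 qed
 ultimately show ?thesis using that[of Z] W(4) by blast
qed

lemma matrix_cstar_minus:
 assumes "X : CM k k" "Y : CM k k"
 shows "X -[matrix_cstar k] Y = X - Y"
proof -
 interpret M: unital_cstar_algebra "matrix_cstar k" by (rule unital_cstar_algebra_matrix)
 show ?thesis using assms by (subst M.minus_eq) (auto intro!: eq_matI)
qed

lemma one_minus_sqrt_le: "0 <= x ==> x <= 1 ==> 1 - sqrt (1 - x) <= (x :: real)"
proof -
 assume x: "0 <= x" "x <= 1"
 have "(1 - x) * (1 - x) <= 1 * (1 - x)" using x by (intro mult_right_mono) auto
 then have "1 - x <= sqrt (1 - x)" by (intro real_le_rsqrt) (simp add: power2_eq_square)
 then show ?thesis by simp
qed

text \<open>The Gram matrix g, the sum of the Z_t^* Z_t, is close to 1, so it has an inverse square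
  root R, and R g R = 1. Writing g = b^2 with b = 1 - y, the bound follows from R - 1 = R y, ||R||
  \<le> 2 and ||y|| \<le> dlt.\<close>

lemma orthonormalize_family:
 assumes Z: "!!t. t < T ==> Z t : CM (k t) r"
 and near: "opn (1\<^sub>m r - sum_mat r r T (%t. adj (Z t) * Z t)) <= dlt" and dlt: "dlt <= 1/2"
 obtains R where "R : CM r r" "opn (R - 1\<^sub>m r) <= 2 * dlt"
 "!!v w. v : CV r ==> w : CV r ==>
 (\<Sum>t<T. cinner ((Z t * R) *! v) ((Z t * R) *! w)) = cinner v w"
proof -
 interpret M: unital_cstar_algebra "matrix_cstar r" by (rule unital_cstar_algebra_matrix)
 define g where "g = sum_mat r r T (%t. adj (Z t) * Z t)"
 have g: "g : CM r r" by (simp add: g_def)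
 have ZZ: "adj (Z t) * Z t : CM r r" if "t < T" for t
 using Z[OF that] by (intro mult_carrier_mat[of _ r "k t"]) auto
 have gc: "cinner (g *! v) w = (\<Sum>t<T. cinner (Z t *! v) (Z t *! w))"
 if v: "v : CV r" and w: "w : CV r" for v w
 proof -
 have "cinner ((adj (Z t) * Z t) *! v) w = cinner (Z t *! v) (Z t *! w)" if t: "t < T" for t
 using cinner_adjoint[OF mat_adjoint_carrier[OF Z[OF t]] mult_mat_vec_carrier[OF Z[OF t] v] w]
 assoc_mult_mat_vec[OF mat_adjoint_carrier[OF Z[OF t]] Z[OF t] v] by simp
 moreover have "cinner (g *! v) w = (\<Sum>t<T. cinner ((adj (Z t) * Z t) *! v) w)"
 unfolding g_def by (rule cinner_sum_mat[OF ZZ v w])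
 ultimately show ?thesis by simp
 qed
 have gs: "adj g = g"
 proof (rule mat_eq_if_cinner_eq[of _ r r])
 fix v w :: "complex vec" assume v: "v : CV r" and w: "w : CV r"
 have "cinner (adj g *! v) w = cnj (cinner (g *! w) v)"
 using cinner_adjoint[OF mat_adjoint_carrier[OF g] v w] cinner_cnj[OF v mult_mat_vec_carrier[OF g w]] by simp
 also have "... = (\<Sum>t<T. cnj (cinner (Z t *! w) (Z t *! v)))" unfolding gc[OF w v] by simp
 also have "... = (\<Sum>t<T. cinner (Z t *! v) (Z t *! w))"
 proof (rule sum.cong[OF refl])
 fix t assume "t : {..<T}"
 then have t: "t < T" by simp
 show "cnj (cinner (Z t *! w) (Z t *! v)) = cinner (Z t *! v) (Z t *! w)"
 by (rule cinner_cnj[symmetric, OF mult_mat_vec_carrier[OF Z[OF t] w] mult_mat_vec_carrier[OF Z[OF t] v]])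
 qed
 finally show "cinner (adj g *! v) w = cinner (g *! v) w" by (simp add: gc[OF v w])
 qed (use g in auto)
 define z where "z = 1\<^sub>m r - g"
 have z: "z : car (matrix_cstar r)" "cnorm (matrix_cstar r) z <= 1" "star (matrix_cstar r) z = z"
 using near dlt mat_adjoint_minus[OF one_carrier_mat g] gs minus_carrier_mat[OF g, of "1\<^sub>m r"]
 by (simp_all add: z_def flip: g_def)
 obtain y where y: "y : car (matrix_cstar r)" "cnorm (matrix_cstar r) y <= 1 - sqrt (1 - cnorm (matrix_cstar r) z)"
 "(\<one>\<^bsub>matrix_cstar r\<^esub> -[matrix_cstar r] y) *[matrix_cstar r] (\<one>\<^bsub>matrix_cstar r\<^esub> -[matrix_cstar r] y)
 = \<one>\<^bsub>matrix_cstar r\<^esub> -[matrix_cstar r] z"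
 "star (matrix_cstar r) y = y"
 using M.root_of_one_minus[OF z(1,2)] z(3) by metis
 have yc: "y : CM r r" using y by simp
 define b where "b = 1\<^sub>m r - y"
 have b: "b : CM r r" using yc by (simp add: b_def minus_carrier_mat)
 have bb: "b * b = g"
 proof -
 have "1\<^sub>m r - (1\<^sub>m r - g) = g" using g by (auto intro!: eq_matI)
 then show ?thesis using y(3) z(1) yc by (simp add: matrix_cstar_minus b_def z_def)
 qed
 have ydlt: "opn y <= dlt"
 using y(2) one_minus_sqrt_le[of "opn z"] z near opn_nonneg[of z r r] by (simp add: z_def g_def)
 then have "cnorm (matrix_cstar r) y < 1" using dlt by simp
 then obtain s where s: "s : car (matrix_cstar r)"
 "(\<one>\<^bsub>matrix_cstar r\<^esub> -[matrix_cstar r] y) *[matrix_cstar r] s = \<one>\<^bsub>matrix_cstar r\<^esub>"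
 "s *[matrix_cstar r] (\<one>\<^bsub>matrix_cstar r\<^esub> -[matrix_cstar r] y) = \<one>\<^bsub>matrix_cstar r\<^esub>"
 "star (matrix_cstar r) s = s" "cnorm (matrix_cstar r) s <= 1 / (1 - cnorm (matrix_cstar r) y)"
 using M.inverse_of_one_minus[OF y(1)] y(4) by metis
 have sc: "s : CM r r" "adj s = s" using s by simp_all
 have bs: "b * s = 1\<^sub>m r" "s * b = 1\<^sub>m r" using s yc by (simp_all add: b_def matrix_cstar_minus)
 have "1 / (1 - opn y) <= 1 / (1/2)" using ydlt dlt by (intro divide_left_mono) auto
 then have s2: "opn s <= 2" using s(5) by simp
 have "s - 1\<^sub>m r = s * y"
 proof -
 have "s * y = s * (1\<^sub>m r - b)"
 proof -
 have "1\<^sub>m r - b = y" using yc by (auto simp: b_def intro!: eq_matI)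
 then show ?thesis by simp
 qed
 then show ?thesis using mult_minus_distrib_mat[OF sc(1) one_carrier_mat b] bs sc by simp
 qed
 then have "opn (s - 1\<^sub>m r) <= opn s * opn y" using opn_mult[OF sc(1) yc] by simp
 also have "... <= 2 * dlt" using s2 ydlt opn_nonneg[OF yc] by (intro mult_mono) auto
 finally have near_one: "opn (s - 1\<^sub>m r) <= 2 * dlt" .
 have sgs: "s * (g * s) = 1\<^sub>m r"
 proof -
 have "g * s = b" unfolding bb[symmetric] using assoc_mult_mat[OF b b sc(1)] bs b by simp
 then show ?thesis using bs by simp
 qed
 show ?thesis
 proof (rule that[OF sc(1) near_one])
 fix v w :: "complex vec" assume v: "v : CV r" and w: "w : CV r"
 have sv: "s *! v : CV r" "s *! w : CV r" using sc v w by auto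
 have gs: "g * s : CM r r" using g sc by simp
 have "(\<Sum>t<T. cinner ((Z t * s) *! v) ((Z t * s) *! w)) = cinner (g *! (s *! v)) (s *! w)"
 unfolding gc[OF sv] using assoc_mult_mat_vec[OF Z sc(1) v] assoc_mult_mat_vec[OF Z sc(1) w] by simp
 also have "... = cinner ((g * s) *! v) (adj s *! w)"
 using assoc_mult_mat_vec[OF g sc(1) v] sc(2) by simp
 also have "... = cinner (s *! ((g * s) *! v)) w"
 by (rule cinner_adjoint[OF sc(1) mult_mat_vec_carrier[OF gs v] w, symmetric])
 also have "s *! ((g * s) *! v) = v"
 using assoc_mult_mat_vec[OF sc(1) gs v] sgs v by simp
 finally show "(\<Sum>t<T. cinner ((Z t * s) *! v) ((Z t * s) *! w)) = cinner v w" .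
 qed
qed

section \<open>Perturbation to projections, and quadratic forms over an algebra\<close>

context unital_cstar_algebra
begin

text \<open>b = 2x - 1 is nearly a symmetry, as 1 - b^2 = -4 (x^2 - x). Let 1 - y be the square root
  of b^2 and s its inverse. Then w = b s is a symmetry and p = (1 + w)/2 a projection; the estimate
  comes from p - x = w y / 2 and ||y|| \<le> 4 ||x^2 - x||.\<close>

lemma near_projection:
 assumes x: "x : car A" "star A x = x" and near: "cnorm A (x \<otimes> x \<ominus> x) <= 1/8"
 obtains p where "p : car A" "star A p = p" "p \<otimes> p = p"
 "cnorm A (p \<ominus> x) <= 2 * cnorm A (x \<otimes> x \<ominus> x)"
proof -
 let ?eps = "cnorm A (x \<otimes> x \<ominus> x)"
 define b where "b = 2 \<odot> x \<ominus> \<one>"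
 have b: "b : car A" "star A b = b" using x by (simp_all add: b_def star_minus star_smult)
 define z where "z = \<one> \<ominus> b \<otimes> b"
 have z: "z : car A" "star A z = z" using b by (simp_all add: z_def star_minus star_mult)
 have "z = (- 4) \<odot> (x \<otimes> x \<ominus> x)"
 unfolding z_def b_def using x(1) by (intro feqI) (simp_all add: lin_simps algebra_simps)
 then have nz: "cnorm A z = 4 * ?eps" using x by (simp add: cnorm_smult)
 then have z1: "cnorm A z <= 1" using near by simp
 obtain y where y: "y : car A" "cnorm A y <= 1 - sqrt (1 - cnorm A z)"
 "(\<one> \<ominus> y) \<otimes> (\<one> \<ominus> y) = \<one> \<ominus> z"
 "!!w. w : car A ==> w \<otimes> z = z \<otimes> w ==> w \<otimes> y = y \<otimes> w"
 "star A y = y"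
 using root_of_one_minus[OF z(1) z1] z(2) by metis
 have yn: "cnorm A y <= 4 * ?eps" using y(2) one_minus_sqrt_le[of "cnorm A z"] z1 nz cnorm_nonneg[OF z(1)] by simp
 then have "cnorm A y < 1" using near by simp
 then obtain s where s: "s : car A" "(\<one> \<ominus> y) \<otimes> s = \<one>" "s \<otimes> (\<one> \<ominus> y) = \<one>" "star A s = s"
 using inverse_of_one_minus[OF y(1)] y(5) by metis
 define c where "c = \<one> \<ominus> y"
 have c: "c : car A" "c \<otimes> s = \<one>" "s \<otimes> c = \<one>" using y(1) s by (simp_all add: c_def)
 have cc: "c \<otimes> c = b \<otimes> b"
 unfolding c_def y(3) z_def using b(1) by (intro feqI) (simp_all add: lin_simps)
 have "b \<otimes> z = z \<otimes> b" using b(1) by (simp add: z_def mult_minus minus_mult mult_assoc)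
 then have "b \<otimes> y = y \<otimes> b" by (rule y(4)[OF b(1)])
 then have bc: "b \<otimes> c = c \<otimes> b" using b(1) y(1) by (simp add: c_def mult_minus minus_mult)
 have sb: "s \<otimes> b = b \<otimes> s"
 proof -
 have "s \<otimes> b = s \<otimes> (b \<otimes> (c \<otimes> s))" using s b c by simp
 also have "... = s \<otimes> ((c \<otimes> b) \<otimes> s)" using s(1) b(1) c(1) by (simp add: mult_assoc flip: bc)
 also have "... = (s \<otimes> c) \<otimes> (b \<otimes> s)" using s(1) b(1) c(1) by (simp add: mult_assoc)
 finally show ?thesis using c s(1) b(1) by simp
 qed
 define w where "w = b \<otimes> s"
 have w: "w : car A" "star A w = w" using b s sb by (simp_all add: w_def star_mult)
 have ww: "w \<otimes> w = \<one>"
 proof -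
 have "w \<otimes> w = b \<otimes> ((s \<otimes> b) \<otimes> s)" using s(1) b(1) by (simp add: w_def mult_assoc)
 also have "... = (b \<otimes> b) \<otimes> (s \<otimes> s)" unfolding sb using s(1) b(1) by (simp add: mult_assoc)
 also have "... = c \<otimes> ((c \<otimes> s) \<otimes> s)" unfolding cc[symmetric] using s(1) c(1) by (simp add: mult_assoc)
 finally show ?thesis using c s(1) by simp
 qed
 have "(cnorm A w)\<^sup>2 <= 1" using cnorm_self_adjoint_square[OF w] ww cnorm_one_le by simp
 then have w1: "cnorm A w <= 1" using cnorm_nonneg[OF w(1)] by (simp add: power_le_one_iff)
 define p where "p = (1/2) \<odot> (\<one> \<oplus> w)"
 have p: "p : car A" "star A p = p" using w by (simp_all add: p_def star_smult star_add)
 have pp: "p \<otimes> p = p"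
 unfolding p_def using w(1) by (intro feqI) (simp_all add: lin_simps ww field_simps)
 have sy: "s \<otimes> y = s \<ominus> \<one>"
 proof -
 have "y = \<one> \<ominus> c" unfolding c_def using y(1) by (intro feqI) (simp_all add: lin_simps)
 then have "s \<otimes> y = s \<otimes> \<one> \<ominus> s \<otimes> c" using s(1) c(1) by (simp add: mult_minus)
 then show ?thesis using c s(1) by simp
 qed
 have "p \<ominus> x = (1/2) \<odot> (w \<otimes> y)"
 proof -
 have "w \<otimes> y = b \<otimes> (s \<otimes> y)" using b(1) s(1) y(1) by (simp add: w_def mult_assoc)
 also have "... = w \<ominus> b" unfolding sy using b(1) s(1) by (simp add: w_def mult_minus)
 finally have wy: "w \<otimes> y = w \<ominus> b" .
 show ?thesis unfolding wy p_def b_def using w(1) x(1) by (intro feqI) (simp_all add: lin_simps field_simps)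
 qed
 then have "cnorm A (p \<ominus> x) <= (1/2) * (cnorm A w * cnorm A y)"
 using cnorm_mult[OF w(1) y(1)] w(1) y(1) by (simp add: cnorm_smult)
 also have "... <= (1/2) * (1 * (4 * ?eps))"
 using w1 yn cnorm_nonneg[OF y(1)] by (intro mult_left_mono mult_mono) auto
 finally have "cnorm A (p \<ominus> x) <= 2 * ?eps" by simp
 with p pp show ?thesis by (rule that)
qed

lemma matrix_form_closed:
 assumes "!!i j. i < r ==> j < r ==> H i j : car A" "!!i. i < r ==> z i : car A"
 shows "matrix_form r H z : car A"
 unfolding matrix_form_def
 by (intro finsum_closed' mult_closed star_closed) (use assms in \<open>auto intro!: finsum_closed'\<close>)

lemma lfun_matrix_form:
 assumes F: "lfun F"
 and H: "!!i j. i < r ==> j < r ==> H i j : car A" and z: "!!i. i < r ==> z i : car A"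
 shows "F (matrix_form r H z) = (\<Sum>j<r. \<Sum>i<r. F (star A (z j) \<otimes> (H i j \<otimes> z i)))"
proof -
 have c: "finsum A (%i. H i j \<otimes> z i) {..<r} : car A" if "j < r" for j
 by (rule finsum_closed') (use H z that in auto)
 have "F (matrix_form r H z) = (\<Sum>j<r. F (star A (z j) \<otimes> finsum A (%i. H i j \<otimes> z i) {..<r}))"
 unfolding matrix_form_def by (rule lfun_finsum[OF F]) (use z c in auto)
 also have "... = (\<Sum>j<r. \<Sum>i<r. F (star A (z j) \<otimes> (H i j \<otimes> z i)))"
 proof (rule sum.cong[OF refl])
 fix j assume j: "j : {..<r}"
 show "F (star A (z j) \<otimes> finsum A (%i. H i j \<otimes> z i) {..<r}) = (\<Sum>i<r. F (star A (z j) \<otimes> (H i j \<otimes> z i)))"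
 by (rule lfun_finsum[OF lfun_mult_left[OF F]]) (use H z j in auto)
 qed
 finally show ?thesis .
qed

lemma star_matrix_form:
 assumes H: "!!i j. i < r ==> j < r ==> H i j : car A" and z: "!!i. i < r ==> z i : car A"
 and s: "!!i j. i < r ==> j < r ==> star A (H i j) = H j i"
 shows "star A (matrix_form r H z) = matrix_form r H z"
proof (rule feqI)
 fix F assume F: "lfun F"
 have G: "lfun (%x. cnj (F (star A x)))"
 using F by (simp add: lfun_def star_add star_smult)
 have "cnj (F (star A (matrix_form r H z)))
 = (\<Sum>j<r. \<Sum>i<r. cnj (F (star A (star A (z j) \<otimes> (H i j \<otimes> z i)))))"
 by (rule lfun_matrix_form[OF G H z])
 also have "... = (\<Sum>j<r. \<Sum>i<r. cnj (F (star A (z i) \<otimes> (H j i \<otimes> z j))))"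
 by (intro sum.cong refl) (simp add: star_mult H z s mult_assoc)
 also have "... = (\<Sum>i<r. \<Sum>j<r. cnj (F (star A (z i) \<otimes> (H j i \<otimes> z j))))" by (rule sum.swap)
 also have "... = cnj (F (matrix_form r H z))" by (simp add: lfun_matrix_form[OF F H z])
 finally show "F (star A (matrix_form r H z)) = F (matrix_form r H z)" by (simp only: complex_cnj_cancel_iff)
qed (use matrix_form_closed[OF H z] in simp_all)

end

lemma (in star_hom_pair) hom_matrix_form:
 assumes H: "!!i j. i < r ==> j < r ==> H i j : car A" and z: "!!i. i < r ==> z i : car A"
 shows "f (A.matrix_form r H z) = B.matrix_form r (%i j. f (H i j)) (%i. f (z i))"
proof -
 have c: "finsum A (%i. H i j *[A] z i) {..<r} : car A" if "j < r" for j
 by (rule A.finsum_closed') (use H z that in auto)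
 have row: "f (finsum A (%i. H i j *[A] z i) {..<r}) = finsum B (%i. f (H i j) *[B] f (z i)) {..<r}" if j: "j < r" for j
 proof -
 have "f (finsum A (%i. H i j *[A] z i) {..<r}) = finsum B (%i. f (H i j *[A] z i)) {..<r}"
 by (rule hom_finsum) (use H z j in auto)
 also have "... = finsum B (%i. f (H i j) *[B] f (z i)) {..<r}"
 by (rule B.M.finsum_cong') (use H z j in \<open>auto simp: hom_mult\<close>)
 finally show ?thesis .
 qed
 have "f (A.matrix_form r H z)
 = finsum B (%j. f (star A (z j) *[A] finsum A (%i. H i j *[A] z i) {..<r})) {..<r}"
 unfolding A.matrix_form_def by (rule hom_finsum) (use z c in auto)
 also have "... = B.matrix_form r (%i j. f (H i j)) (%i. f (z i))"
 unfolding B.matrix_form_def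
 by (rule B.M.finsum_cong')
 (use z c H in \<open>auto simp: hom_mult hom_star row intro!: B.finsum_closed'\<close>)
 finally show ?thesis .
qed

section \<open>Microstates of the corner and approximation of positive functionals by them\<close>

subsection \<open>Matrix models of a corner\<close>

lemma (in unital_cstar_algebra) matrix_form_cong:
 assumes "!!i j. i < r ==> j < r ==> H i j = H' i j" "!!i. i < r ==> z i = z' i"
 and H: "!!i j. i < r ==> j < r ==> H' i j : car A" and z: "!!i. i < r ==> z' i : car A"
 shows "matrix_form r H z = matrix_form r H' z'"
proof -
 have row: "finsum A (%i. H i j \<otimes> z i) {..<r} = finsum A (%i. H' i j \<otimes> z' i) {..<r}" if "j < r" for j
 by (rule M.finsum_cong') (use assms that in auto)
 show ?thesis
 unfolding matrix_form_def
 by (rule M.finsum_cong') (use assms row in \<open>auto intro!: finsum_closed'\<close>)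
qed

locale matrix_sequence =
 fixes k :: "nat => nat"
begin

sublocale cstar_sequence "%n. matrix_cstar (k n)"
 by (intro cstar_sequence.intro unital_cstar_algebra_matrix)

lemma Prod_mat [simp]: "X : car Prod ==> X m : CM (k m) (k m)"
 using Prod_nth[of X m] by simp

lemma Prod_mat_opnorm: "X : car Prod ==> opn (X m) <= cnorm Prod X"
 using Prod_norm_ub[of X m] by simp

lemma Null_mat: "X : Null ==> (%m. opn (X m)) ----> 0"
 by (simp add: Null_iff)

lemma Prod_minus_mat: "X : car Prod ==> Y : car Prod ==> (X -[Prod] Y) m = X m - Y m"
 using Prod_minus_nth[of X Y m] by (simp add: matrix_cstar_minus)

lemma star_Prod_mat: "star Prod X m = adj (X m)"
 by (simp add: Prod_simps(6))

lemma cls_eq_null: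
 assumes "X : car Prod" "Y : car Prod" "cls X = cls Y"
 shows "(%m. opn (X m - Y m)) ----> 0"
 using assms cls_eq_iff[of X Y] Null_mat[of "X -[Prod] Y"] by (simp add: Prod_minus_mat)

lemma cls_eq_if_null:
 assumes "X : car Prod" "Y : car Prod" "(%m. opn (X m - Y m)) ----> 0"
 shows "cls X = cls Y"
 using assms by (simp add: cls_eq_iff Null_iff Prod_minus_mat)

lemma star_hom_cls: "star_hom Prod Quo cls"
 by (simp add: star_hom_def Quo_ops Quo_clsI)

text \<open>A self-adjoint lift x has x_m^2 - x_m tending to 0, so \<open>near_projection\<close>
  applies in all late coordinates; in the others 0 serves as the projection.\<close>

lemma projection_lift:
 assumes E: "E : car Quo" "star Quo E = E" "E *[Quo] E = E"
 obtains p where "p : car Prod" "cls p = E" "!!m. adj (p m) = p m" "!!m. p m * p m = p m"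
proof -
 obtain x0 where x0: "x0 : car Prod" "E = cls x0" using E(1) by (rule Quo_cases)
 define x where "x = (1/2) *:[Prod] (x0 +[Prod] star Prod x0)"
 have x: "x : car Prod" "star Prod x = x"
 using x0 by (simp_all add: x_def P.star_smult P.star_add P.M.a_comm)
 have "cls x = (1/2) *:[Quo] (E +[Quo] star Quo E)" using x0 by (simp add: x_def Quo_ops)
 also have "... = E" unfolding E(2) using E(1) by (intro Q.feqI) (simp_all add: Q.lfun_simps)
 finally have cx: "cls x = E" .
 have "x *[Prod] x -[Prod] x : Null"
 using cls_eq_iff[of "x *[Prod] x" x] x cx E(3) Quot_mult[of x x] by simp
 then have lim: "(%m. opn (x m * x m - x m)) ----> 0"
 using Null_mat[of "x *[Prod] x -[Prod] x"] x by (simp add: Prod_minus_mat) (simp add: Prod_simps(1))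
 have xm: "x m : CM (k m) (k m)" "adj (x m) = x m" for m
 using Prod_mat[OF x(1), of m] star_Prod_mat[of x m] x(2) by simp_all
 have "EX p. p : CM (k m) (k m) & adj p = p & p * p = p &
 (opn (x m * x m - x m) <= 1/8 --> opn (p - x m) <= 2 * opn (x m * x m - x m))" for m
 proof (cases "opn (x m * x m - x m) <= 1/8")
 case True
 interpret M: unital_cstar_algebra "matrix_cstar (k m)" by (rule unital_cstar_algebra_matrix)
 have "cnorm (matrix_cstar (k m)) (x m *[matrix_cstar (k m)] x m -[matrix_cstar (k m)] x m) <= 1/8"
 using True xm(1)[of m] by (simp add: matrix_cstar_minus[of _ "k m"])
 from M.near_projection[OF _ _ this] obtain p where "p : car (matrix_cstar (k m))"
 "star (matrix_cstar (k m)) p = p" "p *[matrix_cstar (k m)] p = p"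
 "cnorm (matrix_cstar (k m)) (p -[matrix_cstar (k m)] x m)
 <= 2 * cnorm (matrix_cstar (k m)) (x m *[matrix_cstar (k m)] x m -[matrix_cstar (k m)] x m)"
 using xm by auto
 then show ?thesis using xm(1)[of m] by (intro exI[of _ p]) (simp add: matrix_cstar_minus[of _ "k m"])
 next
 case False
 then show ?thesis by (intro exI[of _ "0\<^sub>m (k m) (k m)"]) simp
 qed
 then obtain p where p: "!!m. p m : CM (k m) (k m)" "!!m. adj (p m) = p m" "!!m. p m * p m = p m"
 "!!m. opn (x m * x m - x m) <= 1/8 ==> opn (p m - x m) <= 2 * opn (x m * x m - x m)"
 by metis
 have pP: "p : car Prod"
 proof (rule Prod_carrierI[of _ 1])
 fix m
 have "opn (p m) = opn (p m) * opn (p m)"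
 using opn_cstar[OF p(1)[of m]] p(2,3)[of m] by (simp add: power2_eq_square)
 then have "opn (p m) <= 1" by (cases "opn (p m) = 0") auto
 then show "cnorm (matrix_cstar (k m)) (p m) <= 1" by simp
 qed (use p in simp)
 have "(%m. opn (p m - x m)) ----> 0"
 proof (rule tendsto_sandwich[OF _ _ tendsto_const tendsto_mult_right_zero[OF lim, of 2]])
 show "\<forall>\<^sub>F m in sequentially. 0 <= opn (p m - x m)"
 using opn_nonneg[OF minus_carrier_mat[OF xm(1)]] by simp
 have "\<forall>\<^sub>F m in sequentially. opn (x m * x m - x m) < 1/8"
 by (rule order_tendstoD(2)[OF lim]) simp
 then show "\<forall>\<^sub>F m in sequentially. opn (p m - x m) <= 2 * opn (x m * x m - x m)"
 by eventually_elim (use p(4) in auto)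
 qed
 then have "cls p = E" using cls_eq_if_null[OF pP x(1)] cx by simp
 then show ?thesis using that[OF pP] p by blast
qed

end

text \<open>\<open>L\<close> picks representatives for f, and v m is an isometry onto the range of
  the projection p m that represents f e in coordinate m. The normalization \<open>Le\<close> makes
  e correspond to the identity of \<complex>^(q m) exactly and not only asymptotically.\<close>

locale mf_corner = matrix_sequence k + A: unital_cstar_algebra A
 for k :: "nat => nat" and A :: "('a, 'm) cstar_scheme" +
 fixes f :: "'a => (nat => complex mat) set" and e :: 'a
 and L :: "'a => nat => complex mat" and p v :: "nat => complex mat" and q :: "nat => nat"
 assumes emb: "star_embedding A Quo f"
 and e: "e : car A" "star A e = e" "e *[A] e = e"
 and L: "!!a. a : car A ==> L a : car Prod" "!!a. a : car A ==> cls (L a) = f a"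
 and Le: "L e = p"
 and v: "!!m. v m : CM (k m) (q m)" "!!m. adj (v m) * v m = 1\<^sub>m (q m)"
 "!!m. v m * adj (v m) = p m"

lemma (in matrix_sequence) mf_corner_exists:
 assumes A: "unital_cstar_algebra A" and emb: "star_embedding A Quo f"
 and e: "e : car A" "star A e = e" "e *[A] e = e"
 shows "EX L p v q. mf_corner k A f e L p v q"
proof -
 interpret A: unital_cstar_algebra A by (rule A)
 have hom: "star_hom A Quo f" using emb by (simp add: star_embedding_def)
 obtain p where p: "p : car Prod" "cls p = f e" "!!m. adj (p m) = p m" "!!m. p m * p m = p m"
 proof (rule projection_lift[of "f e"])
 show "f e : car Quo" by (rule star_hom_closed[OF hom e(1)])
 show "star Quo (f e) = f e" using star_hom_star[OF hom e(1)] e(2) by simp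
 show "f e *[Quo] f e = f e" using star_hom_mult[OF hom e(1) e(1)] e(3) by simp
 qed metis
 have "EX x. x : car Prod & cls x = f a" if "a : car A" for a
 using star_hom_closed[OF hom that] by (metis Quo_cases)
 then obtain L0 where L0: "!!a. a : car A ==> L0 a : car Prod" "!!a. a : car A ==> cls (L0 a) = f a"
 by metis
 have "EX q v. v : CM (k m) q & adj v * v = 1\<^sub>m q & v * adj v = p m" for m
 using projection_eq_isometry_mult_adjoint[OF Prod_mat[OF p(1)] p(3,4)] by metis
 then obtain q v where v: "!!m. v m : CM (k m) (q m)" "!!m. adj (v m) * v m = 1\<^sub>m (q m)"
 "!!m. v m * adj (v m) = p m" by metis
 have "mf_corner k A f e (L0(e := p)) p v q"
 by (intro mf_corner.intro A mf_corner_axioms.intro) (use emb e p L0 v in auto)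
 then show ?thesis by blast
qed

context mf_corner
begin

sublocale f: star_hom_pair A Quo f
 using emb by (intro star_hom_pair.intro star_hom_pair_axioms.intro A.unital_cstar_algebra_axioms Q.unital_cstar_algebra_axioms) (simp add: star_embedding_def)

sublocale cl: star_hom_pair Prod Quo cls
 by (rule star_hom_pairI[OF P.unital_cstar_algebra_axioms Q.unital_cstar_algebra_axioms]) (rule star_hom_cls)

definition corner :: "'a set" where "corner = {a : car A. e *[A] (a *[A] e) = a}"

text \<open>Compression to the range of p m, written in the coordinates given by v m.\<close>

definition V :: "nat => complex mat => complex mat" where
 "V m X = adj (v m) * (X * v m)"

lemma corner_carrier: "a : corner ==> a : car A" by (simp add: corner_def)

lemma e_corner: "e : corner" using e by (simp add: corner_def)

lemma av: "adj (v m) : CM (q m) (k m)" using v(1) by simp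

lemma V_carrier [simp]: "X : CM (k m) (k m) ==> V m X : CM (q m) (q m)"
 unfolding V_def using v(1)[of m] av[of m] by (intro mult_carrier_mat[of _ _ "k m"])

lemma V_vec:
 assumes X: "X : CM (k m) (k m)" and z: "zt : CV (q m)"
 shows "V m X *! zt = adj (v m) *! (X *! (v m *! zt))"
 unfolding V_def using assoc_mult_mat_vec[OF av mult_carrier_mat[OF X v(1)] z] assoc_mult_mat_vec[OF X v(1) z] by simp

lemma cinner_V: assumes X: "X : CM (k m) (k m)" and z: "zt : CV (q m)" "eta : CV (q m)"
 shows "cinner (V m X *! zt) eta = cinner (X *! (v m *! zt)) (v m *! eta)"
proof -
 have "X *! (v m *! zt) : CV (k m)" using X v(1)[of m] z by auto
 then show ?thesis unfolding V_vec[OF X z(1)] using cinner_adjoint[OF av _ z(2), of "X *! (v m *! zt)"] by simp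
qed

lemma opn_v: "opn (v m) <= 1"
proof -
 have "opn (1\<^sub>m (q m)) <= 1" by (rule opn_le[of _ "q m" "q m"]) auto
 then have "(opn (v m))\<^sup>2 <= 1" using opn_cstar[OF v(1), of m] v(2)[of m] by simp
 then show ?thesis using opn_nonneg[OF v(1)] by (simp add: power_le_one_iff)
qed

lemma opn_V: assumes X: "X : CM (k m) (k m)" shows "opn (V m X) <= opn X"
proof -
 have Xv: "X * v m : CM (k m) (q m)" using X v(1)[of m] by simp
 have "opn (V m X) <= opn (adj (v m)) * opn (X * v m)"
 unfolding V_def by (rule opn_mult[OF av Xv])
 also have "... <= 1 * (opn X * opn (v m))"
 using opn_mult[OF X v(1)] opn_v opn_nonneg[OF Xv]
 by (intro mult_mono) (auto simp: opn_adjoint[OF v(1)])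
 also have "... <= opn X" using opn_v opn_nonneg[OF X] by (simp add: mult_left_le)
 finally show ?thesis .
qed

lemma V_add:
 assumes X: "X : CM (k m) (k m)" and W: "W : CM (k m) (k m)"
 shows "V m (X + W) = V m X + V m W"
 unfolding V_def add_mult_distrib_mat[OF X W v(1)]
 by (rule mult_add_distrib_mat[OF av mult_carrier_mat[OF X v(1)] mult_carrier_mat[OF W v(1)]])

lemma V_smult:
 assumes X: "X : CM (k m) (k m)"
 shows "V m (c \<cdot>\<^sub>m X) = c \<cdot>\<^sub>m V m X"
 unfolding V_def mult_smult_assoc_mat[OF X v(1)]
 by (rule mult_smult_distrib[OF av mult_carrier_mat[OF X v(1)]])

lemma V_adjoint: assumes X: "X : CM (k m) (k m)" shows "V m (adj X) = adj (V m X)"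
proof -
 have Xv: "X * v m : CM (k m) (q m)" using X v(1)[of m] by simp
 show ?thesis
 unfolding V_def mat_adjoint_mult[OF av Xv] mat_adjoint_mult[OF X v(1)]
 using assoc_mult_mat[OF av mat_adjoint_carrier[OF X] v(1)] by simp
qed

text \<open>Since v m times its adjoint is p m, compressions multiply with p inserted between the
  factors.\<close>

lemma V_mult: assumes X: "X : CM (k m) (k m)" and W: "W : CM (k m) (k m)"
 shows "V m X * V m W = V m (X * (p m * W))"
proof -
 have Wv: "W * v m : CM (k m) (q m)" and Xv: "X * v m : CM (k m) (q m)"
 using X W v(1)[of m] by simp_all
 have aW: "adj (v m) * (W * v m) : CM (q m) (q m)" by (rule mult_carrier_mat[OF av Wv])
 have "V m X * V m W = adj (v m) * ((X * v m) * (adj (v m) * (W * v m)))"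
 unfolding V_def by (rule assoc_mult_mat[OF av Xv aW])
 also have "(X * v m) * (adj (v m) * (W * v m)) = X * (v m * (adj (v m) * (W * v m)))"
 by (rule assoc_mult_mat[OF X v(1) aW])
 also have "v m * (adj (v m) * (W * v m)) = p m * (W * v m)"
 unfolding v(3)[symmetric] by (rule assoc_mult_mat[OF v(1) av Wv, symmetric])
 also have "p m * (W * v m) = (p m * W) * v m"
 proof -
 have "p m : CM (k m) (k m)" using v(3)[of m] mult_carrier_mat[OF v(1) av, of m] by simp
 then show ?thesis using assoc_mult_mat[OF _ W v(1)] by simp
 qed
 also have "X * ((p m * W) * v m) = (X * (p m * W)) * v m"
 proof -
 have "p m : CM (k m) (k m)" using v(3)[of m] mult_carrier_mat[OF v(1) av, of m] by simp
 then have "p m * W : CM (k m) (k m)" using W by simp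
 then show ?thesis using assoc_mult_mat[OF X _ v(1)] by simp
 qed
 finally show ?thesis by (simp add: V_def)
qed

lemma p_Prod: "p : car Prod" using L(1)[OF e(1)] by (simp add: Le)

lemma cls_p: "cls p = f e" using L(2)[OF e(1)] by (simp add: Le)

lemma V_p: "V m (p m) = 1\<^sub>m (q m)"
proof -
 have "p m * v m = v m"
 unfolding v(3)[symmetric] using assoc_mult_mat[OF v(1) av v(1), of m] v(2)[of m] v(1)[of m] by simp
 then show ?thesis by (simp add: V_def v(2))
qed

lemma corner_L:
 assumes a: "a : corner"
 shows "cls (p *[Prod] (L a *[Prod] p)) = f a"
proof -
 have ac: "a : car A" using a by (rule corner_carrier)
 have "cls (p *[Prod] (L a *[Prod] p)) = f e *[Quo] (f a *[Quo] f e)"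
 using L[OF ac] p_Prod by (simp add: cl.hom_mult cls_p)
 also have "... = f (e *[A] (a *[A] e))" using ac e by (simp add: f.hom_mult)
 finally show ?thesis using a by (simp add: corner_def)
qed

lemma cinner_pXp:
 assumes X: "X : CM (k m) (k m)" and w: "om : CV (k m)" "om' : CV (k m)"
 shows "cinner ((p m * (X * p m)) *! om) om'
 = cinner (V m X *! (adj (v m) *! om)) (adj (v m) *! om')"
proof -
 have pm: "p m : CM (k m) (k m)" using p_Prod by simp
 have pX: "X * p m : CM (k m) (k m)" using X pm by simp
 have ps: "adj (p m) = p m" using mat_adjoint_mult[OF v(1) av, of m] by (simp add: v(3))
 have aw: "adj (v m) *! om : CV (q m)" "adj (v m) *! om' : CV (q m)"
 using av[of m] w by auto
 have pw: "p m *! om = v m *! (adj (v m) *! om)" if "om : CV (k m)" for om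
 unfolding v(3)[symmetric] by (rule assoc_mult_mat_vec[OF v(1) av that])
 have Xw: "X *! (p m *! om) : CV (k m)" using X pm w by auto
 have "(p m * (X * p m)) *! om = p m *! (X *! (p m *! om))"
 using assoc_mult_mat_vec[OF pm pX w(1)] assoc_mult_mat_vec[OF X pm w(1)] by simp
 then have "cinner ((p m * (X * p m)) *! om) om' = cinner (X *! (p m *! om)) (p m *! om')"
 using cinner_adjoint[OF pm Xw w(2)] ps by simp
 then show ?thesis unfolding pw[OF w(1)] pw[OF w(2)] using cinner_V[OF X aw] by simp
qed

lemma cinner_functional:
 assumes w: "om : CV (k m)" "om' : CV (k m)"
 shows "P.lfun (%X. cinner (X m *! om) om')"
 unfolding P.lfun_def
proof (intro conjI ballI allI)
 fix X Y assume "X : car Prod" "Y : car Prod"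
 then have X: "X m : CM (k m) (k m)" "Y m : CM (k m) (k m)" by simp_all
 show "cinner ((X +[Prod] Y) m *! om) om' = cinner (X m *! om) om' + cinner (Y m *! om) om'"
 using add_mult_distrib_mat_vec[OF X w(1)]
 cinner_add_left[OF mult_mat_vec_carrier[OF X(1) w(1)] mult_mat_vec_carrier[OF X(2) w(1)] w(2)]
 by (simp add: Prod_simps(4))
next
 fix c X assume "X : car Prod"
 then have X: "X m : CM (k m) (k m)" by simp
 have "(c \<cdot>\<^sub>m X m) *! om = c \<cdot>\<^sub>v (X m *! om)" using X w by (intro eq_vecI) auto
 then show "cinner ((c *:[Prod] X) m *! om) om' = c * cinner (X m *! om) om'"
 using cinner_smult_left[OF mult_mat_vec_carrier[OF X w(1)] w(2)] by (simp add: Prod_simps(5))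
qed

text \<open>Take a vector eta, apply the lifts L (z i) and pass to the range of p. For these vectors
  the hypothesis says that, from coordinate J on, the form of the lifted matrix at the lifted z is a
  positive matrix. So its class is positive in the quotient; this class is the image of z^* H z, and
  an injective homomorphism reflects positivity.\<close>

theorem pos_matrix_if_microstates_pos:
 assumes F: "finite F" "F <= corner"
 and nonneg: "!!m zt. m >= J ==> (!!i. i < r ==> zt i : CV (q m)) ==>
 0 <= Re (\<Sum>j<r. \<Sum>i<r. \<Sum>a\<in>F. h a i j * cinner (V m (L a m) *! zt i) (zt j))"
 defines "Hm \<equiv> %i j. finsum A (%a. h a i j *:[A] a) F"
 shows "A.pos_matrix r (%i j. (1/2) *:[A] (Hm i j +[A] star A (Hm j i)))"
proof -
 define H where "H i j = (1/2) *:[A] (Hm i j +[A] star A (Hm j i))" for i j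
 have Fc: "a : car A" if "a : F" for a using F that corner_carrier by auto
 have Hmc: "Hm i j : car A" for i j unfolding Hm_def by (rule A.finsum_closed') (use Fc in simp)
 have Hc: "H i j : car A" for i j using Hmc by (simp add: H_def)
 have Hs: "star A (H i j) = H j i" for i j using Hmc by (simp add: H_def A.star_smult A.star_add A.M.a_comm)
 define pL where "pL a = p *[Prod] (L a *[Prod] p)" for a
 have pL: "pL a : car Prod" "cls (pL a) = f a" if "a : F" for a
 using Fc[OF that] L(1) p_Prod corner_L[of a] F that by (auto simp: pL_def)
 define hP where "hP i j = finsum Prod (%a. h a i j *:[Prod] pL a) F" for i j
 have hPc: "hP i j : car Prod" for i j unfolding hP_def by (rule P.finsum_closed') (use pL in simp)
 define HP where "HP i j = (1/2) *:[Prod] (hP i j +[Prod] star Prod (hP j i))" for i j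
 have HPc: "HP i j : car Prod" for i j using hPc by (simp add: HP_def)
 have HPs: "star Prod (HP i j) = HP j i" for i j using hPc by (simp add: HP_def P.star_smult P.star_add P.M.a_comm)
 have chP: "cls (hP i j) = f (Hm i j)" for i j
 proof -
 have "cls (hP i j) = finsum Quo (%a. cls (h a i j *:[Prod] pL a)) F"
 unfolding hP_def by (rule cl.hom_finsum[OF F(1)]) (use pL in simp)
 also have "... = finsum Quo (%a. f (h a i j *:[A] a)) F"
 by (rule Q.M.finsum_cong') (use pL Fc in \<open>auto simp: cl.hom_smult f.hom_smult\<close>)
 also have "... = f (Hm i j)"
 unfolding Hm_def by (rule f.hom_finsum[OF F(1), symmetric]) (use Fc in simp)
 finally show ?thesis .
 qed
 have cHP: "cls (HP i j) = f (H i j)" for i j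
 using hPc Hmc by (simp add: HP_def H_def cl.hom_smult cl.hom_add cl.hom_star f.hom_smult f.hom_add f.hom_star chP)
 have "A.pos (A.matrix_form r H z)" if z: "!!i. i < r ==> z i : car A" for z
 proof (rule f.injective_hom_reflects_pos)
 show "inj_on f (car A)" using emb by (simp add: star_embedding_def)
 show "A.matrix_form r H z : car A" by (rule A.matrix_form_closed) (use Hc z in auto)
 show "star A (A.matrix_form r H z) = A.matrix_form r H z" by (rule A.star_matrix_form) (use Hc Hs z in auto)
 have Lz: "L (z i) : car Prod" if "i < r" for i using L(1) z that by simp
 define G where "G = P.matrix_form r HP (%i. L (z i))"
 have Gc: "G : car Prod" unfolding G_def by (rule P.matrix_form_closed) (use HPc Lz in auto)
 have Gs: "star Prod G = G" unfolding G_def by (rule P.star_matrix_form) (use HPc HPs Lz in auto)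
 have "f (A.matrix_form r H z) = Q.matrix_form r (%i j. f (H i j)) (%i. f (z i))"
 by (rule f.hom_matrix_form) (use Hc z in auto)
 also have "... = Q.matrix_form r (%i j. cls (HP i j)) (%i. cls (L (z i)))"
 by (rule Q.matrix_form_cong) (simp_all add: cHP L(2) z Hc f.hom_closed)
 also have "... = cls G"
 unfolding G_def by (rule cl.hom_matrix_form[symmetric]) (use HPc Lz in auto)
 finally have fG: "f (A.matrix_form r H z) = cls G" .
 show "Q.pos (f (A.matrix_form r H z))"
 unfolding fG
 proof (rule Quo_pos[OF Gc])
 fix m assume m: "m >= J"
 have Gm: "G m : CM (k m) (k m)" "adj (G m) = G m"
 using Prod_mat[OF Gc, of m] star_Prod_mat[of G m] Gs by simp_all
 show "unital_cstar_algebra.pos (matrix_cstar (k m)) (G m)"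
 proof (rule mat_pos_if_form_nonneg[OF Gm])
 fix eta :: "complex vec" assume eta: "eta : CV (k m)"
 define om where "om i = L (z i) m *! eta" for i
 define zt where "zt i = adj (v m) *! om i" for i
 have om: "om i : CV (k m)" if "i < r" for i
 unfolding om_def by (rule mult_mat_vec_carrier[OF Prod_mat[OF Lz[OF that]] eta])
 have zt: "zt i : CV (q m)" if "i < r" for i
 unfolding zt_def by (rule mult_mat_vec_carrier[OF av om[OF that]])
 define c where "c i j = (\<Sum>a\<in>F. h a i j * cinner (V m (L a m) *! zt i) (zt j))" for i j
 have hc: "cinner (hP i j m *! om i') (om j') = (\<Sum>a\<in>F. h a i j * cinner (V m (L a m) *! zt i') (zt j'))"
 if ij: "i' < r" "j' < r" for i j i' j'
 proof -
 note lf = cinner_functional[OF om[OF ij(1)] om[OF ij(2)]]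
 have "cinner (hP i j m *! om i') (om j') = (\<Sum>a\<in>F. cinner ((h a i j *:[Prod] pL a) m *! om i') (om j'))"
 unfolding hP_def by (rule P.lfun_finsum[OF lf F(1)]) (use pL in simp)
 also have "... = (\<Sum>a\<in>F. h a i j * cinner (pL a m *! om i') (om j'))"
 by (intro sum.cong refl P.lfun_sm[OF lf] pL)
 also have "... = (\<Sum>a\<in>F. h a i j * cinner (V m (L a m) *! zt i') (zt j'))"
 unfolding zt_def pL_def
 by (intro sum.cong refl) (use Fc L(1) in \<open>simp add: Prod_simps(1) cinner_pXp[OF _ om[OF ij(1)] om[OF ij(2)]]\<close>)
 finally show ?thesis .
 qed
 have Hc': "cinner (HP i j m *! om i) (om j) = (c i j + cnj (c j i)) / 2" if ij: "i < r" "j < r" for i j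
 proof -
 note lf = cinner_functional[OF om[OF ij(1)] om[OF ij(2)]]
 have "cinner (HP i j m *! om i) (om j)
 = (1/2) * (cinner (hP i j m *! om i) (om j) + cinner (star Prod (hP j i) m *! om i) (om j))"
 unfolding HP_def using hPc by (simp add: P.lfun_simps[OF lf])
 also have "cinner (star Prod (hP j i) m *! om i) (om j) = cnj (cinner (hP j i m *! om j) (om i))"
 using cinner_adjoint[OF mat_adjoint_carrier[OF Prod_mat[OF hPc]] om[OF ij(1)] om[OF ij(2)], of j i]
 cinner_cnj[OF om[OF ij(1)] mult_mat_vec_carrier[OF Prod_mat[OF hPc] om[OF ij(2)]], of j i]
 by (simp add: Prod_simps(6))
 finally show ?thesis using hc[OF ij] hc[OF ij(2) ij(1)] by (simp add: c_def)
 qed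
 note lfG = cinner_functional[OF eta eta]
 have "cinner (G m *! eta) eta = (\<Sum>j<r. \<Sum>i<r. cinner ((star Prod (L (z j)) *[Prod] (HP i j *[Prod] L (z i))) m *! eta) eta)"
 unfolding G_def by (rule P.lfun_matrix_form[OF lfG]) (use HPc Lz in auto)
 also have "... = (\<Sum>j<r. \<Sum>i<r. cinner (HP i j m *! om i) (om j))"
 proof (intro sum.cong refl)
 fix i j assume "j : {..<r}" "i : {..<r}"
 then have ij: "i < r" "j < r" by auto
 note Zj = Prod_mat[OF Lz[OF ij(2)], of m] and Zi = Prod_mat[OF Lz[OF ij(1)], of m] and Hm' = Prod_mat[OF HPc[of i j], of m]
 have HZ: "HP i j m * L (z i) m : CM (k m) (k m)" using Hm' Zi by simp
 have "(star Prod (L (z j)) *[Prod] (HP i j *[Prod] L (z i))) m *! eta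
 = adj (L (z j) m) *! (HP i j m *! om i)"
 using assoc_mult_mat_vec[OF mat_adjoint_carrier[OF Zj] HZ eta] assoc_mult_mat_vec[OF Hm' Zi eta]
 by (simp add: Prod_simps(1,6) om_def)
 then show "cinner ((star Prod (L (z j)) *[Prod] (HP i j *[Prod] L (z i))) m *! eta) eta
 = cinner (HP i j m *! om i) (om j)"
 using cinner_adjoint[OF mat_adjoint_carrier[OF Zj] mult_mat_vec_carrier[OF Hm' om[OF ij(1)]] eta]
 by (simp add: om_def)
 qed
 also have "... = (\<Sum>j<r. \<Sum>i<r. (c i j + cnj (c j i)) / 2)"
 by (intro sum.cong refl Hc') auto
 finally have "Re (cinner (G m *! eta) eta) = (\<Sum>j<r. \<Sum>i<r. (Re (c i j) + Re (c j i)) / 2)" by simp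
 also have "... = ((\<Sum>j<r. \<Sum>i<r. Re (c i j)) + (\<Sum>j<r. \<Sum>i<r. Re (c j i))) / 2"
 by (simp add: sum.distrib sum_divide_distrib add_divide_distrib)
 also have "(\<Sum>j<r. \<Sum>i<r. Re (c j i)) = (\<Sum>j<r. \<Sum>i<r. Re (c i j))" by (rule sum.swap)
 finally show "0 <= Re (cinner (G m *! eta) eta)"
 using nonneg[OF m zt] by (simp add: c_def)
 qed
 qed
 qed
 then show ?thesis
 unfolding A.pos_matrix_def H_def[symmetric] using Hc Hs by auto
qed

end

locale mf_state = mf_corner k A f e L p v q + C: unital_cstar_algebra C
 for k A f e L p v q and C :: "('c, 'n) cstar_scheme" +
 fixes sg :: "'a => 'c" and phi :: "'c => complex"
 assumes sg: "star_hom A C sg" and phi: "C.pfun phi"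
begin

sublocale sg: star_hom_pair A C sg
 by (rule star_hom_pairI[OF A.unital_cstar_algebra_axioms C.unital_cstar_algebra_axioms]) (rule sg)

lemmas phi_linear = C.pfun_linear[OF phi]

text \<open>In the GNS representation of phi this is the inner product of sg(a) u_i with
  u_j.\<close>

definition Phi :: "(nat => 'c) => nat => nat => 'a => complex" where
 "Phi u i j a = phi (star C (u j) *[C] (sg a *[C] u i))"

lemma Phi_linear:
 assumes "u i : car C" "u j : car C"
 shows "A.lfun (Phi u i j)"
 using assms phi_linear unfolding A.lfun_def C.lfun_def Phi_def
 by (simp add: sg.hom_add sg.hom_smult C.distrib_left C.distrib_right C.smult_mult_left C.smult_mult_right)

lemma Phi_star:
 assumes "u i : car C" "u j : car C" "a : car A"
 shows "Phi u i j (star A a) = cnj (Phi u j i a)"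
 using assms C.pfun_star[OF phi, of "star C (u i) *[C] (sg a *[C] u j)"]
 by (simp add: Phi_def C.star_mult sg.hom_star C.mult_assoc)

text \<open>The sum is phi(w^* w), where w is the sum of the sg(c_i) u_i.\<close>

lemma Phi_cp_family:
 assumes u: "!!i. i < r ==> u i : car C"
 shows "A.cp_family r (Phi u)"
 unfolding A.cp_family_def
proof (intro conjI allI impI Phi_linear u)
 fix c assume c: "ALL i<r. c i : car A"
 define w where "w = finsum C (%i. sg (c i) *[C] u i) {..<r}"
 have cu: "sg (c i) *[C] u i : car C" if "i < r" for i using c u that by simp
 have w: "w : car C" unfolding w_def by (rule C.finsum_closed') (use cu in simp)
 have lf: "C.lfun (%x. phi (y *[C] x))" if "y : car C" for y
 by (rule C.lfun_mult_left[OF phi_linear that])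
 have lf': "C.lfun (%x. cnj (phi (star C x *[C] y)))" if "y : car C" for y
 using that phi_linear by (simp add: C.lfun_def C.star_add C.star_smult C.distrib_right C.smult_mult_left)
 have "cnj (phi (star C w *[C] w)) = (\<Sum>j<r. cnj (phi (star C (sg (c j) *[C] u j) *[C] w)))"
 using C.lfun_finsum[OF lf'[OF w], of "{..<r}" "%i. sg (c i) *[C] u i"] cu by (simp flip: w_def)
 moreover have "phi (star C (sg (c j) *[C] u j) *[C] w)
 = (\<Sum>i<r. Phi u i j (star A (c j) *[A] c i))" if j: "j < r" for j
 proof -
 have "phi (star C (sg (c j) *[C] u j) *[C] w)
 = (\<Sum>i<r. phi (star C (sg (c j) *[C] u j) *[C] (sg (c i) *[C] u i)))"
 unfolding w_def by (rule C.lfun_finsum[OF lf]) (use cu j in auto)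
 also have "... = (\<Sum>i<r. Phi u i j (star A (c j) *[A] c i))"
 by (intro sum.cong refl) (use c u j in \<open>simp add: Phi_def C.star_mult sg.hom_mult sg.hom_star C.mult_assoc\<close>)
 finally show ?thesis .
 qed
 ultimately have "cnj (phi (star C w *[C] w)) = (\<Sum>j<r. cnj (\<Sum>i<r. Phi u i j (star A (c j) *[A] c i)))"
 by (simp del: cnj_sum)
 then have "phi (star C w *[C] w) = (\<Sum>j<r. \<Sum>i<r. Phi u i j (star A (c j) *[A] c i))"
 unfolding cnj_sum[symmetric] complex_cnj_cancel_iff .
 also have "... = (\<Sum>i<r. \<Sum>j<r. Phi u i j (star A (c j) *[A] c i))" by (rule sum.swap)
 finally show "0 <= Re (\<Sum>i<r. \<Sum>j<r. Phi u i j (star A (c j) *[A] c i))"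
 using C.pfun_pos[OF phi C.pos_star_mult[OF w]] by simp
qed

text \<open>By separation of convex cones, a functional keeping \<open>\<Phi>\<close> away from all sums of microstates
  would be positive on the latter; by complete positivity it is then nonnegative at \<open>\<Phi>\<close>.\<close>

lemma microstates_approximate:
 assumes F: "finite F" "F <= corner" and u: "!!i. i < r ==> u i : car C" and eps: "eps > 0"
 shows "EX (T :: nat) m zt. (ALL t<T. J <= m t & (ALL i. zt t i : CV (q (m t)))) &
 (ALL a:F. ALL i<r. ALL j<r. cmod ((\<Sum>t<T. cinner (V (m t) (L a (m t)) *! zt t i) (zt t j)) - Phi u i j a) < eps)"
proof (rule ccontr)
 assume neg: "\<not> ?thesis"
 define val :: "nat => (nat => nat) => (nat => nat => complex vec) => 'a \<times> nat \<times> nat => complex" where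
 "val T m zt = (%(a,i,j). \<Sum>t<T. cinner (V (m t) (L a (m t)) *! zt t i) (zt t j))" for T m zt
 define adm where "adm T m zt \<longleftrightarrow> (ALL t<T. J <= m t & (ALL i. zt t i : CV (q (m t))))"
 for T :: nat and m and zt :: "nat => nat => complex vec"
 define I where "I = F \<times> {..<r} \<times> {..<r}"
 \<comment> \<open>Sums of microstates as functions of (a, i, j), set to 0 off I so that the cone
   properties hold as equations between functions.\<close>
 define K where "K = {(%x. if x : I then g x else 0) | g. EX T m zt. adm T m zt & g = val T m zt}"
 have K_I: "(%x. if x : I then val T m zt x else 0) : K" if "adm T m zt" for T m zt
 unfolding K_def using that by blast
 have VL: "V n (L a n) : CM (q n) (q n)" if "a : F" for a n
 using that F corner_carrier L(1) by (intro V_carrier Prod_mat) auto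
 have Re_sum: "(\<Sum>x\<in>I. h x * g x) = (\<Sum>j<r. \<Sum>i<r. \<Sum>a\<in>F. h (a,i,j) * g (a,i,j))"
 for h g :: "'a \<times> nat \<times> nat => complex"
 proof -
 have "(\<Sum>x\<in>I. h x * g x) = (\<Sum>a\<in>F. \<Sum>i<r. \<Sum>j<r. h (a,i,j) * g (a,i,j))"
 by (simp add: I_def sum.cartesian_product)
 also have "... = (\<Sum>i<r. \<Sum>j<r. \<Sum>a\<in>F. h (a,i,j) * g (a,i,j))"
 by (subst sum.swap, intro sum.cong refl sum.swap)
 also have "... = (\<Sum>j<r. \<Sum>i<r. \<Sum>a\<in>F. h (a,i,j) * g (a,i,j))" by (rule sum.swap)
 finally show ?thesis .
 qed
 define Psi where "Psi = (%(a,i,j). Phi u i j a)"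
 obtain h where h: "!!g. g : K ==> 0 <= Re (\<Sum>x\<in>I. h x * g x)" "Re (\<Sum>x\<in>I. h x * Psi x) < 0"
 proof (rule cone_separation[of I K eps Psi])
 show "finite I" using F by (simp add: I_def)
 have "(%_. 0) = (%x. if x : I then val 0 (%_. J) (%t i. 0\<^sub>v (q J)) x else 0)"
 by (auto simp: val_def split: prod.splits)
 then show "(%_. 0) : K" using K_I[of 0 "%_. J" "%t i. 0\<^sub>v (q J)"] by (simp add: adm_def)
 next
 fix g g' assume "g : K" "g' : K"
 then obtain T m zt T' m' zt' where *: "adm T m zt" "g = (%x. if x : I then val T m zt x else 0)"
 "adm T' m' zt'" "g' = (%x. if x : I then val T' m' zt' x else 0)" unfolding K_def by blast
 \<comment> \<open>Sums of microstates are added by concatenating the families; below, scaling by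
   rho is scaling of the vectors by its square root.\<close>
 define m2 zt2 where "m2 = (%t. if t < T then m t else m' (t - T))" and "zt2 = (%t. if t < T then zt t else zt' (t - T))"
 have "adm (T + T') m2 zt2" using *(1,3) by (auto simp: adm_def m2_def zt2_def)
 moreover have "(%x. g x + g' x) = (%x. if x : I then val (T + T') m2 zt2 x else 0)"
 unfolding *(2,4) by (auto simp: val_def m2_def zt2_def sum_lessThan_add intro!: ext)
 ultimately show "(%x. g x + g' x) : K" using K_I by simp
 next
 fix g and rho :: real assume "g : K" and rho: "rho >= 0"
 then obtain T m zt where *: "adm T m zt" "g = (%x. if x : I then val T m zt x else 0)" unfolding K_def by blast
 define zt2 where "zt2 t i = cr (sqrt rho) \<cdot>\<^sub>v zt t i" for t i
 have "adm T m zt2" using *(1) by (auto simp: adm_def zt2_def)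
 moreover have "cr rho * val T m zt x = val T m zt2 x" if x: "x : I" for x
 proof -
 obtain a i j where aij: "x = (a,i,j)" "a : F" using x by (auto simp: I_def)
 have s: "cr (sqrt rho) * cr (sqrt rho) = cr rho"
 using rho by (simp flip: of_real_mult)
 have "cr rho * cinner (V (m t) (L a (m t)) *! zt t i) (zt t j)
 = cinner (V (m t) (L a (m t)) *! zt2 t i) (zt2 t j)" if t: "t < T" for t
 proof -
 have z: "zt t i : CV (q (m t))" "zt t j : CV (q (m t))" using *(1) t by (auto simp: adm_def)
 note Vz = mult_mat_vec_carrier[OF VL[OF aij(2)] z(1)]
 show ?thesis
 unfolding zt2_def mult_mat_vec[OF VL[OF aij(2)] z(1)]
 using cinner_smult_left[OF Vz smult_carrier_vec[THEN iffD2, OF z(2)]] cinner_smult_right[OF Vz z(2)] by (simp flip: s)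
 qed
 then show ?thesis by (simp add: aij(1) val_def sum_distrib_left)
 qed
 then have "(%x. cr rho * g x) = (%x. if x : I then val T m zt2 x else 0)" unfolding *(2) by auto
 ultimately show "(%x. cr rho * g x) : K" using K_I by simp
 next
 fix g assume "g : K"
 then obtain T m zt where *: "adm T m zt" "g = (%x. if x : I then val T m zt x else 0)" unfolding K_def by blast
 with neg obtain a i j where "a : F" "i < r" "j < r"
 "\<not> cmod ((\<Sum>t<T. cinner (V (m t) (L a (m t)) *! zt t i) (zt t j)) - Phi u i j a) < eps"
 unfolding adm_def by blast
 then show "EX x:I. eps <= cmod (g x - Psi x)"
 by (intro bexI[of _ "(a,i,j)"]) (simp_all add: I_def *(2) val_def Psi_def)
 qed (use eps in auto)
 define hh where "hh a i j = h (a,i,j)" for a i j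
 \<comment> \<open>The coefficients of the separating functional become a matrix over A, and H is
   its hermitian part. Passing from Hm to H does not change the real part of the pairing with
   \<open>Phi\<close>.\<close>
 define Hm where "Hm i j = finsum A (%a. hh a i j *:[A] a) F" for i j
 define H where "H i j = (1/2) *:[A] (Hm i j +[A] star A (Hm j i))" for i j
 have Fc: "a : car A" if "a : F" for a using F that corner_carrier by auto
 have Hmc: "Hm i j : car A" for i j unfolding Hm_def by (rule A.finsum_closed') (use Fc in simp)
 have "A.pos_matrix r H"
 unfolding H_def Hm_def
 proof (rule pos_matrix_if_microstates_pos[OF F])
 fix m and zt :: "nat => complex vec"
 assume m: "m >= J" and zt: "!!i. i < r ==> zt i : CV (q m)"
 define zt' where "zt' t i = (if i < r then zt i else 0\<^sub>v (q m))" for t :: nat and i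
 have "adm 1 (%_. m) zt'" using m zt by (simp add: adm_def zt'_def)
 then have "0 <= Re (\<Sum>x\<in>I. h x * (if x : I then val 1 (%_. m) zt' x else 0))" using h(1)[OF K_I] by blast
 also have "(\<Sum>x\<in>I. h x * (if x : I then val 1 (%_. m) zt' x else 0)) = (\<Sum>x\<in>I. h x * val 1 (%_. m) zt' x)"
 by (intro sum.cong) auto
 also have "... = (\<Sum>j<r. \<Sum>i<r. \<Sum>a\<in>F. hh a i j * cinner (V m (L a m) *! zt i) (zt j))"
 unfolding Re_sum by (intro sum.cong refl) (simp add: val_def zt'_def hh_def)
 finally show "0 <= Re (\<Sum>j<r. \<Sum>i<r. \<Sum>a\<in>F. hh a i j * cinner (V m (L a m) *! zt i) (zt j))" .
 qed
 then have pos: "0 <= Re (\<Sum>i<r. \<Sum>j<r. Phi u i j (H i j))"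
 using Phi_cp_family[OF u] by (rule A.cp_family_pos_matrix)
 have PhiH: "Phi u i j (H i j) = (Phi u i j (Hm i j) + cnj (Phi u j i (Hm j i))) / 2" if ij: "i < r" "j < r" for i j
 unfolding H_def using A.lfun_simps[OF Phi_linear[of u i j]] Phi_star[of u i j "Hm j i"] u ij Hmc by simp
 have "(\<Sum>i<r. \<Sum>j<r. Re (Phi u i j (H i j))) = (\<Sum>i<r. \<Sum>j<r. (Re (Phi u i j (Hm i j)) + Re (Phi u j i (Hm j i))) / 2)"
 by (intro sum.cong refl) (simp add: PhiH)
 also have "... = ((\<Sum>i<r. \<Sum>j<r. Re (Phi u i j (Hm i j))) + (\<Sum>i<r. \<Sum>j<r. Re (Phi u j i (Hm j i)))) / 2"
 by (simp add: sum.distrib sum_divide_distrib add_divide_distrib)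
 also have "(\<Sum>i<r. \<Sum>j<r. Re (Phi u j i (Hm j i))) = (\<Sum>i<r. \<Sum>j<r. Re (Phi u i j (Hm i j)))" by (rule sum.swap)
 finally have "Re (\<Sum>i<r. \<Sum>j<r. Phi u i j (H i j)) = Re (\<Sum>i<r. \<Sum>j<r. Phi u i j (Hm i j))" by simp
 also have "(\<Sum>i<r. \<Sum>j<r. Phi u i j (Hm i j)) = (\<Sum>i<r. \<Sum>j<r. \<Sum>a\<in>F. hh a i j * Phi u i j a)"
 proof (intro sum.cong refl)
 fix i j assume "i : {..<r}" "j : {..<r}"
 then have lf: "A.lfun (Phi u i j)" using Phi_linear u by simp
 have "Phi u i j (Hm i j) = (\<Sum>a\<in>F. Phi u i j (hh a i j *:[A] a))"
 unfolding Hm_def by (rule A.lfun_finsum[OF lf F(1)]) (use Fc in simp)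
 then show "Phi u i j (Hm i j) = (\<Sum>a\<in>F. hh a i j * Phi u i j a)"
 using A.lfun_sm[OF lf] Fc by simp
 qed
 also have "... = (\<Sum>j<r. \<Sum>i<r. \<Sum>a\<in>F. hh a i j * Phi u i j a)" by (rule sum.swap)
 also have "... = (\<Sum>x\<in>I. h x * Psi x)" unfolding Re_sum by (simp add: hh_def Psi_def)
 finally show False using pos h(2) by simp
qed

end

text \<open>Orthonormalization for the inner product of phi. A remainder of length 0 is the zero
  element because phi is faithful, so the expansions hold in the algebra itself. They are stated
  through linear functionals, which separate points and are the form in which they are
  applied.\<close>

lemma (in unital_cstar_algebra) gram_schmidt:
 fixes w :: "nat => 'a"
 assumes phi: "pfun phi"
 and faithful: "!!x. x : car A ==> Re (phi (star A x \<otimes> x)) = 0 ==> x = \<zero>"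
 and e: "e : car A" and w: "!!l. w l : car A" "!!l. e \<otimes> w l = w l"
 shows "EX (r :: nat) u c. (ALL i<r. u i : car A & e \<otimes> u i = u i) &
 (ALL i<r. ALL j<r. phi (star A (u j) \<otimes> u i) = of_bool (i = j)) &
 (ALL l<s. ALL F. lfun F --> F (w l) = (\<Sum>i<r. c l i * F (u i)))"
proof (induction s)
 case 0
 show ?case by (rule exI[of _ 0]) simp
next
 case (Suc s)
 then obtain r :: nat and u c where *: "ALL i<r. u i : car A & e \<otimes> u i = u i"
 "ALL i<r. ALL j<r. phi (star A (u j) \<otimes> u i) = of_bool (i = j)"
 "ALL l<s. ALL F. lfun F --> F (w l) = (\<Sum>i<r. c l i * F (u i))"
 by blast
 have u: "u i : car A" "e \<otimes> u i = u i" if "i < r" for i using *(1) that by auto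
 have orth: "phi (star A (u j) \<otimes> u i) = of_bool (i = j)" if "i < r" "j < r" for i j using *(2) that by blast
 have c: "F (w l) = (\<Sum>i<r. c l i * F (u i))" if "l < s" "lfun F" for l F using *(3) that by blast
 note phil = pfun_linear[OF phi]
 define b where "b i = phi (star A (u i) \<otimes> w s)" for i
 define y where "y = w s \<ominus> finsum A (%i. b i \<odot> u i) {..<r}"
 have fc: "finsum A (%i. b i \<odot> u i) {..<r} : car A" by (rule finsum_closed') (use u in auto)
 have y: "y : car A" using w(1) fc by (simp add: y_def)
 have Fy: "F y = F (w s) - (\<Sum>i<r. b i * F (u i))" if F: "lfun F" for F
 proof -
 have "F (finsum A (%i. b i \<odot> u i) {..<r}) = (\<Sum>i<r. F (b i \<odot> u i))"
 by (rule lfun_finsum[OF F]) (use u in auto)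
 also have "... = (\<Sum>i<r. b i * F (u i))"
 by (intro sum.cong refl lfun_sm[OF F] u) auto
 finally show ?thesis unfolding y_def using w(1) fc by (simp add: lfun_simps[OF F])
 qed
 have ey: "e \<otimes> y = y"
 proof (rule feqI)
 fix F assume F: "lfun F"
 have "F (e \<otimes> y) = F (e \<otimes> w s) - (\<Sum>i<r. b i * F (e \<otimes> u i))" by (rule Fy[OF lfun_mult_left[OF F e]])
 then show "F (e \<otimes> y) = F y" using w u by (simp add: Fy[OF F])
 qed (use e y in auto)
 have uy: "phi (star A (u j) \<otimes> y) = 0" if j: "j < r" for j
 proof -
 have "phi (star A (u j) \<otimes> y) = b j - (\<Sum>i<r. b i * phi (star A (u j) \<otimes> u i))"
 unfolding b_def[of j] by (rule Fy[OF lfun_mult_left[OF phil]]) (use u j in auto)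
 also have "(\<Sum>i<r. b i * phi (star A (u j) \<otimes> u i)) = (\<Sum>i<r. if i = j then b i else 0)"
 by (intro sum.cong refl) (use orth j in simp)
 finally show ?thesis using j by simp
 qed
 have yu: "phi (star A y \<otimes> u j) = 0" if j: "j < r" for j
 using pfun_star[OF phi, of "star A (u j) \<otimes> y"] u[OF j] y uy[OF j] by (simp add: star_mult)
 show ?case
 proof (cases "Re (phi (star A y \<otimes> y)) = 0")
 case True
 then have "y = \<zero>" by (rule faithful[OF y])
 then have Fs: "F (w s) = (\<Sum>i<r. b i * F (u i))" if "lfun F" for F
 using Fy[OF that] lfun_simps[OF that] by simp
 show ?thesis
 by (rule exI[of _ r], rule exI[of _ u], rule exI[of _ "c(s := b)"])
 (use u orth c Fs in \<open>auto simp: less_Suc_eq\<close>)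
 next
 case False
 define rho where "rho = Re (phi (star A y \<otimes> y))"
 have rho: "rho > 0" "phi (star A y \<otimes> y) = cr rho"
 using False pfun_pos[OF phi pos_star_mult[OF y]] pfun_pos_real[OF phi pos_star_mult[OF y]]
 by (simp_all add: rho_def)
 define z where "z = cr (1 / sqrt rho) \<odot> y"
 have z: "z : car A" "e \<otimes> z = z" using y e ey by (simp_all add: z_def smult_mult_right)
 have zz: "phi (star A z \<otimes> z) = 1"
 proof -
 have "phi (star A z \<otimes> z) = cr (1 / sqrt rho) * (cr (1 / sqrt rho) * cr rho)"
 unfolding z_def using y rho(2)
 by (simp add: star_smult smult_mult_left smult_mult_right lfun_simps[OF phil])
 also have "... = cr (1 / sqrt rho * (1 / sqrt rho) * rho)" by (simp only: of_real_mult mult.assoc)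
 also have "1 / sqrt rho * (1 / sqrt rho) * rho = 1" using rho(1) by simp
 finally show ?thesis by simp
 qed
 have uz: "phi (star A (u j) \<otimes> z) = 0" "phi (star A z \<otimes> u j) = 0" if "j < r" for j
 unfolding z_def using y u[OF that] uy[OF that] yu[OF that]
 by (simp_all add: star_smult smult_mult_left smult_mult_right lfun_simps[OF phil])
 have Fs: "F (w s) = (\<Sum>i<r. b i * F (u i)) + cr (sqrt rho) * F z" if F: "lfun F" for F
 unfolding z_def using Fy[OF F] rho(1) y by (simp add: lfun_simps[OF F])
 define c' where "c' l i = (if l = s then (if i = r then cr (sqrt rho) else b i)
 else if i = r then 0 else c l i)" for l i
 have sum: "(\<Sum>i<Suc r. c' l i * F ((u(r := z)) i)) = (\<Sum>i<r. (if l = s then b i else c l i) * F (u i)) + c' l r * F z" for F l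
 by (auto simp: c'_def intro!: sum.cong)
 show ?thesis
 by (rule exI[of _ "Suc r"], rule exI[of _ "u(r := z)"], rule exI[of _ c'], unfold sum)
 (use u z orth zz uz c Fs in \<open>auto simp: less_Suc_eq c'_def\<close>)
 qed
qed

context mf_state
begin

text \<open>Microstates are approximated for F together with e. As e compresses to the identity, its
  microstate sums are the Gram matrix of the vectors, close to 1 because the u_i are orthonormal for
  phi. Orthonormalizing these vectors and completing them to a resolution turns the sums into
  entries of one compressed matrix. Blocks may be repeated, so every positive multiple of N0 is
  available as dimension.\<close>

lemma corner_resolution:
 assumes F: "finite F" "F <= corner" and r: "0 < r"
 and u: "!!i. i < r ==> u i : car C" "!!i. i < r ==> sg e *[C] u i = u i"
 and orth: "!!i j. i < r ==> j < r ==> phi (star C (u j) *[C] u i) = of_bool (i = j)" and eps: "eps > 0"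
 shows "EX N0>0. ALL M>0. EX T m Z. (ALL t<T. J <= m t) & resolution (%t. q (m t)) (N0 * M) T Z & r <= N0 * M &
 (ALL a:F. ALL i<r. ALL j<r. cmod (cinner (compress (N0 * M) T Z (%t. V (m t) (L a (m t))) *! unit_vec (N0 * M) i)
 (unit_vec (N0 * M) j) - Phi u i j a) < eps)"
proof -
 define M0 where "M0 = Max (insert 0 ((%(a,i,j). cmod (Phi u i j a)) ` (F \<times> {..<r} \<times> {..<r})))"
 have fin: "finite (insert 0 ((%(a,i,j). cmod (Phi u i j a)) ` (F \<times> {..<r} \<times> {..<r})))" using F by simp
 have M0: "cmod (Phi u i j a) <= M0" if "a : F" "i < r" "j < r" for a i j
 unfolding M0_def by (rule Max_ge[OF fin]) (use that in force)
 have M0n: "0 <= M0" unfolding M0_def by (rule Max_ge[OF fin]) simp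
 define rr B where "rr = real r * real r" and "B = rr * (M0 + 1)"
 have rr: "rr > 0" and B: "B >= 0" using r M0n by (simp_all add: rr_def B_def)
 \<comment> \<open>The three bounds keep the entries of G a within 1 of \<open>Phi\<close>, the Gram
   matrix within 1/2 of the identity, and the final error eps1 + 6 B rr eps1 below eps.\<close>
 define eps1 where "eps1 = min 1 (min (1 / (2 * rr)) (eps / (2 * (1 + 6 * B * rr))))"
 have D: "0 < 1 + 6 * B * rr" using B rr by (simp add: add_pos_nonneg)
 have eps1: "0 < eps1" "eps1 <= 1" "rr * eps1 <= 1/2" "eps1 + 6 * B * rr * eps1 < eps"
 proof -
 show "0 < eps1" "eps1 <= 1" using eps rr D by (simp_all add: eps1_def)
 have "eps1 <= 1 / (2 * rr)" by (simp add: eps1_def)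
 then have "rr * eps1 <= rr * (1 / (2 * rr))" using rr by (intro mult_left_mono) auto
 then show "rr * eps1 <= 1/2" using rr by simp
 have "eps1 <= eps / (2 * (1 + 6 * B * rr))" by (simp add: eps1_def)
 then have "(1 + 6 * B * rr) * eps1 <= (1 + 6 * B * rr) * (eps / (2 * (1 + 6 * B * rr)))" using D by (intro mult_left_mono) auto
 also have "... = eps / 2" using D by (simp add: field_simps)
 finally show "eps1 + 6 * B * rr * eps1 < eps" using eps by (simp add: algebra_simps)
 qed
 have F': "finite (insert e F)" "insert e F <= corner" using F e_corner by auto
 have "EX (T :: nat) m zt. (ALL t<T. J <= m t & (ALL i. zt t i : CV (q (m t)))) & (ALL a:insert e F. ALL i<r. ALL j<r.
 cmod ((\<Sum>t<T. cinner (V (m t) (L a (m t)) *! zt t i) (zt t j)) - Phi u i j a) < eps1)"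
 by (rule microstates_approximate[OF F' _ eps1(1)]) (rule u(1))
 then obtain T :: nat and m zt where *: "ALL t<T. J <= m t & (ALL i. zt t i : CV (q (m t)))" "ALL a:insert e F. ALL i<r. ALL j<r.
 cmod ((\<Sum>t<T. cinner (V (m t) (L a (m t)) *! zt t i) (zt t j)) - Phi u i j a) < eps1"
 by blast
 have m: "J <= m t" and zt: "zt t i : CV (q (m t))" if "t < T" for t i using *(1) that by auto
 have near: "cmod ((\<Sum>t<T. cinner (V (m t) (L a (m t)) *! zt t i) (zt t j)) - Phi u i j a) < eps1"
 if "a : insert e F" "i < r" "j < r" for a i j using *(2) that by (simp only: Ball_def)
 define Z where "Z t = mat (q (m t)) r (%(i,j). zt t j $ i)" for t
 have Z: "Z t : CM (q (m t)) r" for t by (simp add: Z_def)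
 have Ze: "Z t *! unit_vec r j = zt t j" if "t < T" "j < r" for t j
 proof -
 have "Z t *! unit_vec r j = col (Z t) j" using Z[of t] that by (auto intro!: eq_vecI)
 also have "... = zt t j" using zt[OF that(1), of j] that by (auto simp: Z_def)
 finally show ?thesis .
 qed
 define X where "X a t = V (m t) (L a (m t))" for a t
 have X: "X a t : CM (q (m t)) (q (m t))" if "a : insert e F" for a t
 unfolding X_def by (intro V_carrier Prod_mat L(1) corner_carrier) (use that F'(2) in auto)
 define G where "G a = compress r T Z (X a)" for a
 have G: "G a : CM r r" for a by (simp add: G_def)
 have cG: "cinner (G a *! v) w = (\<Sum>t<T. cinner (X a t *! (Z t *! v)) (Z t *! w))"
 if "a : insert e F" "v : CV r" "w : CV r" for a v w
 unfolding G_def by (rule cinner_compress[OF Z X[OF that(1)] that(2,3)])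
 have Gij: "cmod (G a $$ (j,i) - Phi u i j a) < eps1" if "a : insert e F" "i < r" "j < r" for a i j
 unfolding cinner_unit_vec[OF G that(3,2), symmetric] using near[OF that] that
 by (simp add: cG Ze X_def)
 have GB: "opn (G a) <= B" if a: "a : F" for a
 proof -
 have "cmod (G a $$ (j,i)) <= M0 + 1" if "i < r" "j < r" for i j
 using Gij[of a i j] M0[OF a that] eps1(2) norm_triangle_ineq2[of "G a $$ (j,i)" "Phi u i j a"] a that by simp
 then have "(\<Sum>i<r. \<Sum>j<r. cmod (G a $$ (i,j))) <= (\<Sum>i<r. \<Sum>j<r. M0 + 1)" by (intro sum_mono) auto
 then show ?thesis using opn_le_sum[OF G, of a] by (simp add: B_def rr_def mult.assoc)
 qed
 have Ge: "sum_mat r r T (%t. adj (Z t) * Z t) = G e"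
 proof -
 have "X e t * Z t = Z t" for t using Z[of t] by (simp add: X_def Le V_p)
 then show ?thesis by (simp add: G_def compress_def)
 qed
 have "opn (1\<^sub>m r - G e) <= rr * eps1"
 proof -
 have "cmod ((1\<^sub>m r - G e) $$ (j,i)) <= eps1" if "i < r" "j < r" for i j
 using Gij[of e i j] that u orth G[of e] by (auto simp: Phi_def norm_minus_commute)
 then have "(\<Sum>i<r. \<Sum>j<r. cmod ((1\<^sub>m r - G e) $$ (i,j))) <= (\<Sum>i<r. \<Sum>j<r. eps1)" by (intro sum_mono) auto
 then show ?thesis
 using opn_le_sum[OF minus_carrier_mat[OF G], of "1\<^sub>m r" e] by (simp add: rr_def)
 qed
 then obtain R where R: "R : CM r r" "opn (R - 1\<^sub>m r) <= 2 * (rr * eps1)"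
 and iso: "!!v w. v : CV r ==> w : CV r ==>
 (\<Sum>t<T. cinner ((Z t * R) *! v) ((Z t * R) *! w)) = cinner v w"
 using orthonormalize_family[of T Z "%t. q (m t)" r "rr * eps1"] Z eps1(3) unfolding Ge by blast
 have T: "T > 0"
 proof (rule ccontr)
 assume "\<not> T > 0"
 then have "cinner (unit_vec r 0) (unit_vec r 0) = (0 :: complex)" using iso[of "unit_vec r 0" "unit_vec r 0"] by simp
 then show False using r nrm_unit_vec[OF r] nrm_square[of "unit_vec r 0"] by simp
 qed
 define N0 where "N0 = (\<Sum>t<T. q (m t))"
 have ZR: "Z t * R : CM (q (m t)) r" for t using Z R(1) by (rule mult_carrier_mat)
 have "r <= N0" using resolution_extending[of T "%t. Z t * R" "%t. q (m t)" r N0] ZR iso N0_def by blast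
 then have N0: "N0 > 0" using r by simp
 define S where "S = R - 1\<^sub>m r"
 have S: "S : CM r r" "opn S <= 2 * (rr * eps1)" using R minus_carrier_mat[OF one_carrier_mat, of R r] by (simp_all add: S_def)
 let ?eta = "2 * (rr * eps1)"
 let ?u = "unit_vec r :: nat => complex vec"
 have err: "cmod (cinner (G a *! (R *! ?u i)) (R *! ?u j) - Phi u i j a) < eps" if a: "a : F" and ij: "i < r" "j < r" for a i j
 proof -
 have Ru: "R *! ?u i = ?u i + S *! ?u i" for i using R(1) by (auto simp: S_def minus_mult_distrib_mat_vec intro!: eq_vecI)
 have uc: "?u i : CV r" for i by simp
 have Sc: "S *! ?u i : CV r" for i by (rule mult_mat_vec_carrier[OF S(1) uc])
 have Rc: "R *! ?u i : CV r" for i by (rule mult_mat_vec_carrier[OF R(1) uc])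
 have Sn: "nm2 (S *! ?u i) <= ?eta" if "i < r" for i
 using nrm_mult_le[OF S(1) uc, of i] S(2) that by (simp add: nrm_unit_vec)
 have Rn: "nm2 (R *! ?u j) <= 2"
 using nrm_add[OF uc Sc, of j j] Sn[OF ij(2)] eps1(3) ij by (simp add: Ru nrm_unit_vec)
 have Gc: "G a *! v : CV r" if "v : CV r" for v using G that by (rule mult_mat_vec_carrier)
 have "cinner (G a *! (R *! ?u i)) (R *! ?u j)
 = cinner (G a *! ?u i) (R *! ?u j) + cinner (G a *! (S *! ?u i)) (R *! ?u j)"
 unfolding Ru[of i] mult_add_distrib_mat_vec[OF G uc Sc] by (rule cinner_add_left[OF Gc[OF uc] Gc[OF Sc] Rc])
 also have "cinner (G a *! ?u i) (R *! ?u j) = G a $$ (j,i) + cinner (G a *! ?u i) (S *! ?u j)"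
 unfolding Ru[of j] cinner_add_right[OF Gc[OF uc] uc Sc] cinner_unit_vec[OF G ij(2,1)] ..
 finally have eq: "cinner (G a *! (R *! ?u i)) (R *! ?u j) - Phi u i j a
 = (G a $$ (j,i) - Phi u i j a) + (cinner (G a *! ?u i) (S *! ?u j) + cinner (G a *! (S *! ?u i)) (R *! ?u j))"
 by simp
 have "cmod (cinner (G a *! ?u i) (S *! ?u j)) <= opn (G a) * nm2 (?u i) * nm2 (S *! ?u j)"
 by (rule cmod_cinner_le[OF G uc Sc])
 also have "... <= B * 1 * ?eta"
 using GB[OF a] Sn[OF ij(2)] B opn_nonneg[OF G] ij by (intro mult_mono) (auto simp: nrm_unit_vec)
 finally have e1: "cmod (cinner (G a *! ?u i) (S *! ?u j)) <= B * ?eta" by simp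
 have "cmod (cinner (G a *! (S *! ?u i)) (R *! ?u j)) <= opn (G a) * nm2 (S *! ?u i) * nm2 (R *! ?u j)"
 by (rule cmod_cinner_le[OF G Sc Rc])
 also have "... <= B * ?eta * 2"
 using GB[OF a] Sn[OF ij(1)] Rn B opn_nonneg[OF G] eps1(1) rr by (intro mult_mono) auto
 finally have e2: "cmod (cinner (G a *! (S *! ?u i)) (R *! ?u j)) <= B * ?eta * 2" .
 have "cmod (cinner (G a *! (R *! ?u i)) (R *! ?u j) - Phi u i j a)
 <= cmod (G a $$ (j,i) - Phi u i j a) + (cmod (cinner (G a *! ?u i) (S *! ?u j)) + cmod (cinner (G a *! (S *! ?u i)) (R *! ?u j)))"
 unfolding eq by (intro order_trans[OF norm_triangle_ineq] add_mono order_refl norm_triangle_ineq)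
 also have "... < eps1 + (B * ?eta + B * ?eta * 2)"
 by (intro add_less_le_mono add_mono e1 e2 Gij) (use a ij in auto)
 also have "... = eps1 + 6 * B * rr * eps1" by simp
 finally show ?thesis using eps1(4) by simp
 qed
 have "EX T m Z. (ALL t<T. J <= m t) & resolution (%t. q (m t)) (N0 * M) T Z & r <= N0 * M &
 (ALL a:F. ALL i<r. ALL j<r. cmod (cinner (compress (N0 * M) T Z (%t. V (m t) (L a (m t))) *! unit_vec (N0 * M) i)
 (unit_vec (N0 * M) j) - Phi u i j a) < eps)" if M: "M > 0" for M
 proof -
 \<comment> \<open>M copies of the list of blocks. The vectors live in the first copy and the others
   receive zero maps, so the isometry condition is unaffected.\<close>
 define m' where "m' t = m (t mod T)" for t
 define Om where "Om t = (if t < T then Z t * R else 0\<^sub>m (q (m' t)) r)" for t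
 have m'T: "m' t = m t" if "t < T" for t using that by (simp add: m'_def)
 have Om: "Om t : CM (q (m' t)) r" for t using ZR[of t] by (simp add: Om_def m'T)
 have sum_T: "(\<Sum>t<T * M. g t) = (\<Sum>t<T. g t)" if "!!t. t >= T ==> g t = 0" for g :: "nat => complex"
 using M by (intro sum.mono_neutral_right) (auto intro: that)
 have zero: "Om t *! v = 0\<^sub>v (q (m' t))" if "t >= T" "v : CV r" for t v using that by (auto simp: Om_def)
 have N: "N0 * M = (\<Sum>t<T * M. q (m' t))"
 proof (induction M)
 case (Suc M)
 then show ?case by (simp add: sum_lessThan_add m'_def N0_def)
 qed simp
 obtain Z' where Z': "resolution (%t. q (m' t)) (N0 * M) (T * M) Z'" "r <= N0 * M"
 "!!t j. t < T * M ==> j < r ==> Z' t *! unit_vec (N0 * M) j = Om t *! unit_vec r j"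
 proof (rule resolution_extending[of "T * M" Om "%t. q (m' t)" r "N0 * M"])
 fix v w :: "complex vec" assume v: "v : CV r" and w: "w : CV r"
 have "(\<Sum>t<T * M. cinner (Om t *! v) (Om t *! w)) = (\<Sum>t<T. cinner (Om t *! v) (Om t *! w))"
 by (rule sum_T) (use v w in \<open>simp add: zero\<close>)
 also have "... = cinner v w" unfolding iso[OF v w, symmetric] by (simp add: Om_def)
 finally show "(\<Sum>t<T * M. cinner (Om t *! v) (Om t *! w)) = cinner v w" .
 qed (use Om N in auto)
 have "cinner (compress (N0 * M) (T * M) Z' (%t. V (m' t) (L a (m' t))) *! unit_vec (N0 * M) i) (unit_vec (N0 * M) j)
 = cinner (G a *! (R *! ?u i)) (R *! ?u j)" if a: "a : F" and ij: "i < r" "j < r" for a i j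
 proof -
 have La: "L a n : CM (k n) (k n)" for n using a F(2) corner_carrier L(1) by (intro Prod_mat) auto
 have uc: "?u i : CV r" for i by simp
 have "cinner (compress (N0 * M) (T * M) Z' (%t. V (m' t) (L a (m' t))) *! unit_vec (N0 * M) i) (unit_vec (N0 * M) j)
 = (\<Sum>t<T * M. cinner (V (m' t) (L a (m' t)) *! (Z' t *! unit_vec (N0 * M) i)) (Z' t *! unit_vec (N0 * M) j))"
 by (rule cinner_compress_resolution[OF Z'(1) V_carrier[OF La]]) auto
 also have "... = (\<Sum>t<T * M. cinner (V (m' t) (L a (m' t)) *! (Om t *! ?u i)) (Om t *! ?u j))"
 by (intro sum.cong refl) (simp add: Z'(3) ij)
 also have "... = (\<Sum>t<T. cinner (V (m' t) (L a (m' t)) *! (Om t *! ?u i)) (Om t *! ?u j))"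
 proof (rule sum_T)
 fix t assume t: "t >= T"
 have "V (m' t) (L a (m' t)) *! 0\<^sub>v (q (m' t)) : CV (q (m' t))"
 by (rule mult_mat_vec_carrier[OF V_carrier[OF La]]) simp
 then show "cinner (V (m' t) (L a (m' t)) *! (Om t *! ?u i)) (Om t *! ?u j) = 0"
 unfolding zero[OF t uc] by (simp add: cinner_eq[of _ "q (m' t)"])
 qed
 also have "... = (\<Sum>t<T. cinner (X a t *! (Z t *! (R *! ?u i))) (Z t *! (R *! ?u j)))"
 by (intro sum.cong refl) (simp add: X_def Om_def m'T assoc_mult_mat_vec[OF Z R(1) uc])
 also have "... = cinner (G a *! (R *! ?u i)) (R *! ?u j)"
 by (rule cG[symmetric]) (use a R(1) in auto)
 finally show ?thesis .
 qed
 moreover have "J <= m' t" for t unfolding m'_def by (rule m) (use T in simp)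
 ultimately show ?thesis using Z'(1,2) err by (intro exI[of _ "T * M"] exI[of _ m'] exI[of _ Z']) auto
 qed
 then show ?thesis using N0 by blast
qed

end

section \<open>Block models of an algebra containing matrix units\<close>

subsection \<open>Block matrices\<close>

definition blk :: "nat => nat => (nat => nat => complex mat) => complex mat" where
 "blk n N X = mat (n * N) (n * N) (%(a,b). X (a div N) (b div N) $$ (a mod N, b mod N))"

definition bvec :: "nat => nat => (nat => complex vec) => complex vec" where
 "bvec n N xi = vec (n * N) (%a. xi (a div N) $ (a mod N))"

definition slice :: "nat => complex vec => nat => complex vec" where
 "slice N v i = vec N (%p. v $ (i * N + p))"

lemma blk_carrier [simp]: "blk n N X : CM (n * N) (n * N)" by (simp add: blk_def)

lemma bvec_carrier [simp]: "bvec n N xi : CV (n * N)" by (simp add: bvec_def)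

lemma slice_carrier [simp]: "slice N v i : CV N" by (simp add: slice_def)

lemma sum_blocks:
 fixes g :: "nat => 'a :: comm_monoid_add"
 shows "(\<Sum>a<n * N. g a) = (\<Sum>i<n. \<Sum>p<N. g (i * N + p))"
proof (induction n)
 case (Suc n)
 have "(\<Sum>a<Suc n * N. g a) = (\<Sum>a<n * N + N. g a)" by (simp add: add.commute)
 then show ?case using Suc by (simp add: sum_lessThan_add)
qed simp

lemma block_index: "i < n ==> p < N ==> i * N + p < n * (N :: nat)"
proof -
 assume "i < n" "p < N"
 then have "i * N + p < Suc i * N" by simp
 also have "... <= n * N" using \<open>i < n\<close> by (intro mult_right_mono) auto
 finally show ?thesis .
qed

lemma block_index_div: "a < n * (N :: nat) ==> a div N < n" "a < n * (N :: nat) ==> a mod N < N"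
proof -
 assume a: "a < n * N"
 then have "N > 0" by (cases N) auto
 then show "a div N < n" "a mod N < N" using a by (simp_all add: less_mult_imp_div_less)
qed

lemma blk_index: "i < n ==> j < n ==> p < N ==> q < N ==> blk n N X $$ (i * N + p, j * N + q) = X i j $$ (p,q)"
 using block_index[of i n p N] block_index[of j n q N] by (simp add: blk_def)

lemma slice_bvec: "xi i : CV N ==> i < n ==> slice N (bvec n N xi) i = xi i"
 using block_index[of i n _ N] by (intro eq_vecI) (auto simp: slice_def bvec_def)

lemma cinner_blk:
 assumes X: "!!i j. i < n ==> j < n ==> X i j : CM N N"
 and v: "v : CV (n * N)" and w: "w : CV (n * N)"
 shows "cinner (blk n N X *! v) w = (\<Sum>i<n. \<Sum>j<n. cinner (X i j *! slice N v j) (slice N w i))"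
proof -
 have "cinner (blk n N X *! v) w
 = (\<Sum>i<n. \<Sum>p<N. \<Sum>j<n. \<Sum>q<N. X i j $$ (p,q) * v $ (j * N + q) * cnj (w $ (i * N + p)))"
 unfolding cinner_mat_eq[OF blk_carrier v w] sum_blocks
 by (intro sum.cong refl) (simp add: blk_index)
 also have "... = (\<Sum>i<n. \<Sum>j<n. \<Sum>p<N. \<Sum>q<N. X i j $$ (p,q) * v $ (j * N + q) * cnj (w $ (i * N + p)))"
 by (intro sum.cong refl sum.swap)
 also have "... = (\<Sum>i<n. \<Sum>j<n. cinner (X i j *! slice N v j) (slice N w i))"
 by (intro sum.cong refl, subst cinner_mat_eq[OF X]) (simp_all add: slice_def)
 finally show ?thesis .
qed

lemma nrm_slice:
 assumes v: "v : CV (n * N)" and i: "i < n"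
 shows "nm2 (slice N v i) <= nm2 v"
proof (rule power2_le_imp_le)
 have eq: "Re (cinner u u) = (\<Sum>a<d. (cmod (u $ a))\<^sup>2)" if "u : CV d" for u :: "complex vec" and d
 unfolding cinner_eq[OF that] by (simp add: complex_mult_cnj cmod_power2)
 have "(nm2 (slice N v i))\<^sup>2 = (\<Sum>p<N. (cmod (v $ (i * N + p)))\<^sup>2)"
 unfolding nrm_Re eq[OF slice_carrier] by (simp add: slice_def)
 also have "... <= (\<Sum>i<n. \<Sum>p<N. (cmod (v $ (i * N + p)))\<^sup>2)"
 by (rule member_le_sum[of i "{..<n}" "%i. \<Sum>p<N. (cmod (v $ (i * N + p)))\<^sup>2"]) (use i in \<open>auto intro!: sum_nonneg\<close>)
 finally show "(nm2 (slice N v i))\<^sup>2 <= (nm2 v)\<^sup>2"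
 unfolding nrm_Re[of v] eq[OF v] sum_blocks .
qed simp

lemma opn_blk:
 assumes X: "!!i j. i < n ==> j < n ==> X i j : CM N N"
 shows "opn (blk n N X) <= (\<Sum>i<n. \<Sum>j<n. opn (X i j))"
proof (rule opn_le_if_cinner_le[OF blk_carrier])
 show "0 <= (\<Sum>i<n. \<Sum>j<n. opn (X i j))" using X by (intro sum_nonneg opn_nonneg) auto
 fix v w :: "complex vec" assume v: "v : CV (n * N)" and w: "w : CV (n * N)"
 have "cmod (cinner (X i j *! slice N v j) (slice N w i)) <= opn (X i j) * (nm2 v * nm2 w)"
 if ij: "i < n" "j < n" for i j
 proof -
 have "cmod (cinner (X i j *! slice N v j) (slice N w i))
 <= opn (X i j) * nm2 (slice N v j) * nm2 (slice N w i)"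
 by (rule cmod_cinner_le[OF X[OF ij]]) auto
 also have "... = opn (X i j) * (nm2 (slice N v j) * nm2 (slice N w i))" by simp
 also have "... <= opn (X i j) * (nm2 v * nm2 w)"
 using nrm_slice v w ij opn_nonneg[OF X[OF ij]] by (intro mult_left_mono mult_mono) auto
 finally show ?thesis .
 qed
 then have "(\<Sum>i<n. \<Sum>j<n. cmod (cinner (X i j *! slice N v j) (slice N w i)))
 <= (\<Sum>i<n. \<Sum>j<n. opn (X i j) * (nm2 v * nm2 w))"
 by (intro sum_mono) auto
 moreover have "cinner (blk n N X *! v) w = (\<Sum>i<n. \<Sum>j<n. cinner (X i j *! slice N v j) (slice N w i))"
 by (rule cinner_blk[OF X v w])
 then have "cmod (cinner (blk n N X *! v) w) <= (\<Sum>i<n. \<Sum>j<n. cmod (cinner (X i j *! slice N v j) (slice N w i)))"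
 by (simp only:) (rule order_trans[OF norm_sum sum_mono[OF norm_sum]])
 ultimately show "cmod (cinner (blk n N X *! v) w) <= (\<Sum>i<n. \<Sum>j<n. opn (X i j)) * nm2 v * nm2 w"
 by (simp add: sum_distrib_right mult.assoc)
qed

context
 fixes n N :: nat and X Y :: "nat => nat => complex mat"
 assumes X: "!!i j. i < n ==> j < n ==> X i j : CM N N"
 and Y: "!!i j. i < n ==> j < n ==> Y i j : CM N N"
begin

lemmas XY = carrier_matD[OF X] carrier_matD[OF Y]

lemma blk_add: "blk n N X + blk n N Y = blk n N (%i j. X i j + Y i j)"
 by (rule eq_matI) (auto simp: blk_def block_index_div XY)

lemma blk_minus: "blk n N X - blk n N Y = blk n N (%i j. X i j - Y i j)"
 by (rule eq_matI) (auto simp: blk_def block_index_div XY)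

lemma blk_smult: "c \<cdot>\<^sub>m blk n N X = blk n N (%i j. c \<cdot>\<^sub>m X i j)"
 by (rule eq_matI) (auto simp: blk_def block_index_div XY)

lemma blk_adjoint: "adj (blk n N X) = blk n N (%i j. adj (X j i))"
 by (rule eq_matI) (auto simp: blk_def block_index_div XY)

lemma blk_mult: "blk n N X * blk n N Y = blk n N (%i j. sum_mat N N n (%k. X i k * Y k j))"
proof (rule eq_matI)
 fix a b assume "a < dim_row (blk n N (%i j. sum_mat N N n (%k. X i k * Y k j)))"
 "b < dim_col (blk n N (%i j. sum_mat N N n (%k. X i k * Y k j)))"
 then have a: "a < n * N" and b: "b < n * N" by (auto simp: blk_def)
 note ab = block_index_div[OF a] block_index_div[OF b]
 have "(blk n N X * blk n N Y) $$ (a,b) = (\<Sum>c<n * N. blk n N X $$ (a,c) * blk n N Y $$ (c,b))"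
 using a b by (simp add: blk_def scalar_prod_def atLeast0LessThan)
 also have "... = (\<Sum>k<n. \<Sum>r<N. X (a div N) k $$ (a mod N,r) * Y k (b div N) $$ (r,b mod N))"
 unfolding sum_blocks
 proof (intro sum.cong refl)
 fix k r assume "k : {..<n}" "r : {..<N}"
 then have "k * N + r < n * N" "r < N" using block_index by auto
 then show "blk n N X $$ (a,k * N + r) * blk n N Y $$ (k * N + r,b)
 = X (a div N) k $$ (a mod N,r) * Y k (b div N) $$ (r,b mod N)"
 using a b by (simp add: blk_def)
 qed
 also have "... = (\<Sum>k<n. (X (a div N) k * Y k (b div N)) $$ (a mod N, b mod N))"
 proof (intro sum.cong refl)
 fix k assume "k : {..<n}"
 then show "(\<Sum>r<N. X (a div N) k $$ (a mod N,r) * Y k (b div N) $$ (r,b mod N))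
 = (X (a div N) k * Y k (b div N)) $$ (a mod N, b mod N)"
 using X[of "a div N" k] Y[of k "b div N"] ab by (auto simp: scalar_prod_def atLeast0LessThan)
 qed
 finally show "(blk n N X * blk n N Y) $$ (a,b) = blk n N (%i j. sum_mat N N n (%k. X i k * Y k j)) $$ (a,b)"
 using a b ab by (simp add: blk_def sum_mat_def)
qed (simp_all add: blk_def)

end

subsection \<open>Matrix models of an algebra with matrix units\<close>

text \<open>Stage s decomposes \<complex>^(N s) into corner spaces from coordinates m s t \<ge> s,
  so null sequences become small as s grows. The matrix units eu let A be read as n by n matrices
  over its corner.\<close>

locale mf_model = mf_corner k A f "eu 0 0" L p v q
 for k and A :: "('a, 'm) cstar_scheme" and f and eu :: "nat => nat => 'a" and L p v q +
 fixes n :: nat and N T :: "nat => nat" and m :: "nat => nat => nat" and Z :: "nat => nat => complex mat"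
 assumes n: "0 < n"
 and eu: "!!i j. i < n ==> j < n ==> eu i j : car A"
 "!!i j. i < n ==> j < n ==> star A (eu i j) = eu j i"
 "!!i j l. i < n ==> j < n ==> l < n ==> eu i j *[A] eu j l = eu i l"
 "finsum A (%i. eu i i) {..<n} = \<one>\<^bsub>A\<^esub>"
 and res: "!!s. resolution (%t. q (m s t)) (N s) (T s) (Z s)"
 and m: "!!s t. t < T s ==> s <= m s t"
begin

definition Gam :: "nat => (nat => complex mat) => complex mat" where
 "Gam s X = compress (N s) (T s) (Z s) (%t. V (m s t) (X (m s t)))"

lemma Gam_carrier [simp]: "Gam s X : CM (N s) (N s)" by (simp add: Gam_def)

lemma Gam_add: "X : car Prod ==> Y : car Prod ==> Gam s (X +[Prod] Y) = Gam s X + Gam s Y"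
 unfolding Gam_def by (subst compress_add[OF res, symmetric]) (simp_all add: Prod_simps(4) V_add[OF Prod_mat Prod_mat])

lemma Gam_smult: "X : car Prod ==> Gam s (c *:[Prod] X) = c \<cdot>\<^sub>m Gam s X"
 unfolding Gam_def by (subst compress_smult[OF res, symmetric]) (simp_all add: Prod_simps(5) V_smult[OF Prod_mat])

lemma Gam_minus: "X : car Prod ==> Y : car Prod ==> Gam s (X -[Prod] Y) = Gam s X - Gam s Y"
 unfolding P.minus_eq by (subst Gam_add) (auto simp: Gam_smult carrier_matD[OF Gam_carrier] intro!: eq_matI)

lemma Gam_star: "X : car Prod ==> Gam s (star Prod X) = adj (Gam s X)"
 unfolding Gam_def by (subst compress_adjoint[OF res, symmetric]) (simp_all add: star_Prod_mat V_adjoint[OF Prod_mat])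

lemma Gam_mult: "X : car Prod ==> Y : car Prod ==> Gam s (X *[Prod] (p *[Prod] Y)) = Gam s X * Gam s Y"
 unfolding Gam_def by (subst compress_mult[OF res, symmetric]) (simp_all add: Prod_simps(1) V_mult[OF Prod_mat Prod_mat])

lemma Gam_p: "Gam s p = 1\<^sub>m (N s)"
 unfolding Gam_def V_p by (rule compress_one[OF res])

lemma Gam_norm_le:
 assumes X: "X : car Prod" and c: "0 <= c" "!!j. s <= j ==> opn (X j) <= c"
 shows "opn (Gam s X) <= c"
 unfolding Gam_def
 by (rule compress_norm_le[OF res V_carrier[OF Prod_mat[OF X]] c(1)])
 (rule order_trans[OF opn_V[OF Prod_mat[OF X]] c(2)[OF m]])

text \<open>Stage s involves only coordinates from s on.\<close>

lemma Gam_null: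
 assumes X: "X : Null" shows "(%s. opn (Gam s X)) ----> 0"
proof (rule LIMSEQ_I)
 fix eps :: real assume eps: "eps > 0"
 have XP: "X : car Prod" using X by (simp add: Null_iff)
 obtain J where J: "!!j. j >= J ==> norm (opn (X j) - 0) < eps / 2"
 using LIMSEQ_D[OF Null_mat[OF X], of "eps / 2"] eps by auto
 have "opn (Gam s X) <= eps / 2" if "s >= J" for s
 proof (rule Gam_norm_le[OF XP])
 fix j assume "s <= j"
 then show "opn (X j) <= eps / 2" using J[of j] that by simp
 qed (use eps in simp)
 then show "EX J. ALL s>=J. norm (opn (Gam s X) - 0) < eps"
 using eps opn_nonneg[OF Gam_carrier] by (intro exI[of _ J]) force
qed

lemma Gam_cls_eq:
 assumes "X : car Prod" "Y : car Prod" "cls X = cls Y"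
 shows "(%s. opn (Gam s X - Gam s Y)) ----> 0"
 using Gam_null[of "X -[Prod] Y"] assms by (simp add: cls_eq_iff Gam_minus)

lemma Gam_finsum:
 assumes X: "!!j. j < l ==> X j : car Prod"
 shows "Gam s (finsum Prod X {..<l}) = sum_mat (N s) (N s) l (%j. Gam s (X j))"
proof (rule eq_matI)
 fix a b assume "a < dim_row (sum_mat (N s) (N s) l (%j. Gam s (X j)))" "b < dim_col (sum_mat (N s) (N s) l (%j. Gam s (X j)))"
 then have ab: "a < N s" "b < N s" by (auto simp: sum_mat_def)
 have "P.lfun (%X. Gam s X $$ (a,b))"
 using ab by (simp add: P.lfun_def Gam_add Gam_smult carrier_matD[OF Gam_carrier])
 from P.lfun_finsum[OF this, of "{..<l}" X]
 show "Gam s (finsum Prod X {..<l}) $$ (a,b) = sum_mat (N s) (N s) l (%j. Gam s (X j)) $$ (a,b)"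
 using X ab by (simp add: sum_mat_def)
qed (simp_all add: sum_mat_def carrier_matD[OF Gam_carrier])

text \<open>The (i, j) entry of a when A is read as n by n matrices over the corner of
  \<open>eu 0 0\<close>.\<close>

definition ent :: "nat => nat => 'a => 'a" where
 "ent i j a = eu 0 i *[A] (a *[A] eu j 0)"

definition Th :: "'a => nat => complex mat" where
 "Th a s = blk n (N s) (%i j. Gam s (L (ent i j a)))"

lemma ent_closed [simp]: "i < n ==> j < n ==> a : car A ==> ent i j a : car A"
 using eu(1) n by (simp add: ent_def)

text \<open>Insert the unit as the sum of eu l l = eu l 0 eu 0 0 eu 0 l. The middle factor is kept
  because \<open>Gam_mult\<close> has p between its factors.\<close>

lemma ent_mult:
 assumes ij: "i < n" "j < n" and a: "a : car A" and b: "b : car A"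
 shows "ent i j (a *[A] b) = finsum A (%l. ent i l a *[A] (eu 0 0 *[A] ent l j b)) {..<n}"
proof (rule A.feqI)
 fix F assume F: "A.lfun F"
 define G where "G x = F (eu 0 i *[A] (a *[A] (x *[A] (b *[A] eu j 0))))" for x
 have G: "A.lfun G"
 using F eu(1) ij n a b
 by (simp add: G_def A.lfun_def A.distrib_left A.distrib_right A.smult_mult_left A.smult_mult_right)
 have "F (ent i j (a *[A] b)) = G (finsum A (%i. eu i i) {..<n})"
 unfolding eu(4) using eu(1) ij n a b by (simp add: G_def ent_def A.mult_assoc A.one_mult)
 also have "... = (\<Sum>l<n. G (eu l l))" by (rule A.lfun_finsum[OF G]) (use eu in auto)
 also have "... = (\<Sum>l<n. F (ent i l a *[A] (eu 0 0 *[A] ent l j b)))"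
 proof (intro sum.cong refl)
 fix l assume "l : {..<n}"
 then have l: "l < n" by simp
 have "eu l l *[A] (b *[A] eu j 0) = (eu l 0 *[A] (eu 0 0 *[A] eu 0 l)) *[A] (b *[A] eu j 0)"
 using eu(3) l n by simp
 then show "G (eu l l) = F (ent i l a *[A] (eu 0 0 *[A] ent l j b))"
 using eu(1) l n a b ij by (simp add: G_def ent_def A.mult_assoc)
 qed
 also have "... = F (finsum A (%l. ent i l a *[A] (eu 0 0 *[A] ent l j b)) {..<n})"
 by (rule A.lfun_finsum[OF F, symmetric]) (use eu n ij a b in auto)
 finally show "F (ent i j (a *[A] b)) = F (finsum A (%l. ent i l a *[A] (eu 0 0 *[A] ent l j b)) {..<n})" .
qed (use a b ij eu n in \<open>auto intro!: A.finsum_closed'\<close>)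

sublocale S: matrix_sequence "%s. n * N s" .

lemma blk_null:
 assumes X: "!!i j. i < n ==> j < n ==> (%s. opn (X s i j)) ----> 0"
 and Xc: "!!s i j. i < n ==> j < n ==> X s i j : CM (N s) (N s)"
 shows "(%s. opn (blk n (N s) (X s))) ----> 0"
proof (rule tendsto_sandwich[OF _ _ tendsto_const])
 show "\<forall>\<^sub>F s in sequentially. 0 <= opn (blk n (N s) (X s))" using opn_nonneg[OF blk_carrier] by simp
 show "\<forall>\<^sub>F s in sequentially. opn (blk n (N s) (X s)) <= (\<Sum>i<n. \<Sum>j<n. opn (X s i j))"
 using opn_blk[OF Xc] by simp
 have "(%s. \<Sum>i<n. \<Sum>j<n. opn (X s i j)) ----> (\<Sum>i<n. \<Sum>j<n. 0)"
 by (intro tendsto_sum X) auto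
 then show "(%s. \<Sum>i<n. \<Sum>j<n. opn (X s i j)) ----> 0" by simp
qed

lemma Th_Prod: "a : car A ==> Th a : car S.Prod"
proof (rule S.Prod_carrierI[of _ "\<Sum>i<n. \<Sum>j<n. cnorm Prod (L (ent i j a))"])
 fix s assume a: "a : car A"
 show "Th a s : car (matrix_cstar (n * N s))" by (simp add: Th_def)
 have "opn (Th a s) <= (\<Sum>i<n. \<Sum>j<n. opn (Gam s (L (ent i j a))))"
 unfolding Th_def by (rule opn_blk) simp
 also have "... <= (\<Sum>i<n. \<Sum>j<n. cnorm Prod (L (ent i j a)))"
 by (intro sum_mono Gam_norm_le Prod_mat_opnorm P.cnorm_nonneg L(1) ent_closed) (use a in auto)
 finally show "cnorm (matrix_cstar (n * N s)) (Th a s) <= (\<Sum>i<n. \<Sum>j<n. cnorm Prod (L (ent i j a)))" by simp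
qed

text \<open>Arbitrary lifts of the entries of a give the same class as \<open>Th a\<close>, so each
  homomorphism property can be checked on conveniently chosen lifts.\<close>

lemma Th_minus_null:
 assumes a: "a : car A" and X: "!!i j. i < n ==> j < n ==> X i j : car Prod"
 and eq: "!!i j. i < n ==> j < n ==> cls (X i j) = f (ent i j a)"
 and Y: "Y : car S.Prod" "!!s. Y s = blk n (N s) (%i j. Gam s (X i j))"
 shows "Th a -[S.Prod] Y : S.Null"
proof -
 have "(%s. opn (Gam s (L (ent i j a)) - Gam s (X i j))) ----> 0" if "i < n" "j < n" for i j
 by (rule Gam_cls_eq) (use L a X eq that in auto)
 then have "(%s. opn (blk n (N s) (%i j. Gam s (L (ent i j a)) - Gam s (X i j)))) ----> 0"
 by (rule blk_null) (simp_all add: minus_carrier_mat[OF Gam_carrier])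
 then have "(%s. opn (Th a s - Y s)) ----> 0"
 unfolding Th_def Y(2) by (subst blk_minus) simp_all
 then show ?thesis using S.cls_eq_if_null[OF Th_Prod[OF a] Y(1)] Th_Prod[OF a] Y(1) by (simp add: S.cls_eq_iff)
qed

theorem star_hom_Th: "star_hom A S.Quo (%a. S.cls (Th a))"
proof (rule S.star_hom_Quo)
 note LL = L[OF ent_closed]
 fix a assume a: "a : car A"
 show "Th (star A a) -[S.Prod] star S.Prod (Th a) : S.Null"
 proof (rule Th_minus_null[where X = "%i j. star Prod (L (ent j i a))"])
 show "star S.Prod (Th a) s = blk n (N s) (%i j. Gam s (star Prod (L (ent j i a))))" for s
 proof -
 have "star S.Prod (Th a) s = blk n (N s) (%i j. adj (Gam s (L (ent j i a))))"
 unfolding S.star_Prod_mat Th_def by (rule blk_adjoint) auto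
 also have "... = blk n (N s) (%i j. Gam s (star Prod (L (ent j i a))))"
 using LL(1) a by (intro eq_matI) (auto simp: blk_def block_index_div Gam_star)
 finally show ?thesis .
 qed
 show "cls (star Prod (L (ent j i a))) = f (ent i j (star A a))" if "i < n" "j < n" for i j
 proof -
 have "star A (ent j i a) = ent i j (star A a)" using eu n that a by (simp add: ent_def A.star_mult A.mult_assoc)
 then show ?thesis using LL that a f.hom_star[of "ent j i a"] by (simp add: cl.hom_star)
 qed
 qed (use a LL Th_Prod in auto)
 show "Th (z *:[A] a) -[S.Prod] (z *:[S.Prod] Th a) : S.Null" for z
 proof (rule Th_minus_null[where X = "%i j. z *:[Prod] L (ent i j a)"])
 show "(z *:[S.Prod] Th a) s = blk n (N s) (%i j. Gam s (z *:[Prod] L (ent i j a)))" for s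
 proof -
 have "(z *:[S.Prod] Th a) s = blk n (N s) (%i j. z \<cdot>\<^sub>m Gam s (L (ent i j a)))"
 unfolding S.Prod_simps(5) matrix_cstar_simps Th_def by (rule blk_smult) auto
 also have "... = blk n (N s) (%i j. Gam s (z *:[Prod] L (ent i j a)))"
 using LL(1) a by (intro eq_matI) (auto simp: blk_def block_index_div Gam_smult)
 finally show ?thesis .
 qed
 show "cls (z *:[Prod] L (ent i j a)) = f (ent i j (z *:[A] a))" if "i < n" "j < n" for i j
 proof -
 have "z *:[A] ent i j a = ent i j (z *:[A] a)"
 using eu n that a by (simp add: ent_def A.smult_mult_left A.smult_mult_right)
 then show ?thesis using LL that a f.hom_smult[of "ent i j a" z] by (simp add: cl.hom_smult)
 qed
 qed (use a LL Th_Prod in auto)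
 fix b assume b: "b : car A"
 show "Th (a +[A] b) -[S.Prod] (Th a +[S.Prod] Th b) : S.Null"
 proof (rule Th_minus_null[where X = "%i j. L (ent i j a) +[Prod] L (ent i j b)"])
 show "(Th a +[S.Prod] Th b) s = blk n (N s) (%i j. Gam s (L (ent i j a) +[Prod] L (ent i j b)))" for s
 proof -
 have "(Th a +[S.Prod] Th b) s = blk n (N s) (%i j. Gam s (L (ent i j a)) + Gam s (L (ent i j b)))"
 unfolding S.Prod_simps(4) matrix_cstar_simps Th_def by (rule blk_add) auto
 also have "... = blk n (N s) (%i j. Gam s (L (ent i j a) +[Prod] L (ent i j b)))"
 using LL(1) a b by (intro eq_matI) (auto simp: blk_def block_index_div Gam_add)
 finally show ?thesis .
 qed
 show "cls (L (ent i j a) +[Prod] L (ent i j b)) = f (ent i j (a +[A] b))" if "i < n" "j < n" for i j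
 proof -
 have "ent i j a +[A] ent i j b = ent i j (a +[A] b)"
 using eu n that a b by (simp add: ent_def A.distrib_left A.distrib_right)
 then show ?thesis using LL that a b f.hom_add[of "ent i j a" "ent i j b"] by (simp add: cl.hom_add)
 qed
 qed (use a b LL Th_Prod in auto)
 show "Th (a *[A] b) -[S.Prod] (Th a *[S.Prod] Th b) : S.Null"
 proof (rule Th_minus_null[where X = "%i j. finsum Prod (%l. L (ent i l a) *[Prod] (p *[Prod] L (ent l j b))) {..<n}"])
 have XP: "L (ent i l a) *[Prod] (p *[Prod] L (ent l j b)) : car Prod" if "i < n" "j < n" "l < n" for i j l
 using LL(1) p_Prod a b that by simp
 then show "finsum Prod (%l. L (ent i l a) *[Prod] (p *[Prod] L (ent l j b))) {..<n} : car Prod"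
 if "i < n" "j < n" for i j using that by (intro P.finsum_closed') auto
 show "(Th a *[S.Prod] Th b) s
 = blk n (N s) (%i j. Gam s (finsum Prod (%l. L (ent i l a) *[Prod] (p *[Prod] L (ent l j b))) {..<n}))" for s
 proof -
 have "(Th a *[S.Prod] Th b) s
 = blk n (N s) (%i j. sum_mat (N s) (N s) n (%l. Gam s (L (ent i l a)) * Gam s (L (ent l j b))))"
 unfolding S.Prod_simps(1) matrix_cstar_simps Th_def by (rule blk_mult) auto
 also have "... = blk n (N s) (%i j. Gam s (finsum Prod (%l. L (ent i l a) *[Prod] (p *[Prod] L (ent l j b))) {..<n}))"
 proof -
 have "sum_mat (N s) (N s) n (%l. Gam s (L (ent i l a)) * Gam s (L (ent l j b)))
 = Gam s (finsum Prod (%l. L (ent i l a) *[Prod] (p *[Prod] L (ent l j b))) {..<n})"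
 if "i < n" "j < n" for i j
 using XP[OF that] LL(1) a b that
 by (subst Gam_finsum) (auto simp: sum_mat_def Gam_mult simp del: index_mult_mat intro!: cong_mat sum.cong)
 then show ?thesis by (intro eq_matI) (auto simp: blk_def block_index_div)
 qed
 finally show ?thesis .
 qed
 show "cls (finsum Prod (%l. L (ent i l a) *[Prod] (p *[Prod] L (ent l j b))) {..<n}) = f (ent i j (a *[A] b))"
 if ij: "i < n" "j < n" for i j
 proof -
 have "cls (finsum Prod (%l. L (ent i l a) *[Prod] (p *[Prod] L (ent l j b))) {..<n})
 = finsum Quo (%l. cls (L (ent i l a) *[Prod] (p *[Prod] L (ent l j b)))) {..<n}"
 by (rule cl.hom_finsum) (use XP[OF ij] in auto)
 also have "... = finsum Quo (%l. f (ent i l a *[A] (eu 0 0 *[A] ent l j b))) {..<n}"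
 by (rule Q.M.finsum_cong')
 (use LL p_Prod a b ij e(1) in \<open>auto simp: cl.hom_mult f.hom_mult cls_p\<close>)
 also have "... = f (ent i j (a *[A] b))"
 unfolding ent_mult[OF ij a b] by (rule f.hom_finsum[symmetric]) (use a b ij e(1) in auto)
 finally show ?thesis .
 qed
 qed (use a b Th_Prod in auto)
qed (use Th_Prod A.cstar_algebra_axioms in auto)

text \<open>Multiples of \<open>eu 0 0\<close> lift to multiples of p, and p becomes the identity at
  every stage. The class depends on the scalars and the sizes alone, which is why the homomorphisms
  of A and B can agree on D.\<close>

lemma cls_Th_scalar_entries:
 assumes a: "a : car A" and z: "!!i j. i < n ==> j < n ==> ent i j a = z i j *:[A] eu 0 0"
 shows "S.cls (Th a) = S.cls (%s. blk n (N s) (%i j. z i j \<cdot>\<^sub>m 1\<^sub>m (N s)))"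
proof -
 let ?Y = "%s. blk n (N s) (%i j. z i j \<cdot>\<^sub>m 1\<^sub>m (N s))"
 have Y: "?Y : car S.Prod"
 proof (rule S.Prod_carrierI[of _ "\<Sum>i<n. \<Sum>j<n. cmod (z i j)"])
 fix s
 have one: "opn (1\<^sub>m (N s)) <= 1" by (rule opn_le[of _ "N s" "N s"]) auto
 have "opn (?Y s) <= (\<Sum>i<n. \<Sum>j<n. opn (z i j \<cdot>\<^sub>m 1\<^sub>m (N s)))" by (rule opn_blk) simp
 also have "... <= (\<Sum>i<n. \<Sum>j<n. cmod (z i j))"
 by (intro sum_mono) (simp add: opn_smult[OF one_carrier_mat] mult_left_le one)
 finally show "cnorm (matrix_cstar (n * N s)) (?Y s) <= (\<Sum>i<n. \<Sum>j<n. cmod (z i j))" by simp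
 qed simp
 have "Th a -[S.Prod] ?Y : S.Null"
 by (rule Th_minus_null[where X = "%i j. z i j *:[Prod] p", OF a _ _ Y])
 (use p_Prod e(1) z in \<open>auto simp: cl.hom_smult f.hom_smult cls_p Gam_smult Gam_p\<close>)
 then show ?thesis using Y Th_Prod[OF a] by (simp add: S.cls_eq_iff)
qed

lemma cinner_Th:
 assumes a: "a : car A" and xi: "!!i. i < n ==> xi i : CV (N s)" "!!i. i < n ==> xi' i : CV (N s)"
 shows "cinner (Th a s *! bvec n (N s) xi) (bvec n (N s) xi')
 = (\<Sum>i<n. \<Sum>j<n. cinner (Gam s (L (ent i j a)) *! xi j) (xi' i))"
 unfolding Th_def by (subst cinner_blk) (use xi in \<open>auto simp: slice_bvec intro!: sum.cong\<close>)

end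

section \<open>Common vectors for the models of two algebras\<close>

definition padded :: "nat => nat => (nat => complex) => complex vec" where
 "padded r N c = vec N (%i. if i < r then c i else 0)"

lemma padded_carrier [simp]: "padded r N c : CV N" by (simp add: padded_def)

lemma cinner_padded:
 assumes G: "G : CM N N" and r: "r <= N"
 shows "cinner (G *! padded r N b) (padded r N c)
 = (\<Sum>j<r. \<Sum>i<r. b i * cnj (c j) * cinner (G *! unit_vec N i) (unit_vec N j))"
proof -
 have "cinner (G *! padded r N b) (padded r N c)
 = (\<Sum>j<N. \<Sum>i<N. G $$ (j,i) * padded r N b $ i * cnj (padded r N c $ j))"
 by (rule cinner_mat_eq[OF G padded_carrier padded_carrier])
 also have "... = (\<Sum>j<r. \<Sum>i<N. G $$ (j,i) * padded r N b $ i * cnj (padded r N c $ j))"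
 by (rule sum.mono_neutral_right) (use r in \<open>auto simp: padded_def\<close>)
 also have "... = (\<Sum>j<r. \<Sum>i<r. G $$ (j,i) * padded r N b $ i * cnj (padded r N c $ j))"
 by (intro sum.cong refl sum.mono_neutral_right) (use r in \<open>auto simp: padded_def\<close>)
 also have "... = (\<Sum>j<r. \<Sum>i<r. b i * cnj (c j) * cinner (G *! unit_vec N i) (unit_vec N j))"
 using r by (intro sum.cong refl) (simp add: padded_def cinner_unit_vec[OF G])
 finally show ?thesis .
qed

context mf_state
begin

text \<open>The argument w' enters antilinearly; it is expanded through the linear functional x
  \<mapsto> cnj (phi (x^* y)).\<close>

lemma phi_sesquilinear:
 assumes w: "w : car C" "w' : car C" and a: "a : car A" and u: "!!i. i < r ==> u i : car C"
 and b: "!!F. C.lfun F ==> F w = (\<Sum>i<r. b i * F (u i))"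
 and c: "!!F. C.lfun F ==> F w' = (\<Sum>i<r. c i * F (u i))"
 shows "phi (star C w' *[C] (sg a *[C] w)) = (\<Sum>j<r. \<Sum>i<r. b i * cnj (c j) * Phi u i j a)"
proof -
 have lf: "C.lfun (%x. cnj (phi (star C x *[C] y)))" if "y : car C" for y
 using that phi_linear by (simp add: C.lfun_def C.star_add C.star_smult C.distrib_right C.smult_mult_left)
 have "cnj (phi (star C w' *[C] (sg a *[C] w))) = (\<Sum>j<r. c j * cnj (phi (star C (u j) *[C] (sg a *[C] w))))"
 by (rule c[OF lf]) (use a w in simp)
 also have "... = cnj (\<Sum>j<r. cnj (c j) * phi (star C (u j) *[C] (sg a *[C] w)))" by simp
 finally have "phi (star C w' *[C] (sg a *[C] w)) = (\<Sum>j<r. cnj (c j) * phi (star C (u j) *[C] (sg a *[C] w)))"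
 unfolding complex_cnj_cancel_iff .
 also have "... = (\<Sum>j<r. \<Sum>i<r. b i * cnj (c j) * Phi u i j a)"
 proof (intro sum.cong refl)
 fix j assume "j : {..<r}"
 then have "star C (u j) : car C" using u by simp
 then have "C.lfun (%x. phi (star C (u j) *[C] (sg a *[C] x)))"
 using C.lfun_mult_left[OF C.lfun_mult_left[OF phi_linear]] a by simp
 from b[OF this] show "cnj (c j) * phi (star C (u j) *[C] (sg a *[C] w)) = (\<Sum>i<r. b i * cnj (c j) * Phi u i j a)"
 by (simp add: Phi_def sum_distrib_left mult.assoc mult.left_commute)
 qed
 finally show ?thesis .
qed

lemma padded_approx:
 assumes G: "G : CM N N" and r: "r <= N"
 and near: "!!i j. i < r ==> j < r ==> cmod (cinner (G *! unit_vec N i) (unit_vec N j) - Phi u i j a) < eps"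
 and eps: "eps > 0" and K: "(\<Sum>i<r. cmod (b i)) <= K" "(\<Sum>i<r. cmod (c i)) <= K"
 shows "cmod (cinner (G *! padded r N b) (padded r N c) - (\<Sum>j<r. \<Sum>i<r. b i * cnj (c j) * Phi u i j a)) <= K * K * eps"
proof -
 let ?d = "%i j. cinner (G *! unit_vec N i) (unit_vec N j) - Phi u i j a"
 have "cinner (G *! padded r N b) (padded r N c) - (\<Sum>j<r. \<Sum>i<r. b i * cnj (c j) * Phi u i j a)
 = (\<Sum>j<r. \<Sum>i<r. b i * cnj (c j) * ?d i j)"
 unfolding cinner_padded[OF G r] by (simp add: sum_subtractf right_diff_distrib)
 also have "cmod ... <= (\<Sum>j<r. \<Sum>i<r. cmod (b i * cnj (c j) * ?d i j))" by (rule order_trans[OF norm_sum sum_mono[OF norm_sum]])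
 also have "... <= (\<Sum>j<r. \<Sum>i<r. cmod (b i) * cmod (c j) * eps)"
 proof (intro sum_mono)
 fix i j assume "i : {..<r}" "j : {..<r}"
 then have "cmod (?d i j) <= eps" using near[of i j] by simp
 then have "cmod (b i) * cmod (c j) * cmod (?d i j) <= cmod (b i) * cmod (c j) * eps" by (rule mult_left_mono) simp
 then show "cmod (b i * cnj (c j) * ?d i j) <= cmod (b i) * cmod (c j) * eps" unfolding norm_mult complex_mod_cnj .
 qed
 also have "... = (\<Sum>i<r. cmod (b i)) * (\<Sum>i<r. cmod (c i)) * eps"
 unfolding sum_product by (simp only: sum_distrib_right) (rule sum.swap)
 also have "... <= K * K * eps"
 proof -
 have "0 <= (\<Sum>i<r. cmod (b i))" "0 <= (\<Sum>i<r. cmod (c i))" by (simp_all add: sum_nonneg)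
 then show ?thesis using K eps by (intro mult_mono) auto
 qed
 finally show ?thesis .
qed

end

text \<open>One orthonormal family u for w 0, ..., w (b - 1) serves both algebras, because sg e =
  sg' e' fixes it. \<open>corner_resolution\<close> provides all positive multiples of NA and of NB,
  so both models fit on \<complex>^N with N = NA NB, and the same coordinate vectors represent the w
  l for both.\<close>

lemma common_resolutions:
 fixes w :: "nat => 'c"
 assumes A: "mf_state k A f e L p v q C sg phi" and B: "mf_state k' B f' e' L' p' v' q' C sg' phi"
 and e: "sg e = sg' e'"
 and faithful: "!!x. x : car C ==> Re (phi (star C x *[C] x)) = 0 ==> x = \<zero>\<^bsub>C\<^esub>"
 and w: "!!l. w l : car C" "!!l. sg e *[C] w l = w l" "w 0 ~= \<zero>\<^bsub>C\<^esub>"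
 and F: "finite F" "F <= mf_corner.corner A e" "finite F'" "F' <= mf_corner.corner B e'"
 and eps: "eps > 0" and b: "0 < b"
 shows "EX N T m Z T' m' Z' xi. 0 < N & resolution (%t. q (m t)) N T Z & (ALL t<T. s <= m t) &
 resolution (%t. q' (m' t)) N T' Z' & (ALL t<T'. s <= m' t) & (ALL l. xi l : CV N) &
 (ALL a:F. ALL j<b. ALL l<b. cmod (cinner (compress N T Z (%t. mf_corner.V v (m t) (L a (m t))) *! xi j) (xi l)
 - phi (star C (w l) *[C] (sg a *[C] w j))) < eps) &
 (ALL a:F'. ALL j<b. ALL l<b. cmod (cinner (compress N T' Z' (%t. mf_corner.V v' (m' t) (L' a (m' t))) *! xi j) (xi l)
 - phi (star C (w l) *[C] (sg' a *[C] w j))) < eps)"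
proof -
 interpret A: mf_state k A f e L p v q C sg phi by (rule A)
 interpret B: mf_state k' B f' e' L' p' v' q' C sg' phi by (rule B)
 have ec: "sg e : car C" using A.e(1) by simp
 have "EX (r :: nat) u c. (ALL i<r. u i : car C & sg e *[C] u i = u i) &
 (ALL i<r. ALL j<r. phi (star C (u j) *[C] u i) = of_bool (i = j)) &
 (ALL l<b. ALL F. A.C.lfun F --> F (w l) = (\<Sum>i<r. c l i * F (u i)))"
 by (rule A.C.gram_schmidt[OF A.phi]) (erule (1) faithful | rule ec w)+
 then obtain r :: nat and u c where *: "ALL i<r. u i : car C & sg e *[C] u i = u i"
 "ALL i<r. ALL j<r. phi (star C (u j) *[C] u i) = of_bool (i = j)"
 "ALL l<b. ALL F. A.C.lfun F --> F (w l) = (\<Sum>i<r. c l i * F (u i))"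
 by blast
 have u: "u i : car C" "sg e *[C] u i = u i" if "i < r" for i using *(1) that by auto
 have orth: "phi (star C (u j) *[C] u i) = of_bool (i = j)" if "i < r" "j < r" for i j using *(2) that by blast
 have c: "F (w l) = (\<Sum>i<r. c l i * F (u i))" if "l < b" "A.C.lfun F" for l F using *(3) that by blast
 \<comment> \<open>An empty family u would force w 0 = 0.\<close>
 have r: "r > 0"
 proof (rule ccontr)
 assume "\<not> r > 0"
 then have "w 0 = \<zero>\<^bsub>C\<^esub>" using c[OF b] w(1)
 by (intro A.C.feqI) (auto simp: A.C.lfun_simps)
 then show False using w(3) by simp
 qed
 define K where "K = (\<Sum>l<b. \<Sum>i<r. cmod (c l i))"
 have K: "(\<Sum>i<r. cmod (c l i)) <= K" if "l < b" for l
 unfolding K_def by (rule member_le_sum[of l "{..<b}" "%l. \<Sum>i<r. cmod (c l i)"]) (use that in \<open>auto intro!: sum_nonneg\<close>)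
 define dlt where "dlt = eps / (1 + K * K)"
 have K0: "0 < 1 + K * K" using zero_le_square[of K] by linarith
 then have dlt: "dlt > 0" "K * K * dlt < eps" using eps by (simp_all add: dlt_def field_simps)
 have "EX NA>0. ALL M>0. EX T m Z. (ALL t<T. s <= m t) & resolution (%t. q (m t)) (NA * M) T Z & r <= NA * M &
 (ALL a:F. ALL i<r. ALL j<r. cmod (cinner (compress (NA * M) T Z (%t. A.V (m t) (L a (m t))) *! unit_vec (NA * M) i)
 (unit_vec (NA * M) j) - A.Phi u i j a) < dlt)"
 by (rule A.corner_resolution[OF F(1,2) r]) (erule u | erule (1) orth | rule dlt(1))+
 then obtain NA where NA: "NA > 0" "ALL M>0. EX T m Z. (ALL t<T. s <= m t) & resolution (%t. q (m t)) (NA * M) T Z & r <= NA * M &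
 (ALL a:F. ALL i<r. ALL j<r. cmod (cinner (compress (NA * M) T Z (%t. A.V (m t) (L a (m t))) *! unit_vec (NA * M) i)
 (unit_vec (NA * M) j) - A.Phi u i j a) < dlt)"
 by blast
 have u': "sg' e' *[C] u i = u i" if "i < r" for i using u(2)[OF that] e by simp
 have "EX NB>0. ALL M>0. EX T m Z. (ALL t<T. s <= m t) & resolution (%t. q' (m t)) (NB * M) T Z & r <= NB * M &
 (ALL a:F'. ALL i<r. ALL j<r. cmod (cinner (compress (NB * M) T Z (%t. B.V (m t) (L' a (m t))) *! unit_vec (NB * M) i)
 (unit_vec (NB * M) j) - B.Phi u i j a) < dlt)"
 by (rule B.corner_resolution[OF F(3,4) r]) (erule u(1) u' | erule (1) orth | rule dlt(1))+
 then obtain NB where NB: "NB > 0" "ALL M>0. EX T m Z. (ALL t<T. s <= m t) & resolution (%t. q' (m t)) (NB * M) T Z & r <= NB * M &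
 (ALL a:F'. ALL i<r. ALL j<r. cmod (cinner (compress (NB * M) T Z (%t. B.V (m t) (L' a (m t))) *! unit_vec (NB * M) i)
 (unit_vec (NB * M) j) - B.Phi u i j a) < dlt)"
 by blast
 define N where "N = NA * NB"
 obtain T :: nat and m Z where T: "ALL t<T. s <= m t" "resolution (%t. q (m t)) N T Z" "r <= N"
 "ALL a:F. ALL i<r. ALL j<r. cmod (cinner (compress N T Z (%t. A.V (m t) (L a (m t))) *! unit_vec N i)
 (unit_vec N j) - A.Phi u i j a) < dlt"
 using NA(2)[rule_format, OF NB(1)] unfolding N_def[symmetric] by blast
 obtain T' :: nat and m' Z' where T': "ALL t<T'. s <= m' t" "resolution (%t. q' (m' t)) N T' Z'"
 "ALL a:F'. ALL i<r. ALL j<r. cmod (cinner (compress N T' Z' (%t. B.V (m' t) (L' a (m' t))) *! unit_vec N i)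
 (unit_vec N j) - B.Phi u i j a) < dlt"
 using NB(2)[rule_format, OF NA(1)] unfolding N_def[symmetric] mult.commute[of NB NA] by blast
 have eA: "cmod (cinner (compress N T Z (%t. A.V (m t) (L a (m t))) *! padded r N (c j)) (padded r N (c l))
 - phi (star C (w l) *[C] (sg a *[C] w j))) < eps" if a: "a : F" and jl: "j < b" "l < b" for a j l
 proof -
 have ac: "a : car A" using a F(2) A.corner_carrier by auto
 have eq: "phi (star C (w l) *[C] (sg a *[C] w j)) = (\<Sum>i'<r. \<Sum>i<r. c j i * cnj (c l i') * A.Phi u i i' a)"
 by (rule A.phi_sesquilinear[OF w(1) w(1) ac u(1) c[OF jl(1)] c[OF jl(2)]])
 show ?thesis unfolding eq
 by (rule le_less_trans[OF A.padded_approx[OF compress_carrier T(3) _ dlt(1) K[OF jl(1)] K[OF jl(2)]] dlt(2)])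
 (use T(4) a in blast)
 qed
 have eB: "cmod (cinner (compress N T' Z' (%t. B.V (m' t) (L' a (m' t))) *! padded r N (c j)) (padded r N (c l))
 - phi (star C (w l) *[C] (sg' a *[C] w j))) < eps" if a: "a : F'" and jl: "j < b" "l < b" for a j l
 proof -
 have ac: "a : car B" using a F(4) B.corner_carrier by auto
 have eq: "phi (star C (w l) *[C] (sg' a *[C] w j)) = (\<Sum>i'<r. \<Sum>i<r. c j i * cnj (c l i') * B.Phi u i i' a)"
 by (rule B.phi_sesquilinear[OF w(1) w(1) ac u(1) c[OF jl(1)] c[OF jl(2)]])
 show ?thesis unfolding eq
 by (rule le_less_trans[OF B.padded_approx[OF compress_carrier T(3) _ dlt(1) K[OF jl(1)] K[OF jl(2)]] dlt(2)])
 (use T'(3) a in blast)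
 qed
 have "0 < N" using NA(1) NB(1) by (simp add: N_def)
 then show ?thesis
 by (intro exI[of _ N] exI[of _ T] exI[of _ m] exI[of _ Z] exI[of _ T'] exI[of _ m'] exI[of _ Z']
 exI[of _ "%l. padded r N (c l)"] conjI T(1,2) T'(1,2) ballI allI impI padded_carrier eA eB)
qed

text \<open>The w (l n + i) are the n components e_0i d_l of d_l in the corner, and the xi s are
  their models at stage s. The limits say that these models reproduce phi on the entries of the
  elements of G.\<close>

locale mf_tower = mf_model k A f eu L p v q n N T m Z + mf_state k A f "eu 0 0" L p v q C sg phi
 for k and A :: "('a, 'm) cstar_scheme" and f and eu L p v q n N T m Z and C :: "('c, 'n) cstar_scheme" and sg phi +
 fixes d w :: "nat => 'c" and xi :: "nat => nat => complex vec" and G :: "'a set"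
 assumes unital: "sg \<one>\<^bsub>A\<^esub> = \<one>\<^bsub>C\<^esub>"
 and d: "!!l. d l : car C" and w: "!!l i. i < n ==> w (l * n + i) = sg (eu 0 i) *[C] d l"
 and xi: "!!s l. xi s l : CV (N s)"
 and G: "G <= car A"
 and lim: "!!a i j l l'. [|a : G; i < n; j < n|] ==>
 (%s. cinner (Gam s (L (ent i j a)) *! xi s l) (xi s l')) ----> phi (star C (w l') *[C] (sg (ent i j a) *[C] w l))"
 and lim_e: "!!l l'. (%s. cinner (Gam s (L (eu 0 0)) *! xi s l) (xi s l')) ----> phi (star C (w l') *[C] (sg (eu 0 0) *[C] w l))"
begin

definition eta :: "nat => nat => complex vec" where
 "eta s l = bvec n (N s) (%i. xi s (l * n + i))"

lemma eta_carrier [simp]: "eta s l : CV (n * N s)" by (simp add: eta_def)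

lemma ent_sandwich:
 assumes a: "a : car A" and ij: "i < n" "j < n"
 shows "star C (w (l' * n + i)) *[C] (sg (ent i j a) *[C] w (l * n + j))
 = star C (d l') *[C] (sg (eu i i) *[C] (sg a *[C] (sg (eu j j) *[C] d l)))"
proof -
 have "star C (w (l' * n + i)) *[C] (sg (ent i j a) *[C] w (l * n + j))
 = star C (d l') *[C] (sg (eu i 0 *[A] eu 0 i) *[C] (sg a *[C] (sg (eu j 0 *[A] eu 0 j) *[C] d l)))"
 using eu(1,2) n ij a d
 by (simp add: w ent_def sg.hom_mult C.star_mult C.mult_assoc flip: sg.hom_star)
 then show ?thesis using eu(3) n ij by simp
qed

text \<open>The diagonal units add up to 1 and sg is unital.\<close>

lemma sum_sandwich:
 assumes F: "C.lfun F" and x: "x : car C" "y : car C"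
 shows "(\<Sum>i<n. F (x *[C] (sg (eu i i) *[C] y))) = F (x *[C] y)"
proof -
 have "A.lfun (%a. F (x *[C] (sg a *[C] y)))"
 using F x by (simp add: A.lfun_def C.lfun_def sg.hom_add sg.hom_smult
 C.distrib_left C.distrib_right C.smult_mult_left C.smult_mult_right)
 from A.lfun_finsum[OF this, of "{..<n}" "%i. eu i i"] show ?thesis
 using eu x by (simp add: unital C.one_mult)
qed

text \<open>Blockwise the left side tends to the sum over i and j of phi at d_l'^* e_ii a e_jj d_l,
  and the diagonal units add up to 1.\<close>

theorem tower_limit:
 assumes a: "a : G"
 shows "(%s. cinner (Th a s *! eta s l) (eta s l')) ----> phi (star C (d l') *[C] (sg a *[C] d l))"
proof -
 have ac: "a : car A" using a G by auto
 have "(%s. \<Sum>i<n. \<Sum>j<n. cinner (Gam s (L (ent i j a)) *! xi s (l * n + j)) (xi s (l' * n + i)))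
 ----> (\<Sum>i<n. \<Sum>j<n. phi (star C (w (l' * n + i)) *[C] (sg (ent i j a) *[C] w (l * n + j))))"
 by (intro tendsto_sum lim a) auto
 moreover have "cinner (Th a s *! eta s l) (eta s l')
 = (\<Sum>i<n. \<Sum>j<n. cinner (Gam s (L (ent i j a)) *! xi s (l * n + j)) (xi s (l' * n + i)))" for s
 unfolding eta_def by (rule cinner_Th[OF ac xi xi])
 moreover have "(\<Sum>i<n. \<Sum>j<n. phi (star C (w (l' * n + i)) *[C] (sg (ent i j a) *[C] w (l * n + j))))
 = phi (star C (d l') *[C] (sg a *[C] d l))"
 proof -
 have "(\<Sum>j<n. phi (star C (w (l' * n + i)) *[C] (sg (ent i j a) *[C] w (l * n + j))))
 = phi (star C (d l') *[C] (sg (eu i i) *[C] (sg a *[C] d l)))" if i: "i < n" for i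
 using sum_sandwich[OF phi_linear, of "star C (d l') *[C] (sg (eu i i) *[C] sg a)" "d l"] i ac d eu(1)
 by (simp add: ent_sandwich C.mult_assoc)
 then show ?thesis using sum_sandwich[OF phi_linear, of "star C (d l')" "sg a *[C] d l"] ac d by simp
 qed
 ultimately show ?thesis by simp
qed

text \<open>Plain inner products are read off from \<open>eu 0 0\<close>, whose chosen lift is sent
  to the identity by \<open>Gam\<close>.\<close>

theorem tower_gram: "(%s. cinner (eta s l) (eta s l')) ----> phi (star C (d l') *[C] d l)"
proof -
 have "(%s. \<Sum>i<n. cinner (Gam s (L (eu 0 0)) *! xi s (l * n + i)) (xi s (l' * n + i)))
 ----> (\<Sum>i<n. phi (star C (w (l' * n + i)) *[C] (sg (eu 0 0) *[C] w (l * n + i))))"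
 by (intro tendsto_sum lim_e)
 moreover have "(\<Sum>i<n. cinner (Gam s (L (eu 0 0)) *! xi s (l * n + i)) (xi s (l' * n + i))) = cinner (eta s l) (eta s l')" for s
 proof -
 have "cinner (Gam s (L (eu 0 0)) *! xi s (l * n + i)) (xi s (l' * n + i)) = cinner (xi s (l * n + i)) (xi s (l' * n + i))" for i
 using xi by (simp add: Le Gam_p)
 then show ?thesis
 unfolding eta_def cinner_eq[OF bvec_carrier] sum_blocks
 by (intro sum.cong refl) (use xi block_index in \<open>simp add: cinner_eq[of _ "N s"] bvec_def\<close>)
 qed
 moreover have "(\<Sum>i<n. phi (star C (w (l' * n + i)) *[C] (sg (eu 0 0) *[C] w (l * n + i)))) = phi (star C (d l') *[C] d l)"
 proof -
 have "star C (w (l' * n + i)) *[C] (sg (eu 0 0) *[C] w (l * n + i)) = star C (d l') *[C] (sg (eu i i) *[C] d l)"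
 if i: "i < n" for i
 proof -
 have "star C (w (l' * n + i)) *[C] (sg (eu 0 0) *[C] w (l * n + i))
 = star C (d l') *[C] (sg (eu i 0 *[A] (eu 0 0 *[A] eu 0 i)) *[C] d l)"
 using eu(1,2) n i d
 by (simp add: w sg.hom_mult C.star_mult C.mult_assoc del: eu(3) flip: sg.hom_star)
 then show ?thesis using eu(3) n i by simp
 qed
 then show ?thesis using sum_sandwich[OF phi_linear, of "star C (d l')" "d l"] d by simp
 qed
 ultimately show ?thesis by simp
qed

end

section \<open>From the universal property to a homomorphism into the matrix quotient\<close>

subsection \<open>Separability and the universal property\<close>

lemma rational_complex_approx:
 assumes "dlt > 0" obtains a b :: rat where "cmod (z - Complex (of_rat a) (of_rat b)) < dlt"
proof -
 obtain a b :: rat where "Re z - dlt/2 < of_rat a" "of_rat a < Re z" "Im z - dlt/2 < of_rat b" "of_rat b < Im z"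
 using of_rat_dense[of "Re z - dlt/2" "Re z"] of_rat_dense[of "Im z - dlt/2" "Im z"] assms by auto
 then show ?thesis using cmod_le[of "z - Complex (of_rat a) (of_rat b)"] by (intro that[of a b]) simp
qed

context cstar_algebra
begin

definition gen_step :: "'a set => 'a set" where
 "gen_step U = U \<union> (%(x,y). x \<oplus> y) ` (U \<times> U) \<union> (%(x,y). x \<otimes> y) ` (U \<times> U) \<union> star A ` U \<union>
 (%((a :: rat,b :: rat),x). Complex (of_rat a) (of_rat b) \<odot> x) ` (UNIV \<times> U)"

primrec gen :: "'a set => nat => 'a set" where
 "gen X 0 = insert \<zero> X"
| "gen X (Suc l) = gen_step (gen X l)"

text \<open>The *-algebra over the Gaussian rationals generated by X; it is countable when X
  is.\<close>

definition alg_hull :: "'a set => 'a set" where "alg_hull X = (\<Union>l. gen X l)"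

lemma gen_mono: "l <= l' ==> gen X l <= gen X l'"
 by (rule lift_Suc_mono_le) (auto simp: gen_step_def)

lemma alg_hull_gen: "x : alg_hull X \<longleftrightarrow> (EX l. x : gen X l)" by (auto simp: alg_hull_def)

lemma alg_hull_gen2:
 assumes "x : alg_hull X" "y : alg_hull X" obtains l where "x : gen X l" "y : gen X l"
 using assms gen_mono[of _ _ X] unfolding alg_hull_gen by (meson nat_le_linear subsetD)

lemma countable_alg_hull: "countable X ==> countable (alg_hull X)"
proof -
 assume X: "countable X"
 have "countable (gen X l)" for l
 by (induction l) (auto simp: gen_step_def X intro!: countable_Un countable_image countable_SIGMA)
 then show ?thesis by (simp add: alg_hull_def)
qed

lemma alg_hull_subset: "X <= car A ==> alg_hull X <= car A"
proof -
 assume X: "X <= car A"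
 have "gen X l <= car A" for l
 by (induction l) (use X in \<open>auto simp: gen_step_def\<close>)
 then show ?thesis by (auto simp: alg_hull_def)
qed

lemma alg_hull_base: "\<zero> : alg_hull X" "X <= alg_hull X"
 using UN_upper[of 0 UNIV "gen X"] by (auto simp: alg_hull_def)

lemma gen_step_ops:
 assumes "x : U"
 shows "star A x : gen_step U" "Complex (of_rat a) (of_rat b) \<odot> x : gen_step U"
 "y : U ==> x \<oplus> y : gen_step U" "y : U ==> x \<otimes> y : gen_step U"
 using assms image_eqI[of "x \<oplus> y" "%(x,y). x \<oplus> y" "(x,y)" "U \<times> U"] image_eqI[of "x \<otimes> y" "%(x,y). x \<otimes> y" "(x,y)" "U \<times> U"]
 image_eqI[of "Complex (of_rat a) (of_rat b) \<odot> x" "%((a :: rat,b :: rat),x). Complex (of_rat a) (of_rat b) \<odot> x" "((a,b),x)" "UNIV \<times> U"]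
 by (simp_all add: gen_step_def)

lemma gen_Suc_alg_hull: "x : gen_step (gen X l) ==> x : alg_hull X"
 unfolding alg_hull_gen by (rule exI[of _ "Suc l"]) simp

lemma alg_hull_add: "x : alg_hull X ==> y : alg_hull X ==> x \<oplus> y : alg_hull X"
 by (erule (1) alg_hull_gen2) (rule gen_Suc_alg_hull[OF gen_step_ops(3)])

lemma alg_hull_mult: "x : alg_hull X ==> y : alg_hull X ==> x \<otimes> y : alg_hull X"
 by (erule (1) alg_hull_gen2) (rule gen_Suc_alg_hull[OF gen_step_ops(4)])

lemma alg_hull_star: "x : alg_hull X ==> star A x : alg_hull X"
 using gen_Suc_alg_hull[OF gen_step_ops(1)] unfolding alg_hull_gen[of x] by blast

lemma alg_hull_rational: "x : alg_hull X ==> Complex (of_rat a) (of_rat b) \<odot> x : alg_hull X"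
 using gen_Suc_alg_hull[OF gen_step_ops(2)] unfolding alg_hull_gen[of x] by blast

definition cl :: "'a set => 'a set" where
 "cl S = {x : car A. ALL eps>0. EX y:S. cnorm A (x \<ominus> y) < eps}"

lemma cl_approx: "x : cl S ==> eps > 0 ==> EX y:S. cnorm A (x \<ominus> y) < eps"
 by (simp add: cl_def)

lemma cl_closed:
 assumes S: "S <= car A" shows "closedin (ctopology A) (cl S)"
proof (rule in_closure_conv)
 fix x l assume x: "!!n. x n : cl S" and l: "conv x l"
 have xc: "x n : car A" "l : car A" for n using l by (auto simp: conv_def)
 show "l : cl S"
 unfolding cl_def
 proof (intro CollectI conjI allI impI xc)
 fix eps :: real assume eps: "eps > 0"
 have "\<forall>\<^sub>F n in sequentially. cnorm A (x n \<ominus> l) < eps/2"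
 by (rule order_tendstoD(2)[of _ 0]) (use l eps in \<open>auto simp: conv_def\<close>)
 then obtain n where n: "cnorm A (x n \<ominus> l) < eps/2" by (auto simp: eventually_sequentially)
 obtain y where y: "y : S" "cnorm A (x n \<ominus> y) < eps/2" using cl_approx[OF x[of n] half_gt_zero[OF eps]] by blast
 then have "cnorm A (l \<ominus> y) < eps"
 using cnorm_minus_trans[OF xc(2) xc(1)[of n], of y] n cnorm_minus_commute[OF xc(2) xc(1)[of n]] S by auto
 then show "EX y:S. cnorm A (l \<ominus> y) < eps" using y(1) by blast
 qed
qed (auto simp: cl_def)

lemma cl_conv:
 assumes S: "S <= car A" and l: "l : cl S"
 obtains x where "!!n. x n : S" "conv x l"
proof -
 have "ALL n. EX y. y : S & cnorm A (l \<ominus> y) < inverse (real (Suc n))"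
 using cl_approx[OF l, of "inverse (real (Suc _))"] by auto
 then obtain x where x: "!!n. x n : S" "!!n. cnorm A (l \<ominus> x n) < inverse (real (Suc n))" by metis
 have c: "x n : car A" "l : car A" for n using x(1)[of n] S l by (auto simp: cl_def)
 have "conv x l"
 proof (rule conv_bound[OF c _ LIMSEQ_inverse_real_of_nat])
 fix n show "cnorm A (x n \<ominus> l) <= inverse (real (Suc n))"
 unfolding cnorm_minus_commute[OF c(1)[of n] c(2)] using x(2)[of n] by (rule less_imp_le)
 qed
 with x(1) show ?thesis by (rule that)
qed

lemma cl_subset: "S <= car A ==> S <= cl S"
 by (force simp: cl_def cnorm_eq_0_iff intro!: bexI[rotated])

text \<open>Arbitrary scalar multiples are limits of Gaussian rational ones, and the operations are
  continuous.\<close>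

lemma cstar_subalgebra_cl_alg_hull:
 assumes X: "X <= car A" shows "cstar_subalgebra (cl (alg_hull X)) A"
proof -
 note S = alg_hull_subset[OF X]
 note closed = closed_conv[OF cl_closed[OF S]]
 have lim: "conv (%n. x n) l ==> (!!n. x n : alg_hull X) ==> l : cl (alg_hull X)" for x l
 by (rule closed) (use cl_subset[OF S] in auto)
 have c: "cl (alg_hull X) <= car A" by (auto simp: cl_def)
 have smr: "z \<odot> x : cl (alg_hull X)" if x: "x : alg_hull X" for z x
 proof -
 have xc: "x : car A" using x S by auto
 show ?thesis
 unfolding cl_def
 proof (intro CollectI conjI allI impI)
 fix eps :: real assume eps: "eps > 0"
 have n: "0 < 1 + cnorm A x" using cnorm_nonneg[OF xc] by simp
 with eps have "0 < eps / (1 + cnorm A x)" by simp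
 then obtain a b where ab: "cmod (z - Complex (of_rat a) (of_rat b)) < eps / (1 + cnorm A x)"
 by (rule rational_complex_approx)
 let ?c = "Complex (of_rat a) (of_rat b)"
 have "z \<odot> x \<ominus> ?c \<odot> x = (z - ?c) \<odot> x" using xc by (intro feqI) (simp_all add: lfun_simps algebra_simps)
 then have "cnorm A (z \<odot> x \<ominus> ?c \<odot> x) = cmod (z - ?c) * cnorm A x" using xc by (simp add: cnorm_smult)
 also have "... <= cmod (z - ?c) * (1 + cnorm A x)" by (intro mult_left_mono) auto
 also have "... < eps" using ab n by (simp add: pos_less_divide_eq)
 finally show "EX y:alg_hull X. cnorm A (z \<odot> x \<ominus> y) < eps" using alg_hull_rational[OF x] by blast
 qed (use xc in simp)
 qed
 have sm: "z \<odot> l : cl (alg_hull X)" if l: "l : cl (alg_hull X)" for z l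
 proof -
 obtain x where x: "!!n. x n : alg_hull X" "conv x l" by (rule cl_conv[OF S l]) blast
 show ?thesis by (rule closed[OF smr[OF x(1)] conv_sm[OF x(2)]])
 qed
 have add: "l \<oplus> l' : cl (alg_hull X)" and mult: "l \<otimes> l' : cl (alg_hull X)"
 if l: "l : cl (alg_hull X)" "l' : cl (alg_hull X)" for l l'
 proof -
 obtain x where x: "!!n. x n : alg_hull X" "conv x l" by (rule cl_conv[OF S l(1)]) blast
 obtain y where y: "!!n. y n : alg_hull X" "conv y l'" by (rule cl_conv[OF S l(2)]) blast
 show "l \<oplus> l' : cl (alg_hull X)" by (rule lim[OF conv_add[OF x(2) y(2)]]) (rule alg_hull_add[OF x(1) y(1)])
 show "l \<otimes> l' : cl (alg_hull X)" by (rule lim[OF conv_mult[OF x(2) y(2)]]) (rule alg_hull_mult[OF x(1) y(1)])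
 qed
 have star: "star A l : cl (alg_hull X)" if l: "l : cl (alg_hull X)" for l
 proof -
 obtain x where x: "!!n. x n : alg_hull X" "conv x l" by (rule cl_conv[OF S l]) blast
 show ?thesis by (rule lim[OF conv_star[OF x(2)]]) (rule alg_hull_star[OF x(1)])
 qed
 have "Module.submodule (cl (alg_hull X)) complex_ring A"
 proof (rule submoduleI)
 fix l assume l: "l : cl (alg_hull X)"
 then have lc: "l : car A" using c by auto
 have "\<ominus> l = (- 1) \<odot> l" using M.minus_equality[of "(- 1) \<odot> l" l] minus_eq[OF lc lc] lc by (simp add: M.a_comm)
 then show "\<ominus> l : cl (alg_hull X)" using sm[OF l] by simp
 qed (use c add sm alg_hull_base(1)[of X] cl_subset[OF S] in auto)
 then show ?thesis
 unfolding cstar_subalgebra_def using mult star cl_closed[OF S] by blast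
qed

lemma generated_dense:
 assumes "cstar_generated A X = car A" "X <= car A"
 shows "car A = cl (alg_hull X)"
proof -
 have "cstar_generated A X <= cl (alg_hull X)"
 unfolding cstar_generated_def
 using cstar_subalgebra_cl_alg_hull[OF assms(2)] alg_hull_base(2)[of X] cl_subset[OF alg_hull_subset[OF assms(2)]] by blast
 then show ?thesis using assms by (auto simp: cl_def)
qed

lemma closure_of_eq_cl: "S <= car A ==> ctopology A closure_of S = cl S"
proof -
 interpret X: Metric_space "car A" "cdist A" by (rule Metric_space_cdist)
 assume S: "S <= car A"
 then show ?thesis
 unfolding ctopology_def X.metric_closure_of X.in_mball cl_def by (auto simp: cdist_def subset_iff)
qed

lemma topspace_ctopology: "topspace (ctopology A) = car A"
proof -
 interpret X: Metric_space "car A" "cdist A" by (rule Metric_space_cdist)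
 show ?thesis by (simp add: ctopology_def)
qed

lemma separable_if_dense: "countable T ==> T <= car A ==> car A = cl T ==> separable_cstar A"
 unfolding separable_cstar_def separable_space_def topspace_ctopology using closure_of_eq_cl by metis

lemma separable_dense_seq:
 assumes "separable_cstar A"
 obtains d :: "nat => 'a" where "!!l. d l : car A" "car A = cl (range d)"
proof -
 obtain T where T: "countable T" "T <= car A" "ctopology A closure_of T = car A"
 using assms unfolding separable_cstar_def separable_space_def topspace_ctopology by blast
 have clT: "car A = cl T" using closure_of_eq_cl[OF T(2)] T(3) by simp
 have "\<zero> : cl T" unfolding clT[symmetric] by simp
 then have "T ~= {}" using cl_approx[of \<zero> T 1] by auto
 then have "range (from_nat_into T) = T" by (rule range_from_nat_into[OF _ T(1)])
 then show ?thesis using clT T(2) by (intro that[of "from_nat_into T"]) auto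
qed

text \<open>A point of the closure is determined by the set of pairs (index of y in T, k) for which
  its distance to y is below 1/(k + 1), and sets of naturals inject into the reals.\<close>

lemma inj_real_if_dense:
 assumes T: "countable T" "T <= car A"
 obtains g :: "'a => real" where "inj_on g (cl T)"
proof -
 define h where "h x = {k. EX y:T. to_nat_on T y = fst (prod_decode k) & cnorm A (x \<ominus> y) < inverse (real (Suc (snd (prod_decode k))))}" for x
 have "inj_on h (cl T)"
 proof (rule inj_onI, rule ccontr)
 fix x y assume x: "x : cl T" and y: "y : cl T" and h: "h x = h y" and ne: "x ~= y"
 have c: "x : car A" "y : car A" using x y by (auto simp: cl_def)
 have "cnorm A (x \<ominus> y) > 0" using ne c cnorm_eq_0_iff[of "x \<ominus> y"] cnorm_nonneg[of "x \<ominus> y"] by (simp add: less_le)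
 then obtain k where k: "inverse (real (Suc k)) < cnorm A (x \<ominus> y) / 2" using reals_Archimedean[of "cnorm A (x \<ominus> y) / 2"] by auto
 obtain z where z: "z : T" "cnorm A (x \<ominus> z) < inverse (real (Suc k))"
 using cl_approx[OF x, of "inverse (real (Suc k))"] by auto
 then have "prod_encode (to_nat_on T z, k) : h x" by (auto simp: h_def)
 then obtain z' where "z' : T" "to_nat_on T z' = to_nat_on T z" "cnorm A (y \<ominus> z') < inverse (real (Suc k))"
 unfolding h by (auto simp: h_def)
 then have "cnorm A (y \<ominus> z) < inverse (real (Suc k))" using inj_on_to_nat_on[OF T(1)] z(1) by (auto dest: inj_onD)
 then show False
 using cnorm_minus_trans[of x z y] cnorm_minus_commute[of z y] z c T(2) k by auto
 qed
 moreover obtain r :: "nat set => real" where "inj r"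
 using nat_sets_eqpoll_reals unfolding eqpoll_def by (auto dest: bij_betw_imp_inj_on)
 ultimately have "inj_on (r \<circ> h) (cl T)" by (meson comp_inj_on inj_on_subset subset_UNIV)
 then show ?thesis by (rule that)
qed

end

text \<open>The C*-structure of S carried along an injection into another type. The universal
  property of C speaks about algebras with carrier in the type of C, while the matrix quotient lives
  in a different type.\<close>

definition transport :: "('q, 'm) cstar_scheme => 'q set => ('q => 'c) => 'c cstar" where
 "transport Q S io = (let g = inv_into S io in
 \<lparr>carrier = io ` S, monoid.mult = (%x y. io (g x *[Q] g y)), one = io \<one>\<^bsub>Q\<^esub>, zero = io \<zero>\<^bsub>Q\<^esub>,
 add = (%x y. io (g x +[Q] g y)), module.smult = (%c x. io (c *:[Q] g x)),
 star = (%x. io (star Q (g x))), cnorm = (%x. cnorm Q (g x))\<rparr>)"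

context
 fixes Q :: "('q, 'm) cstar_scheme" and S :: "'q set" and io :: "'q => 'c"
 assumes Q: "unital_cstar_algebra Q" and S: "cstar_subalgebra S Q" and one: "\<one>\<^bsub>Q\<^esub> : S" and inj: "inj_on io S"
begin

interpretation Q: unital_cstar_algebra Q by (rule Q)

interpretation sub: Module.submodule S complex_ring Q using S by (simp add: cstar_subalgebra_def)

lemma transport_closed [simp]:
 "\<zero>\<^bsub>Q\<^esub> : S" "x : S ==> y : S ==> x +[Q] y : S" "x : S ==> c *:[Q] x : S"
 "x : S ==> y : S ==> x *[Q] y : S" "x : S ==> star Q x : S" "x : S ==> x : car Q" "\<one>\<^bsub>Q\<^esub> : S"
 using S one sub.one_closed sub.m_closed[of x y] sub.smult_closed[of c x] sub.subset
 by (auto simp: cstar_subalgebra_def complex_ring_def)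

lemma transport_inv [simp]: "x : S ==> inv_into S io (io x) = x" by (rule inv_into_f_f[OF inj])

lemma transport_simps [simp]:
 "car (transport Q S io) = io ` S" "\<zero>\<^bsub>transport Q S io\<^esub> = io \<zero>\<^bsub>Q\<^esub>" "\<one>\<^bsub>transport Q S io\<^esub> = io \<one>\<^bsub>Q\<^esub>"
 "x : S ==> y : S ==> io x +[transport Q S io] io y = io (x +[Q] y)"
 "x : S ==> y : S ==> io x *[transport Q S io] io y = io (x *[Q] y)"
 "x : S ==> c *:[transport Q S io] io x = io (c *:[Q] x)" "x : S ==> star (transport Q S io) (io x) = io (star Q x)"
 "x : S ==> cnorm (transport Q S io) (io x) = cnorm Q x"
 by (simp_all add: transport_def Let_def)

lemma unital_cstar_algebra_transport: "unital_cstar_algebra (transport Q S io)"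
proof (rule unital_cstar_algebraI)
 fix X :: "nat => 'c"
 assume X: "!!l. X l : car (transport Q S io)"
 and C: "!!e. e > 0 ==> EX N. ALL p>=N. ALL q>=N. cnorm (transport Q S io) (X p +[transport Q S io] (- 1) *:[transport Q S io] X q) < e"
 have "ALL l. EX y. y : S & X l = io y" using X by auto
 then obtain Y where Y: "!!l. Y l : S" "!!l. X l = io (Y l)" by metis
 have Yc: "Y l : car Q" for l using Y(1) by simp
 have "EX N. ALL p>=N. ALL q>=N. cnorm Q (Y p -[Q] Y q) < e" if "e > 0" for e
 using C[OF that] by (simp add: Y Q.minus_eq[OF Yc Yc])
 from Q.Cauchy_conv[OF Yc this] obtain y where y: "Q.conv Y y" by blast
 have yS: "y : S" using Q.closed_conv[OF _ Y(1) y] S by (simp add: cstar_subalgebra_def)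
 then have "(%l. cnorm Q (Y l -[Q] y)) ----> 0" "y : car Q" using y by (simp_all add: Q.conv_def)
 then show "EX L:car (transport Q S io). (%l. cnorm (transport Q S io) (X l +[transport Q S io] (- 1) *:[transport Q S io] L)) ----> 0"
 using yS by (intro bexI[of _ "io y"]) (simp_all add: Y Q.minus_eq[OF Yc])
next
 fix x assume "x : car (transport Q S io)"
 then obtain y where y: "y : S" "x = io y" by auto
 show "cnorm (transport Q S io) x = 0 \<longleftrightarrow> x = \<zero>\<^bsub>transport Q S io\<^esub>"
 using y Q.cnorm_eq_0_iff[of y] inj_on_eq_iff[OF inj, of y "\<zero>\<^bsub>Q\<^esub>"] by simp
 have "(- 1) *:[Q] y +[Q] y = \<zero>\<^bsub>Q\<^esub>" using y by (intro Q.feqI) (simp_all add: Q.lfun_simps)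
 then show "(- 1) *:[transport Q S io] x +[transport Q S io] x = \<zero>\<^bsub>transport Q S io\<^esub>" using y by simp
 show "(c + d) *:[transport Q S io] x = c *:[transport Q S io] x +[transport Q S io] d *:[transport Q S io] x" for c d
 proof -
 have "(c + d) *:[Q] y = c *:[Q] y +[Q] d *:[Q] y"
 using y by (intro Q.feqI) (simp_all add: Q.lfun_simps algebra_simps)
 then show ?thesis using y by simp
 qed
 show "(c * d) *:[transport Q S io] x = c *:[transport Q S io] (d *:[transport Q S io] x)" for c d
 proof -
 have "(c * d) *:[Q] y = c *:[Q] (d *:[Q] y)"
 using y by (intro Q.feqI) (simp_all add: Q.lfun_simps algebra_simps)
 then show ?thesis using y by simp
 qed
 show "1 *:[transport Q S io] x = x"
 proof -
 have "1 *:[Q] y = y" using y by (intro Q.feqI) (simp_all add: Q.lfun_simps)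
 then show ?thesis using y by simp
 qed
next
 fix x y assume "x : car (transport Q S io)" "y : car (transport Q S io)"
 then obtain x' y' where "x' : S" "y' : S" "x = io x'" "y = io y'" by auto
 then show "x +[transport Q S io] y = y +[transport Q S io] x" using Q.M.a_comm[of x' y'] by simp
qed (auto simp: Q.M.a_assoc Q.distrib_left Q.distrib_right Q.mult_assoc Q.smult_mult_left Q.smult_mult_right
 Q.star_star Q.star_add Q.star_smult Q.star_mult Q.cnorm_nonneg Q.cnorm_triangle Q.cnorm_smult Q.cnorm_mult
 Q.cstar_identity Q.one_mult Q.mult_one Q.sm_add_right)

lemma star_hom_from_transport: "star_hom (transport Q S io) Q (inv_into S io)"
 unfolding star_hom_def by auto

lemma star_hom_to_transport:
 assumes f: "star_hom A Q f" and fS: "f ` car A <= S"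
 shows "star_hom A (transport Q S io) (%a. io (f a))"
proof -
 have "f a : S" if "a : car A" for a using that fS by auto
 then show ?thesis
 unfolding star_hom_def
 by (simp add: star_hom_add[OF f] star_hom_smult[OF f] star_hom_mult[OF f] star_hom_star[OF f])
qed

end

section \<open>Injectivity through asymptotic GNS vectors\<close>

subsection \<open>Faithfulness\<close>

text \<open>In the limit the eta s l have the Gram matrix of the GNS vectors of the d l. For a
  generator c both c and c^* c are realized on them: the first gives the inner products of the image
  with the eta, the second its norm.\<close>

locale dense_model = matrix_sequence k + C: unital_cstar_algebra C
 for k and C :: "('c, 'm) cstar_scheme" +
 fixes hp :: "'c => (nat => complex mat) set" and phi :: "'c => complex" and M :: real
 and d :: "nat => 'c" and eta :: "nat => nat => complex vec" and G :: "'c set"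
 assumes hp: "star_hom C Quo hp"
 and phi: "C.pfun phi" "!!x. x : car C ==> cmod (phi x) <= M * cnorm C x"
 "!!x. x : car C ==> Re (phi (star C x *[C] x)) = 0 ==> x = \<zero>\<^bsub>C\<^esub>"
 and d: "!!l. d l : car C" "!!x eps. x : car C ==> eps > 0 ==> EX l. cnorm C (x -[C] d l) < eps"
 and eta: "!!s l. eta s l : CV (k s)"
 "!!l l'. (%s. cinner (eta s l) (eta s l')) ----> phi (star C (d l') *[C] d l)"
 and G: "G <= car C" "!!c. c : G ==> star C c : G" "cstar_generated C G = car C" "G ~= {}"
 and lim: "!!c a. c : G ==> a : {c, star C c *[C] c} ==> EX X. X : car Prod & cls X = hp a &
 (ALL l l'. (%s. cinner (X s *! eta s l) (eta s l')) ----> phi (star C (d l') *[C] (a *[C] d l)))"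
begin

sublocale hp: star_hom_pair C Quo hp
 by (rule star_hom_pairI[OF C.unital_cstar_algebra_axioms Q.unital_cstar_algebra_axioms]) (rule hp)

sublocale cl: star_hom_pair Prod Quo cls
 by (rule star_hom_pairI[OF P.unital_cstar_algebra_axioms Q.unital_cstar_algebra_axioms]) (rule star_hom_cls)

definition vs :: "(nat => complex vec) => bool" where "vs zt \<longleftrightarrow> (ALL s. zt s : CV (k s))"

definition gram :: "'c => (nat => complex vec) => 'c => (nat => complex vec) => bool" where
 "gram x zt y xi \<longleftrightarrow> x : car C & y : car C & vs zt & vs xi & (%s. cinner (zt s) (xi s)) ----> phi (star C y *[C] x)"

text \<open>The sequence zt asymptotically represents the GNS vector of x: some d l and its eta
  approximate x and zt simultaneously. In this form no completion of C is needed.\<close>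

definition tracks :: "'c => (nat => complex vec) => bool" where
 "tracks x zt \<longleftrightarrow> x : car C & vs zt &
 (ALL eps>0. EX l. cnorm C (x -[C] d l) < eps & (\<forall>\<^sub>F s in sequentially. nm2 (zt s - eta s l) < eps))"

lemmas lf = C.pfun_linear[OF phi(1)]

lemma vs_lin: "vs zt ==> vs xi ==> vs (%s. zt s + a \<cdot>\<^sub>v xi s)" by (simp add: vs_def)

lemma vs_mult: "X : car Prod ==> vs zt ==> vs (%s. X s *! zt s)"
 unfolding vs_def using mult_mat_vec_carrier[OF Prod_mat] by blast

lemma gram_sym: assumes g: "gram x zt y xi" shows "gram y xi x zt"
proof -
 have "(%s. cnj (cinner (zt s) (xi s))) ----> cnj (phi (star C y *[C] x))" using g by (intro tendsto_cnj) (simp add: gram_def)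
 moreover have "cnj (cinner (zt s) (xi s)) = cinner (xi s) (zt s)" for s
 using g cinner_cnj[of "zt s" "k s" "xi s"] by (simp add: gram_def vs_def)
 moreover have "cnj (phi (star C y *[C] x)) = phi (star C x *[C] y)"
 using g C.pfun_star[OF phi(1), of "star C y *[C] x"] by (simp add: gram_def C.star_mult)
 ultimately show ?thesis using g by (simp add: gram_def)
qed

lemma gram_lin:
 assumes g: "gram x zt y xi" "gram x' zt' y xi" shows "gram (x +[C] a *:[C] x') (%s. zt s + a \<cdot>\<^sub>v zt' s) y xi"
proof -
 have "(%s. cinner (zt s) (xi s) + a * cinner (zt' s) (xi s)) ----> phi (star C y *[C] x) + a * phi (star C y *[C] x')"
 using g by (intro tendsto_intros) (simp_all add: gram_def)
 moreover have "cinner (zt s + a \<cdot>\<^sub>v zt' s) (xi s) = cinner (zt s) (xi s) + a * cinner (zt' s) (xi s)" for s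
 using g cinner_add_left[of "zt s" "k s" "a \<cdot>\<^sub>v zt' s" "xi s"] cinner_smult_left[of "zt' s" "k s" "xi s" a] by (simp add: gram_def vs_def)
 moreover have "phi (star C y *[C] (x +[C] a *:[C] x')) = phi (star C y *[C] x) + a * phi (star C y *[C] x')"
 using g by (simp add: gram_def C.distrib_left C.smult_mult_right C.lfun_simps[OF lf])
 ultimately show ?thesis using g by (simp add: gram_def vs_lin)
qed

lemma gram_d: "gram (d l) (%s. eta s l) (d l') (%s. eta s l')"
 using eta d(1) by (simp add: gram_def vs_def)

text \<open>The squared norms of zt s tend to phi(x^* x), which is at most M ||x||^2.\<close>

lemma gram_small:
 assumes g: "gram x zt x zt" and eps: "eps > 0" and x: "cnorm C x < eps / (1 + \<bar>M\<bar>)"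
 shows "\<forall>\<^sub>F s in sequentially. nm2 (zt s) < eps"
proof -
 have xc: "x : car C" using g by (simp add: gram_def)
 have lim: "(%s. Re (cinner (zt s) (zt s))) ----> Re (phi (star C x *[C] x))" using g by (intro tendsto_Re) (simp add: gram_def)
 have M: "0 < 1 + \<bar>M\<bar>" by simp
 have "Re (phi (star C x *[C] x)) <= cmod (phi (star C x *[C] x))" by (rule complex_Re_le_cmod)
 also have "... <= M * (cnorm C x)\<^sup>2" using phi(2)[of "star C x *[C] x"] xc by (simp add: C.cstar_identity)
 also have "... <= (1 + \<bar>M\<bar>)\<^sup>2 * (cnorm C x)\<^sup>2"
 proof (rule mult_right_mono)
 have "M <= 1 + \<bar>M\<bar>" "(1 + \<bar>M\<bar>) * 1 <= (1 + \<bar>M\<bar>) * (1 + \<bar>M\<bar>)" by (simp, rule mult_left_mono) simp_all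
 then show "M <= (1 + \<bar>M\<bar>)\<^sup>2" unfolding power2_eq_square mult_1_right by (rule order_trans)
 qed simp
 also have "... = ((1 + \<bar>M\<bar>) * cnorm C x)\<^sup>2" by (simp add: power_mult_distrib)
 also have "... < eps\<^sup>2"
 using x M C.cnorm_nonneg[OF xc] by (intro power_strict_mono) (simp_all add: pos_less_divide_eq mult.commute)
 finally have "\<forall>\<^sub>F s in sequentially. Re (cinner (zt s) (zt s)) < eps\<^sup>2" by (rule order_tendstoD(2)[OF lim])
 then show ?thesis
 proof eventually_elim
 case (elim s)
 then have "(nm2 (zt s))\<^sup>2 < eps\<^sup>2" by (simp add: nrm_Re)
 then show ?case using eps by (simp add: power2_less_imp_less)
 qed
qed

text \<open>The norm of zt and its inner products with the eta determine the limit of the norm of zt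
  - eta l, which is small when x is close to d l.\<close>

lemma tracks_if_gram:
 assumes g: "gram x zt x zt" "!!l. gram x zt (d l) (%s. eta s l)"
 shows "tracks x zt"
 unfolding tracks_def
proof (intro conjI allI impI)
 show x: "x : car C" "vs zt" using g by (simp_all add: gram_def)
 fix eps :: real assume eps: "eps > 0"
 have "0 < min eps (eps / (1 + \<bar>M\<bar>))" using eps by simp
 then obtain l where l: "cnorm C (x -[C] d l) < min eps (eps / (1 + \<bar>M\<bar>))" using d(2)[OF x(1)] by blast
 let ?y = "x +[C] (- 1) *:[C] d l" and ?xi = "%s. zt s + (- 1) \<cdot>\<^sub>v eta s l"
 note y = C.minus_eq[OF x(1) d(1)[of l]]
 have xi: "zt s + (- 1) \<cdot>\<^sub>v eta s l = zt s - eta s l" for s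
 using x(2) eta(1)[of s l] by (intro eq_vecI) (auto simp: vs_def)
 have "gram x zt ?y ?xi" by (rule gram_sym, rule gram_lin[OF g(1)], rule gram_sym, rule g(2))
 moreover have "gram (d l) (%s. eta s l) ?y ?xi" by (rule gram_sym, rule gram_lin[OF g(2) gram_d])
 ultimately have "gram ?y ?xi ?y ?xi" by (rule gram_lin)
 moreover have "cnorm C ?y < eps / (1 + \<bar>M\<bar>)" unfolding y[symmetric] using l by simp
 ultimately have "\<forall>\<^sub>F s in sequentially. nm2 (zt s + (- 1) \<cdot>\<^sub>v eta s l) < eps" using gram_small[of ?y ?xi eps] eps by blast
 then show "EX l. cnorm C (x -[C] d l) < eps & (\<forall>\<^sub>F s in sequentially. nm2 (zt s - eta s l) < eps)"
 unfolding xi using l by (intro exI[of _ l]) simp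
qed

lemma vec_dist_trans:
 assumes "u : CV n" "v : CV n" "w : CV n"
 shows "nm2 (u - w) <= nm2 (u - v) + nm2 (v - w)"
proof -
 have "u - w = (u - v) + (v - w)" using assms by (intro eq_vecI) auto
 then show ?thesis using nrm_add[of "u - v" n "v - w"] assms by simp
qed

lemma tracks_limit:
 assumes x: "x : car C" "vs zt"
 and near: "!!eps. eps > 0 ==> EX y xi. tracks y xi & cnorm C (x -[C] y) < eps & (\<forall>\<^sub>F s in sequentially. nm2 (zt s - xi s) < eps)"
 shows "tracks x zt"
 unfolding tracks_def
proof (intro conjI allI impI x)
 fix eps :: real assume eps: "eps > 0"
 obtain y xi where y: "tracks y xi" "cnorm C (x -[C] y) < eps/2" "\<forall>\<^sub>F s in sequentially. nm2 (zt s - xi s) < eps/2"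
 using near[OF half_gt_zero[OF eps]] by blast
 then have yc: "y : car C" "vs xi" by (simp_all add: tracks_def)
 obtain l where l: "cnorm C (y -[C] d l) < eps/2" "\<forall>\<^sub>F s in sequentially. nm2 (xi s - eta s l) < eps/2"
 using y(1) half_gt_zero[OF eps] unfolding tracks_def by blast
 have "cnorm C (x -[C] d l) < eps" using C.cnorm_minus_trans[OF x(1) yc(1) d(1)[of l]] y(2) l(1) by simp
 moreover have "\<forall>\<^sub>F s in sequentially. nm2 (zt s - eta s l) < eps"
 using y(3) l(2)
 proof eventually_elim
 case (elim s)
 then show ?case using vec_dist_trans[of "zt s" "k s" "xi s" "eta s l"] x(2) yc(2) eta(1) by (simp add: vs_def)
 qed
 ultimately show "EX l. cnorm C (x -[C] d l) < eps & (\<forall>\<^sub>F s in sequentially. nm2 (zt s - eta s l) < eps)" by blast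
qed

lemma tracks_null:
 assumes t: "tracks x xi" "vs zt" "(%s. nm2 (zt s - xi s)) ----> 0" shows "tracks x zt"
proof (rule tracks_limit[OF _ t(2)])
 show xc: "x : car C" using t(1) by (simp add: tracks_def)
 fix eps :: real assume "eps > 0"
 then show "EX y xi. tracks y xi & cnorm C (x -[C] y) < eps & (\<forall>\<^sub>F s in sequentially. nm2 (zt s - xi s) < eps)"
 using t(1) order_tendstoD(2)[OF t(3)] xc by (intro exI[of _ x] exI[of _ xi]) simp
qed

lemma tracks_lin:
 assumes x: "tracks x zt" and y: "tracks y xi" shows "tracks (x +[C] a *:[C] y) (%s. zt s + a \<cdot>\<^sub>v xi s)"
proof (rule tracks_limit)
 have c: "x : car C" "y : car C" "vs zt" "vs xi" using x y by (simp_all add: tracks_def)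
 then show "x +[C] a *:[C] y : car C" "vs (%s. zt s + a \<cdot>\<^sub>v xi s)" by (simp_all add: vs_lin)
 fix eps :: real assume eps: "eps > 0"
 define dlt where "dlt = eps / (2 * (1 + cmod a))"
 have a1: "0 < 1 + cmod a" using norm_ge_zero[of a] by linarith
 have dlt: "dlt > 0" using eps a1 by (simp add: dlt_def)
 have dlteps: "r + cmod a * r' < eps" if "r < dlt" "r' < dlt" for r r'
 proof -
 have "cmod a * r' <= cmod a * dlt" using that by (intro mult_left_mono) auto
 moreover have "(1 + cmod a) * dlt = eps / 2" using a1 by (simp add: dlt_def field_simps)
 ultimately show ?thesis using that(1) eps by (simp add: distrib_right)
 qed
 obtain l where l: "cnorm C (x -[C] d l) < dlt" "\<forall>\<^sub>F s in sequentially. nm2 (zt s - eta s l) < dlt" using x dlt unfolding tracks_def by blast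
 obtain l' where l': "cnorm C (y -[C] d l') < dlt" "\<forall>\<^sub>F s in sequentially. nm2 (xi s - eta s l') < dlt" using y dlt unfolding tracks_def by blast
 let ?y = "d l +[C] a *:[C] d l'" and ?xi = "%s. eta s l + a \<cdot>\<^sub>v eta s l'"
 have g: "gram ?y ?xi (d j) (%s. eta s j)" for j by (rule gram_lin[OF gram_d gram_d])
 have "tracks ?y ?xi" by (rule tracks_if_gram[OF gram_lin[OF gram_sym[OF g] gram_sym[OF g]] g])
 moreover have "cnorm C (x +[C] a *:[C] y -[C] ?y) < eps"
 proof -
 have "x +[C] a *:[C] y -[C] ?y = (x -[C] d l) +[C] a *:[C] (y -[C] d l')"
 using c(1,2) d(1) by (intro C.feqI) (simp_all add: C.lfun_simps algebra_simps)
 then have "cnorm C (x +[C] a *:[C] y -[C] ?y) <= cnorm C (x -[C] d l) + cmod a * cnorm C (y -[C] d l')"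
 using C.cnorm_triangle[of "x -[C] d l" "a *:[C] (y -[C] d l')"] c(1,2) d(1) by (simp add: C.cnorm_smult)
 then show ?thesis using dlteps[OF l(1) l'(1)] by simp
 qed
 moreover have "\<forall>\<^sub>F s in sequentially. nm2 (zt s + a \<cdot>\<^sub>v xi s - ?xi s) < eps"
 using l(2) l'(2)
 proof eventually_elim
 case (elim s)
 have cs: "zt s : CV (k s)" "xi s : CV (k s)" "eta s l : CV (k s)" "eta s l' : CV (k s)"
 using c eta(1) by (simp_all add: vs_def)
 have "zt s + a \<cdot>\<^sub>v xi s - ?xi s = (zt s - eta s l) + a \<cdot>\<^sub>v (xi s - eta s l')"
 using cs by (intro eq_vecI) (auto simp: algebra_simps)
 then show ?case using nrm_add[of "zt s - eta s l" "k s" "a \<cdot>\<^sub>v (xi s - eta s l')"] cs dlteps[OF elim] by simp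
 qed
 ultimately show "EX y' xi'. tracks y' xi' & cnorm C (x +[C] a *:[C] y -[C] y') < eps & (\<forall>\<^sub>F s in sequentially. nm2 (zt s + a \<cdot>\<^sub>v xi s - xi' s) < eps)"
 by blast
qed

text \<open>There are d (l n) converging to x with zt s eventually within 1/(n + 1) of eta s (l n).
  If zt tends to 0, then phi at the squares of the d (l n) tends to 0, so phi(x^* x) = 0 and
  faithfulness applies.\<close>

lemma tracks_zero: assumes x: "tracks x zt" and z: "(%s. nm2 (zt s)) ----> 0" shows "x = \<zero>\<^bsub>C\<^esub>"
proof -
 have c: "x : car C" "vs zt" using x by (simp_all add: tracks_def)
 have "ALL n. EX l. cnorm C (x -[C] d l) < inverse (real (Suc n)) & (\<forall>\<^sub>F s in sequentially. nm2 (zt s - eta s l) < inverse (real (Suc n)))"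
 using x unfolding tracks_def by simp
 then obtain l where l: "!!n. cnorm C (x -[C] d (l n)) < inverse (real (Suc n))"
 "!!n. \<forall>\<^sub>F s in sequentially. nm2 (zt s - eta s (l n)) < inverse (real (Suc n))" by metis
 have conv: "C.conv (%n. d (l n)) x"
 proof (rule C.conv_bound[OF d(1) c(1) _ LIMSEQ_inverse_real_of_nat])
 fix n show "cnorm C (d (l n) -[C] x) <= inverse (real (Suc n))"
 unfolding C.cnorm_minus_commute[OF d(1) c(1)] using l(1)[of n] by (rule less_imp_le)
 qed
 define y where "y n = star C (d (l n)) *[C] d (l n)" for n
 have yc: "C.conv y (star C x *[C] x)" unfolding y_def by (rule C.conv_mult[OF C.conv_star[OF conv] conv])
 have small: "Re (phi (y n)) <= (2 * inverse (real (Suc n)))\<^sup>2" for n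
 proof (rule tendsto_upperbound)
 show "(%s. Re (cinner (eta s (l n)) (eta s (l n)))) ----> Re (phi (y n))" unfolding y_def by (intro tendsto_Re eta(2))
 have "\<forall>\<^sub>F s in sequentially. nm2 (zt s) < inverse (real (Suc n))" by (rule order_tendstoD(2)[OF z]) simp
 with l(2)[of n] show "\<forall>\<^sub>F s in sequentially. Re (cinner (eta s (l n)) (eta s (l n))) <= (2 * inverse (real (Suc n)))\<^sup>2"
 proof eventually_elim
 case (elim s)
 have cs: "zt s : CV (k s)" "eta s (l n) : CV (k s)" using c eta(1) by (simp_all add: vs_def)
 have "eta s (l n) = zt s + (- 1) \<cdot>\<^sub>v (zt s - eta s (l n))" using cs by (intro eq_vecI) auto
 then have "nm2 (eta s (l n)) <= nm2 (zt s) + nm2 (zt s - eta s (l n))"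
 using nrm_add[of "zt s" "k s" "(- 1) \<cdot>\<^sub>v (zt s - eta s (l n))"] cs by simp
 then have "nm2 (eta s (l n)) <= 2 * inverse (real (Suc n))" using elim by simp
 then show ?case unfolding nrm_Re[symmetric] by (intro power_mono) auto
 qed
 qed simp
 have "(%n. phi (y n) - phi (star C x *[C] x)) ----> 0"
 proof (rule Lim_null_comparison)
 show "(%n. M * cnorm C (y n -[C] star C x *[C] x)) ----> 0"
 by (rule tendsto_mult_right_zero) (use yc in \<open>simp add: C.conv_def\<close>)
 show "\<forall>\<^sub>F n in sequentially. norm (phi (y n) - phi (star C x *[C] x)) <= M * cnorm C (y n -[C] star C x *[C] x)"
 using phi(2)[of "y _ -[C] star C x *[C] x"] d(1) c(1) by (intro always_eventually allI) (simp add: y_def C.lfun_simps[OF lf])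
 qed
 then have "(%n. Re (phi (y n))) ----> Re (phi (star C x *[C] x))" by (intro tendsto_Re) (simp add: LIM_zero_iff)
 moreover have "(%n. (2 * inverse (real (Suc n)))\<^sup>2) ----> (2 * 0)\<^sup>2" by (intro tendsto_intros LIMSEQ_inverse_real_of_nat)
 ultimately have "Re (phi (star C x *[C] x)) <= (2 * 0)\<^sup>2" by (rule LIMSEQ_le) (use small in blast)
 then have "Re (phi (star C x *[C] x)) = 0"
 using C.pfun_pos[OF phi(1) C.pos_star_mult[OF c(1)]] by simp
 then show ?thesis by (rule phi(3)[OF c(1)])
qed

text \<open>Every lift of hp c acts on the eta asymptotically as c acts on the GNS vectors. Lifts
  differ by null sequences, so one lift is enough (\<open>goodI\<close>).\<close>

definition good :: "'c => bool" where
 "good c \<longleftrightarrow> c : car C & (ALL X j. X : car Prod --> cls X = hp c --> tracks (c *[C] d j) (%s. X s *! eta s j))"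

lemma lift: assumes "c : car C" obtains X where "X : car Prod" "cls X = hp c"
 using hp.hom_closed[OF assms] by (metis Quo_cases)

lemma eta_norm: "(%s. nm2 (eta s j)) ----> sqrt (Re (phi (star C (d j) *[C] d j)))"
proof -
 have "(%s. (nm2 (eta s j))\<^sup>2) ----> Re (phi (star C (d j) *[C] d j))"
 unfolding nrm_Re by (intro tendsto_Re eta(2))
 from tendsto_real_sqrt[OF this] show ?thesis by simp
qed

lemma norm_diff_mult:
 assumes X: "X : car Prod" "Y : car Prod"
 shows "nm2 (X s *! eta s j - Y s *! eta s j) <= opn (X s - Y s) * nm2 (eta s j)"
 unfolding minus_mult_distrib_mat_vec[OF Prod_mat[OF X(1)] Prod_mat[OF X(2)] eta(1), symmetric]
 by (rule nrm_mult_le[OF minus_carrier_mat[OF Prod_mat[OF X(2)]] eta(1)])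

lemma null_mult:
 assumes X: "X : car Prod" "Y : car Prod" "cls X = cls Y"
 shows "(%s. nm2 (X s *! eta s j - Y s *! eta s j)) ----> 0"
proof (rule Lim_null_comparison)
 show "(%s. opn (X s - Y s) * nm2 (eta s j)) ----> 0"
 using tendsto_mult[OF cls_eq_null[OF X] eta_norm] by simp
qed (simp add: norm_diff_mult[OF X(1,2)])

lemma goodI:
 assumes c: "c : car C" and Y: "Y : car Prod" "cls Y = hp c" "!!j. tracks (c *[C] d j) (%s. Y s *! eta s j)"
 shows "good c"
 unfolding good_def
proof (intro conjI allI impI c)
 fix X j assume X: "X : car Prod" "cls X = hp c"
 have "vs (%s. X s *! eta s j)" using eta(1) by (intro vs_mult X(1)) (simp add: vs_def)
 then show "tracks (c *[C] d j) (%s. X s *! eta s j)"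
 by (rule tracks_null[OF Y(3) _ null_mult[OF X(1) Y(1)]]) (use X Y in simp)
qed

text \<open>Passage from the eta to all tracked sequences, by boundedness of X and of multiplication
  by c. Closure of good elements under products rests on it.\<close>

lemma good_tracks:
 assumes c: "good c" and X: "X : car Prod" "cls X = hp c" and x: "tracks x zt"
 shows "tracks (c *[C] x) (%s. X s *! zt s)"
proof (rule tracks_limit)
 have cc: "c : car C" and xc: "x : car C" "vs zt" using c x by (simp_all add: good_def tracks_def)
 then show "c *[C] x : car C" "vs (%s. X s *! zt s)" using X by (simp_all add: vs_mult)
 fix eps :: real assume eps: "eps > 0"
 define B where "B = 1 + cnorm C c + cnorm Prod X"
 have B: "0 < B" "cnorm C c <= B" "cnorm Prod X <= B" using C.cnorm_nonneg[OF cc] P.cnorm_nonneg[OF X(1)] by (simp_all add: B_def)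
 obtain l where l: "cnorm C (x -[C] d l) < eps / B" "\<forall>\<^sub>F s in sequentially. nm2 (zt s - eta s l) < eps / B"
 using x divide_pos_pos[OF eps B(1)] unfolding tracks_def by blast
 have mono: "r * r' < eps" if "r <= B" "r' < eps / B" "0 <= r'" for r r'
 using mult_right_mono[OF that(1,3)] mult_strict_left_mono[OF that(2) B(1)] B(1) by simp
 have "tracks (c *[C] d l) (%s. X s *! eta s l)" using c X by (simp add: good_def)
 moreover have "cnorm C (c *[C] x -[C] c *[C] d l) < eps"
 using C.cnorm_mult[OF cc, of "x -[C] d l"] mono[OF B(2) l(1)] xc d(1) cc C.cnorm_nonneg[of "x -[C] d l"] by (simp add: C.mult_minus)
 moreover have "\<forall>\<^sub>F s in sequentially. nm2 (X s *! zt s - X s *! eta s l) < eps"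
 using l(2)
 proof eventually_elim
 case (elim s)
 have cs: "zt s : CV (k s)" using xc by (simp add: vs_def)
 have "nm2 (X s *! zt s - X s *! eta s l) <= opn (X s) * nm2 (zt s - eta s l)"
 unfolding mult_minus_distrib_mat_vec[OF Prod_mat[OF X(1)] cs eta(1), symmetric]
 by (rule nrm_mult_le[OF Prod_mat[OF X(1)]]) (use cs eta(1) in simp)
 then show ?case using mono[OF order_trans[OF Prod_mat_opnorm[OF X(1)] B(3)] elim, of s] by simp
 qed
 ultimately show "EX y xi. tracks y xi & cnorm C (c *[C] x -[C] y) < eps & (\<forall>\<^sub>F s in sequentially. nm2 (X s *! zt s - xi s) < eps)"
 by blast
qed

text \<open>The inner products of X eta with the eta come from the limit for c. Its norm comes from
  the limit for c^* c, because a lift Y of the image of c^* c differs from X^* X by a null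
  sequence.\<close>

lemma good_G: assumes c: "c : G" shows "good c"
proof -
 have cc: "c : car C" using c G(1) by auto
 obtain X where X: "X : car Prod" "cls X = hp c"
 "!!l l'. (%s. cinner (X s *! eta s l) (eta s l')) ----> phi (star C (d l') *[C] (c *[C] d l))"
 using lim[OF c, of c] by blast
 obtain Y where Y: "Y : car Prod" "cls Y = hp (star C c *[C] c)"
 "!!l l'. (%s. cinner (Y s *! eta s l) (eta s l')) ----> phi (star C (d l') *[C] ((star C c *[C] c) *[C] d l))"
 using lim[OF c, of "star C c *[C] c"] by blast
 have XX: "star Prod X *[Prod] X : car Prod" "cls (star Prod X *[Prod] X) = cls Y"
 using X Y(2) cc by (simp_all add: cl.hom_mult cl.hom_star hp.hom_mult hp.hom_star)
 have v: "vs (%s. X s *! eta s j)" for j using eta(1) by (intro vs_mult X(1)) (simp add: vs_def)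
 show ?thesis
 proof (rule goodI[OF cc X(1,2)], rule tracks_if_gram)
 fix j
 show "gram (c *[C] d j) (%s. X s *! eta s j) (d l) (%s. eta s l)" for l
 using X(3) v cc d(1) eta(1) by (simp add: gram_def vs_def)
 have z: "(%s. cinner (Y s *! eta s j - (star Prod X *[Prod] X) s *! eta s j) (eta s j)) ----> 0"
 proof (rule Lim_null_comparison)
 show "(%s. nm2 (Y s *! eta s j - (star Prod X *[Prod] X) s *! eta s j) * nm2 (eta s j)) ----> 0"
 using tendsto_mult[OF null_mult[OF Y(1) XX(1) XX(2)[symmetric]] eta_norm] by simp
 show "\<forall>\<^sub>F s in sequentially. norm (cinner (Y s *! eta s j - (star Prod X *[Prod] X) s *! eta s j) (eta s j))
 <= nm2 (Y s *! eta s j - (star Prod X *[Prod] X) s *! eta s j) * nm2 (eta s j)"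
 by (intro always_eventually allI cinner_Cauchy_Schwarz[OF minus_carrier_vec eta(1)] mult_mat_vec_carrier[OF Prod_mat eta(1)] Y(1) XX(1))
 qed
 have e: "cinner (Y s *! eta s j - (star Prod X *[Prod] X) s *! eta s j) (eta s j)
 = cinner (Y s *! eta s j) (eta s j) - cinner (X s *! eta s j) (X s *! eta s j)" for s
 proof -
 note Xs = Prod_mat[OF X(1), of s] and Xv = mult_mat_vec_carrier[OF Prod_mat[OF X(1)] eta(1), of s j]
 have "(star Prod X *[Prod] X) s *! eta s j = adj (X s) *! (X s *! eta s j)"
 using assoc_mult_mat_vec[OF mat_adjoint_carrier[OF Xs] Xs eta(1)] by (simp add: Prod_simps(1) star_Prod_mat)
 then show ?thesis
 using cinner_diff_left[OF mult_mat_vec_carrier[OF Prod_mat[OF Y(1)] eta(1)] mult_mat_vec_carrier[OF Prod_mat[OF XX(1)] eta(1)] eta(1), of s j j j]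
 cinner_adjoint[OF mat_adjoint_carrier[OF Xs] Xv eta(1)[of s j]] by simp
 qed
 have "(%s. cinner (Y s *! eta s j) (eta s j) - cinner (Y s *! eta s j - (star Prod X *[Prod] X) s *! eta s j) (eta s j))
 ----> phi (star C (d j) *[C] ((star C c *[C] c) *[C] d j)) - 0"
 by (rule tendsto_diff[OF Y(3) z])
 then show "gram (c *[C] d j) (%s. X s *! eta s j) (c *[C] d j) (%s. X s *! eta s j)"
 using v cc d(1) by (simp add: gram_def e C.star_mult C.mult_assoc)
 qed
qed

lemma good_lin:
 assumes a: "good a" and b: "good b" shows "good (a +[C] z *:[C] b)"
proof -
 have c: "a : car C" "b : car C" using a b by (simp_all add: good_def)
 obtain X where X: "X : car Prod" "cls X = hp a" by (rule lift[OF c(1)])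
 obtain Y where Y: "Y : car Prod" "cls Y = hp b" by (rule lift[OF c(2)])
 show ?thesis
 proof (rule goodI)
 show "X +[Prod] z *:[Prod] Y : car Prod" "cls (X +[Prod] z *:[Prod] Y) = hp (a +[C] z *:[C] b)"
 using X Y c by (simp_all add: cl.hom_add cl.hom_smult hp.hom_add hp.hom_smult)
 fix j
 have "(X +[Prod] z *:[Prod] Y) s *! eta s j = X s *! eta s j + z \<cdot>\<^sub>v (Y s *! eta s j)" for s
 using Prod_mat[OF X(1), of s] Prod_mat[OF Y(1), of s] eta(1)[of s j]
 by (simp add: Prod_simps(4,5) add_mult_distrib_mat_vec[of _ "k s" "k s"]) (auto intro!: eq_vecI)
 moreover have "(a +[C] z *:[C] b) *[C] d j = a *[C] d j +[C] z *:[C] (b *[C] d j)" using c d(1) by (simp add: C.distrib_right C.smult_mult_left)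
 moreover have "tracks (a *[C] d j) (%s. X s *! eta s j)" "tracks (b *[C] d j) (%s. Y s *! eta s j)"
 using a b X Y by (simp_all add: good_def)
 ultimately show "tracks ((a +[C] z *:[C] b) *[C] d j) (%s. (X +[Prod] z *:[Prod] Y) s *! eta s j)" by (simp add: tracks_lin)
 qed (use c in simp)
qed

lemma good_mult:
 assumes a: "good a" and b: "good b" shows "good (a *[C] b)"
proof -
 have c: "a : car C" "b : car C" using a b by (simp_all add: good_def)
 obtain X where X: "X : car Prod" "cls X = hp a" by (rule lift[OF c(1)])
 obtain Y where Y: "Y : car Prod" "cls Y = hp b" by (rule lift[OF c(2)])
 show ?thesis
 proof (rule goodI)
 show "X *[Prod] Y : car Prod" "cls (X *[Prod] Y) = hp (a *[C] b)" using X Y c by (simp_all add: cl.hom_mult hp.hom_mult)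
 fix j
 have "(X *[Prod] Y) s *! eta s j = X s *! (Y s *! eta s j)" for s
 using assoc_mult_mat_vec[OF Prod_mat[OF X(1)] Prod_mat[OF Y(1)] eta(1)] by (simp add: Prod_simps(1))
 moreover have "tracks (b *[C] d j) (%s. Y s *! eta s j)" using b Y by (simp add: good_def)
 ultimately show "tracks ((a *[C] b) *[C] d j) (%s. (X *[Prod] Y) s *! eta s j)"
 using good_tracks[OF a X] c d(1) by (simp add: C.mult_assoc)
 qed (use c in simp)
qed

text \<open>Since hp is contractive, lifts of hp c and hp (x n) are eventually close in operator
  norm, hence in their action on the eta.\<close>

lemma good_limit:
 assumes x: "!!n. good (x n)" and c: "C.conv x c" shows "good c"
proof -
 have cc: "c : car C" "x n : car C" for n using c by (simp_all add: C.conv_def)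
 obtain X where X: "X : car Prod" "cls X = hp c" by (rule lift[OF cc(1)])
 show ?thesis
 proof (rule goodI[OF cc(1) X])
 fix j
 show "tracks (c *[C] d j) (%s. X s *! eta s j)"
 proof (rule tracks_limit)
 show "c *[C] d j : car C" "vs (%s. X s *! eta s j)" using cc d(1) X eta(1) by (simp_all add: vs_mult vs_def[of "%s. eta s j"])
 fix eps :: real assume eps: "eps > 0"
 define B where "B = 1 + sqrt (Re (phi (star C (d j) *[C] d j))) + cnorm C (d j)"
 have sq: "0 <= sqrt (Re (phi (star C (d j) *[C] d j)))"
 using C.pfun_pos[OF phi(1) C.pos_star_mult[OF d(1)]] by simp
 have B: "0 < B" "cnorm C (d j) <= B" "sqrt (Re (phi (star C (d j) *[C] d j))) < B"
 using sq C.cnorm_nonneg[OF d(1)[of j]] unfolding B_def by linarith+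
 define dlt where "dlt = eps / (2 * B)"
 have dlt: "dlt > 0" "2 * dlt * B = eps" using eps B(1) by (simp_all add: dlt_def)
 have "\<forall>\<^sub>F n in sequentially. cnorm C (x n -[C] c) < dlt"
 by (rule order_tendstoD(2)[of _ 0]) (use c dlt(1) in \<open>auto simp: C.conv_def\<close>)
 then obtain n where "cnorm C (x n -[C] c) < dlt" by (auto simp: eventually_sequentially)
 then have n: "cnorm C (c -[C] x n) < dlt" using C.cnorm_minus_commute[OF cc(1) cc(2)[of n]] by simp
 obtain Y where Y: "Y : car Prod" "cls Y = hp (x n)" by (rule lift[OF cc(2)])
 have XY: "X -[Prod] Y : car Prod" using X Y by simp
 have "cls (X -[Prod] Y) = hp (c -[C] x n)" using X Y cc by (simp add: cl.hom_minus hp.hom_minus)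
 then have "cnorm Quo (cls (X -[Prod] Y)) < dlt" using hp.hom_contractive[of "c -[C] x n"] n cc(1) cc(2)[of n] by simp
 with Quot_norm_lower[OF XY dlt(1)] have op: "\<forall>\<^sub>F s in sequentially. opn (X s - Y s) < 2 * dlt"
 using X(1) Y(1) by (simp add: Prod_minus_mat) (erule eventually_mono; simp)
 have eb: "\<forall>\<^sub>F s in sequentially. nm2 (eta s j) < B"
 by (rule order_tendstoD(2)[OF eta_norm B(3)])
 have "tracks (x n *[C] d j) (%s. Y s *! eta s j)" using x[of n] Y by (simp add: good_def)
 moreover have "cnorm C (c *[C] d j -[C] x n *[C] d j) < eps"
 proof -
 have "cnorm C ((c -[C] x n) *[C] d j) <= cnorm C (c -[C] x n) * cnorm C (d j)" by (rule C.cnorm_mult) (use cc d(1) in auto)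
 also have "... <= dlt * B" using n B dlt C.cnorm_nonneg[OF d(1)[of j]] by (intro mult_mono) auto
 also have "... < eps" using dlt eps by simp
 finally show ?thesis using cc d(1) by (simp add: C.minus_mult)
 qed
 moreover have "\<forall>\<^sub>F s in sequentially. nm2 (X s *! eta s j - Y s *! eta s j) < eps"
 using op eb
 proof eventually_elim
 case (elim s)
 have "opn (X s - Y s) * nm2 (eta s j) < 2 * dlt * B"
 using elim opn_nonneg[OF minus_carrier_mat[OF Prod_mat[OF Y(1)]]] by (intro mult_strict_mono') auto
 then show ?case using norm_diff_mult[OF X(1) Y(1), of s j] dlt(2) by simp
 qed
 ultimately show "EX y xi. tracks y xi & cnorm C (c *[C] d j -[C] y) < eps & (\<forall>\<^sub>F s in sequentially. nm2 (X s *! eta s j - xi s) < eps)"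
 by blast
 qed
 qed
qed

text \<open>The good elements with good adjoint form a C*-subalgebra containing G, hence are
  everything. If hp c = 0, the zero sequence is a lift, so c d_j = 0 for all j; some d_j is within
  1/2 of 1, and therefore ||c|| \<le> ||c||/2.\<close>

theorem injective: "inj_on hp (car C)"
proof -
 define S where "S = {c. good c & good (star C c)}"
 have Sc: "S <= car C" by (auto simp: S_def good_def)
 have lin: "a +[C] z *:[C] b : S" if "a : S" "b : S" for a b z
 using that Sc good_lin[of a b z] good_lin[of "star C a" "star C b" "cnj z"] by (auto simp: S_def C.star_add C.star_smult subset_iff)
 have GS: "G <= S" using good_G G(2) by (auto simp: S_def)
 obtain c where c: "c : S" using GS G(4) by auto
 have "c +[C] (- 1) *:[C] c = \<zero>\<^bsub>C\<^esub>" using c Sc by (intro C.feqI) (auto simp: C.lfun_simps)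
 then have zero: "\<zero>\<^bsub>C\<^esub> : S" using lin[OF c c, of "- 1"] by simp
 have sm: "z *:[C] a : S" if a: "a : S" for a z
 proof -
 have "z *:[C] a : car C" using a Sc by auto
 then show ?thesis using lin[OF zero a, of z] by simp
 qed
 have "Module.submodule S complex_ring C"
 proof (rule C.submoduleI[OF Sc zero])
 fix a b assume a: "a : S" and b: "b : S"
 have ab: "a : car C" "b : car C" using a b Sc by auto
 have "1 *:[C] b = b" using ab by (intro C.feqI) (simp_all add: C.lfun_simps)
 then show "a +[C] b : S" using lin[OF a b, of 1] by simp
 have "\<ominus>\<^bsub>C\<^esub> a = (- 1) *:[C] a" using C.M.minus_equality[of "(- 1) *:[C] a" a] C.minus_eq[OF ab(1) ab(1)] ab by (simp add: C.M.a_comm)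
 then show "\<ominus>\<^bsub>C\<^esub> a : S" using sm[OF a] by simp
 qed (rule sm)
 moreover have "a *[C] b : S" if "a : S" "b : S" for a b
 using that Sc good_mult[of a b] good_mult[of "star C b" "star C a"] by (auto simp: S_def C.star_mult subset_iff)
 moreover have "star C a : S" if "a : S" for a using that Sc by (auto simp: S_def C.star_star subset_iff)
 moreover have "closedin (ctopology C) S"
 proof (rule C.in_closure_conv[OF Sc])
 fix x l assume x: "!!n. x n : S" and l: "C.conv x l"
 then show "l : S" using good_limit[of x l] good_limit[OF _ C.conv_star[OF l]] by (simp add: S_def)
 qed
 ultimately have "cstar_subalgebra S C" by (simp add: cstar_subalgebra_def)
 then have all: "good c" if "c : car C" for c
 using that GS G(3) unfolding cstar_generated_def S_def by blast
 show ?thesis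
 proof (rule inj_onI)
 fix x y assume xy: "x : car C" "y : car C" "hp x = hp y"
 define c where "c = x -[C] y"
 have cc: "c : car C" using xy by (simp add: c_def)
 have pc: "cls \<zero>\<^bsub>Prod\<^esub> = hp c" using xy by (simp add: c_def hp.hom_minus)
 have "c *[C] d j = \<zero>\<^bsub>C\<^esub>" for j
 proof (rule tracks_zero)
 show "tracks (c *[C] d j) (%s. \<zero>\<^bsub>Prod\<^esub> s *! eta s j)" using all[OF cc] pc by (simp add: good_def)
 have "\<zero>\<^bsub>Prod\<^esub> s *! eta s j = 0\<^sub>v (k s)" for s using eta(1)[of s j] by (auto simp: Prod_simps intro!: eq_vecI)
 then show "(%s. nm2 (\<zero>\<^bsub>Prod\<^esub> s *! eta s j)) ----> 0" by simp
 qed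
 moreover obtain j where j: "cnorm C (\<one>\<^bsub>C\<^esub> -[C] d j) < 1/2" using d(2)[OF C.one_closed, of "1/2"] by auto
 moreover have "c *[C] (\<one>\<^bsub>C\<^esub> -[C] d j) = c -[C] c *[C] d j" for j
 using cc d(1) C.one_closed by (simp add: C.mult_minus C.mult_one)
 moreover have "c -[C] \<zero>\<^bsub>C\<^esub> = c" using cc by (intro C.feqI) (simp_all add: C.lfun_simps)
 ultimately have "cnorm C c <= cnorm C c * cnorm C (\<one>\<^bsub>C\<^esub> -[C] d j)"
 using C.cnorm_mult[OF cc, of "\<one>\<^bsub>C\<^esub> -[C] d j"] d(1) C.one_closed by simp
 also have "... <= cnorm C c * (1/2)" using j C.cnorm_nonneg[OF cc] by (intro mult_left_mono) auto
 finally have "c = \<zero>\<^bsub>C\<^esub>" using C.cnorm_nonneg[OF cc] C.cnorm_eq_0_iff[OF cc] by simp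
 then show "x = y" using xy by (simp add: c_def C.minus_eq_zero_iff)
 qed
qed

end

lemma (in cstar_algebra) separable_dense_seq':
 assumes "separable_cstar A"
 shows "EX d :: nat => 'a. range d <= car A & (ALL x:car A. x : cl (range d))"
proof (rule separable_dense_seq[OF assms])
 fix d :: "nat => 'a" assume d: "!!l. d l : car A" and e: "car A = cl (range d)"
 have "x : cl (range d)" if "x : car A" for x using that unfolding e[symmetric] .
 moreover have "range d <= car A" using d by blast
 ultimately show ?thesis by blast
qed

lemma (in star_hom_pair) hom_image_subset_if_dense:
 assumes S: "cstar_subalgebra S B" and d: "range d <= car A" "ALL x:car A. x : A.cl (range d)"
 and fS: "!!l :: nat. f (d l) : S"
 shows "f ` car A <= S"
proof (rule image_subsetI)
 fix a assume a: "a : car A"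
 have Sc: "closedin (ctopology B) S" using S by (simp add: cstar_subalgebra_def)
 obtain x where x: "!!n. x n : range d" "A.conv x a" by (rule A.cl_conv[OF d(1) bspec[OF d(2) a]]) blast
 have xc: "x n : car A" for n using x(2) by (simp add: A.conv_def)
 have *: "B.conv (%n. f (x n)) (f a)"
 proof (rule B.conv_bound[of _ _ "%n. cnorm A (x n -[A] a)"])
 show "cnorm B (f (x n) -[B] f a) <= cnorm A (x n -[A] a)" for n
 using hom_contractive[of "x n -[A] a"] hom_minus[OF xc[of n] a] xc[of n] a by simp
 show "(%n. cnorm A (x n -[A] a)) ----> 0" using x(2) by (simp add: A.conv_def)
 qed (use xc a in auto)
 have "f (x n) : S" for n using x(1)[of n] fS by auto
 then show "f a : S" by (rule B.closed_conv[OF Sc _ *])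
qed

text \<open>The C*-subalgebra generated by the unit and both images is separable, so it has at most
  continuum many elements and can be copied into the type of C, where the universal property
  applies.\<close>

lemma universal_star_hom:
 fixes C :: "'c cstar" and Q :: "('q, 'm) cstar_scheme"
 assumes fap: "full_amalgamated_free_product D A B \<psi>\<^sub>A \<psi>\<^sub>B C \<sigma>\<^sub>A \<sigma>\<^sub>B"
 and A: "unital_cstar_algebra A" "separable_cstar A" and B: "unital_cstar_algebra B" "separable_cstar B"
 and Q: "unital_cstar_algebra Q" and nonzero: "\<one>\<^bsub>C\<^esub> ~= \<zero>\<^bsub>C\<^esub>"
 and h: "star_hom A Q h" "star_hom B Q h'" and agree: "ALL d:car D. h (\<psi>\<^sub>A d) = h' (\<psi>\<^sub>B d)"
 shows "EX hp. star_hom C Q hp & (ALL a:car A. hp (\<sigma>\<^sub>A a) = h a) & (ALL b:car B. hp (\<sigma>\<^sub>B b) = h' b)"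
proof -
 interpret full_amalgamated_free_product D A B \<psi>\<^sub>A \<psi>\<^sub>B C \<sigma>\<^sub>A \<sigma>\<^sub>B by (rule fap)
 interpret A: unital_cstar_algebra A by (rule A)
 interpret B: unital_cstar_algebra B by (rule B)
 interpret C: unital_cstar_algebra C by (rule unital_cstar_algebra_C)
 interpret Q: unital_cstar_algebra Q by (rule Q)
 interpret h: star_hom_pair A Q h
 by (rule star_hom_pairI[OF A.unital_cstar_algebra_axioms Q.unital_cstar_algebra_axioms]) (rule h)
 interpret h': star_hom_pair B Q h'
 by (rule star_hom_pairI[OF B.unital_cstar_algebra_axioms Q.unital_cstar_algebra_axioms]) (rule h)
 obtain d :: "nat => _" where d: "range d <= car A" "ALL x:car A. x : A.cl (range d)"
 using A.separable_dense_seq'[OF A(2)] by blast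
 obtain d' :: "nat => _" where d': "range d' <= car B" "ALL x:car B. x : B.cl (range d')"
 using B.separable_dense_seq'[OF B(2)] by blast
 \<comment> \<open>The unit is included so that S is unital, as the facts about
   \<open>transport\<close> assume.\<close>
 define X where "X = {\<one>\<^bsub>Q\<^esub>} \<union> range (%l. h (d l)) \<union> range (%l. h' (d' l))"
 have X: "X <= car Q" using d(1) d'(1) Q.one_closed by (auto simp: X_def)
 define S where "S = Q.cl (Q.alg_hull X)"
 note T = Q.alg_hull_subset[OF X]
 have XS: "X <= S" unfolding S_def by (rule subset_trans[OF Q.alg_hull_base(2) Q.cl_subset[OF T]])
 have S: "cstar_subalgebra S Q" unfolding S_def by (rule Q.cstar_subalgebra_cl_alg_hull[OF X])
 have hS: "h ` car A <= S" by (rule h.hom_image_subset_if_dense[OF S d]) (use XS in \<open>auto simp: X_def\<close>)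
 have h'S: "h' ` car B <= S" by (rule h'.hom_image_subset_if_dense[OF S d']) (use XS in \<open>auto simp: X_def\<close>)
 have "countable X" by (simp add: X_def)
 from Q.countable_alg_hull[OF this] T obtain g :: "'q => real" where g: "inj_on g S"
 unfolding S_def by (rule Q.inj_real_if_dense)
 \<comment> \<open>The multiples of the nonzero unit of C form a continuum in the type of C.\<close>
 define io where "io x = cr (g x) *:[C] \<one>\<^bsub>C\<^esub>" for x
 have io: "inj_on io S"
 proof (rule inj_onI)
 fix x y assume xy: "x : S" "y : S" "io x = io y"
 have "cr (g x - g y) *:[C] \<one>\<^bsub>C\<^esub> = io x -[C] io y"
 unfolding io_def using C.one_closed by (intro C.feqI) (simp_all add: C.lfun_simps algebra_simps)
 also have "... = \<zero>\<^bsub>C\<^esub>" using xy(3) C.one_closed by (simp add: io_def)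
 finally have "cnorm C (cr (g x - g y) *:[C] \<one>\<^bsub>C\<^esub>) = 0" by (simp del: of_real_diff)
 then have "cmod (cr (g x - g y)) * cnorm C \<one>\<^bsub>C\<^esub> = 0" unfolding C.cnorm_smult[OF C.one_closed] .
 then have "g x = g y" using nonzero C.cnorm_eq_0_iff[OF C.one_closed] by (simp del: of_real_diff)
 then show "x = y" using inj_onD[OF g _ xy(1,2)] by simp
 qed
 have one: "\<one>\<^bsub>Q\<^esub> : S" using XS by (auto simp: X_def)
 note tr = Q S one io
 interpret E: unital_cstar_algebra "transport Q S io" by (rule unital_cstar_algebra_transport[OF tr])
 obtain hp where hp: "star_hom C (transport Q S io) hp" "ALL a:car A. hp (\<sigma>\<^sub>A a) = io (h a)" "ALL b:car B. hp (\<sigma>\<^sub>B b) = io (h' b)"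
 proof -
 have "ALL d:car D. io (h (\<psi>\<^sub>A d)) = io (h' (\<psi>\<^sub>B d))" using agree by simp
 from universal[OF E.cstar_algebra_axioms star_hom_to_transport[OF tr h(1) hS] star_hom_to_transport[OF tr h(2) h'S] this]
 show ?thesis using that by blast
 qed
 have "star_hom C Q (%x. inv_into S io (hp x))"
 using star_hom_comp[OF hp(1) star_hom_from_transport[OF tr]] by (simp add: comp_def)
 then show ?thesis
 using hp(2,3) hS h'S by (intro exI[of _ "%x. inv_into S io (hp x)"]) (simp add: image_subset_iff inv_into_f_f[OF io])
qed

section \<open>Matrix units of D and assembly of the models\<close>

subsection \<open>Matrix units and the main theorem\<close>

definition emat :: "nat => nat => nat => complex mat" where
 "emat n i j = mat n n (%(a,b). if a = i & b = j then 1 else 0)"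

lemma emat_carrier [simp]: "emat n i j : CM n n" by (simp add: emat_def)

lemma emat_mult:
 assumes X: "X : CM n n" and j: "j < n"
 shows "emat n i j * X = mat n n (%(a,b). if a = i then X $$ (j,b) else 0)"
proof (rule eq_matI)
 fix a b assume "a < dim_row (mat n n (%(a,b). if a = i then X $$ (j,b) else 0))" "b < dim_col (mat n n (%(a,b). if a = i then X $$ (j,b) else 0))"
 then have ab: "a < n" "b < n" by auto
 have "(emat n i j * X) $$ (a,b) = (\<Sum>c<n. (if a = i & c = j then 1 else 0) * X $$ (c,b))"
 using ab X by (simp add: emat_def scalar_prod_def atLeast0LessThan)
 also have "... = (\<Sum>c<n. if c = j then (if a = i then X $$ (j,b) else 0) else 0)" by (rule sum.cong) auto
 finally show "(emat n i j * X) $$ (a,b) = mat n n (%(a,b). if a = i then X $$ (j,b) else 0) $$ (a,b)" using ab j by simp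
qed (use X in \<open>auto simp: emat_def\<close>)

lemma mult_emat:
 assumes X: "X : CM n n" and i: "i < n"
 shows "X * emat n i j = mat n n (%(a,b). if b = j then X $$ (a,i) else 0)"
proof (rule eq_matI)
 fix a b assume "a < dim_row (mat n n (%(a,b). if b = j then X $$ (a,i) else 0))" "b < dim_col (mat n n (%(a,b). if b = j then X $$ (a,i) else 0))"
 then have ab: "a < n" "b < n" by auto
 have "(X * emat n i j) $$ (a,b) = (\<Sum>c<n. X $$ (a,c) * (if c = i & b = j then 1 else 0))"
 using ab X by (simp add: emat_def scalar_prod_def atLeast0LessThan)
 also have "... = (\<Sum>c<n. if c = i then (if b = j then X $$ (a,i) else 0) else 0)" by (rule sum.cong) auto
 finally show "(X * emat n i j) $$ (a,b) = mat n n (%(a,b). if b = j then X $$ (a,i) else 0) $$ (a,b)" using ab i by simp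
qed (use X in \<open>auto simp: emat_def\<close>)

text \<open>Everything is pulled back from the standard matrix units. The last conjunct is
  minimality of the projection mu 0 0: it gives each x of D scalar entries, namely those of the
  matrix g x.\<close>

lemma matrix_units:
 fixes D :: "('d, 'm) cstar_scheme"
 assumes D: "unital_cstar_algebra D" and n: "0 < n" and iso: "star_isomorphic D (matrix_cstar n)"
 shows "EX mu :: nat => nat => 'd. (ALL i<n. ALL j<n. mu i j : car D & star D (mu i j) = mu j i & (ALL l<n. mu i j *[D] mu j l = mu i l)) &
 finsum D (%i. mu i i) {..<n} = \<one>\<^bsub>D\<^esub> & mu 0 0 ~= \<zero>\<^bsub>D\<^esub> &
 (ALL x:car D. EX z. ALL i<n. ALL j<n. mu 0 i *[D] (x *[D] mu j 0) = z i j *:[D] mu 0 0)"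
proof -
 interpret D: unital_cstar_algebra D by (rule D)
 interpret M: unital_cstar_algebra "matrix_cstar n" by (rule unital_cstar_algebra_matrix)
 obtain g where g: "star_hom D (matrix_cstar n) g" "bij_betw g (car D) (car (matrix_cstar n))"
 using iso unfolding star_isomorphic_def by blast
 interpret g: star_hom_pair D "matrix_cstar n" g
 by (rule star_hom_pairI[OF D.unital_cstar_algebra_axioms M.unital_cstar_algebra_axioms]) (rule g)
 have inj: "x = y" if "g x = g y" "x : car D" "y : car D" for x y
 using inj_onD[OF bij_betw_imp_inj_on[OF g(2)] that] .
 define mu where "mu i j = inv_into (car D) g (emat n i j)" for i j
 have im: "emat n i j : g ` car D" for i j using bij_betw_imp_surj_on[OF g(2)] by simp
 have mu: "mu i j : car D" "g (mu i j) = emat n i j" for i j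
 unfolding mu_def using inv_into_into[OF im] f_inv_into_f[OF im] by auto
 have gc: "g x : CM n n" if "x : car D" for x using g.hom_closed[OF that] by simp
 have one: "g \<one>\<^bsub>D\<^esub> = 1\<^sub>m n"
 proof -
 have "1\<^sub>m n : g ` car D" using bij_betw_imp_surj_on[OF g(2)] by simp
 then obtain x where x: "x : car D" "g x = 1\<^sub>m n" by auto
 have "g \<one>\<^bsub>D\<^esub> * 1\<^sub>m n = g (\<one>\<^bsub>D\<^esub> *[D] x)" using g.hom_mult[OF D.one_closed x(1)] x(2) by simp
 then show ?thesis using x gc[OF D.one_closed] D.one_mult by simp
 qed
 have star: "star D (mu i j) = mu j i" for i j
 by (rule inj) (use mu in \<open>auto simp: g.hom_star emat_def intro!: eq_matI\<close>)
 have mult: "mu i j *[D] mu j l = mu i l" if "i < n" "j < n" for i j l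
 by (rule inj) (use mu that in \<open>auto simp: g.hom_mult emat_mult, auto simp: emat_def intro!: eq_matI\<close>)
 have sum: "finsum D (%i. mu i i) {..<n} = \<one>\<^bsub>D\<^esub>"
 proof (rule inj)
 have "g (finsum D (%i. mu i i) {..<n}) = finsum (matrix_cstar n) (%i. g (mu i i)) {..<n}"
 by (rule g.hom_finsum) (use mu in auto)
 also have "... = finsum (matrix_cstar n) (%i. emat n i i) {..<n}" by (simp add: mu)
 also have "... = 1\<^sub>m n"
 proof (rule eq_matI)
 fix a b assume "a < dim_row (1\<^sub>m n :: complex mat)" "b < dim_col (1\<^sub>m n :: complex mat)"
 then have ab: "a < n" "b < n" by auto
 have "M.lfun (%X. X $$ (a,b))" using ab by (auto simp: M.lfun_def)
 from M.lfun_finsum[OF this, of "{..<n}" "%i. emat n i i"]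
 have "finsum (matrix_cstar n) (%i. emat n i i) {..<n} $$ (a,b) = (\<Sum>i<n. emat n i i $$ (a,b))" by simp
 also have "... = (\<Sum>i<n. if i = a then (if a = b then 1 else 0) else 0)" using ab by (intro sum.cong) (auto simp: emat_def)
 finally show "finsum (matrix_cstar n) (%i. emat n i i) {..<n} $$ (a,b) = 1\<^sub>m n $$ (a,b)" using ab by simp
 qed (use M.finsum_closed'[of "{..<n}" "%i. emat n i i"] in auto)
 finally show "g (finsum D (%i. mu i i) {..<n}) = g \<one>\<^bsub>D\<^esub>" by (simp add: one)
 qed (use mu D.one_closed in \<open>auto intro!: D.finsum_closed'\<close>)
 have nz: "mu 0 0 ~= \<zero>\<^bsub>D\<^esub>"
 proof
 assume "mu 0 0 = \<zero>\<^bsub>D\<^esub>"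
 then have "emat n 0 0 = 0\<^sub>m n n" using mu(2)[of 0 0] g.hom_zero by simp
 then have "emat n 0 0 $$ (0,0) = 0" using n by simp
 then show False using n by (simp add: emat_def)
 qed
 have "mu 0 i *[D] (x *[D] mu j 0) = g x $$ (i,j) *:[D] mu 0 0" if x: "x : car D" and ij: "i < n" "j < n" for x i j
 proof (rule inj)
 have "emat n 0 i * (g x * emat n j 0) = g x $$ (i,j) \<cdot>\<^sub>m emat n 0 0"
 unfolding mult_emat[OF gc[OF x] ij(2)] using ij n by (subst emat_mult) (auto simp: emat_def intro!: eq_matI)
 then show "g (mu 0 i *[D] (x *[D] mu j 0)) = g (g x $$ (i,j) *:[D] mu 0 0)" using mu x by (simp add: g.hom_mult g.hom_smult)
 qed (use mu x in auto)
 then have "ALL x:car D. EX z. ALL i<n. ALL j<n. mu 0 i *[D] (x *[D] mu j 0) = z i j *:[D] mu 0 0"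
 by (intro ballI exI[of _ "%i j. g _ $$ (i,j)"]) blast
 then show ?thesis using mu(1) star mult sum nz by (intro exI[of _ mu]) simp
qed

lemma tendsto_if_near:
 fixes x :: "nat => complex"
 assumes "!!s. s >= s0 ==> cmod (x s - y) < inverse (real (Suc s))" shows "x ----> y"
proof -
 have "(%s. x s - y) ----> 0"
 by (rule Lim_null_comparison[OF _ LIMSEQ_inverse_real_of_nat])
 (use assms in \<open>force simp: eventually_sequentially intro: less_imp_le\<close>)
 then show ?thesis by (simp add: LIM_zero_iff)
qed

text \<open>At stage s the errors are below 1/(s + 1) for the entries of elements of H s and for
  vector indices up to s, so every fixed choice of element and indices converges.\<close>

lemma mf_towerI:
 fixes A :: "('a, 'm) cstar_scheme" and eu :: "nat => nat => 'a" and H :: "nat => 'a set"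
 assumes st: "mf_state k A f (eu 0 0) L p v q C sg phi" and n: "0 < n"
 and eu: "!!i j. i < n ==> j < n ==> eu i j : car A"
 "!!i j. i < n ==> j < n ==> star A (eu i j) = eu j i"
 "!!i j l. i < n ==> j < n ==> l < n ==> eu i j *[A] eu j l = eu i l"
 "finsum A (%i. eu i i) {..<n} = \<one>\<^bsub>A\<^esub>"
 and res: "!!s. resolution (%t. q (m s t)) (N s) (T s) (Z s)" and m: "!!s t. t < T s ==> s <= m s t"
 and unital: "sg \<one>\<^bsub>A\<^esub> = \<one>\<^bsub>C\<^esub>" and d: "!!l. d l : car C"
 and w: "!!l i. i < n ==> w (l * n + i) = sg (eu 0 i) *[C] d l" and xi: "!!s l. xi s l : CV (N s)"
 and H: "!!s. H s <= car A" "!!s s'. s <= s' ==> H s <= H s'"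
 and near: "!!s a j l. [|a : insert (eu 0 0) ((%(a,i,j). eu 0 i *[A] (a *[A] eu j 0)) ` (H s \<times> {..<n} \<times> {..<n})); j < Suc s; l < Suc s|] ==>
 cmod (cinner (compress (N s) (T s) (Z s) (%t. mf_corner.V v (m s t) (L a (m s t))) *! xi s j) (xi s l)
 - phi (star C (w l) *[C] (sg a *[C] w j))) < inverse (real (Suc s))"
 shows "mf_tower k A f eu L p v q n N T m Z C sg phi d w xi (\<Union>s. H s)"
proof -
 interpret st: mf_state k A f "eu 0 0" L p v q C sg phi by (rule st)
 interpret mf_model k A f eu L p v q n N T m Z
 by (intro mf_model.intro st.mf_corner_axioms mf_model_axioms.intro n eu res m)
 show ?thesis
 proof (intro mf_tower.intro mf_model_axioms st mf_tower_axioms.intro unital d w xi)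
 show "(\<Union>s. H s) <= car A" using H(1) by auto
 fix l l'
 show "(%s. cinner (Gam s (L (eu 0 0)) *! xi s l) (xi s l')) ----> phi (star C (w l') *[C] (sg (eu 0 0) *[C] w l))"
 unfolding Gam_def by (rule tendsto_if_near[of "max l l'"], rule near) auto
 fix a i j assume a: "a : (\<Union>s. H s)" and ij: "i < n" "j < n"
 then obtain s0 where s0: "a : H s0" by auto
 show "(%s. cinner (Gam s (L (ent i j a)) *! xi s l) (xi s l')) ----> phi (star C (w l') *[C] (sg (ent i j a) *[C] w l))"
 unfolding Gam_def
 proof (rule tendsto_if_near[of "max s0 (max l l')"], rule near)
 fix s assume s: "s >= max s0 (max l l')"
 then have "(a,i,j) : H s \<times> {..<n} \<times> {..<n}" using H(2)[of s0 s] s0 ij by auto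
 then show "ent i j a : insert (eu 0 0) ((%(a,i,j). eu 0 i *[A] (a *[A] eu j 0)) ` (H s \<times> {..<n} \<times> {..<n}))"
 unfolding ent_def by (intro insertI2 image_eqI[of _ _ "(a,i,j)"]) simp_all
 qed auto
 qed
qed

definition star_seq :: "('a, 'm) cstar_scheme => (nat => 'a) => 'a set" where
 "star_seq A d = (\<Union>l. {d l, star A (d l)})"

text \<open>Finite sets increasing with s. The products are included because injectivity uses limits
  for c and c^* c, where c runs through the d l and their adjoints.\<close>

definition square_seq :: "('a, 'm) cstar_scheme => (nat => 'a) => nat => 'a set" where
 "square_seq A d s = (\<Union>l\<in>{..s}. {d l, star A (d l), star A (d l) *[A] d l, d l *[A] star A (d l)})"

lemma (in cstar_algebra) star_square_seq:
 assumes "range d <= car A"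
 shows "star_seq A d <= car A" "countable (star_seq A d)" "range d <= star_seq A d"
 "x : star_seq A d ==> star A x : star_seq A d" "square_seq A d s <= car A" "finite (square_seq A d s)"
 "s <= s' ==> square_seq A d s <= square_seq A d s'"
 "x : star_seq A d ==> x : (\<Union>s. square_seq A d s)" "x : star_seq A d ==> star A x \<otimes> x : (\<Union>s. square_seq A d s)"
proof -
 have d: "d l : car A" for l using assms by auto
 then show "star_seq A d <= car A" "countable (star_seq A d)" "range d <= star_seq A d" "finite (square_seq A d s)"
 "square_seq A d s <= car A"
 by (auto simp: star_seq_def square_seq_def)
 show "square_seq A d s <= square_seq A d s'" if "s <= s'" using that unfolding square_seq_def by (intro UN_mono) auto
 assume "x : star_seq A d"
 then obtain l where x: "x = d l \<or> x = star A (d l)" by (auto simp: star_seq_def)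
 then show "star A x : star_seq A d" using d by (auto simp: star_seq_def star_star)
 have "x : square_seq A d l & star A x \<otimes> x : square_seq A d l" using x d by (auto simp: square_seq_def star_star)
 then show "x : (\<Union>s. square_seq A d s)" "star A x \<otimes> x : (\<Union>s. square_seq A d s)" by auto
qed

lemma entries_in_corner:
 fixes A :: "('a, 'm) cstar_scheme" and eu :: "nat => nat => 'a"
 assumes co: "mf_corner k A f (eu 0 0) L p v q" and n: "0 < n"
 and eu: "!!i j. i < n ==> j < n ==> eu i j : car A"
 "!!i j l. i < n ==> j < n ==> l < n ==> eu i j *[A] eu j l = eu i l"
 and H: "H <= car A"
 shows "insert (eu 0 0) ((%(a,i,j). eu 0 i *[A] (a *[A] eu j 0)) ` (H \<times> {..<n} \<times> {..<n})) <= mf_corner.corner A (eu 0 0)"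
proof -
 interpret mf_corner k A f "eu 0 0" L p v q by (rule co)
 have "eu 0 i *[A] (a *[A] eu j 0) : corner" if "a : H" "i < n" "j < n" for a i j
 proof -
 have c: "a : car A" "eu 0 i : car A" "eu j 0 : car A" "eu 0 0 : car A" using that H eu(1) n by auto
 have "eu 0 0 *[A] ((eu 0 i *[A] (a *[A] eu j 0)) *[A] eu 0 0)
 = (eu 0 0 *[A] eu 0 i) *[A] (a *[A] (eu j 0 *[A] eu 0 0))" using c by (simp add: A.mult_assoc)
 then show ?thesis using eu(2) n that c by (simp add: corner_def)
 qed
 then show ?thesis using e_corner by auto
qed

theorem proposition2p1:
  fixes A :: "'a cstar" and B :: "'b cstar" and C :: "'c cstar" and D :: "'d cstar"
    and \<psi>\<^sub>A :: "'d \<Rightarrow> 'a" and \<psi>\<^sub>B :: "'d \<Rightarrow> 'b"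
    and \<sigma>\<^sub>A :: "'a \<Rightarrow> 'c" and \<sigma>\<^sub>B :: "'b \<Rightarrow> 'c"
    and n :: nat
  assumes "unital_cstar_algebra A" and "separable_cstar A"
    and "unital_cstar_algebra B" and "separable_cstar B"
    and "unital_cstar_algebra D"
    and "unital_star_embedding D A \<psi>\<^sub>A" and "unital_star_embedding D B \<psi>\<^sub>B"
    and "0 < n" and "star_isomorphic D (matrix_cstar n)"
    and "full_amalgamated_free_product D A B \<psi>\<^sub>A \<psi>\<^sub>B C \<sigma>\<^sub>A \<sigma>\<^sub>B"
  shows "MF_algebra C \<longleftrightarrow> MF_algebra A \<and> MF_algebra B"
proof -
 interpret A: unital_cstar_algebra A by (rule assms)
 interpret B: unital_cstar_algebra B by (rule assms)
 interpret D: unital_cstar_algebra D by (rule assms)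
 interpret fap: full_amalgamated_free_product D A B \<psi>\<^sub>A \<psi>\<^sub>B C \<sigma>\<^sub>A \<sigma>\<^sub>B by (rule assms)
 interpret C: unital_cstar_algebra C by (rule fap.unital_cstar_algebra_C)
 have sgA: "star_hom A C \<sigma>\<^sub>A" "inj_on \<sigma>\<^sub>A (car A)" "\<sigma>\<^sub>A \<one>\<^bsub>A\<^esub> = \<one>\<^bsub>C\<^esub>"
 and sgB: "star_hom B C \<sigma>\<^sub>B" "inj_on \<sigma>\<^sub>B (car B)" "\<sigma>\<^sub>B \<one>\<^bsub>B\<^esub> = \<one>\<^bsub>C\<^esub>"
 using fap.embedding_A fap.embedding_B by (simp_all add: unital_star_embedding_def star_embedding_def)
 have psiA: "star_hom D A \<psi>\<^sub>A" "inj_on \<psi>\<^sub>A (car D)" "\<psi>\<^sub>A \<one>\<^bsub>D\<^esub> = \<one>\<^bsub>A\<^esub>"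
 and psiB: "star_hom D B \<psi>\<^sub>B" "\<psi>\<^sub>B \<one>\<^bsub>D\<^esub> = \<one>\<^bsub>B\<^esub>"
 using assms(6,7) by (simp_all add: unital_star_embedding_def star_embedding_def)
 interpret sA: star_hom_pair A C \<sigma>\<^sub>A
 by (rule star_hom_pairI[OF A.unital_cstar_algebra_axioms C.unital_cstar_algebra_axioms]) (rule sgA)
 interpret sB: star_hom_pair B C \<sigma>\<^sub>B
 by (rule star_hom_pairI[OF B.unital_cstar_algebra_axioms C.unital_cstar_algebra_axioms]) (rule sgB)
 interpret pA: star_hom_pair D A \<psi>\<^sub>A
 by (rule star_hom_pairI[OF D.unital_cstar_algebra_axioms A.unital_cstar_algebra_axioms]) (rule psiA)
 interpret pB: star_hom_pair D B \<psi>\<^sub>B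
 by (rule star_hom_pairI[OF D.unital_cstar_algebra_axioms B.unital_cstar_algebra_axioms]) (rule psiB)
 show ?thesis
 proof
 \<comment> \<open>An embedding of C is composed with the embeddings of A and of B into C.\<close>
 assume "MF_algebra C"
 then obtain k f where k: "ALL n. 0 < k n" and f: "star_embedding C (cstar_quotient (cstar_product (%n. matrix_cstar (k n)))
 (cstar_null_ideal (%n. matrix_cstar (k n)))) f" (is "star_embedding C ?Q f")
 unfolding MF_algebra_def by blast
 have f': "star_hom C ?Q f" "inj_on f (car C)" using f by (simp_all add: star_embedding_def)
 have "inj_on (%a. f (\<sigma>\<^sub>A a)) (car A)"
 by (intro inj_onI, rule inj_onD[OF sgA(2)], rule inj_onD[OF f'(2)]) auto
 then have "star_embedding A ?Q (%a. f (\<sigma>\<^sub>A a))" using star_hom_comp[OF sgA(1) f'(1)] by (simp add: star_embedding_def)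
 moreover have "inj_on (%a. f (\<sigma>\<^sub>B a)) (car B)"
 by (intro inj_onI, rule inj_onD[OF sgB(2)], rule inj_onD[OF f'(2)]) auto
 then have "star_embedding B ?Q (%a. f (\<sigma>\<^sub>B a))" using star_hom_comp[OF sgB(1) f'(1)] by (simp add: star_embedding_def)
 ultimately show "MF_algebra A & MF_algebra B"
 unfolding MF_algebra_def using A.cstar_algebra_axioms B.cstar_algebra_axioms assms(2,4) k by blast
 next
 assume mf: "MF_algebra A & MF_algebra B"
 obtain dA :: "nat => 'a" where dA: "range dA <= car A" "ALL x:car A. x : A.cl (range dA)"
 using A.separable_dense_seq'[OF assms(2)] by blast
 obtain dB :: "nat => 'b" where dB: "range dB <= car B" "ALL x:car B. x : B.cl (range dB)"
 using B.separable_dense_seq'[OF assms(4)] by blast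
 note hA = A.star_square_seq[OF dA(1)] and hB = B.star_square_seq[OF dB(1)]
 define G where "G = \<sigma>\<^sub>A ` star_seq A dA \<union> \<sigma>\<^sub>B ` star_seq B dB"
 have Gc: "G <= car C" using hA(1) hB(1) by (auto simp: G_def)
 have cG: "countable G" using hA(2) hB(2) by (simp add: G_def)
 have gen: "cstar_generated C G = car C"
 proof
 have "C.cl (C.alg_hull G) : {S. cstar_subalgebra S C & G <= S}"
 using C.cstar_subalgebra_cl_alg_hull[OF Gc] subset_trans[OF C.alg_hull_base(2) C.cl_subset[OF C.alg_hull_subset[OF Gc]]] by simp
 then have "cstar_generated C G <= C.cl (C.alg_hull G)" unfolding cstar_generated_def by (rule Inter_lower)
 then show "cstar_generated C G <= car C" by (rule subset_trans) (auto simp: C.cl_def)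
 have "\<sigma>\<^sub>A ` car A \<union> \<sigma>\<^sub>B ` car B <= S" if S: "cstar_subalgebra S C" "G <= S" for S
 proof (rule Un_least)
 show "\<sigma>\<^sub>A ` car A <= S" by (rule sA.hom_image_subset_if_dense[OF S(1) dA]) (rule subsetD[OF S(2)], unfold G_def, rule UnI1, rule imageI, rule subsetD[OF hA(3) rangeI])
 show "\<sigma>\<^sub>B ` car B <= S" by (rule sB.hom_image_subset_if_dense[OF S(1) dB]) (rule subsetD[OF S(2)], unfold G_def, rule UnI2, rule imageI, rule subsetD[OF hB(3) rangeI])
 qed
 then show "car C <= cstar_generated C G"
 unfolding fap.generated[symmetric] unfolding cstar_generated_def by (intro Inter_anti_mono) blast
 qed
 have sepC: "separable_cstar C"
 by (rule C.separable_if_dense[OF C.countable_alg_hull[OF cG] C.alg_hull_subset[OF Gc] C.generated_dense[OF gen Gc]])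
 obtain d' :: "nat => 'c" where d': "range d' <= car C" "ALL x:car C. x : C.cl (range d')"
 using C.separable_dense_seq'[OF sepC] by blast
 \<comment> \<open>The unit comes first, so that w 0 is the image of the nonzero projection
   \<open>euA 0 0\<close>.\<close>
 define d where "d l = (case l of 0 => \<one>\<^bsub>C\<^esub> | Suc l => d' l)" for l
 have d: "d l : car C" for l using d'(1) C.one_closed by (auto simp: d_def split: nat.split)
 have dense: "EX l. cnorm C (x -[C] d l) < eps" if x: "x : car C" "eps > 0" for x eps
 proof -
 obtain l where "cnorm C (x -[C] d' l) < eps" using C.cl_approx[OF bspec[OF d'(2) x(1)] x(2)] by auto
 then show ?thesis by (intro exI[of _ "Suc l"]) (simp add: d_def)
 qed
 have "EX phi M. C.pfun phi & (ALL x:car C. cmod (phi x) <= M * cnorm C x) &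
 (ALL x:car C. Re (phi (star C x *[C] x)) = 0 --> x = \<zero>\<^bsub>C\<^esub>)"
 by (rule C.faithful_state[of d]) (use d dense in \<open>blast+\<close>)
 then obtain phi M where phi: "C.pfun phi" "!!x. x : car C ==> cmod (phi x) <= M * cnorm C x"
 "!!x. x : car C ==> Re (phi (star C x *[C] x)) = 0 ==> x = \<zero>\<^bsub>C\<^esub>" by blast
 obtain mu :: "nat => nat => 'd" where mu': "ALL i<n. ALL j<n. mu i j : car D & star D (mu i j) = mu j i & (ALL l<n. mu i j *[D] mu j l = mu i l)"
 "finsum D (%i. mu i i) {..<n} = \<one>\<^bsub>D\<^esub>" "mu 0 0 ~= \<zero>\<^bsub>D\<^esub>"
 "ALL x:car D. EX z. ALL i<n. ALL j<n. mu 0 i *[D] (x *[D] mu j 0) = z i j *:[D] mu 0 0"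
 using matrix_units[OF assms(5,8,9)] by blast
 have mu: "mu i j : car D" "star D (mu i j) = mu j i" if "i < n" "j < n" for i j using mu'(1) that by auto
 have mu_mult: "mu i j *[D] mu j l = mu i l" if "i < n" "j < n" "l < n" for i j l using mu'(1) that by auto
 define euA euB where "euA i j = \<psi>\<^sub>A (mu i j)" and "euB i j = \<psi>\<^sub>B (mu i j)" for i j
 have euA: "!!i j. i < n ==> j < n ==> euA i j : car A" "!!i j. i < n ==> j < n ==> star A (euA i j) = euA j i"
 "!!i j l. i < n ==> j < n ==> l < n ==> euA i j *[A] euA j l = euA i l"
 by (simp_all add: euA_def mu mu_mult flip: pA.hom_star pA.hom_mult)
 have euB: "!!i j. i < n ==> j < n ==> euB i j : car B" "!!i j. i < n ==> j < n ==> star B (euB i j) = euB j i"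
 "!!i j l. i < n ==> j < n ==> l < n ==> euB i j *[B] euB j l = euB i l"
 by (simp_all add: euB_def mu mu_mult flip: pB.hom_star pB.hom_mult)
 have sumA: "finsum A (%i. euA i i) {..<n} = \<one>\<^bsub>A\<^esub>"
 unfolding euA_def psiA(3)[symmetric] mu'(2)[symmetric] by (rule pA.hom_finsum[symmetric]) (use mu in auto)
 have sumB: "finsum B (%i. euB i i) {..<n} = \<one>\<^bsub>B\<^esub>"
 unfolding euB_def psiB(2)[symmetric] mu'(2)[symmetric] by (rule pB.hom_finsum[symmetric]) (use mu in auto)
 have eu_eq: "\<sigma>\<^sub>A (euA i j) = \<sigma>\<^sub>B (euB i j)" if "i < n" "j < n" for i j
 using fap.amalgamated mu(1)[OF that] by (simp add: euA_def euB_def)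
 note n = assms(8)
 obtain kA fA where fA: "star_embedding A (cstar_quotient (cstar_product (%n. matrix_cstar (kA n)))
 (cstar_null_ideal (%n. matrix_cstar (kA n)))) fA" using mf unfolding MF_algebra_def by blast
 obtain kB fB where fB: "star_embedding B (cstar_quotient (cstar_product (%n. matrix_cstar (kB n)))
 (cstar_null_ideal (%n. matrix_cstar (kB n)))) fB" using mf unfolding MF_algebra_def by blast
 obtain LA rA vA qA where coA: "mf_corner kA A fA (euA 0 0) LA rA vA qA"
 using matrix_sequence.mf_corner_exists[OF assms(1) fA euA(1)[OF n n] euA(2)[OF n n] euA(3)[OF n n n]] by blast
 obtain LB rB vB qB where coB: "mf_corner kB B fB (euB 0 0) LB rB vB qB"
 using matrix_sequence.mf_corner_exists[OF assms(3) fB euB(1)[OF n n] euB(2)[OF n n] euB(3)[OF n n n]] by blast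
 have stA: "mf_state kA A fA (euA 0 0) LA rA vA qA C \<sigma>\<^sub>A phi"
 by (intro mf_state.intro mf_state_axioms.intro coA C.unital_cstar_algebra_axioms sgA phi(1))
 have stB: "mf_state kB B fB (euB 0 0) LB rB vB qB C \<sigma>\<^sub>B phi"
 by (intro mf_state.intro mf_state_axioms.intro coB C.unital_cstar_algebra_axioms sgB phi(1))
 \<comment> \<open>The index l n + i encodes the pair (l, i), so w runs through all e_0i
   d_l.\<close>
 define w where "w l = \<sigma>\<^sub>A (euA 0 (l mod n)) *[C] d (l div n)" for l
 have wA: "w (l * n + i) = \<sigma>\<^sub>A (euA 0 i) *[C] d l" and wB: "w (l * n + i) = \<sigma>\<^sub>B (euB 0 i) *[C] d l" if "i < n" for l i
 using that n eu_eq[OF n that] by (simp_all add: w_def)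
 have wc: "w l : car C" for l using euA(1) n d by (simp add: w_def)
 have ew: "\<sigma>\<^sub>A (euA 0 0) *[C] w l = w l" for l
 proof -
 have i: "l mod n < n" using n by simp
 have "\<sigma>\<^sub>A (euA 0 0) *[C] w l = \<sigma>\<^sub>A (euA 0 0 *[A] euA 0 (l mod n)) *[C] d (l div n)"
 unfolding w_def using euA(1)[OF n n] euA(1)[OF n i] d by (simp add: sA.hom_mult C.mult_assoc)
 then show ?thesis by (simp add: euA(3)[OF n n i] w_def)
 qed
 have w0: "w 0 ~= \<zero>\<^bsub>C\<^esub>"
 proof
 assume "w 0 = \<zero>\<^bsub>C\<^esub>"
 then have "\<sigma>\<^sub>A (euA 0 0) = \<sigma>\<^sub>A \<zero>\<^bsub>A\<^esub>" using euA(1)[OF n n] by (simp add: w_def d_def C.mult_one)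
 then have "euA 0 0 = \<zero>\<^bsub>A\<^esub>" by (rule inj_onD[OF sgA(2)]) (use euA(1)[OF n n] in auto)
 then have "\<psi>\<^sub>A (mu 0 0) = \<psi>\<^sub>A \<zero>\<^bsub>D\<^esub>" by (simp add: euA_def)
 then have "mu 0 0 = \<zero>\<^bsub>D\<^esub>" by (rule inj_onD[OF psiA(2)]) (use mu(1)[OF n n] in auto)
 then show False using mu'(3) by simp
 qed
 have nonzero: "\<one>\<^bsub>C\<^esub> ~= \<zero>\<^bsub>C\<^esub>" using w0 C.one_mult[OF wc[of 0]] C.zero_mult[OF wc[of 0]] by metis
 define FA where "FA s = insert (euA 0 0) ((%(a,i,j). euA 0 i *[A] (a *[A] euA j 0)) ` (square_seq A dA s \<times> {..<n} \<times> {..<n}))" for s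
 define FB where "FB s = insert (euB 0 0) ((%(a,i,j). euB 0 i *[B] (a *[B] euB j 0)) ` (square_seq B dB s \<times> {..<n} \<times> {..<n}))" for s
 have F: "finite (FA s)" "FA s <= mf_corner.corner A (euA 0 0)" "finite (FB s)" "FB s <= mf_corner.corner B (euB 0 0)" for s
 unfolding FA_def FB_def using hA(6) hB(6)
 entries_in_corner[where eu = euA, OF coA n euA(1) euA(3) hA(5)[of s]] entries_in_corner[where eu = euB, OF coB n euB(1) euB(3) hB(5)[of s]]
 by simp_all
 \<comment> \<open>All data of stage s are collected in one predicate, so that they can be chosen
   for all s at once.\<close>
 define R where "R s N T m Z T' m' Z' xi \<longleftrightarrow> 0 < N & resolution (%t. qA (m t)) N T Z & (ALL t<T. s <= m t) &
 resolution (%t. qB (m' t)) N T' Z' & (ALL t<T'. s <= m' t) & (ALL l. xi l : CV N) &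
 (ALL a:FA s. ALL j<Suc s. ALL l<Suc s. cmod (cinner (compress N T Z (%t. mf_corner.V vA (m t) (LA a (m t))) *! xi j) (xi l)
 - phi (star C (w l) *[C] (\<sigma>\<^sub>A a *[C] w j))) < inverse (real (Suc s))) &
 (ALL a:FB s. ALL j<Suc s. ALL l<Suc s. cmod (cinner (compress N T' Z' (%t. mf_corner.V vB (m' t) (LB a (m' t))) *! xi j) (xi l)
 - phi (star C (w l) *[C] (\<sigma>\<^sub>B a *[C] w j))) < inverse (real (Suc s)))"
 for s N and T :: nat and m Z and T' :: nat and m' Z' and xi :: "nat => complex vec"
 have "EX N T m Z T' m' Z' xi. R s N T m Z T' m' Z' xi" for s
 unfolding R_def
 by (rule common_resolutions[OF stA stB eu_eq[OF n n]]) (erule (1) phi(3) | rule wc ew w0 F | simp)+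
 then have "ALL s. EX N T m Z T' m' Z' xi. R s N T m Z T' m' Z' xi" by blast
 then obtain N T m Z T' m' Z' xi where R: "!!s. R s (N s) (T s) (m s) (Z s) (T' s) (m' s) (Z' s) (xi s)" by metis
 have R1: "0 < N s" "resolution (%t. qA (m s t)) (N s) (T s) (Z s)" "resolution (%t. qB (m' s t)) (N s) (T' s) (Z' s)"
 "t < T s ==> s <= m s t" "t < T' s ==> s <= m' s t" "xi s l : CV (N s)" for s t l
 using R[of s] unfolding R_def by blast+
 have RA: "cmod (cinner (compress (N s) (T s) (Z s) (%t. mf_corner.V vA (m s t) (LA a (m s t))) *! xi s j) (xi s l)
 - phi (star C (w l) *[C] (\<sigma>\<^sub>A a *[C] w j))) < inverse (real (Suc s))" if "a : FA s" "j < Suc s" "l < Suc s" for s a j l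
 using R[of s] that unfolding R_def by blast
 have RB: "cmod (cinner (compress (N s) (T' s) (Z' s) (%t. mf_corner.V vB (m' s t) (LB a (m' s t))) *! xi s j) (xi s l)
 - phi (star C (w l) *[C] (\<sigma>\<^sub>B a *[C] w j))) < inverse (real (Suc s))" if "a : FB s" "j < Suc s" "l < Suc s" for s a j l
 using R[of s] that unfolding R_def by blast
 interpret tA: mf_tower kA A fA euA LA rA vA qA n N T m Z C \<sigma>\<^sub>A phi d w xi "\<Union>s. square_seq A dA s"
 by (rule mf_towerI[where eu = euA, OF stA n]) (erule (1) euA(1,2) | erule (2) euA(3) | rule sumA R1(2) R1(6) sgA(3) d hA(5) | erule wA hA(7) R1(4) | erule (2) RA[unfolded FA_def])+
 interpret tB: mf_tower kB B fB euB LB rB vB qB n N T' m' Z' C \<sigma>\<^sub>B phi d w xi "\<Union>s. square_seq B dB s"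
 by (rule mf_towerI[where eu = euB, OF stB n]) (erule (1) euB(1,2) | erule (2) euB(3) | rule sumB R1(3) R1(6) sgB(3) d hB(5) | erule wB hB(7) R1(5) | erule (2) RB[unfolded FB_def])+
 \<comment> \<open>Both models send x to the scalar block matrix with the same entries z i
   j.\<close>
 have agree: "ALL x:car D. tA.S.cls (tA.Th (\<psi>\<^sub>A x)) = tA.S.cls (tB.Th (\<psi>\<^sub>B x))"
 proof
 fix x assume x: "x : car D"
 then obtain z where z: "ALL i<n. ALL j<n. mu 0 i *[D] (x *[D] mu j 0) = z i j *:[D] mu 0 0" using mu'(4) by blast
 have "tA.ent i j (\<psi>\<^sub>A x) = z i j *:[A] euA 0 0" "tB.ent i j (\<psi>\<^sub>B x) = z i j *:[B] euB 0 0" if ij: "i < n" "j < n" for i j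
 proof -
 have c: "mu 0 i : car D" "mu j 0 : car D" "mu 0 0 : car D" using mu(1) n ij by simp_all
 have "tA.ent i j (\<psi>\<^sub>A x) = \<psi>\<^sub>A (mu 0 i *[D] (x *[D] mu j 0))" "tB.ent i j (\<psi>\<^sub>B x) = \<psi>\<^sub>B (mu 0 i *[D] (x *[D] mu j 0))"
 using c x by (simp_all add: tA.ent_def tB.ent_def euA_def euB_def pA.hom_mult pB.hom_mult)
 then show "tA.ent i j (\<psi>\<^sub>A x) = z i j *:[A] euA 0 0" "tB.ent i j (\<psi>\<^sub>B x) = z i j *:[B] euB 0 0"
 using z ij c by (simp_all add: euA_def euB_def pA.hom_smult pB.hom_smult)
 qed
 then show "tA.S.cls (tA.Th (\<psi>\<^sub>A x)) = tA.S.cls (tB.Th (\<psi>\<^sub>B x))"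
 using tA.cls_Th_scalar_entries[of "\<psi>\<^sub>A x" z] tB.cls_Th_scalar_entries[of "\<psi>\<^sub>B x" z] x by simp
 qed
 obtain hp where hp: "star_hom C tA.S.Quo hp" "!!a. a : car A ==> hp (\<sigma>\<^sub>A a) = tA.S.cls (tA.Th a)"
 "!!b. b : car B ==> hp (\<sigma>\<^sub>B b) = tA.S.cls (tB.Th b)"
 using universal_star_hom[OF assms(10,1,2,3,4) tA.S.Q.unital_cstar_algebra_axioms nonzero tA.star_hom_Th tB.star_hom_Th agree] by blast
 have limA: "EX X. X : car tA.S.Prod & tA.S.cls X = hp (\<sigma>\<^sub>A a) &
 (ALL l l'. (%s. cinner (X s *! tA.eta s l) (tA.eta s l')) ----> phi (star C (d l') *[C] (\<sigma>\<^sub>A a *[C] d l)))"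
 if a: "a : (\<Union>s. square_seq A dA s)" for a
 proof -
 have ac: "a : car A" using a hA(5) by blast
 show ?thesis by (rule exI[of _ "tA.Th a"], intro conjI allI) (rule tA.Th_Prod[OF ac] hp(2)[OF ac, symmetric] tA.tower_limit[OF a])+
 qed
 have limB: "EX X. X : car tA.S.Prod & tA.S.cls X = hp (\<sigma>\<^sub>B a) &
 (ALL l l'. (%s. cinner (X s *! tA.eta s l) (tA.eta s l')) ----> phi (star C (d l') *[C] (\<sigma>\<^sub>B a *[C] d l)))"
 if a: "a : (\<Union>s. square_seq B dB s)" for a
 proof -
 have ac: "a : car B" using a hB(5) by blast
 show ?thesis by (rule exI[of _ "tB.Th a"], intro conjI allI) (rule tB.Th_Prod[OF ac] hp(3)[OF ac, symmetric] tB.tower_limit[OF a])+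
 qed
 \<comment> \<open>The two towers share n, N and xi, hence the vectors eta, so one family of vectors
   controls the generators from A and from B.\<close>
 interpret dense_model "%s. n * N s" C hp phi M d tA.eta G
 proof (intro dense_model.intro dense_model_axioms.intro C.unital_cstar_algebra_axioms)
 fix c assume c: "c : G"
 then consider a where "a : star_seq A dA" "c = \<sigma>\<^sub>A a" | b where "b : star_seq B dB" "c = \<sigma>\<^sub>B b" by (auto simp: G_def)
 note cs = this
 from cs show "star C c : G"
 proof cases
 case (1 a)
 have "a : car A" using 1(1) hA(1) by blast
 then have "star C c = \<sigma>\<^sub>A (star A a)" by (simp add: 1(2) sA.hom_star)
 then show ?thesis using hA(4)[OF 1(1)] by (simp add: G_def)
 next
 case (2 b)
 have "b : car B" using 2(1) hB(1) by blast
 then have "star C c = \<sigma>\<^sub>B (star B b)" by (simp add: 2(2) sB.hom_star)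
 then show ?thesis using hB(4)[OF 2(1)] by (simp add: G_def)
 qed
 fix a assume a: "a : {c, star C c *[C] c}"
 from cs show "EX X. X : car tA.S.Prod & tA.S.cls X = hp a &
 (ALL l l'. (%s. cinner (X s *! tA.eta s l) (tA.eta s l')) ----> phi (star C (d l') *[C] (a *[C] d l)))"
 proof cases
 case (1 x)
 have "x : car A" using 1(1) hA(1) by blast
 then have "star C c *[C] c = \<sigma>\<^sub>A (star A x *[A] x)" using 1(2) by (simp add: sA.hom_mult sA.hom_star)
 then show ?thesis using a 1(2) limA[OF hA(8)[OF 1(1)]] limA[OF hA(9)[OF 1(1)]] by (elim insertE emptyE) simp_all
 next
 case (2 x)
 have "x : car B" using 2(1) hB(1) by blast
 then have "star C c *[C] c = \<sigma>\<^sub>B (star B x *[B] x)" using 2(2) by (simp add: sB.hom_mult sB.hom_star)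
 then show ?thesis using a 2(2) limB[OF hB(8)[OF 2(1)]] limB[OF hB(9)[OF 2(1)]] by (elim insertE emptyE) simp_all
 qed
 next
 show "G ~= {}" using hA(3) by (auto simp: G_def)
 qed (rule hp(1) phi(1) d Gc gen tA.eta_carrier tA.tower_gram | erule phi(2) | erule (1) phi(3) | erule (1) dense)+
 have "star_embedding C tA.S.Quo hp" using hp(1) injective by (simp add: star_embedding_def)
 moreover have "ALL s. 0 < n * N s" using n R1(1) by simp
 ultimately show "MF_algebra C"
 unfolding MF_algebra_def
 by (intro conjI C.cstar_algebra_axioms sepC exI[of _ "%s. n * N s"] exI[of _ hp])
 qed
qed

end
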